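(* Let $H$ be a complex Hilbert space and let $A\subseteq \mathcal K(H)$ be a norm-closed subalgebra of the algebra $\mathcal K(H)$ of compact operators on $H$. Then $A$ has the complete reduction property if and only if $A$ is similar to a C*-algebra, i.e. if and only if there is a bounded invertible operator $S\in\mathcal B(H)$ such that $SAS^{-1}$ is a self-adjoint subalgebra of $\mathcal B(H)$.
   Context: Let $H$ be a complex Hilbert space and $A\subseteq\mathcal B(H)$ a norm-closed subalgebra (not necessarily self-adjoint or unital). Let $H^{(\infty)}=H\otimes_2\ell^2(\mathbb N)$ be the Hilbert space of square-summable sequences in $H$, with $A$ acting by $a\cdot(\xi_i)_i=(a\xi_i)_i$. A submodule is a norm-closed $A$-invariant subspace. $A$ has the complete reduction property if for every submodule $V\subseteq H^{(\infty)}$ there is a submodule $W\subseteq H^{(\infty)}$ with $H^{(\infty)}=V\oplus W$ (direct sum, not necessarily orthogonal). *)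

theory Defs
  imports "HOL-Analysis.Analysis"
begin

section \<open>Complex Hilbert spaces\<close>

class complex_normed_vector = real_normed_vector +
  fixes scaleC :: "complex \<Rightarrow> 'a \<Rightarrow> 'a"  (infixr \<open>*\<^sub>C\<close> 75)
  assumes scaleC_add_right: "a *\<^sub>C (x + y) = a *\<^sub>C x + a *\<^sub>C y"
    and scaleC_add_left: "(a + b) *\<^sub>C x = a *\<^sub>C x + b *\<^sub>C x"
    and scaleC_scaleC: "a *\<^sub>C b *\<^sub>C x = (a * b) *\<^sub>C x"
    and scaleR_eq_scaleC: "r *\<^sub>R x = complex_of_real r *\<^sub>C x"
    and norm_scaleC: "norm (a *\<^sub>C x) = cmod a * norm x"

text \<open>
  The class \<^class>\<open>real_inner\<close> is used only for the norm and topology: its inner product is the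
  real part of the complex one, so that \<open>norm x = sqrt (Re (cinner x x))\<close>.
  The form \<open>cinner\<close> is linear in its first argument and conjugate-linear in its second.
\<close>

class chilbert_space = complex_normed_vector + real_inner + complete_space +
  fixes cinner :: "'a \<Rightarrow> 'a \<Rightarrow> complex"
  assumes cinner_commute: "cinner x y = cnj (cinner y x)"
    and cinner_add_left: "cinner (x + y) z = cinner x z + cinner y z"
    and cinner_scaleC_left: "cinner (a *\<^sub>C x) y = a * cinner x y"
    and inner_eq_Re_cinner: "inner x y = Re (cinner x y)"

definition csubspace :: "'a::complex_normed_vector set \<Rightarrow> bool" where
  "csubspace V \<longleftrightarrow> 0 \<in> V \<and> (\<forall>x\<in>V. \<forall>y\<in>V. x + y \<in> V) \<and> (\<forall>c. \<forall>x\<in>V. c *\<^sub>C x \<in> V)"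

lemma scaleC_one [simp]: "1 *\<^sub>C x = (x::'a::complex_normed_vector)"
  using scaleR_eq_scaleC[of 1 x] by simp

lemma bounded_linear_scaleC: "bounded_linear (\<lambda>x::'a::complex_normed_vector. c *\<^sub>C x)"
  by (rule bounded_linear_intro[where K = "cmod c"])
     (simp_all add: scaleC_add_right scaleR_eq_scaleC scaleC_scaleC norm_scaleC mult.commute)

lemma norm_eq_sqrt_cinner: "norm (x::'a::chilbert_space) = sqrt (Re (cinner x x))"
  by (simp add: norm_eq_sqrt_inner inner_eq_Re_cinner)

lemma Im_cinner: "Im (cinner x y) = inner ((-\<i>) *\<^sub>C x) (y::'a::chilbert_space)"
  unfolding inner_eq_Re_cinner cinner_scaleC_left by simp


section \<open>Operators\<close>

text \<open>
  Elements of \<open>'a \<Rightarrow>\<^sub>L 'a\<close> are bounded real-linear maps with the operator norm; the bounded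
  operators of a complex Hilbert space are those that are moreover complex-linear.
\<close>

instantiation blinfun :: (real_normed_vector, complex_normed_vector) complex_normed_vector
begin

lift_definition scaleC_blinfun :: "complex \<Rightarrow> ('a \<Rightarrow>\<^sub>L 'b) \<Rightarrow> ('a \<Rightarrow>\<^sub>L 'b)"
  is "\<lambda>c f x. c *\<^sub>C f x"
  by (rule bounded_linear_compose[OF bounded_linear_scaleC])

instance
proof
  fix a b :: complex and r :: real and x y :: "'a \<Rightarrow>\<^sub>L 'b"
  show "a *\<^sub>C (x + y) = a *\<^sub>C x + a *\<^sub>C y" by transfer (simp add: scaleC_add_right)
  show "(a + b) *\<^sub>C x = a *\<^sub>C x + b *\<^sub>C x" by transfer (simp add: scaleC_add_left)
  show "a *\<^sub>C b *\<^sub>C x = (a * b) *\<^sub>C x" by transfer (simp add: scaleC_scaleC)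
  show "r *\<^sub>R x = complex_of_real r *\<^sub>C x" by transfer (simp add: scaleR_eq_scaleC)
  have le: "norm (c *\<^sub>C z) \<le> cmod c * norm z" for c and z :: "'a \<Rightarrow>\<^sub>L 'b"
  proof (rule norm_blinfun_bound)
    fix v
    have "norm (blinfun_apply (c *\<^sub>C z) v) = cmod c * norm (blinfun_apply z v)"
      by (simp add: scaleC_blinfun.rep_eq norm_scaleC)
    also have "\<dots> \<le> cmod c * (norm z * norm v)"
      by (intro mult_left_mono norm_blinfun) auto
    finally show "norm (blinfun_apply (c *\<^sub>C z) v) \<le> cmod c * norm z * norm v"
      by (simp add: mult.assoc)
  qed simp
  show "norm (a *\<^sub>C x) = cmod a * norm x"
  proof (cases "a = 0")
    case True
    then show ?thesis using le[of 0 x] by simp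
  next
    case False
    have "inverse a *\<^sub>C a *\<^sub>C x = x"
      using False by (transfer fixing: a) (simp add: scaleC_scaleC)
    then have "norm x \<le> inverse (cmod a) * norm (a *\<^sub>C x)"
      using le[of "inverse a" "a *\<^sub>C x"] by (simp add: norm_inverse)
    then have "cmod a * norm x \<le> cmod a * (inverse (cmod a) * norm (a *\<^sub>C x))"
      by (rule mult_left_mono) simp
    also have "\<dots> = norm (a *\<^sub>C x)"
      using False by (subst mult.assoc[symmetric]) simp
    finally show ?thesis by (rule antisym[OF le])
  qed
qed

end

definition bounded_ops :: "('a::chilbert_space \<Rightarrow>\<^sub>L 'a) set" where
  "bounded_ops = {T :: 'a \<Rightarrow>\<^sub>L 'a. \<forall>c x. T (c *\<^sub>C x) = c *\<^sub>C T x}"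

definition compact_ops :: "('a::chilbert_space \<Rightarrow>\<^sub>L 'a) set" where
  "compact_ops = {T \<in> bounded_ops. compact (closure (blinfun_apply T ` cball 0 1))}"

definition op_subalgebra :: "('a::chilbert_space \<Rightarrow>\<^sub>L 'a) set \<Rightarrow> bool" where
  "op_subalgebra A \<longleftrightarrow> A \<subseteq> bounded_ops \<and> csubspace A \<and> (\<forall>S\<in>A. \<forall>T\<in>A. S o\<^sub>L T \<in> A)"

definition is_adjoint :: "('a::chilbert_space \<Rightarrow>\<^sub>L 'a) \<Rightarrow> ('a \<Rightarrow>\<^sub>L 'a) \<Rightarrow> bool" where
  "is_adjoint T T' \<longleftrightarrow> (\<forall>x y. cinner (T x) y = cinner x (T' y))"

lemma is_adjoint_unique:
  assumes "is_adjoint T T'" "is_adjoint T T''"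
  shows "T' = T''"
proof (rule blinfun_eqI)
  fix y
  have "inner x (T' y) = inner x (T'' y)" for x
    using assms by (metis is_adjoint_def inner_eq_Re_cinner)
  then have "inner (T' y - T'' y) (T' y - T'' y) = 0"
    by (simp add: inner_diff_right)
  then show "T' y = T'' y" by simp
qed

definition self_adjoint_set :: "('a::chilbert_space \<Rightarrow>\<^sub>L 'a) set \<Rightarrow> bool" where
  "self_adjoint_set A \<longleftrightarrow> (\<forall>T\<in>A. \<exists>T'\<in>A. is_adjoint T T')"

definition are_inverse_ops :: "('a::chilbert_space \<Rightarrow>\<^sub>L 'a) \<Rightarrow> ('a \<Rightarrow>\<^sub>L 'a) \<Rightarrow> bool" where
  "are_inverse_ops S R \<longleftrightarrow> S \<in> bounded_ops \<and> R \<in> bounded_ops \<and>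
     S o\<^sub>L R = id_blinfun \<and> R o\<^sub>L S = id_blinfun"

text \<open>
  Norm-closedness of \<open>S A S\<^sup>-\<^sup>1\<close> is not demanded: it is inherited from \<open>A\<close>, since conjugation by
  \<open>S\<close> is a homeomorphism of the algebra of bounded operators.
\<close>

definition similar_to_cstar_algebra :: "('a::chilbert_space \<Rightarrow>\<^sub>L 'a) set \<Rightarrow> bool" where
  "similar_to_cstar_algebra A \<longleftrightarrow>
     (\<exists>S R. are_inverse_ops S R \<and>
        op_subalgebra ((\<lambda>T. S o\<^sub>L T o\<^sub>L R) ` A) \<and>
        self_adjoint_set ((\<lambda>T. S o\<^sub>L T o\<^sub>L R) ` A))"


section \<open>The infinite amplification\<close>

typedef (overloaded) 'a ell2 = "{f :: nat \<Rightarrow> 'a::chilbert_space. summable (\<lambda>i. (norm (f i))\<^sup>2)}"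
  morphisms ell2_nth Abs_ell2
  by (rule exI[of _ "\<lambda>_. 0"]) simp

setup_lifting type_definition_ell2

lemma square_summable_add:
  fixes f g :: "nat \<Rightarrow> 'a::real_inner"
  assumes "summable (\<lambda>i. (norm (f i))\<^sup>2)" "summable (\<lambda>i. (norm (g i))\<^sup>2)"
  shows "summable (\<lambda>i. (norm (f i + g i))\<^sup>2)"
proof (rule summable_comparison_test')
  show "summable (\<lambda>i. 2 * (norm (f i))\<^sup>2 + 2 * (norm (g i))\<^sup>2)"
    using assms by (intro summable_add summable_mult)
  fix i
  have "(norm (f i + g i))\<^sup>2 + (norm (f i - g i))\<^sup>2 = 2 * (norm (f i))\<^sup>2 + 2 * (norm (g i))\<^sup>2"
    by (simp add: power2_norm_eq_inner inner_add inner_diff inner_commute)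
  then have "(norm (f i + g i))\<^sup>2 \<le> 2 * (norm (f i))\<^sup>2 + 2 * (norm (g i))\<^sup>2"
    using zero_le_power2[of "norm (f i - g i)"] by linarith
  then show "norm ((norm (f i + g i))\<^sup>2) \<le> 2 * (norm (f i))\<^sup>2 + 2 * (norm (g i))\<^sup>2"
    by simp
qed

lemma square_summable_mono:
  fixes f :: "nat \<Rightarrow> 'a::real_normed_vector" and g :: "nat \<Rightarrow> 'b::real_normed_vector"
  assumes "summable (\<lambda>i. (norm (f i))\<^sup>2)" "\<And>i. norm (g i) \<le> K * norm (f i)"
  shows "summable (\<lambda>i. (norm (g i))\<^sup>2)"
proof (rule summable_comparison_test')
  show "summable (\<lambda>i. K\<^sup>2 * (norm (f i))\<^sup>2)" using assms(1) by (rule summable_mult)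
  show "norm ((norm (g i))\<^sup>2) \<le> K\<^sup>2 * (norm (f i))\<^sup>2" for i
    using power_mono[OF assms(2)[of i], of 2] by (simp add: power_mult_distrib)
qed

lemma summable_inner:
  fixes f g :: "nat \<Rightarrow> 'a::real_inner"
  assumes "summable (\<lambda>i. (norm (f i))\<^sup>2)" "summable (\<lambda>i. (norm (g i))\<^sup>2)"
  shows "summable (\<lambda>i. inner (f i) (g i))"
proof (rule summable_comparison_test')
  show "summable (\<lambda>i. (norm (f i))\<^sup>2 + (norm (g i))\<^sup>2)"
    using assms by (intro summable_add)
  fix i
  have "\<bar>inner (f i) (g i)\<bar> \<le> norm (f i) * norm (g i)" by (rule Cauchy_Schwarz_ineq2)
  also have "\<dots> \<le> (norm (f i))\<^sup>2 + (norm (g i))\<^sup>2"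
    using sum_squares_bound[of "norm (f i)" "norm (g i)"]
      mult_nonneg_nonneg[OF norm_ge_zero[of "f i"] norm_ge_zero[of "g i"]] by linarith
  finally show "norm (inner (f i) (g i)) \<le> (norm (f i))\<^sup>2 + (norm (g i))\<^sup>2" by simp
qed

lemma summable_cinner:
  fixes f g :: "nat \<Rightarrow> 'a::chilbert_space"
  assumes "summable (\<lambda>i. (norm (f i))\<^sup>2)" "summable (\<lambda>i. (norm (g i))\<^sup>2)"
  shows "summable (\<lambda>i. cinner (f i) (g i))"
proof -
  have "summable (\<lambda>i. (norm ((-\<i>) *\<^sub>C f i))\<^sup>2)"
    using assms(1) by (simp add: norm_scaleC)
  then have "summable (\<lambda>i. Im (cinner (f i) (g i)))"
    unfolding Im_cinner by (rule summable_inner[OF _ assms(2)])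
  moreover have "summable (\<lambda>i. Re (cinner (f i) (g i)))"
    using summable_inner[OF assms] by (simp add: inner_eq_Re_cinner)
  ultimately show ?thesis by (simp add: summable_complex_iff)
qed

instantiation ell2 :: (chilbert_space) real_inner
begin

lift_definition zero_ell2 :: "'a ell2" is "\<lambda>_. 0" by simp

lift_definition plus_ell2 :: "'a ell2 \<Rightarrow> 'a ell2 \<Rightarrow> 'a ell2" is "\<lambda>f g i. f i + g i"
  by (rule square_summable_add)

lift_definition uminus_ell2 :: "'a ell2 \<Rightarrow> 'a ell2" is "\<lambda>f i. - f i" by simp

lift_definition minus_ell2 :: "'a ell2 \<Rightarrow> 'a ell2 \<Rightarrow> 'a ell2" is "\<lambda>f g i. f i - g i"
  using square_summable_add[of f "\<lambda>i. - g i" for f g] by simp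

lift_definition scaleR_ell2 :: "real \<Rightarrow> 'a ell2 \<Rightarrow> 'a ell2" is "\<lambda>r f i. r *\<^sub>R f i"
  by (simp add: power_mult_distrib summable_mult)

lift_definition inner_ell2 :: "'a ell2 \<Rightarrow> 'a ell2 \<Rightarrow> real" is "\<lambda>f g. \<Sum>i. inner (f i) (g i)" .

definition norm_ell2 :: "'a ell2 \<Rightarrow> real" where "norm_ell2 x = sqrt (inner x x)"

definition sgn_ell2 :: "'a ell2 \<Rightarrow> 'a ell2" where "sgn_ell2 x = scaleR (inverse (norm x)) x"

definition dist_ell2 :: "'a ell2 \<Rightarrow> 'a ell2 \<Rightarrow> real" where "dist_ell2 x y = norm (x - y)"

definition uniformity_ell2 :: "('a ell2 \<times> 'a ell2) filter" where
  "uniformity_ell2 = (INF e\<in>{0 <..}. principal {(x, y). dist x y < e})"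

definition open_ell2 :: "'a ell2 set \<Rightarrow> bool" where
  "open_ell2 S = (\<forall>x\<in>S. \<forall>\<^sub>F (x', y) in uniformity. x' = x \<longrightarrow> y \<in> S)"

instance
proof
  fix a b r :: real and x y z :: "'a ell2" and S :: "'a ell2 set"
  show "x + y + z = x + (y + z)" by transfer (simp add: add.assoc)
  show "x + y = y + x" by transfer (simp add: add.commute)
  show "0 + x = x" by transfer simp
  show "- x + x = 0" by transfer simp
  show "x - y = x + - y" by transfer simp
  show "a *\<^sub>R (x + y) = a *\<^sub>R x + a *\<^sub>R y" by transfer (simp add: scaleR_add_right)
  show "(a + b) *\<^sub>R x = a *\<^sub>R x + b *\<^sub>R x" by transfer (simp add: scaleR_add_left)
  show "a *\<^sub>R b *\<^sub>R x = (a * b) *\<^sub>R x" by transfer simp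
  show "1 *\<^sub>R x = x" by transfer simp
  show "sgn x = inverse (norm x) *\<^sub>R x" by (rule sgn_ell2_def)
  show "dist x y = norm (x - y)" by (rule dist_ell2_def)
  show "uniformity = (INF e\<in>{0 <..}. principal {(x :: 'a ell2, y). dist x y < e})"
    by (rule uniformity_ell2_def)
  show "open S = (\<forall>x\<in>S. \<forall>\<^sub>F (x', y) in uniformity. x' = x \<longrightarrow> y \<in> S)"
    by (rule open_ell2_def)
  show "inner x y = inner y x" by transfer (simp add: inner_commute)
  show "inner (x + y) z = inner x z + inner y z"
    by transfer (simp add: inner_add_left suminf_add summable_inner)
  show "inner (r *\<^sub>R x) y = r * inner x y"
    by transfer (simp add: suminf_mult summable_inner)
  show "0 \<le> inner x x"
    by transfer (simp add: suminf_nonneg summable_inner)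
  show "inner x x = 0 \<longleftrightarrow> x = 0"
    by transfer (subst suminf_eq_zero_iff, auto simp: summable_inner)
  show "norm x = sqrt (inner x x)" by (rule norm_ell2_def)
qed

end

lemma norm_ell2_eq: "norm x = sqrt (\<Sum>i. (norm (ell2_nth x i))\<^sup>2)"
  by (simp add: norm_eq_sqrt_inner inner_ell2.rep_eq power2_norm_eq_inner)

lemma summable_ell2_nth: "summable (\<lambda>i. (norm (ell2_nth x i))\<^sup>2)"
  using ell2_nth[of x] by simp

lemma sum_norm_ell2_le: "(\<Sum>i\<in>{..<n}. (norm (ell2_nth x i))\<^sup>2) \<le> (norm x)\<^sup>2"
proof -
  have "0 \<le> (\<Sum>i. (norm (ell2_nth x i))\<^sup>2)"
    by (rule suminf_nonneg[OF summable_ell2_nth]) simp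
  then show ?thesis
    by (simp add: norm_ell2_eq sum_le_suminf[OF summable_ell2_nth])
qed

lemma norm_ell2_nth_le: "norm (ell2_nth x i) \<le> norm x"
proof (rule power2_le_imp_le)
  have "(norm (ell2_nth x i))\<^sup>2 \<le> (\<Sum>i\<in>{..<Suc i}. (norm (ell2_nth x i))\<^sup>2)"
    by (rule member_le_sum) auto
  also have "\<dots> \<le> (norm x)\<^sup>2" by (rule sum_norm_ell2_le)
  finally show "(norm (ell2_nth x i))\<^sup>2 \<le> (norm x)\<^sup>2" .
qed simp

instance ell2 :: (chilbert_space) complete_space
proof
  fix X :: "nat \<Rightarrow> 'a ell2"
  assume X: "Cauchy X"
  have "Cauchy (\<lambda>n. ell2_nth (X n) i)" for i
  proof (rule metric_CauchyI)
    fix e :: real assume "0 < e"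
    then obtain M where M: "\<forall>m\<ge>M. \<forall>n\<ge>M. dist (X m) (X n) < e"
      using X unfolding Cauchy_def by blast
    have "dist (ell2_nth (X m) i) (ell2_nth (X n) i) \<le> dist (X m) (X n)" for m n
      using norm_ell2_nth_le[of "X m - X n" i] by (simp add: dist_norm minus_ell2.rep_eq)
    then show "\<exists>M. \<forall>m\<ge>M. \<forall>n\<ge>M. dist (ell2_nth (X m) i) (ell2_nth (X n) i) < e"
      using M by (meson order_le_less_trans)
  qed
  then have "\<exists>l. (\<lambda>n. ell2_nth (X n) i) \<longlonglongrightarrow> l" for i
    using Cauchy_convergent convergent_def by blast
  then obtain L where L: "\<And>i. (\<lambda>n. ell2_nth (X n) i) \<longlonglongrightarrow> L i" by metis
  have partial: "(\<Sum>i\<in>{..<k}. (norm (ell2_nth (X m) i - L i))\<^sup>2) \<le> e\<^sup>2"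
    if M: "\<forall>m\<ge>M. \<forall>n\<ge>M. dist (X m) (X n) < e" and m: "m \<ge> M" for e M m k
  proof (rule LIMSEQ_le_const2)
    show "(\<lambda>n. \<Sum>i\<in>{..<k}. (norm (ell2_nth (X m) i - ell2_nth (X n) i))\<^sup>2)
            \<longlonglongrightarrow> (\<Sum>i\<in>{..<k}. (norm (ell2_nth (X m) i - L i))\<^sup>2)"
      by (intro tendsto_intros L)
    have "(\<Sum>i\<in>{..<k}. (norm (ell2_nth (X m) i - ell2_nth (X n) i))\<^sup>2) \<le> e\<^sup>2" if "n \<ge> M" for n
    proof -
      have "(\<Sum>i\<in>{..<k}. (norm (ell2_nth (X m) i - ell2_nth (X n) i))\<^sup>2) \<le> (norm (X m - X n))\<^sup>2"
        using sum_norm_ell2_le[of "X m - X n" k] by (simp add: minus_ell2.rep_eq)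
      also have "\<dots> \<le> e\<^sup>2"
        using M m that by (intro power_mono) (auto simp: dist_norm less_imp_le)
      finally show ?thesis .
    qed
    then show "\<exists>N. \<forall>n\<ge>N. (\<Sum>i\<in>{..<k}. (norm (ell2_nth (X m) i - ell2_nth (X n) i))\<^sup>2) \<le> e\<^sup>2"
      by blast
  qed
  have diff: "summable (\<lambda>i. (norm (ell2_nth (X m) i - L i))\<^sup>2)"
    if "\<forall>m\<ge>M. \<forall>n\<ge>M. dist (X m) (X n) < e" "m \<ge> M" for e M m
    by (rule summableI_nonneg_bounded[where x = "e\<^sup>2"]) (use partial[OF that] in auto)
  obtain M1 where M1: "\<forall>m\<ge>M1. \<forall>n\<ge>M1. dist (X m) (X n) < 1"
    using X unfolding Cauchy_def by (meson zero_less_one)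
  have "summable (\<lambda>i. (norm (ell2_nth (X M1) i + - (ell2_nth (X M1) i - L i)))\<^sup>2)"
    by (rule square_summable_add[OF summable_ell2_nth])
       (simp only: norm_minus_cancel, rule diff[OF M1 order_refl])
  then have "summable (\<lambda>i. (norm (L i))\<^sup>2)" by simp
  then have nth: "ell2_nth (Abs_ell2 L) = L" by (simp add: Abs_ell2_inverse)
  have "X \<longlonglongrightarrow> Abs_ell2 L"
  proof (rule metric_LIMSEQ_I)
    fix r :: real assume r: "0 < r"
    then obtain M where M: "\<forall>m\<ge>M. \<forall>n\<ge>M. dist (X m) (X n) < r / 2"
      using X unfolding Cauchy_def by (meson half_gt_zero)
    have "dist (X m) (Abs_ell2 L) < r" if m: "m \<ge> M" for m
    proof -
      have "(\<Sum>i. (norm (ell2_nth (X m) i - L i))\<^sup>2) \<le> (r / 2)\<^sup>2"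
        by (rule suminf_le_const[OF diff[OF M m] partial[OF M m]])
      then have "sqrt (\<Sum>i. (norm (ell2_nth (X m) i - L i))\<^sup>2) \<le> r / 2"
        using r by (intro real_le_lsqrt[of "r / 2"]) simp_all
      then have "dist (X m) (Abs_ell2 L) \<le> r / 2"
        by (simp add: dist_norm norm_ell2_eq minus_ell2.rep_eq nth)
      then show ?thesis using r by simp
    qed
    then show "\<exists>no. \<forall>n\<ge>no. dist (X n) (Abs_ell2 L) < r" by blast
  qed
  then show "convergent X" by (auto simp: convergent_def)
qed

instantiation ell2 :: (chilbert_space) chilbert_space
begin

lift_definition scaleC_ell2 :: "complex \<Rightarrow> 'a ell2 \<Rightarrow> 'a ell2" is "\<lambda>c f i. c *\<^sub>C f i"
  by (simp add: norm_scaleC power_mult_distrib summable_mult)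

lift_definition cinner_ell2 :: "'a ell2 \<Rightarrow> 'a ell2 \<Rightarrow> complex" is "\<lambda>f g. \<Sum>i. cinner (f i) (g i)" .

instance
proof
  fix a b :: complex and r :: real and x y z :: "'a ell2"
  show "a *\<^sub>C (x + y) = a *\<^sub>C x + a *\<^sub>C y" by transfer (simp add: scaleC_add_right)
  show "(a + b) *\<^sub>C x = a *\<^sub>C x + b *\<^sub>C x" by transfer (simp add: scaleC_add_left)
  show "a *\<^sub>C b *\<^sub>C x = (a * b) *\<^sub>C x" by transfer (simp add: scaleC_scaleC)
  show "r *\<^sub>R x = complex_of_real r *\<^sub>C x" by transfer (simp add: scaleR_eq_scaleC)
  show "norm (a *\<^sub>C x) = cmod a * norm x"
    using suminf_mult[OF summable_ell2_nth[of x], of "(cmod a)\<^sup>2"]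
    by (simp add: norm_ell2_eq scaleC_ell2.rep_eq norm_scaleC power_mult_distrib real_sqrt_mult)
  show "cinner x y = cnj (cinner y x)"
  proof transfer
    fix f g :: "nat \<Rightarrow> 'a"
    assume "summable (\<lambda>i. (norm (f i))\<^sup>2)" "summable (\<lambda>i. (norm (g i))\<^sup>2)"
    then have "(\<lambda>i. cnj (cinner (g i) (f i))) sums cnj (\<Sum>i. cinner (g i) (f i))"
      by (subst sums_cnj) (intro summable_sums summable_cinner)
    then show "(\<Sum>i. cinner (f i) (g i)) = cnj (\<Sum>i. cinner (g i) (f i))"
      by (metis (no_types, lifting) cinner_commute sums_cong sums_unique)
  qed
  show "cinner (x + y) z = cinner x z + cinner y z"
    by transfer (simp add: cinner_add_left suminf_add summable_cinner)
  show "cinner (a *\<^sub>C x) y = a * cinner x y"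
    by transfer (simp add: cinner_scaleC_left suminf_mult summable_cinner)
  show "inner x y = Re (cinner x y)"
    by transfer (simp add: inner_eq_Re_cinner Re_suminf summable_cinner)
qed

end

lift_definition amplify :: "('a::chilbert_space \<Rightarrow>\<^sub>L 'a) \<Rightarrow> 'a ell2 \<Rightarrow> 'a ell2"
  is "\<lambda>T f i. blinfun_apply T (f i)"
  by (erule square_summable_mono) (rule norm_blinfun)


section \<open>The complete reduction property\<close>

definition is_submodule :: "('a::chilbert_space \<Rightarrow>\<^sub>L 'a) set \<Rightarrow> 'a ell2 set \<Rightarrow> bool" where
  "is_submodule A V \<longleftrightarrow> csubspace V \<and> closed V \<and> (\<forall>T\<in>A. \<forall>x\<in>V. amplify T x \<in> V)"

definition complete_reduction_property :: "('a::chilbert_space \<Rightarrow>\<^sub>L 'a) set \<Rightarrow> bool" where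
  "complete_reduction_property A \<longleftrightarrow>
     (\<forall>V. is_submodule A V \<longrightarrow>
        (\<exists>W. is_submodule A W \<and> V \<inter> W = {0} \<and> (\<forall>z. \<exists>x\<in>V. \<exists>y\<in>W. z = x + y)))"

end

theory Submission
  imports Defs "HOL-Computational_Algebra.Fundamental_Theorem_Algebra"
begin

text \<open>
  Similar algebras share the complete reduction property, and for a self-adjoint algebra orthogonal
  complements of submodules are submodules.

  Conversely, the closed graph theorem and a gluing argument bound the norms of suitable module
  projections by a constant \<open>K\<close>. The main step is that a nonzero module without annihilated vectors
  contains an eigenvector of some \<open>a \<in> A\<close>. Otherwise Lomonosov's theorem shows that the lattice of
  submodules, and then that of submodules invariant under the commutant, has no gaps; projections
  onto the latter are central, and a sign averaging argument along fine chains gives \<open>A = 0\<close> on the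
  module. By Riesz theory eigenvectors yield idempotents in \<open>A\<close>, and minimal ones \<open>p\<close> satisfy
  \<open>p A p = \<complex> p\<close>.

  For a maximal family of inequivalent minimal idempotents \<open>p\<close>, with unit vectors \<open>\<xi>\<close> and
  orthonormal bases of the ranges \<open>p H\<close>, projections onto graph submodules show that
  \<open>\<Sum> a\<^sub>e e \<mapsto> (a\<^sub>e \<xi>)\<^sub>e\<close> is an isomorphism of the nondegenerate part of \<open>H\<close> onto an orthogonal sum of
  modules. In the transported inner product the rank one operators
  \<open>v \<mapsto> \<langle>v, b \<xi>\<rangle> c \<xi>\<close> belong to \<open>A\<close> and are permuted by taking adjoints; they contain an approximate
  unit of \<open>A\<close>, so \<open>A\<close> is self-adjoint. The square root of the operator that represents the new inner
  product is the similarity.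
\<close>

section \<open>Geometry of complex Hilbert spaces\<close>

text \<open>A compact operator may be quasinilpotent, as Volterra operators are, and then it has no
  spectral idempotents; a single element of \<open>A\<close> need not help, and eigenvectors have to
  be forced by complementing submodules.

  Two lattices are needed because projections onto arbitrary submodules need not commute. All
  projections onto submodules of \<open>W\<close> belong to the commutant, and those onto submodules
  that the commutant preserves are central in it; differences along a chain of the latter are
  therefore commuting idempotents, and signed sums of them stay bounded by \<open>2 * K\<close>.

  Graphs supply most other estimates: the graph of \<open>l\<close> times a module map is again a
  submodule, while \<open>K\<close> depends neither on \<open>l\<close> nor on the number of copies
  of \<open>H\<close> involved. Choosing \<open>l\<close> large or small turns this into a bound for
  the map. Every finite power of \<open>H\<close> sits inside the amplification, so the constants do
  not grow with the number of idempotents; this is what lets the comparison pass from finite sums to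
  closures.

  On the vectors annihilated by \<open>A\<close> the original inner product is kept.\<close>

instance chilbert_space \<subseteq> banach ..

interpretation cvs: vector_space "scaleC :: complex \<Rightarrow> 'a \<Rightarrow> 'a::complex_normed_vector"
  by unfold_locales (simp_all add: scaleC_add_right scaleC_add_left scaleC_scaleC)

lemma csubspace_iff: "csubspace V \<longleftrightarrow> cvs.subspace V"
  by (simp add: csubspace_def cvs.subspace_def)

lemma csubspaceD:
  assumes "csubspace V"
  shows csubspace_0: "0 \<in> V"
    and csubspace_add: "x \<in> V \<Longrightarrow> y \<in> V \<Longrightarrow> x + y \<in> V"
    and csubspace_scaleC: "x \<in> V \<Longrightarrow> c *\<^sub>C x \<in> V"
    and csubspace_diff: "x \<in> V \<Longrightarrow> y \<in> V \<Longrightarrow> x - y \<in> V"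
    and csubspace_uminus: "x \<in> V \<Longrightarrow> - x \<in> V"
    and csubspace_sum: "(\<And>i. i \<in> I \<Longrightarrow> f i \<in> V) \<Longrightarrow> sum f I \<in> V"
    and csubspace_scaleR: "x \<in> V \<Longrightarrow> r *\<^sub>R x \<in> V"
  using assms unfolding csubspace_iff
  by (simp_all add: cvs.subspace_0 cvs.subspace_add cvs.subspace_scale cvs.subspace_diff
      cvs.subspace_neg cvs.subspace_sum scaleR_eq_scaleC)

lemma csubspace_imp_subspace: "csubspace V \<Longrightarrow> subspace V"
  by (simp add: subspace_def csubspaceD)

lemma csubspace_Int: "csubspace V \<Longrightarrow> csubspace W \<Longrightarrow> csubspace (V \<inter> W)"
  by (auto simp: csubspace_def)

lemma csubspace_UNIV [simp]: "csubspace UNIV"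
  by (auto simp: csubspace_def)

lemma csubspace_zero [simp]: "csubspace {0}"
  by (auto simp: csubspace_def cvs.scale_zero_right)

lemma tendsto_scaleC:
  fixes f :: "'b \<Rightarrow> 'a::complex_normed_vector"
  assumes "(c \<longlongrightarrow> a) F" "(f \<longlongrightarrow> x) F"
  shows "((\<lambda>i. c i *\<^sub>C f i) \<longlongrightarrow> a *\<^sub>C x) F"
proof -
  have "bounded_bilinear (\<lambda>(c::complex) (x::'a). c *\<^sub>C x)"
    by unfold_locales
      (auto simp: scaleC_add_right scaleC_add_left scaleR_eq_scaleC scaleC_scaleC norm_scaleC
        mult.commute scaleR_conv_of_real intro!: exI[of _ 1])
  then show ?thesis using assms by (rule bounded_bilinear.tendsto)
qed

lemma csubspace_closure:
  assumes "csubspace (V :: 'a::complex_normed_vector set)" shows "csubspace (closure V)"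
  unfolding csubspace_def
proof (intro conjI allI ballI)
  show "0 \<in> closure V" using csubspace_0[OF assms] closure_subset by blast
  fix x assume x: "x \<in> closure V"
  then obtain f where f: "\<And>n. f n \<in> V" "f \<longlonglongrightarrow> x" unfolding closure_sequential by blast
  show "c *\<^sub>C x \<in> closure V" for c
    unfolding closure_sequential
    using f by (intro exI[of _ "\<lambda>n. c *\<^sub>C f n"])
       (auto intro!: tendsto_scaleC csubspace_scaleC[OF assms])
  fix y assume "y \<in> closure V"
  then obtain g where g: "\<And>n. g n \<in> V" "g \<longlonglongrightarrow> y" unfolding closure_sequential by blast
  show "x + y \<in> closure V"
    unfolding closure_sequential
    using f g by (intro exI[of _ "\<lambda>n. f n + g n"])
       (auto intro!: tendsto_add csubspace_add[OF assms])
qed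

lemma csubspace_cspan [simp]: "csubspace (cvs.span X)"
  by (simp add: csubspace_iff cvs.subspace_span)

subsection \<open>The inner product\<close>

lemma cinner_add_right: "cinner x (y + z) = cinner x y + cinner x (z::'a::chilbert_space)"
  by (metis cinner_add_left cinner_commute complex_cnj_add)

lemma cinner_scaleC_right: "cinner x (a *\<^sub>C y) = cnj a * cinner x (y::'a::chilbert_space)"
  by (metis cinner_scaleC_left cinner_commute complex_cnj_mult)

lemma cinner_zero_left [simp]: "cinner 0 (y::'a::chilbert_space) = 0"
  using cinner_add_left[of 0 0 y] by simp

lemma cinner_zero_right [simp]: "cinner (y::'a::chilbert_space) 0 = 0"
  using cinner_add_right[of y 0 0] by simp

lemma cinner_uminus_left: "cinner (- x) y = - cinner x (y::'a::chilbert_space)"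
  using cinner_scaleC_left[of "-1" x y] by simp

lemma cinner_uminus_right: "cinner x (- y) = - cinner x (y::'a::chilbert_space)"
  using cinner_scaleC_right[of x "-1" y] by simp

lemma cinner_diff_left: "cinner (x - y) z = cinner x z - cinner y (z::'a::chilbert_space)"
  using cinner_add_left[of x "- y" z] by (simp add: cinner_uminus_left)

lemma cinner_diff_right: "cinner x (y - z) = cinner x y - cinner x (z::'a::chilbert_space)"
  using cinner_add_right[of x y "- z"] by (simp add: cinner_uminus_right)

lemma cinner_sum_left: "cinner (sum f I) y = (\<Sum>i\<in>I. cinner (f i) (y::'a::chilbert_space))"
  by (induction I rule: infinite_finite_induct) (simp_all add: cinner_add_left)

lemma cinner_sum_right: "cinner x (sum f I) = (\<Sum>i\<in>I. cinner (x::'a::chilbert_space) (f i))"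
  by (induction I rule: infinite_finite_induct) (simp_all add: cinner_add_right)

lemma cinner_self: "cinner x x = complex_of_real ((norm (x::'a::chilbert_space))\<^sup>2)"
proof (rule complex_eqI)
  show "Re (cinner x x) = Re (complex_of_real ((norm x)\<^sup>2))"
    by (simp add: inner_eq_Re_cinner[symmetric] power2_norm_eq_inner)
  have "cinner x x = cnj (cinner x x)" by (rule cinner_commute)
  then show "Im (cinner x x) = Im (complex_of_real ((norm x)\<^sup>2))"
    by (simp add: complex_eq_iff)
qed

lemma cinner_eq_0_commute: "cinner x y = 0 \<longleftrightarrow> cinner y (x::'a::chilbert_space) = 0"
  by (metis cinner_commute complex_cnj_zero)

lemma norm_cinner_le: "cmod (cinner x y) \<le> norm x * norm (y::'a::chilbert_space)"
proof (cases "cinner x y = 0")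
  case False
  define c where "c = cnj (cinner x y) / cmod (cinner x y)"
  have c: "cmod c = 1" using False by (simp add: c_def norm_divide)
  have "c * cinner x y = complex_of_real (cmod (cinner x y))"
    using False by (simp add: c_def mult.commute[of "cnj _"] complex_norm_square[symmetric]
        power2_eq_square)
  then have "cmod (cinner x y) = inner (c *\<^sub>C x) y"
    by (simp add: inner_eq_Re_cinner cinner_scaleC_left)
  also have "\<dots> \<le> norm (c *\<^sub>C x) * norm y" by (rule norm_cauchy_schwarz)
  finally show ?thesis by (simp add: norm_scaleC c)
qed simp

lemma bounded_bilinear_cinner: "bounded_bilinear (cinner :: 'a::chilbert_space \<Rightarrow> 'a \<Rightarrow> complex)"
  by unfold_locales
    (auto simp: cinner_add_left cinner_add_right scaleR_eq_scaleC cinner_scaleC_left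
      cinner_scaleC_right scaleR_conv_of_real intro!: exI[of _ 1] norm_cinner_le)

lemmas tendsto_cinner = bounded_bilinear.tendsto[OF bounded_bilinear_cinner]

lemmas bounded_linear_cinner_left = bounded_bilinear.bounded_linear_left[OF bounded_bilinear_cinner]

lemma cinner_eqI:
  assumes "\<And>z. cinner x z = cinner y (z::'a::chilbert_space)" shows "x = y"
proof -
  have "cinner (x - y) (x - y) = 0" by (simp add: cinner_diff_left assms)
  then show ?thesis by (simp add: cinner_self)
qed

lemma norm_add_sq:
  "(norm (x + y))\<^sup>2 = (norm x)\<^sup>2 + 2 * inner x y + (norm (y::'a::real_inner))\<^sup>2"
  by (simp add: power2_norm_eq_inner inner_add inner_commute)

lemma parallelogram:
  "(norm (x + y))\<^sup>2 + (norm (x - y))\<^sup>2 = 2 * (norm x)\<^sup>2 + 2 * (norm (y::'a::real_inner))\<^sup>2"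
  by (simp add: power2_norm_eq_inner inner_add inner_diff inner_commute)

subsection \<open>Orthogonal projections\<close>

text \<open>Minimizing sequences are Cauchy: by the parallelogram law two almost closest points of
  \<open>V\<close> are close together, since their midpoint lies in \<open>V\<close> and is at
  distance at least \<open>d\<close> too.\<close>

lemma closest_point_exists_subspace:
  fixes x :: "'a::{real_inner,complete_space}"
  assumes V: "subspace V" "closed V"
  shows "\<exists>v\<in>V. \<forall>w\<in>V. norm (x - v) \<le> norm (x - w)"
proof -
  define d where "d = infdist x V"
  have ne: "V \<noteq> {}" using subspace_0[OF V(1)] by blast
  have d_le: "d \<le> norm (x - w)" if "w \<in> V" for w
    using infdist_le[OF that, of x] by (simp add: d_def dist_norm)
  have d0: "0 \<le> d" by (simp add: d_def infdist_nonneg)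
  have "\<exists>v\<in>V. (norm (x - v))\<^sup>2 < d\<^sup>2 + 1 / real (Suc n)" for n
  proof -
    have "d < sqrt (d\<^sup>2 + 1 / real (Suc n))"
      by (rule real_less_rsqrt) simp
    then have "\<exists>v\<in>V. dist x v < sqrt (d\<^sup>2 + 1 / real (Suc n))"
      using infdist_attains_inf cInf_lessD[of "(\<lambda>v. dist x v) ` V" "sqrt (d\<^sup>2 + 1 / real (Suc n))"] ne
      unfolding d_def infdist_def by auto
    then obtain v where v: "v \<in> V" "norm (x - v) < sqrt (d\<^sup>2 + 1 / real (Suc n))"
      by (auto simp: dist_norm)
    then have "(norm (x - v))\<^sup>2 < (sqrt (d\<^sup>2 + 1 / real (Suc n)))\<^sup>2"
      by (intro power_strict_mono) auto
    then show ?thesis using v by (auto simp: add_nonneg_nonneg)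
  qed
  then obtain v where v: "\<And>n. v n \<in> V" "\<And>n. (norm (x - v n))\<^sup>2 < d\<^sup>2 + 1 / real (Suc n)"
    by metis
  have bd: "(norm (v m - v n))\<^sup>2 \<le> 2 / real (Suc m) + 2 / real (Suc n)" for m n
  proof -
    have "(1/2) *\<^sub>R (v m + v n) \<in> V"
      using V v by (simp add: subspace_add subspace_scale)
    from d_le[OF this] have "d\<^sup>2 \<le> (norm (x - (1/2) *\<^sub>R (v m + v n)))\<^sup>2"
      using d0 by (intro power_mono) auto
    moreover have "(x - v m) + (x - v n) = 2 *\<^sub>R (x - (1/2) *\<^sub>R (v m + v n))"
      by (simp add: algebra_simps scaleR_2)
    then have "(norm ((x - v m) + (x - v n)))\<^sup>2 = 4 * (norm (x - (1/2) *\<^sub>R (v m + v n)))\<^sup>2"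
      by (simp add: power_mult_distrib)
    moreover have "norm ((x - v m) - (x - v n)) = norm (v m - v n)"
      by (simp add: norm_minus_commute)
    ultimately show ?thesis
      using parallelogram[of "x - v m" "x - v n"] v(2)[of m] v(2)[of n] by simp
  qed
  have "Cauchy v"
  proof (rule metric_CauchyI)
    fix e :: real assume e: "0 < e"
    obtain N where N: "4 / e\<^sup>2 < real (Suc N)"
      using reals_Archimedean2[of "4 / e\<^sup>2"] by (metis less_SucI of_nat_less_iff order_less_trans lessI)
    have "dist (v m) (v n) < e" if "m \<ge> N" "n \<ge> N" for m n
    proof -
      have "2 / real (Suc m) + 2 / real (Suc n) \<le> 2 / real (Suc N) + 2 / real (Suc N)"
        using that by (intro add_mono divide_left_mono) auto
      also have "\<dots> = 4 / real (Suc N)" by simp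
      also have "\<dots> < e\<^sup>2" using N e by (simp add: field_simps)
      finally have "(norm (v m - v n))\<^sup>2 < e\<^sup>2" using bd[of m n] by linarith
      then show ?thesis using e by (simp add: dist_norm power2_less_imp_less)
    qed
    then show "\<exists>N. \<forall>m\<ge>N. \<forall>n\<ge>N. dist (v m) (v n) < e" by blast
  qed
  then obtain l where l: "v \<longlonglongrightarrow> l" using Cauchy_convergent_iff convergent_def by blast
  have lV: "l \<in> V" using closed_sequentially[OF V(2)] v(1) l by blast
  have lim1: "(\<lambda>n. (norm (x - v n))\<^sup>2) \<longlonglongrightarrow> (norm (x - l))\<^sup>2" by (intro tendsto_intros l)
  have lim2: "(\<lambda>n. d\<^sup>2 + 1 / real (Suc n)) \<longlonglongrightarrow> d\<^sup>2 + 0"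
    by (intro tendsto_intros LIMSEQ_Suc[OF lim_1_over_n])
  have le: "(norm (x - v n))\<^sup>2 \<le> d\<^sup>2 + 1 / real (Suc n)" for n
    using v(2)[of n] by (rule less_imp_le)
  have "(norm (x - l))\<^sup>2 \<le> d\<^sup>2 + 0"
    by (rule LIMSEQ_le[OF lim1 lim2]) (use le in blast)
  then have "norm (x - l) \<le> d" using d0 by (intro power2_le_imp_le[OF _ d0]) simp
  then show ?thesis using lV d_le by (meson order_trans)
qed

lemma orthogonal_projection_exists:
  fixes x :: "'a::{real_inner,complete_space}"
  assumes V: "subspace V" "closed V"
  shows "\<exists>v\<in>V. \<forall>w\<in>V. inner (x - v) w = 0"
proof -
  obtain v where v: "v \<in> V" "\<And>w. w \<in> V \<Longrightarrow> norm (x - v) \<le> norm (x - w)"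
    using closest_point_exists_subspace[OF V, of x] by blast
  have "inner (x - v) w = 0" if w: "w \<in> V" for w
  proof (cases "w = 0")
    case False
    \<comment> \<open>\<open>t\<close> minimizes the distance from \<open>x\<close> to
      \<open>v + t w\<close>. Passing to that point lowers the squared distance by
      \<open>t\<^sup>2 * inner w w\<close>, so minimality of \<open>v\<close> forces
      \<open>t = 0\<close>.\<close>
    define t where "t = inner (x - v) w / inner w w"
    have ww: "inner w w > 0" using False by simp
    have "v + t *\<^sub>R w \<in> V" using V v w by (simp add: subspace_add subspace_scale)
    then have "(norm (x - v))\<^sup>2 \<le> (norm (x - (v + t *\<^sub>R w)))\<^sup>2"
      using v(2) by (intro power_mono) auto
    also have "x - (v + t *\<^sub>R w) = (x - v) + (- t) *\<^sub>R w" by (simp add: algebra_simps)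
    also have "(norm \<dots>)\<^sup>2 = (norm (x - v))\<^sup>2 - 2 * t * inner (x - v) w + t\<^sup>2 * inner w w"
      unfolding norm_add_sq
      by (simp add: power2_norm_eq_inner[symmetric] power_mult_distrib)
    also have "2 * t * inner (x - v) w = 2 * t\<^sup>2 * inner w w"
      using ww by (simp add: t_def power2_eq_square)
    finally have "t\<^sup>2 * inner w w \<le> 0" by (simp add: mult.commute)
    moreover have "0 < t\<^sup>2 * inner w w" if "t \<noteq> 0" using ww that by simp
    ultimately have "t = 0" by linarith
    then show ?thesis using ww by (simp add: t_def)
  qed simp
  then show ?thesis using v by blast
qed

text \<open>Orthogonality is asked for the real inner product only. For a complex subspace it
  implies complex orthogonality, because the subspace is stable under multiplication by the
  imaginary unit; see \<open>proj_corth\<close>.\<close>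

definition proj :: "'a::chilbert_space set \<Rightarrow> 'a \<Rightarrow> 'a" where
  "proj V x = (SOME v. v \<in> V \<and> (\<forall>w\<in>V. inner (x - v) w = 0))"

context
  fixes V :: "'a::chilbert_space set"
  assumes V: "csubspace V" "closed V"
begin

lemma proj_in: "proj V x \<in> V"
  and proj_orth: "w \<in> V \<Longrightarrow> inner (x - proj V x) w = 0"
proof -
  have "\<exists>v. v \<in> V \<and> (\<forall>w\<in>V. inner (x - v) w = 0)"
    using orthogonal_projection_exists[OF csubspace_imp_subspace[OF V(1)] V(2), of x] by blast
  then have "proj V x \<in> V \<and> (\<forall>w\<in>V. inner (x - proj V x) w = 0)"
    unfolding proj_def by (rule someI_ex)
  then show "proj V x \<in> V" "w \<in> V \<Longrightarrow> inner (x - proj V x) w = 0" by auto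
qed

lemma proj_corth: 
  assumes "w \<in> V" shows "cinner (x - proj V x) w = 0"
proof (rule complex_eqI)
  show "Re (cinner (x - proj V x) w) = Re 0"
    using proj_orth[OF assms, of x] by (simp add: inner_eq_Re_cinner)
  have "inner (x - proj V x) (\<i> *\<^sub>C w) = 0"
    by (rule proj_orth) (simp add: csubspace_scaleC[OF V(1)] assms)
  then show "Im (cinner (x - proj V x) w) = Im 0"
    by (simp add: inner_eq_Re_cinner cinner_scaleC_right)
qed

lemma proj_unique:
  assumes "v \<in> V" "\<And>w. w \<in> V \<Longrightarrow> inner (x - v) w = 0"
  shows "proj V x = v"
proof -
  have d: "proj V x - v \<in> V" using assms proj_in csubspace_diff[OF V(1)] by blast
  have "inner (proj V x - v) (proj V x - v)
        = inner (x - v) (proj V x - v) - inner (x - proj V x) (proj V x - v)"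
    by (simp add: inner_diff_left[symmetric])
  also have "\<dots> = 0" using d by (simp add: assms(2) proj_orth)
  finally show ?thesis by simp
qed

lemma proj_ident: "v \<in> V \<Longrightarrow> proj V v = v"
  by (rule proj_unique) auto

lemma proj_add: "proj V (x + y) = proj V x + proj V y"
proof (rule proj_unique)
  fix w assume "w \<in> V"
  then have "inner (x - proj V x) w + inner (y - proj V y) w = 0" by (simp add: proj_orth)
  then show "inner (x + y - (proj V x + proj V y)) w = 0"
    by (simp add: inner_diff_left inner_add_left)
qed (simp add: proj_in csubspace_add[OF V(1)])

lemma proj_scaleC: "proj V (c *\<^sub>C x) = c *\<^sub>C proj V x"
proof (rule proj_unique)
  fix w assume "w \<in> V"
  then have "cinner (c *\<^sub>C x - c *\<^sub>C proj V x) w = 0"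
    using proj_corth[of w x] by (simp add: cinner_diff_left cinner_scaleC_left)
  then show "inner (c *\<^sub>C x - c *\<^sub>C proj V x) w = 0"
    by (simp add: inner_eq_Re_cinner)
qed (simp add: proj_in csubspace_scaleC[OF V(1)])

lemma proj_diff: "proj V (x - y) = proj V x - proj V y"
  using proj_add[of x "(-1) *\<^sub>C y"] proj_scaleC[of "-1" y] by simp

lemma proj_pythagoras: "(norm x)\<^sup>2 = (norm (proj V x))\<^sup>2 + (norm (x - proj V x))\<^sup>2"
  using norm_add_sq[of "proj V x" "x - proj V x"] proj_orth[OF proj_in, of x x]
  by (simp add: inner_commute)

lemma norm_proj_le: "norm (proj V x) \<le> norm x"
  by (rule power2_le_imp_le) (simp_all add: proj_pythagoras[of x])

lemma norm_diff_proj_le: "norm (x - proj V x) \<le> norm x"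
  by (rule power2_le_imp_le) (simp_all add: proj_pythagoras[of x])

lemma norm_diff_proj_le_dist:
  assumes "v \<in> V" shows "norm (x - proj V x) \<le> norm (x - v)"
proof -
  have "x - v - proj V (x - v) = x - proj V x"
    by (simp add: proj_diff proj_ident[OF assms])
  then show ?thesis using norm_diff_proj_le[of "x - v"] by (simp only:)
qed

end

definition ocomp :: "'a::chilbert_space set \<Rightarrow> 'a set" where
  "ocomp V = {x. \<forall>v\<in>V. cinner x v = 0}"

lemma csubspace_ocomp: "csubspace (ocomp V)"
  by (auto simp: csubspace_def ocomp_def cinner_add_left cinner_scaleC_left)

lemma closed_ocomp: "closed (ocomp V)"
proof -
  have "ocomp V = (\<Inter>v\<in>V. {x. cinner x v = 0})" by (auto simp: ocomp_def)
  moreover have "closed {x. cinner x v = 0}" for v :: 'a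
    by (intro closed_Collect_eq continuous_on_const
      linear_continuous_on bounded_linear_cinner_left)
  ultimately show ?thesis by auto
qed

lemma proj_ocomp:
  assumes V: "csubspace V" "closed V"
  shows "proj (ocomp V) x = x - proj V x"
proof (rule proj_unique[OF csubspace_ocomp closed_ocomp])
  show "x - proj V x \<in> ocomp V" by (simp add: ocomp_def proj_corth[OF V])
  fix w assume "w \<in> ocomp V"
  then have "cinner (proj V x) w = 0"
    using proj_in[OF V, of x] by (simp add: ocomp_def cinner_eq_0_commute[of _ w])
  then show "inner (x - (x - proj V x)) w = 0" by (simp add: inner_eq_Re_cinner)
qed

lemma ocomp_antimono: "V \<subseteq> W \<Longrightarrow> ocomp W \<subseteq> ocomp V"
  by (auto simp: ocomp_def)

lemma ocomp_ocomp:
  assumes V: "csubspace V" "closed V"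
  shows "ocomp (ocomp V) = V"
proof (intro equalityI subsetI)
  fix x assume "x \<in> ocomp (ocomp V)"
  then have "proj (ocomp (ocomp V)) x = x"
    by (simp add: proj_ident csubspace_ocomp closed_ocomp)
  then have "proj V x = x"
    by (simp add: proj_ocomp csubspace_ocomp closed_ocomp V)
  then show "x \<in> V" using proj_in[OF V, of x] by simp
next
  fix x assume "x \<in> V"
  then show "x \<in> ocomp (ocomp V)" by (auto simp: ocomp_def cinner_eq_0_commute[of x])
qed

subsection \<open>Riesz representation and adjoints\<close>

lemma riesz_representation:
  fixes f :: "'a::chilbert_space \<Rightarrow> complex"
  assumes f: "bounded_linear f" and fc: "\<And>c x. f (c *\<^sub>C x) = c * f x"
  shows "\<exists>g. \<forall>x. f x = cinner x g"
proof (cases "\<forall>x. f x = 0")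
  case True
  then show ?thesis by (intro exI[of _ 0]) simp
next
  case False
  then obtain x0 where x0: "f x0 \<noteq> 0" by blast
  interpret f: bounded_linear f by (rule f)
  define V where "V = {x. f x = 0}"
  have V: "csubspace V" "closed V"
    unfolding V_def csubspace_def
    by (auto simp: f.add fc intro!: closed_Collect_eq continuous_on_const linear_continuous_on f)
  define u where "u = x0 - proj V x0"
  have fu: "f u \<noteq> 0" using proj_in[OF V, of x0] x0 by (simp add: u_def f.diff V_def)
  then have u0: "u \<noteq> 0" by auto
  \<comment> \<open>The scalar is chosen so that \<open>cinner u g = f u\<close>; the rest follows
    because the kernel \<open>V\<close> has codimension one and is orthogonal to
    \<open>u\<close>.\<close>
  define g where "g = (cnj (f u) / complex_of_real ((norm u)\<^sup>2)) *\<^sub>C u"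
  have "f x = cinner x g" for x
  proof -
    have "x - (f x / f u) *\<^sub>C u \<in> V" using fu by (simp add: V_def f.diff fc)
    then have "cinner u (x - (f x / f u) *\<^sub>C u) = 0" unfolding u_def by (rule proj_corth[OF V])
    then have "cinner (x - (f x / f u) *\<^sub>C u) u = 0" by (simp add: cinner_eq_0_commute)
    then have "cinner x u = (f x / f u) * complex_of_real ((norm u)\<^sup>2)"
      by (simp add: cinner_diff_left cinner_scaleC_left cinner_self)
    then show ?thesis using fu u0 by (simp add: g_def cinner_scaleC_right)
  qed
  then show ?thesis by blast
qed

lemma bounded_opsD: "T \<in> bounded_ops \<Longrightarrow> blinfun_apply T (c *\<^sub>C x) = c *\<^sub>C blinfun_apply T x"
  by (simp add: bounded_ops_def)

lemma bounded_opsI: "(\<And>c x. blinfun_apply T (c *\<^sub>C x) = c *\<^sub>C blinfun_apply T x) \<Longrightarrow> T \<in> bounded_ops"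
  by (simp add: bounded_ops_def)

lemma blinfun_scaleC [simp]: "blinfun_apply (c *\<^sub>C T) x = c *\<^sub>C blinfun_apply T x"
  by (simp add: scaleC_blinfun.rep_eq)

lemma bounded_ops_closure:
  shows bounded_ops_id: "id_blinfun \<in> bounded_ops"
    and bounded_ops_0: "0 \<in> bounded_ops"
    and bounded_ops_add: "S \<in> bounded_ops \<Longrightarrow> T \<in> bounded_ops \<Longrightarrow> S + T \<in> bounded_ops"
    and bounded_ops_diff: "S \<in> bounded_ops \<Longrightarrow> T \<in> bounded_ops \<Longrightarrow> S - T \<in> bounded_ops"
    and bounded_ops_scaleC: "S \<in> bounded_ops \<Longrightarrow> c *\<^sub>C S \<in> bounded_ops"
    and bounded_ops_compose: "S \<in> bounded_ops \<Longrightarrow> T \<in> bounded_ops \<Longrightarrow> S o\<^sub>L T \<in> bounded_ops"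
  by (auto simp: bounded_ops_def blinfun.bilinear_simps scaleC_add_right mult.commute
      cvs.scale_right_diff_distrib)

lemma csubspace_bounded_ops: "csubspace bounded_ops"
  by (simp add: csubspace_def bounded_ops_closure)

lemma tendsto_blinfun_apply:
  assumes "(F \<longlongrightarrow> T) G" shows "((\<lambda>i. blinfun_apply (F i) x) \<longlongrightarrow> blinfun_apply T x) G"
  using assms by (intro tendsto_intros)

lemma closed_bounded_ops: "closed (bounded_ops :: ('a::chilbert_space \<Rightarrow>\<^sub>L 'a) set)"
  unfolding closed_sequential_limits
proof (intro allI impI, elim conjE)
  fix F :: "nat \<Rightarrow> 'a \<Rightarrow>\<^sub>L 'a" and T
  assume F: "\<forall>n. F n \<in> bounded_ops" and T: "F \<longlonglongrightarrow> T"
  show "T \<in> bounded_ops"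
  proof (rule bounded_opsI)
    fix c x
    have "(\<lambda>n. F n (c *\<^sub>C x)) \<longlonglongrightarrow> T (c *\<^sub>C x)" by (rule tendsto_blinfun_apply[OF T])
    moreover have "(\<lambda>n. F n (c *\<^sub>C x)) \<longlonglongrightarrow> c *\<^sub>C T x"
      using F by (simp add: bounded_opsD) (intro tendsto_scaleC tendsto_const tendsto_blinfun_apply T)
    ultimately show "T (c *\<^sub>C x) = c *\<^sub>C T x" by (rule LIMSEQ_unique)
  qed
qed

lemma riesz_form:
  fixes B :: "'a::chilbert_space \<Rightarrow> 'a \<Rightarrow> complex"
  assumes add1: "\<And>x x' y. B (x + x') y = B x y + B x' y"
    and scale1: "\<And>c x y. B (c *\<^sub>C x) y = c * B x y"
    and add2: "\<And>x y y'. B x (y + y') = B x y + B x y'"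
    and scale2: "\<And>c x y. B x (c *\<^sub>C y) = cnj c * B x y"
    and bd: "\<And>x y. cmod (B x y) \<le> K * norm x * norm y"
  shows "\<exists>G\<in>bounded_ops. \<forall>x y. B x y = cinner x (blinfun_apply G y)"
proof -
  have K: "\<bar>K\<bar> * norm x * norm y \<ge> cmod (B x y)" for x y
    by (rule order_trans[OF bd]) (intro mult_right_mono; simp)
  have "\<exists>g. \<forall>x. B x y = cinner x g" for y
  proof (rule riesz_representation)
    show "bounded_linear (\<lambda>x. B x y)"
    proof (rule bounded_linear_intro[where K = "\<bar>K\<bar> * norm y"])
      show "norm (B x y) \<le> norm x * (\<bar>K\<bar> * norm y)" for x
        using K[of x y] by (simp add: ac_simps)
      show "B (r *\<^sub>R x) y = r *\<^sub>R B x y" for r x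
        by (simp add: scaleR_eq_scaleC scale1 scaleR_conv_of_real)
    qed (rule add1)
  qed (rule scale1)
  then obtain g where g: "\<And>x y. B x y = cinner x (g y)" by metis
  have ga: "g (y + y') = g y + g y'" for y y'
  proof -
    have "cinner x (g (y + y')) = cinner x (g y + g y')" for x
      unfolding cinner_add_right g[symmetric] by (rule add2)
    then show ?thesis by (metis cinner_eqI cinner_commute)
  qed
  have gc: "g (c *\<^sub>C y) = c *\<^sub>C g y" for c y
  proof -
    have "cinner x (g (c *\<^sub>C y)) = cinner x (c *\<^sub>C g y)" for x
      unfolding cinner_scaleC_right g[symmetric] by (rule scale2)
    then show ?thesis by (metis cinner_eqI cinner_commute)
  qed
  have gn: "norm (g y) \<le> norm y * \<bar>K\<bar>" for y
  proof (cases "g y = 0")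
    case False
    have "(norm (g y))\<^sup>2 = cmod (B (g y) y)" unfolding g cinner_self by (simp add: norm_power)
    also have "\<dots> \<le> norm (g y) * (\<bar>K\<bar> * norm y)" using K[of "g y" y] by (simp add: ac_simps)
    finally show ?thesis using False by (simp add: power2_eq_square mult.commute)
  qed simp
  have "bounded_linear g"
    by (rule bounded_linear_intro[where K = "\<bar>K\<bar>"]) (simp_all add: ga gc scaleR_eq_scaleC gn)
  then have "blinfun_apply (Blinfun g) = g" by (rule bounded_linear_Blinfun_apply)
  then show ?thesis by (intro bexI[of _ "Blinfun g"]) (auto simp: g gc intro: bounded_opsI)
qed

lemma adjoint_exists:
  assumes T: "T \<in> bounded_ops"
  shows "\<exists>T'\<in>bounded_ops. is_adjoint T T'"
proof -
  have "\<exists>G\<in>bounded_ops. \<forall>x y. cinner (blinfun_apply T x) y = cinner x (blinfun_apply G y)"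
  proof (rule riesz_form)
    show "cmod (cinner (blinfun_apply T x) y) \<le> norm T * norm x * norm y" for x y
      by (rule order_trans[OF norm_cinner_le]) (intro mult_right_mono norm_blinfun; simp)
  qed (simp_all add: bounded_opsD[OF T] blinfun.add_right cinner_add_left cinner_add_right
      cinner_scaleC_left cinner_scaleC_right)
  then show ?thesis by (auto simp: is_adjoint_def)
qed

subsection \<open>Finite orthonormal systems\<close>

definition orthonormal :: "'a::chilbert_space set \<Rightarrow> bool" where
  "orthonormal F \<longleftrightarrow> (\<forall>e\<in>F. \<forall>f\<in>F. cinner e f = (if e = f then 1 else 0))"

lemma cinner_orthonormal_sum:
  assumes "finite F" "orthonormal F" "e \<in> F"
  shows "cinner (\<Sum>f\<in>F. c f *\<^sub>C f) e = c e"
proof -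
  have "cinner (\<Sum>f\<in>F. c f *\<^sub>C f) e = (\<Sum>f\<in>F. c f * cinner f e)"
    by (simp add: cinner_sum_left cinner_scaleC_left)
  also have "\<dots> = (\<Sum>f\<in>F. if f = e then c f else 0)"
    using assms by (intro sum.cong) (auto simp: orthonormal_def)
  also have "\<dots> = c e" using assms by simp
  finally show ?thesis .
qed

lemma norm_sum_indexed_orthonormal:
  assumes "finite I" "\<And>i j. i \<in> I \<Longrightarrow> j \<in> I \<Longrightarrow> cinner (e i) (e j) = (if i = j then 1 else 0)"
  shows "(norm (\<Sum>i\<in>I. c i *\<^sub>C e i))\<^sup>2 = (\<Sum>i\<in>I. (cmod (c i))\<^sup>2)"
proof -
  have "complex_of_real ((norm (\<Sum>i\<in>I. c i *\<^sub>C e i))\<^sup>2)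
      = (\<Sum>i\<in>I. c i * (\<Sum>j\<in>I. cnj (c j) * cinner (e i) (e j)))"
    unfolding cinner_self[symmetric]
    by (subst cinner_sum_left)
       (simp add: cinner_sum_right cinner_scaleC_left cinner_scaleC_right sum_distrib_left ac_simps)
  also have "\<dots> = (\<Sum>i\<in>I. c i * (\<Sum>j\<in>I. if i = j then cnj (c j) else 0))"
    using assms by (intro sum.cong refl arg_cong2[of _ _ _ _ "(*)"]) auto
  also have "\<dots> = (\<Sum>i\<in>I. c i * cnj (c i))" using assms(1) by simp
  also have "\<dots> = complex_of_real (\<Sum>i\<in>I. (cmod (c i))\<^sup>2)"
    by (simp add: complex_norm_square[symmetric])
  finally show ?thesis using of_real_eq_iff by blast
qed

lemma norm_sum_orthonormal:
  assumes "finite F" "orthonormal F"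
  shows "(norm (\<Sum>f\<in>F. c f *\<^sub>C f))\<^sup>2 = (\<Sum>f\<in>F. (cmod (c f))\<^sup>2)"
  using norm_sum_indexed_orthonormal[OF assms(1), of "\<lambda>f. f" c] assms(2)
  by (simp add: orthonormal_def)

text \<open>One Gram-Schmidt step: \<open>e\<close> is the normalized residual of \<open>x\<close>,
  so \<open>x\<close> is fully expanded once \<open>e\<close> has been added. The set
  \<open>X\<close> records where the new vector lies.\<close>

lemma orthonormal_insert:
  assumes F: "finite F" "orthonormal F" and x: "x \<noteq> (\<Sum>f\<in>F. cinner x f *\<^sub>C f)"
    and X: "csubspace X" "F \<subseteq> X" "x \<in> X"
  shows "\<exists>e. e \<notin> F \<and> orthonormal (insert e F) \<and> e \<in> X
           \<and> x = (\<Sum>f\<in>insert e F. cinner x f *\<^sub>C f)"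
proof -
  define y where "y = x - (\<Sum>f\<in>F. cinner x f *\<^sub>C f)"
  have y0: "y \<noteq> 0" using x by (simp add: y_def)
  define e where "e = complex_of_real (1 / norm y) *\<^sub>C y"
  have yF: "cinner y f = 0" if "f \<in> F" for f
    using cinner_orthonormal_sum[OF F that] by (simp add: y_def cinner_diff_left)
  then have eF: "cinner e f = 0" "cinner f e = 0" if "f \<in> F" for f
    using that by (simp_all add: e_def cinner_scaleC_left cinner_scaleC_right cinner_eq_0_commute[of f])
  have ee: "cinner e e = 1"
    using y0 by (simp add: e_def cinner_self norm_scaleC norm_divide power2_eq_square)
  have eX: "e \<in> X"
    unfolding e_def y_def using X
    by (intro csubspace_scaleC csubspace_diff csubspace_sum) auto
  have enF: "e \<notin> F" using eF ee by force
  have on: "orthonormal (insert e F)"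
    using F(2) eF ee by (auto simp: orthonormal_def)
  have "cinner x e = cinner y e"
    using eF by (simp add: y_def cinner_diff_left cinner_sum_left cinner_scaleC_left)
  also have "\<dots> = norm y"
    using y0 by (simp add: e_def cinner_scaleC_right cinner_self power2_eq_square)
  finally have "cinner x e *\<^sub>C e = y"
    using y0 by (simp add: e_def scaleC_scaleC)
  then have "x = (\<Sum>f\<in>insert e F. cinner x f *\<^sub>C f)"
    using F(1) enF by (simp add: y_def)
  with on enF eX show ?thesis by blast
qed

lemma orthonormal_expansion_mono:
  assumes F: "finite F" "orthonormal (insert e F)" "e \<notin> F"
    and x: "x = (\<Sum>f\<in>F. cinner x f *\<^sub>C f)"
  shows "x = (\<Sum>f\<in>insert e F. cinner x f *\<^sub>C f)"
proof -
  have "cinner x e = (\<Sum>f\<in>F. cinner x f * cinner f e)"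
    by (subst x) (simp add: cinner_sum_left cinner_scaleC_left)
  also have "\<dots> = 0" using F by (auto simp: orthonormal_def intro!: sum.neutral)
  finally show ?thesis using x F by simp
qed

lemma gram_schmidt:
  assumes "finite X"
  shows "\<exists>F. finite F \<and> orthonormal F \<and> F \<subseteq> cvs.span X
           \<and> (\<forall>x\<in>X. x = (\<Sum>f\<in>F. cinner x f *\<^sub>C f))"
  using assms
proof (induction X)
  case empty
  then show ?case by (intro exI[of _ "{}"]) (auto simp: orthonormal_def)
next
  case (insert x X)
  then obtain F where F: "finite F" "orthonormal F" "F \<subseteq> cvs.span X"
      "\<And>y. y \<in> X \<Longrightarrow> y = (\<Sum>f\<in>F. cinner y f *\<^sub>C f)" by blast
  have sub: "F \<subseteq> cvs.span (insert x X)" using F(3) cvs.span_mono[of X "insert x X"] by blast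
  show ?case
  proof (cases "x = (\<Sum>f\<in>F. cinner x f *\<^sub>C f)")
    case True
    then show ?thesis using F sub by (intro exI[of _ F]) auto
  next
    case False
    obtain e where e: "e \<notin> F" "orthonormal (insert e F)" "e \<in> cvs.span (insert x X)"
        "x = (\<Sum>f\<in>insert e F. cinner x f *\<^sub>C f)"
      using orthonormal_insert[OF F(1,2) False _ sub] cvs.span_base[of x "insert x X"] by auto
    have "y = (\<Sum>f\<in>insert e F. cinner y f *\<^sub>C f)" if "y \<in> X" for y
      by (rule orthonormal_expansion_mono[OF F(1) e(2,1) F(4)[OF that]])
    then show ?thesis using F(1) e sub by (intro exI[of _ "insert e F"]) auto
  qed
qed

text \<open>Finite-dimensional subspaces are described by the expansion equation of an orthonormal
  basis, which makes their closedness immediate.\<close>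

lemma closed_orthonormal_expansion:
  "closed {x. x = (\<Sum>f\<in>F. cinner x f *\<^sub>C (f::'a::chilbert_space))}"
proof -
  have "continuous_on UNIV (\<lambda>x. cinner x f *\<^sub>C f)" for f :: 'a
    unfolding continuous_on_def
    by (auto intro!: tendsto_scaleC tendsto_cinner tendsto_ident_at)
  then show ?thesis by (intro closed_Collect_eq continuous_intros) auto
qed

section \<open>Uniformly bounded module projections\<close>

text \<open>By Baire's theorem some \<open>F n\<close> contains a ball, so every \<open>y\<close> is
  approximated arbitrarily well by vectors \<open>z\<close> with
  \<open>norm (f z) \<le> C * norm y\<close>. Correcting the error repeatedly writes
  \<open>y\<close> as a series whose image converges absolutely, and the graph hypothesis identifies
  the sum of the images with \<open>f y\<close>.\<close>

lemma closed_graph_theorem: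
  fixes f :: "'a::banach \<Rightarrow> 'b::banach"
  assumes f: "linear f"
    and graph: "\<And>X x y. X \<longlonglongrightarrow> x \<Longrightarrow> (\<lambda>n. f (X n)) \<longlonglongrightarrow> y \<Longrightarrow> f x = y"
  shows "bounded_linear f"
proof -
  interpret f: linear f by (rule f)
  define F where "F n = closure {x. norm (f x) \<le> real n}" for n :: nat
  have "\<Union>(range F) = UNIV"
  proof -
    have "x \<in> F (nat \<lceil>norm (f x)\<rceil>)" for x
      unfolding F_def by (rule closure_subset[THEN subsetD]) (simp add: of_nat_ceiling)
    then show ?thesis by blast
  qed
  then have "\<exists>n. interior (F n) \<noteq> {}"
    using Met_TC.metric_Baire_category_alt[where 'a='a, of "range F"]
    by (auto simp: complete_UNIV F_def)
  then obtain n x0 r where n: "r > 0" "ball x0 r \<subseteq> F n"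
    by (auto simp: mem_interior)
  \<comment> \<open>Differences of two vectors from the ball give the bound \<open>2 * n\<close> on
    vectors of norm below \<open>r\<close>; rescaling \<open>y\<close> to norm \<open>r / 2\<close>
    contributes the factor \<open>2 / r\<close>.\<close>
  define C where "C = 4 * real n / r"
  have C0: "0 \<le> C" using n(1) by (simp add: C_def)
  have small: "\<exists>z. norm (y - z) < e \<and> norm (f z) \<le> 2 * real n" if "norm y < r" "e > 0" for y e
  proof -
    have "x0 + y \<in> F n" "x0 \<in> F n"
      using n(1) that by (auto intro!: n(2)[THEN subsetD] simp: dist_norm)
    then obtain u w where u: "norm (f u) \<le> real n" "dist u (x0 + y) < e / 2"
      and w: "norm (f w) \<le> real n" "dist w x0 < e / 2"
      unfolding F_def closure_approachable using \<open>e > 0\<close> by (metis half_gt_zero mem_Collect_eq)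
    have "norm (f (u - w)) \<le> 2 * real n"
      using norm_triangle_ineq4[of "f u" "f w"] u w by (simp add: f.diff)
    moreover have "norm (y - (u - w)) < e"
    proof -
      have eq: "y - (u - w) = (w - x0) - (u - (x0 + y))" by simp
      show ?thesis
        using norm_triangle_ineq4[of "w - x0" "u - (x0 + y)"] u w unfolding eq dist_norm by linarith
    qed
    ultimately show ?thesis by blast
  qed
  have approx: "\<exists>z. norm (y - z) < e \<and> norm (f z) \<le> C * norm y" if "e > 0" for y e
  proof (cases "y = 0")
    case True
    then show ?thesis using that by (intro exI[of _ 0]) (simp add: f.zero)
  next
    case False
    define t where "t = r / (2 * norm y)"
    have t: "t > 0" using False n(1) by (simp add: t_def)
    have "norm (t *\<^sub>R y) < r" using False n(1) by (simp add: t_def)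
    then obtain z where z: "norm (t *\<^sub>R y - z) < t * e" "norm (f z) \<le> 2 * real n"
      using small[of "t *\<^sub>R y" "t * e"] mult_pos_pos[OF t \<open>e > 0\<close>] by blast
    have "t * norm (y - z /\<^sub>R t) = norm (t *\<^sub>R y - z)"
      using t by (simp flip: norm_scaleR add: scaleR_diff_right norm_scaleR[of t, symmetric, unfolded abs_of_pos[OF t]])
    then have "norm (y - z /\<^sub>R t) < e" using z(1) mult_less_cancel_left_pos[OF t] by metis
    moreover have "norm (f (z /\<^sub>R t)) \<le> C * norm y"
    proof -
      have "norm (f (z /\<^sub>R t)) = norm (f z) / t"
        using t by (simp add: f.scaleR divide_inverse mult.commute)
      also have "\<dots> \<le> 2 * real n / t" using z t by (simp add: divide_right_mono)
      also have "\<dots> = C * norm y" using False n(1) by (simp add: C_def t_def)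
      finally show ?thesis .
    qed
    ultimately show ?thesis by blast
  qed
  define g where "g y e = (SOME z. norm (y - z) < e \<and> norm (f z) \<le> C * norm y)" for y e
  have g: "norm (y - g y e) < e" "norm (f (g y e)) \<le> C * norm y" if "e > 0" for y e
    using someI_ex[OF approx[OF that, of y]] unfolding g_def by auto
  have "norm (f y) \<le> norm y * (2 * C)" for y
  proof (cases "y = 0")
    case False
    \<comment> \<open>Successive approximation: each correction leaves an error of at most
      \<open>norm y / 2 ^ Suc k\<close>, and its image is controlled by the previous error. The
      images then sum to at most \<open>2 * C * norm y\<close>.\<close>
    define s where "s = rec_nat 0 (\<lambda>k s. s + g (y - s) (norm y / 2 ^ Suc k))"
    have s0: "s 0 = 0" and sS: "\<And>k. s (Suc k) = s k + g (y - s k) (norm y / 2 ^ Suc k)"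
      by (simp_all add: s_def)
    have pos: "norm y / 2 ^ k > 0" for k :: nat using False by simp
    have b1: "norm (y - s k) \<le> norm y / 2 ^ k" for k
    proof (cases k)
      case (Suc j)
      have eq: "y - s k = (y - s j) - g (y - s j) (norm y / 2 ^ Suc j)" by (simp add: Suc sS)
      show ?thesis unfolding eq by (subst Suc) (rule less_imp_le[OF g(1)[OF pos]])
    qed (simp add: s0)
    have b2: "norm (f (g (y - s k) (norm y / 2 ^ Suc k))) \<le> (C * norm y) * (1/2) ^ k" for k
    proof -
      have "norm (f (g (y - s k) (norm y / 2 ^ Suc k))) \<le> C * norm (y - s k)"
        by (rule g(2)[OF pos])
      also have "\<dots> \<le> C * (norm y / 2 ^ k)" by (rule mult_left_mono[OF b1 C0])
      finally show ?thesis by (simp add: power_divide)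
    qed
    define h where "h k = f (g (y - s k) (norm y / 2 ^ Suc k))" for k
    have sm: "summable (\<lambda>k. (C * norm y) * (1/2::real) ^ k)"
      by (intro summable_mult summable_geometric) simp
    have hs: "summable h"
      by (rule summable_comparison_test'[OF sm, of 0]) (use b2 in \<open>simp add: h_def\<close>)
    have fs: "f (s k) = sum h {..<k}" for k
      by (induction k) (simp_all add: s0 sS f.zero f.add h_def)
    have "(\<lambda>k. norm y / 2 ^ k) \<longlonglongrightarrow> 0"
      using tendsto_mult[OF tendsto_const[of "norm y"] LIMSEQ_power_zero[of "1/2::real"]]
      by (simp add: power_divide)
    then have "(\<lambda>k. y - s k) \<longlonglongrightarrow> 0"
      by (rule Lim_null_comparison[rotated]) (use b1 in auto)
    then have "(\<lambda>k. y - (y - s k)) \<longlonglongrightarrow> y - 0" by (intro tendsto_intros)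
    then have "s \<longlonglongrightarrow> y" by simp
    moreover have "(\<lambda>k. f (s k)) \<longlonglongrightarrow> suminf h"
      unfolding fs using summable_LIMSEQ[OF hs] .
    ultimately have "f y = suminf h" by (rule graph)
    also have "norm \<dots> \<le> (\<Sum>k. (C * norm y) * (1/2) ^ k)"
      by (rule norm_suminf_le) (use b2 sm in \<open>simp_all add: h_def\<close>)
    also have "\<dots> = norm y * (2 * C)"
      by (subst suminf_mult) (simp_all add: suminf_geometric)
    finally show ?thesis .
  qed (simp add: f.zero)
  then show ?thesis
    by (intro bounded_linear_intro[where K = "2 * C"]) (simp_all add: f.add f.scaleR)
qed

lemma amplify_simps:
  shows amplify_add: "amplify T (x + y) = amplify T x + amplify T y"
    and amplify_zero [simp]: "amplify T 0 = 0"
    and amplify_diff: "amplify T (x - y) = amplify T x - amplify T y"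
    and amplify_op_add: "amplify (S + T) x = amplify S x + amplify T x"
    and amplify_op_zero [simp]: "amplify 0 x = 0"
    and amplify_compose: "amplify (S o\<^sub>L T) x = amplify S (amplify T x)"
    and amplify_op_scaleC: "amplify (c *\<^sub>C T) x = c *\<^sub>C amplify T x"
    and amplify_id [simp]: "amplify id_blinfun x = x"
  by (transfer; simp add: blinfun.bilinear_simps)+

lemma amplify_scaleC: "T \<in> bounded_ops \<Longrightarrow> amplify T (c *\<^sub>C x) = c *\<^sub>C amplify T x"
  by transfer (simp add: bounded_opsD)

lemma norm_amplify_le: "norm (amplify T x) \<le> norm T * norm x"
proof (rule power2_le_imp_le)
  have "(norm (amplify T x))\<^sup>2 = (\<Sum>i. (norm (blinfun_apply T (ell2_nth x i)))\<^sup>2)"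
    by (simp add: norm_ell2_eq amplify.rep_eq suminf_nonneg
        summable_ell2_nth[of "amplify T x", unfolded amplify.rep_eq])
  also have "\<dots> \<le> (\<Sum>i. (norm T)\<^sup>2 * (norm (ell2_nth x i))\<^sup>2)"
  proof (rule suminf_le)
    show "(norm (blinfun_apply T (ell2_nth x i)))\<^sup>2 \<le> (norm T)\<^sup>2 * (norm (ell2_nth x i))\<^sup>2" for i
      unfolding power_mult_distrib[symmetric] by (intro power_mono norm_blinfun) simp
  qed (use summable_ell2_nth[of "amplify T x"] summable_ell2_nth[of x] in
      \<open>simp_all add: amplify.rep_eq summable_mult\<close>)
  also have "\<dots> = (norm T * norm x)\<^sup>2"
    by (subst suminf_mult[OF summable_ell2_nth])
      (simp add: norm_ell2_eq power_mult_distrib suminf_nonneg summable_ell2_nth)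
  finally show "(norm (amplify T x))\<^sup>2 \<le> (norm T * norm x)\<^sup>2" .
qed simp

lemma bounded_linear_amplify: "T \<in> bounded_ops \<Longrightarrow> bounded_linear (amplify T)"
  by (rule bounded_linear_intro[where K = "norm T"])
    (simp_all add: amplify_add amplify_scaleC scaleR_eq_scaleC norm_amplify_le mult.commute[of _ "norm T"])

definition module_proj ::
    "('a::chilbert_space \<Rightarrow>\<^sub>L 'a) set \<Rightarrow> 'a ell2 set \<Rightarrow> ('a ell2 \<Rightarrow>\<^sub>L 'a ell2) \<Rightarrow> bool" where
  "module_proj A V P \<longleftrightarrow> P \<in> bounded_ops \<and> (\<forall>x. P x \<in> V) \<and> (\<forall>x\<in>V. P x = x) \<and>
     (\<forall>T\<in>A. \<forall>x. P (amplify T x) = amplify T (P x))"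

text \<open>The projection along a complementary submodule. It has closed graph because both
  summands are closed, and it commutes with \<open>A\<close> because both are invariant.\<close>

lemma module_proj_exists:
  assumes crp: "complete_reduction_property A" and A: "A \<subseteq> bounded_ops"
    and V: "is_submodule A V"
  shows "\<exists>P. module_proj A V P"
proof -
  obtain W where W: "is_submodule A W" and VW: "V \<inter> W = {0}"
      and dec: "\<forall>z. \<exists>x\<in>V. \<exists>y\<in>W. z = x + y"
    using crp[unfolded complete_reduction_property_def, rule_format, OF V] by blast
  have "\<exists>v. v \<in> V \<and> z - v \<in> W" for z
  proof -
    obtain x y where "x \<in> V" "y \<in> W" "z = x + y" using dec by blast
    then show ?thesis by (intro exI[of _ x]) simp
  qed
  then obtain p where p: "\<And>z. p z \<in> V" "\<And>z. z - p z \<in> W" by metis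
  have cV: "csubspace V" "closed V" and cW: "csubspace W" "closed W"
    using V W by (auto simp: is_submodule_def)
  have uniq: "p z = v" if "v \<in> V" "z - v \<in> W" for z v
  proof -
    have "p z - v \<in> V" using p that csubspace_diff[OF cV(1)] by blast
    moreover have "p z - v = (z - v) - (z - p z)" by simp
    then have "p z - v \<in> W" using p that csubspace_diff[OF cW(1)] by metis
    ultimately have "p z - v \<in> V \<inter> W" by blast
    then show ?thesis using VW by simp
  qed
  have add: "p (x + y) = p x + p y" for x y
  proof (rule uniq)
    have "x + y - (p x + p y) = (x - p x) + (y - p y)" by simp
    then show "x + y - (p x + p y) \<in> W" using p(2) csubspace_add[OF cW(1)] by metis
  qed (simp add: p csubspace_add[OF cV(1)])
  have scale: "p (c *\<^sub>C x) = c *\<^sub>C p x" for c x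
  proof (rule uniq)
    have "c *\<^sub>C x - c *\<^sub>C p x = c *\<^sub>C (x - p x)" by (simp add: cvs.scale_right_diff_distrib)
    then show "c *\<^sub>C x - c *\<^sub>C p x \<in> W" using p(2) csubspace_scaleC[OF cW(1)] by metis
  qed (simp add: p csubspace_scaleC[OF cV(1)])
  have lin: "linear p" by (rule linearI) (simp_all add: add scale scaleR_eq_scaleC)
  have bl: "bounded_linear p"
  proof (rule closed_graph_theorem[OF lin])
    fix X x y assume X: "X \<longlonglongrightarrow> x" and y: "(\<lambda>n. p (X n)) \<longlonglongrightarrow> y"
    show "p x = y"
    proof (rule uniq)
      show "y \<in> V" using closed_sequentially[OF cV(2) _ y] p by blast
      show "x - y \<in> W"
        using closed_sequentially[OF cW(2) _ tendsto_diff[OF X y]] p by blast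
    qed
  qed
  note ap = bounded_linear_Blinfun_apply[OF bl]
  have "module_proj A V (Blinfun p)"
    unfolding module_proj_def ap
  proof (intro conjI ballI allI)
    show "Blinfun p \<in> bounded_ops" by (rule bounded_opsI) (simp add: ap scale)
    show "p x = x" if "x \<in> V" for x using uniq[of x x] that csubspace_0[OF cW(1)] by simp
    fix T x assume T: "T \<in> A"
    show "p (amplify T x) = amplify T (p x)"
    proof (rule uniq)
      show "amplify T (p x) \<in> V" using V T p by (auto simp: is_submodule_def)
      show "amplify T x - amplify T (p x) \<in> W"
        using W T p by (auto simp: is_submodule_def amplify_diff[symmetric])
    qed
  qed (rule p)
  then show ?thesis by blast
qed

text \<open>The pairing function exhibits the amplification as an orthogonal sum of countably many
  copies of itself. \<open>slice n\<close> is the coordinate map of the \<open>n\<close>-th copy and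
  \<open>unslice n\<close> its isometric inclusion.\<close>

lift_definition slice :: "nat \<Rightarrow> 'a::chilbert_space ell2 \<Rightarrow> 'a ell2"
  is "\<lambda>n x i. x (prod_encode (n, i))"
proof -
  fix n and x :: "nat \<Rightarrow> 'a" assume s: "summable (\<lambda>i. (norm (x i))\<^sup>2)"
  have "inj (\<lambda>i. prod_encode (n, i))" by (auto intro!: injI)
  then show "summable (\<lambda>i. (norm (x (prod_encode (n, i))))\<^sup>2)"
    using summable_reindex[OF s, of "\<lambda>i. prod_encode (n, i)"] by (simp add: o_def)
qed

lemma norm_slice_le: "norm (slice n x) \<le> norm x"
proof -
  have "inj (\<lambda>i. prod_encode (n, i))" by (auto intro!: injI)
  then have "(\<Sum>i. (norm (ell2_nth x (prod_encode (n, i))))\<^sup>2) \<le> (\<Sum>i. (norm (ell2_nth x i))\<^sup>2)"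
    using suminf_reindex_mono[OF summable_ell2_nth[of x], of "\<lambda>i. prod_encode (n, i)"]
    by (simp add: o_def)
  then show ?thesis by (simp add: norm_ell2_eq slice.rep_eq)
qed

lemma prod_decode_section_sums:
  fixes y :: "nat \<Rightarrow> 'a::chilbert_space"
  assumes "(\<lambda>i. (norm (y i))\<^sup>2) sums s"
  shows "(\<lambda>j. (norm (if fst (prod_decode j) = n then y (snd (prod_decode j)) else 0))\<^sup>2) sums s"
    (is "?f sums s")
proof -
  let ?g = "\<lambda>i. prod_encode (n, i)"
  have "strict_mono ?g"
    by (simp add: strict_mono_Suc_iff prod_encode_def)
  moreover have "?f j = 0" if "j \<notin> range ?g" for j
  proof -
    have "j = prod_encode (fst (prod_decode j), snd (prod_decode j))" by simp
    then have "fst (prod_decode j) \<noteq> n" using that by (metis rangeI)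
    then show ?thesis by simp
  qed
  ultimately have "(\<lambda>i. ?f (?g i)) sums s \<longleftrightarrow> ?f sums s" by (rule sums_mono_reindex)
  then show ?thesis using assms by simp
qed

lift_definition unslice :: "nat \<Rightarrow> 'a::chilbert_space ell2 \<Rightarrow> 'a ell2"
  is "\<lambda>n y j. if fst (prod_decode j) = n then y (snd (prod_decode j)) else 0"
  by (rule sums_summable[OF prod_decode_section_sums[OF summable_sums]])

lemma norm_unslice: "norm (unslice n y) = norm y"
  unfolding norm_ell2_eq unslice.rep_eq
  using sums_unique[OF prod_decode_section_sums[OF summable_sums[OF summable_ell2_nth[of y]], of n]]
  by simp

lemma slice_unslice: "slice m (unslice n y) = (if m = n then y else 0)"
  by (transfer; auto)

lemma slice_amplify: "slice n (amplify T x) = amplify T (slice n x)"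
  by transfer simp

lemma unslice_amplify: "unslice n (amplify T x) = amplify T (unslice n x)"
  by transfer (auto simp: fun_eq_iff)

lemma slice_add: "slice n (x + y) = slice n x + slice n y"
  and slice_scaleC: "slice n (c *\<^sub>C x) = c *\<^sub>C slice n x"
  and unslice_add: "unslice n (x + y) = unslice n x + unslice n y"
  and unslice_scaleC: "unslice n (c *\<^sub>C x) = c *\<^sub>C unslice n x"
  by (transfer; simp add: fun_eq_iff)+

lemma slice_zero [simp]: "slice n 0 = 0"
  by transfer simp

lemma bounded_linear_slice: "bounded_linear (slice n)"
  by (rule bounded_linear_intro[where K = 1])
    (simp_all add: slice_add slice_scaleC scaleR_eq_scaleC norm_slice_le)

text \<open>
  If no constant worked, submodules \<open>V n\<close> without projections of norm at most \<open>n\<close> could be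
  glued along \<open>nat \<times> nat \<cong> nat\<close>; compressing one projection onto the glued submodule to its
  slices would bound all of them.
\<close>

lemma module_proj_uniform:
  fixes A :: "('a::chilbert_space \<Rightarrow>\<^sub>L 'a) set"
  assumes crp: "complete_reduction_property A" and A: "A \<subseteq> bounded_ops"
  shows "\<exists>K. \<forall>V. is_submodule A V \<longrightarrow> (\<exists>P. module_proj A V P \<and> norm P \<le> K)"
proof (rule ccontr)
  assume "\<not> ?thesis"
  then have "\<forall>n::nat. \<exists>V. is_submodule A V \<and> (\<forall>P. module_proj A V P \<longrightarrow> \<not> norm P \<le> real n)"
    by blast
  then obtain V where V: "\<And>n. is_submodule A (V n)"
      and Vn: "\<And>n P. module_proj A (V n) P \<Longrightarrow> \<not> norm P \<le> real n"
    by metis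
  define Z where "Z = {x. \<forall>n. slice n x \<in> V n}"
  have cV: "csubspace (V n)" "closed (V n)" for n using V[of n] by (auto simp: is_submodule_def)
  have "csubspace Z"
    using cV(1) unfolding Z_def csubspace_def by (auto simp: slice_add slice_scaleC)
  moreover have "closed Z"
  proof -
    have "Z = (\<Inter>n. slice n -` V n)" by (auto simp: Z_def)
    then show ?thesis
      by (auto intro!: closed_vimage cV linear_continuous_on bounded_linear_slice)
  qed
  moreover have "amplify T x \<in> Z" if "T \<in> A" "x \<in> Z" for T x
    using that V by (auto simp: Z_def slice_amplify is_submodule_def)
  ultimately have "is_submodule A Z" by (simp add: is_submodule_def)
  then obtain P where P: "module_proj A Z P" using module_proj_exists[OF crp A] by blast
  \<comment> \<open>Compressing \<open>P\<close> to any slice does not increase its norm, so an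
    index above \<open>norm P\<close> contradicts the choice of \<open>V n\<close>.\<close>
  define n where "n = nat \<lceil>norm P\<rceil>"
  define p where "p = (\<lambda>x. slice n (P (unslice n x)))"
  have Pc: "P \<in> bounded_ops" using P by (simp add: module_proj_def)
  have pb: "norm (p x) \<le> norm x * norm P" for x
  proof -
    have "norm (p x) \<le> norm (P (unslice n x))" unfolding p_def by (rule norm_slice_le)
    also have "\<dots> \<le> norm P * norm (unslice n x)" by (rule norm_blinfun)
    finally show ?thesis by (simp add: norm_unslice mult.commute)
  qed
  have psc: "p (c *\<^sub>C x) = c *\<^sub>C p x" for c x
    by (simp add: p_def unslice_scaleC slice_scaleC bounded_opsD[OF Pc])
  have "bounded_linear p"
    by (rule bounded_linear_intro[where K = "norm P"])
      (simp_all add: pb psc scaleR_eq_scaleC, simp add: p_def unslice_add slice_add blinfun.add_right)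
  note ap = bounded_linear_Blinfun_apply[OF this]
  have "module_proj A (V n) (Blinfun p)"
    unfolding module_proj_def ap
  proof (intro conjI ballI allI)
    show "Blinfun p \<in> bounded_ops" by (rule bounded_opsI) (simp add: ap psc)
    show "p x \<in> V n" for x
      using P by (auto simp: module_proj_def Z_def p_def)
    show "p x = x" if "x \<in> V n" for x
    proof -
      have "unslice n x \<in> Z"
        using that cV(1) by (auto simp: Z_def slice_unslice csubspace_def)
      then have "P (unslice n x) = unslice n x" using P by (simp add: module_proj_def)
      then show ?thesis by (simp add: p_def slice_unslice)
    qed
    show "p (amplify T x) = amplify T (p x)" if "T \<in> A" for T x
      using P that by (simp add: p_def unslice_amplify slice_amplify module_proj_def)
  qed
  moreover have "norm (Blinfun p) \<le> norm P"
    by (rule norm_blinfun_bound) (use pb in \<open>simp_all add: ap mult.commute\<close>)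
  then have "norm (Blinfun p) \<le> real n" unfolding n_def by linarith
  ultimately show False using Vn by blast
qed

section \<open>Riesz theory of compact operators\<close>

lemma compact_ops_bounded: "T \<in> compact_ops \<Longrightarrow> T \<in> bounded_ops"
  by (simp add: compact_ops_def)

lemma compact_ops_subseq:
  fixes x :: "nat \<Rightarrow> 'a::chilbert_space"
  assumes T: "T \<in> compact_ops" and x: "\<And>n. norm (x n) \<le> B"
  shows "\<exists>l r. strict_mono r \<and> (\<lambda>n. blinfun_apply T (x (r n))) \<longlonglongrightarrow> l"
proof -
  define C where "C = \<bar>B\<bar> + 1"
  have C: "C > 0" "norm (x n) \<le> C" for n using x[of n] by (auto simp: C_def)
  have "compact (closure (blinfun_apply T ` cball 0 1))" using T by (simp add: compact_ops_def)
  moreover have "T (x n /\<^sub>R C) \<in> closure (blinfun_apply T ` cball 0 1)" for n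
    using C(1) C(2)[of n] by (intro closure_subset[THEN subsetD] imageI) (simp add: field_simps)
  ultimately obtain l r where r: "strict_mono r" "((\<lambda>n. T (x n /\<^sub>R C)) \<circ> r) \<longlonglongrightarrow> l"
    unfolding compact_def by metis
  have "(\<lambda>n. C *\<^sub>R T (x (r n) /\<^sub>R C)) \<longlonglongrightarrow> C *\<^sub>R l"
    using r(2) by (intro tendsto_intros) (simp add: o_def)
  then have "(\<lambda>n. T (x (r n))) \<longlonglongrightarrow> C *\<^sub>R l"
    using C(1) by (simp add: blinfun.scaleR_right)
  then show ?thesis using r(1) by blast
qed

lemma compact_ops_not_separated:
  fixes x :: "nat \<Rightarrow> 'a::chilbert_space"
  assumes T: "T \<in> compact_ops" and x: "\<And>n. norm (x n) \<le> B" and e: "e > 0"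
    and sep: "\<And>m n. m < n \<Longrightarrow> e \<le> norm (blinfun_apply T (x m) - blinfun_apply T (x n))"
  shows False
proof -
  obtain l r where r: "strict_mono r" "(\<lambda>n. T (x (r n))) \<longlonglongrightarrow> l"
    using compact_ops_subseq[OF T, of x B] x by blast
  then have "Cauchy (\<lambda>n. T (x (r n)))" by (auto intro: LIMSEQ_imp_Cauchy)
  then obtain N where N: "\<And>m n. m \<ge> N \<Longrightarrow> n \<ge> N \<Longrightarrow> norm (T (x (r m)) - T (x (r n))) < e"
    using e unfolding Cauchy_iff by metis
  show False
    using N[of N "Suc N"] sep[of "r N" "r (Suc N)"] r(1) by (simp add: strict_mono_def)
qed

lemma compact_ops_finite_net:
  assumes T: "T \<in> compact_ops" and e: "e > 0"
  shows "\<exists>X. finite X \<and> X \<subseteq> blinfun_apply T ` cball 0 1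
           \<and> (\<forall>x. norm x \<le> 1 \<longrightarrow> (\<exists>y\<in>X. norm (blinfun_apply T x - y) < e))"
proof -
  let ?S = "blinfun_apply T ` cball 0 1"
  have "compact (closure ?S)" using T by (simp add: compact_ops_def)
  moreover have "closure ?S \<subseteq> (\<Union>y\<in>?S. ball y e)"
  proof
    fix z assume "z \<in> closure ?S"
    then obtain y where "y \<in> ?S" "dist y z < e" using e unfolding closure_approachable by blast
    then show "z \<in> (\<Union>y\<in>?S. ball y e)" by auto
  qed
  ultimately obtain X where X: "X \<subseteq> ?S" "finite X" "closure ?S \<subseteq> (\<Union>y\<in>X. ball y e)"
    by (elim compactE_image[where C = ?S and f = "\<lambda>y. ball y e"]) auto
  have "\<exists>y\<in>X. norm (T x - y) < e" if "norm x \<le> 1" for x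
  proof -
    have "T x \<in> closure ?S" using that by (intro closure_subset[THEN subsetD]) auto
    then show ?thesis using X(3) by (fastforce simp: dist_norm norm_minus_commute)
  qed
  then show ?thesis using X by blast
qed

text \<open>Otherwise there are unit vectors with \<open>x - c x\<close> tending to
  \<open>0\<close>. Along a subsequence their images under \<open>c\<close> converge, hence so do
  the vectors themselves, and the limit is a unit vector of \<open>X\<close> fixed by
  \<open>c\<close>.\<close>

lemma compact_bounded_below:
  assumes c: "c \<in> compact_ops" and X: "csubspace X" "closed X"
    and inj: "\<And>x. x \<in> X \<Longrightarrow> blinfun_apply c x = x \<Longrightarrow> x = 0"
  shows "\<exists>\<delta>>0. \<forall>x\<in>X. \<delta> * norm x \<le> norm (x - blinfun_apply c x)"
proof (rule ccontr)
  assume neg: "\<not> ?thesis"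
  have "\<exists>x. x \<in> X \<and> norm x = 1 \<and> norm (x - c x) < 1 / real (Suc n)" for n
  proof -
    have "\<not> (\<forall>x\<in>X. 1 / real (Suc n) * norm x \<le> norm (x - c x))"
      using neg by (metis of_nat_0_less_iff zero_less_Suc zero_less_divide_1_iff)
    then obtain x where x: "x \<in> X" "norm (x - c x) < 1 / real (Suc n) * norm x"
      by (auto simp: not_le)
    then have x0: "norm x > 0" by auto
    have eq: "(x /\<^sub>R norm x) - c (x /\<^sub>R norm x) = (x - c x) /\<^sub>R norm x"
      by (simp add: blinfun.scaleR_right scaleR_diff_right)
    have "norm ((x /\<^sub>R norm x) - c (x /\<^sub>R norm x)) < 1 / real (Suc n)"
      unfolding eq norm_scaleR using x(2) x0 by (simp add: field_simps)
    then show ?thesis using x(1) x0 X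
      by (intro exI[of _ "x /\<^sub>R norm x"]) (auto simp: csubspace_scaleR)
  qed
  then obtain x where x: "\<And>n. x n \<in> X" "\<And>n. norm (x n) = 1"
      "\<And>n. norm (x n - c (x n)) < 1 / real (Suc n)" by metis
  obtain l r where r: "strict_mono r" "(\<lambda>n. c (x (r n))) \<longlonglongrightarrow> l"
    using compact_ops_subseq[OF c, of x 1] x(2) by auto
  have "(\<lambda>n. x n - c (x n)) \<longlonglongrightarrow> 0"
    by (rule Lim_null_comparison[OF _ LIMSEQ_Suc[OF lim_1_over_n]])
      (rule always_eventually, intro allI less_imp_le x(3))
  then have d: "(\<lambda>n. x (r n) - c (x (r n))) \<longlonglongrightarrow> 0"
    using LIMSEQ_subseq_LIMSEQ[OF _ r(1)] by (fastforce simp: o_def)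
  have xl: "(\<lambda>n. x (r n)) \<longlonglongrightarrow> l" using tendsto_add[OF d r(2)] by simp
  have "l \<in> X" using closed_sequentially[OF X(2) _ xl] x(1) by blast
  have "(\<lambda>n. c (x (r n))) \<longlonglongrightarrow> c l" by (intro tendsto_intros xl)
  then have "c l = l" using r(2) LIMSEQ_unique by blast
  have "norm l = 1" using tendsto_norm[OF xl] x(2) by (simp add: LIMSEQ_const_iff)
  then show False using inj[OF \<open>l \<in> X\<close> \<open>c l = l\<close>] by simp
qed

lemma csubspace_kernel: "T \<in> bounded_ops \<Longrightarrow> csubspace {x. blinfun_apply T x = 0}"
  by (auto simp: csubspace_def blinfun.bilinear_simps bounded_opsD)

lemma closed_kernel: "closed {x. blinfun_apply T x = 0}"
  by (intro closed_Collect_eq continuous_intros)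

lemma csubspace_image:
  assumes "T \<in> bounded_ops" "csubspace X" shows "csubspace (blinfun_apply T ` X)"
  unfolding csubspace_def
proof (intro conjI allI ballI)
  show "0 \<in> blinfun_apply T ` X"
    using csubspace_0[OF assms(2)] by (intro image_eqI[of _ _ 0]) simp_all
  show "x + y \<in> blinfun_apply T ` X" if "x \<in> blinfun_apply T ` X" "y \<in> blinfun_apply T ` X" for x y
    using that csubspace_add[OF assms(2)] by (auto simp: blinfun.add_right[symmetric])
  show "c *\<^sub>C x \<in> blinfun_apply T ` X" if "x \<in> blinfun_apply T ` X" for c x
    using that csubspace_scaleC[OF assms(2)] by (auto simp: bounded_opsD[OF assms(1), symmetric])
qed

lemma closed_image_bounded_below:
  assumes X: "csubspace X" "closed X" and d: "\<delta> > 0"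
    and bb: "\<And>x. x \<in> X \<Longrightarrow> \<delta> * norm x \<le> norm (blinfun_apply T x)"
  shows "closed (blinfun_apply (T :: 'a::chilbert_space \<Rightarrow>\<^sub>L 'a) ` X)"
  unfolding closed_sequential_limits
proof (intro allI impI, elim conjE)
  fix y l assume y: "\<forall>n. y n \<in> T ` X" and l: "y \<longlonglongrightarrow> l"
  then have "\<forall>n. \<exists>a. a \<in> X \<and> y n = T a" by blast
  then obtain x where x: "\<And>n. x n \<in> X" "\<And>n. y n = T (x n)" by metis
  have "Cauchy x"
    unfolding Cauchy_iff
  proof (intro allI impI)
    fix e :: real assume e: "e > 0"
    have "Cauchy y" using l by (rule LIMSEQ_imp_Cauchy)
    then obtain M where M: "\<And>m n. m \<ge> M \<Longrightarrow> n \<ge> M \<Longrightarrow> norm (y m - y n) < \<delta> * e"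
      using mult_pos_pos[OF d e] unfolding Cauchy_iff by metis
    have "norm (x m - x n) < e" if "m \<ge> M" "n \<ge> M" for m n
    proof -
      have "\<delta> * norm (x m - x n) \<le> norm (y m - y n)"
        using bb[of "x m - x n"] x csubspace_diff[OF X(1)] by (simp add: blinfun.diff_right)
      also have "\<dots> < \<delta> * e" using M that by blast
      finally show ?thesis using d by simp
    qed
    then show "\<exists>M. \<forall>m\<ge>M. \<forall>n\<ge>M. norm (x m - x n) < e" by blast
  qed
  then obtain a where a: "x \<longlonglongrightarrow> a" using Cauchy_convergent convergent_def by blast
  have "a \<in> X" using closed_sequentially[OF X(2) _ a] x by blast
  have "y \<longlonglongrightarrow> T a" unfolding x(2) by (intro tendsto_intros a)
  then show "l \<in> T ` X" using l LIMSEQ_unique \<open>a \<in> X\<close> by blast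
qed

text \<open>The operator \<open>1 - c\<close> is bounded below on the orthogonal complement of its
  kernel, and this complement already has the full range as image.\<close>

lemma closed_range_id_minus_compact:
  assumes c: "c \<in> compact_ops"
  shows "closed (range (blinfun_apply (id_blinfun - c)))"
proof -
  define d where "d = id_blinfun - c"
  have cb: "d \<in> bounded_ops"
    using c by (simp add: d_def bounded_ops_closure compact_ops_bounded)
  define N where "N = {x. blinfun_apply d x = 0}"
  have N: "csubspace N" "closed N"
    unfolding N_def using csubspace_kernel[OF cb] closed_kernel by auto
  have "x = 0" if "x \<in> ocomp N" "c x = x" for x
  proof -
    have "x \<in> N" using that by (simp add: N_def d_def blinfun.diff_left)
    then have "cinner x x = 0" using that by (simp add: ocomp_def)
    then show ?thesis by (simp add: cinner_self)
  qed
  then obtain \<delta> where \<delta>: "\<delta> > 0" "\<And>x. x \<in> ocomp N \<Longrightarrow> \<delta> * norm x \<le> norm (x - c x)"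
    using compact_bounded_below[OF c csubspace_ocomp closed_ocomp] by blast
  have "closed (d ` ocomp N)"
    by (rule closed_image_bounded_below[OF csubspace_ocomp closed_ocomp \<delta>(1)])
      (use \<delta>(2) in \<open>simp add: d_def blinfun.diff_left\<close>)
  moreover have "d ` ocomp N = range d"
  proof -
    have "d x \<in> d ` ocomp N" for x
    proof
      show "d x = d (x - proj N x)"
        using proj_in[OF N, of x] by (simp add: blinfun.diff_right N_def)
      show "x - proj N x \<in> ocomp N" by (simp add: ocomp_def proj_corth[OF N])
    qed
    then show ?thesis by blast
  qed
  ultimately show ?thesis by (simp add: d_def)
qed

text \<open>The Riesz lemma. Orthogonality provides the distance \<open>1\<close> exactly, so
  strictly monotone chains of subspaces yield separated unit vectors without any loss.\<close>

lemma unit_vector_orthogonal: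
  fixes V W :: "'a::chilbert_space set"
  assumes V: "csubspace V" "closed V" and W: "csubspace W" "V \<subseteq> W" "V \<noteq> W"
  shows "\<exists>x\<in>W. norm x = 1 \<and> (\<forall>v\<in>V. 1 \<le> norm (x - v))"
proof -
  obtain w where w: "w \<in> W" "w \<notin> V" using W by blast
  define u where "u = w - proj V w"
  have u: "u \<in> W" "u \<noteq> 0"
    using w W proj_in[OF V, of w] csubspace_diff[OF W(1)] by (auto simp: u_def)
  define x where "x = u /\<^sub>R norm u"
  have x: "x \<in> W" "norm x = 1" using u W(1) by (auto simp: x_def csubspace_scaleR)
  have "proj V x = 0"
  proof (rule proj_unique[OF V csubspace_0[OF V(1)]])
    show "inner (x - 0) v = 0" if "v \<in> V" for v
      using proj_orth[OF V that, of w] by (simp add: x_def u_def)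
  qed
  then have "1 \<le> norm (x - v)" if "v \<in> V" for v
    using norm_diff_proj_le_dist[OF V that, of x] x by simp
  then show ?thesis using x by blast
qed

text \<open>\<open>A\<close> may lack the identity, so the inverse of \<open>1 - b\<close> is
  written as \<open>1 + b'\<close> with \<open>b'\<close> in \<open>A\<close>. It is the fixed point
  of the contraction sending \<open>a\<close> to \<open>b + b a\<close>, which maps the complete set
  \<open>A\<close> into itself.\<close>

lemma neumann_in_subalgebra:
  assumes alg: "op_subalgebra A" and cl: "closed A" and b: "b \<in> A" "norm b < 1"
  shows "\<exists>b'\<in>A. \<forall>x. (x + blinfun_apply b' x) - b (x + b' x) = x \<and> (x - b x) + b' (x - b x) = x"
proof -
  have "\<exists>!a. a \<in> A \<and> b + (b o\<^sub>L a) = a"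
  proof (rule Banach_fix[where c = "norm b"])
    show "complete A" using cl by (simp add: complete_eq_closed)
    show "A \<noteq> {}" using b by blast
    show "(\<lambda>a. b + (b o\<^sub>L a)) ` A \<subseteq> A"
      using b alg by (auto simp: op_subalgebra_def intro: csubspace_add)
    fix x y
    have "dist (b + (b o\<^sub>L x)) (b + (b o\<^sub>L y)) = norm (b o\<^sub>L (x - y))"
      by (simp add: dist_norm bounded_bilinear.diff_right[OF bounded_bilinear_blinfun_compose])
    also have "\<dots> \<le> norm b * dist x y"
      by (simp add: dist_norm norm_blinfun_compose)
    finally show "dist (b + (b o\<^sub>L x)) (b + (b o\<^sub>L y)) \<le> norm b * dist x y" .
  qed (use b in auto)
  then obtain a where a: "a \<in> A" "b + (b o\<^sub>L a) = a" by blast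
  have ap: "a x = b x + b (a x)" for x
    using arg_cong[OF a(2), of "\<lambda>T. blinfun_apply T x"] by (simp add: blinfun.add_left)
  have inj: "y = 0" if "b y = y" for y
  proof -
    have "norm y * (1 - norm b) \<le> 0" using norm_blinfun[of b y] that by (simp add: algebra_simps)
    then show ?thesis using b(2) by (simp add: mult_le_0_iff)
  qed
  have right: "(x + a x) - b (x + a x) = x" for x
    using ap[of x] by (simp add: blinfun.add_right)
  \<comment> \<open>A right inverse of the injective operator \<open>1 - b\<close> is also a left
    inverse: the defect \<open>?z\<close> is fixed by \<open>b\<close>.\<close>
  have "(x - b x) + a (x - b x) = x" for x
  proof -
    let ?z = "(x - b x) + a (x - b x) - x"
    have "b ?z = ?z"
      using right[of "x - b x"] by (simp add: blinfun.bilinear_simps algebra_simps)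
    from inj[OF this] show ?thesis by simp
  qed
  then show ?thesis using a right by blast
qed

section \<open>Riesz theory inside an algebra of compact operators\<close>

context
  fixes A :: "('a::chilbert_space \<Rightarrow>\<^sub>L 'a) set"
  assumes A: "A \<subseteq> compact_ops" "op_subalgebra A"
begin

private lemma A_bounded: "a \<in> A \<Longrightarrow> a \<in> bounded_ops"
  using A(1) by (auto simp: compact_ops_bounded)

private lemma A_sub: "csubspace A" using A(2) by (simp add: op_subalgebra_def)

private lemma A_comp: "a \<in> A \<Longrightarrow> b \<in> A \<Longrightarrow> a o\<^sub>L b \<in> A" using A(2) by (simp add: op_subalgebra_def)

text \<open>After expansion every term of the power except the identity lies in \<open>A\<close>.
  Thus powers of \<open>1 - c\<close> are again compact perturbations of the identity and the
  preceding lemmas apply to them.\<close>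

lemma pow_id_minus:
  assumes c: "c \<in> A"
  shows "\<exists>b\<in>A. \<forall>x. ((\<lambda>x. x - blinfun_apply c x) ^^ k) x = x - blinfun_apply b x"
proof (induction k)
  case 0
  then show ?case using csubspace_0[OF A_sub] by (intro bexI[of _ 0]) auto
next
  case (Suc k)
  then obtain b where b: "b \<in> A" "\<And>x. ((\<lambda>x. x - c x) ^^ k) x = x - b x" by blast
  have mem: "b + c - (c o\<^sub>L b) \<in> A"
    by (intro csubspace_diff[OF A_sub] csubspace_add[OF A_sub] A_comp b c)
  then show ?case
    by (intro bexI[OF _ mem]) (simp add: b(2) blinfun.bilinear_simps algebra_simps)
qed

text \<open>Ascent and descent of \<open>1 - c\<close> are finite: a strictly increasing sequence of
  kernels, or a strictly decreasing sequence of ranges, contains unit vectors at distance at least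
  \<open>1\<close> from the preceding kernel or following range, and their images under
  \<open>c\<close> stay separated. For large \<open>k\<close> the \<open>k\<close>-th power
  \<open>1 - b\<close> is then injective on its closed range, hence bounded below there.\<close>

lemma riesz_decomposition:
  assumes c: "c \<in> A"
  shows "\<exists>k\<ge>1. \<exists>b\<in>A. (\<forall>x. ((\<lambda>x. x - blinfun_apply c x) ^^ k) x = x - blinfun_apply b x)
     \<and> (\<forall>x. \<exists>y. x - blinfun_apply b x = (id_blinfun - b) ((id_blinfun - b) y))
     \<and> (\<exists>\<delta>>0. \<forall>x\<in>range (blinfun_apply (id_blinfun - b)). \<delta> * norm x \<le> norm (x - blinfun_apply b x))"
proof -
  define D where "D = (\<lambda>x. x - blinfun_apply c x)"
  obtain b where b: "\<And>k. b k \<in> A" "\<And>k x. (D ^^ k) x = x - blinfun_apply (b k) x"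
    using pow_id_minus[OF c] unfolding D_def by metis
  define d where "d k = id_blinfun - b k" for k
  have d: "(D ^^ k) x = d k x" for k x by (simp add: b d_def blinfun.diff_left)
  have dcomp: "d (j + k) x = d j (d k x)" for j k x
    by (simp only: d[symmetric] funpow_add o_def)
  have dS: "d (Suc k) x = d k x - d k (c x)" "d (Suc k) x = d k x - c (d k x)" for k x
  proof -
    have d1: "d 1 y = y - c y" for y using d[of 1 y] by (simp add: D_def)
    show "d (Suc k) x = d k x - d k (c x)"
      using dcomp[of k 1 x] unfolding d1 by (simp add: blinfun.diff_right)
    show "d (Suc k) x = d k x - c (d k x)"
      using dcomp[of 1 k x] unfolding d1 by simp
  qed
  have dbd: "d k \<in> bounded_ops" for k by (simp add: d_def bounded_ops_closure A_bounded b)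
  have ccomp: "c \<in> compact_ops" using c A by blast
  have "\<exists>k. {x. d (Suc k) x = 0} = {x. d k x = 0}"
  proof (rule ccontr)
    assume neg: "\<not> ?thesis"
    have "\<exists>x. d (Suc k) x = 0 \<and> norm x = 1 \<and> (\<forall>v. d k v = 0 \<longrightarrow> 1 \<le> norm (x - v))" for k
    proof -
      have "{x. d k x = 0} \<subseteq> {x. d (Suc k) x = 0}"
        using dcomp[of 1 k] by auto
      then show ?thesis
        using unit_vector_orthogonal[OF csubspace_kernel[OF dbd] closed_kernel csubspace_kernel[OF dbd],
            of k "Suc k"] neg by blast
    qed
    then obtain x where x: "\<And>k. d (Suc k) (x k) = 0" "\<And>k. norm (x k) = 1"
        "\<And>k v. d k v = 0 \<Longrightarrow> 1 \<le> norm (x k - v)" by metis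
    show False
    proof (rule compact_ops_not_separated[OF ccomp, of x 1 1])
      fix m n :: nat assume mn: "m < n"
      have z: "d n (x m) = 0"
        using dcomp[of "n - Suc m" "Suc m" "x m"] mn x(1)[of m] by simp
      \<comment> \<open>This vector lies in the kernel of \<open>d n\<close>, since
        \<open>d n\<close> kills \<open>x n - c (x n)\<close> as well as \<open>c (x m)\<close>, and
        \<open>x n - ?v\<close> is the difference of the two images.\<close>
      let ?v = "x n - c (x n) + c (x m)"
      have "d n (c (x m)) = d n (x m) - d (Suc n) (x m)" by (simp add: dS(1))
      also have "\<dots> = 0" using z dcomp[of 1 n "x m"] by simp
      finally have "d n ?v = 0"
        using x(1)[of n] by (simp add: blinfun.bilinear_simps dS(1))
      then have "1 \<le> norm (x n - ?v)" by (rule x(3))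
      then show "1 \<le> norm (c (x m) - c (x n))"
        by (simp add: norm_minus_commute)
    qed (use x in auto)
  qed
  then obtain k1 where k1: "{x. d (Suc k1) x = 0} = {x. d k1 x = 0}" by blast
  have ker: "d k1 x = 0" if "d (k1 + j) x = 0" for j x
    using that
  proof (induction j arbitrary: x)
    case (Suc j)
    have "d (Suc k1) (d j x) = 0" using Suc.prems dcomp[of "Suc k1" j x] by simp
    then have "d k1 (d j x) = 0" using k1 by blast
    then show ?case using Suc.IH dcomp[of k1 j x] by simp
  qed simp
  have "\<exists>k. range (d (Suc k)) = range (d k)"
  proof (rule ccontr)
    assume neg: "\<not> ?thesis"
    have cl: "closed (range (d k))" for k
      unfolding d_def using b(1) A by (intro closed_range_id_minus_compact) blast
    have sub: "range (d (Suc k)) \<subseteq> range (d k)" for k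
      using dcomp[of k 1] by auto
    have "\<exists>x\<in>range (d k). norm x = 1 \<and> (\<forall>v\<in>range (d (Suc k)). 1 \<le> norm (x - v))" for k
      by (rule unit_vector_orthogonal[OF csubspace_image[OF dbd csubspace_UNIV] cl
            csubspace_image[OF dbd csubspace_UNIV] sub]) (use neg in blast)
    then obtain x where x: "\<And>k. x k \<in> range (d k)" "\<And>k. norm (x k) = 1"
        "\<And>k v. v \<in> range (d (Suc k)) \<Longrightarrow> 1 \<le> norm (x k - v)" by metis
    show False
    proof (rule compact_ops_not_separated[OF ccomp, of x 1 1])
      fix m n :: nat assume mn: "m < n"
      obtain y where y: "x m = d m y" using x(1) by blast
      obtain z where z: "x n = d n z" using x(1) by blast
      have "x n = d (Suc m) (d (n - Suc m) z)" using mn dcomp[of "Suc m" "n - Suc m" z] z by simp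
      moreover have "x m - c (x m) = d (Suc m) y" by (simp add: y dS(2))
      moreover have "x n - c (x n) = d (Suc m) (d (n - m) z)"
      proof -
        have "Suc n = Suc m + (n - m)" using mn by simp
        then have "d (Suc n) z = d (Suc m) (d (n - m) z)" using dcomp by metis
        then show ?thesis using z by (simp add: dS(2))
      qed
      ultimately have "x m - c (x m) + (x n - (x n - c (x n)))
          = d (Suc m) (y + (d (n - Suc m) z - d (n - m) z))"
        by (simp add: blinfun.bilinear_simps)
      moreover have "x m - c (x m) + (x n - (x n - c (x n))) = x m - (c (x m) - c (x n))"
        by simp
      ultimately have "x m - (c (x m) - c (x n)) \<in> range (d (Suc m))" by (metis rangeI)
      then have "1 \<le> norm (x m - (x m - (c (x m) - c (x n))))" by (rule x(3))
      then show "1 \<le> norm (c (x m) - c (x n))" by simp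
    qed (use x in auto)
  qed
  then obtain k2 where k2: "range (d (Suc k2)) = range (d k2)" by blast
  have ran: "\<exists>y. d k2 x = d (k2 + j) y" for j x
  proof (induction j)
    case (Suc j)
    then obtain y where y: "d k2 x = d (k2 + j) y" by blast
    obtain w where w: "d k2 y = d (Suc k2) w" using k2 by (metis rangeE rangeI)
    have "d (k2 + j) y = d j (d k2 y)" using dcomp[of j k2] by (simp add: add.commute)
    also have "\<dots> = d (k2 + Suc j) w"
      using dcomp[of j "Suc k2"] w by (simp add: add.commute)
    finally show ?case using y by auto
  qed auto
  \<comment> \<open>Any exponent beyond both \<open>k1\<close> and \<open>k2\<close> works; the
    successor also ensures \<open>1 \<le> k\<close>.\<close>
  define k where "k = Suc (k1 + k2)"
  have kk: "d k x = 0" if "d k (d k x) = 0" for x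
  proof -
    have "d (k1 + (k + Suc k2)) x = 0"
      using that dcomp[of k k x] by (simp add: k_def algebra_simps)
    then have "d k1 x = 0" by (rule ker)
    then show ?thesis using dcomp[of "Suc k2" k1 x] by (simp add: k_def add.commute)
  qed
  have rr: "\<exists>y. d k x = d k (d k y)" for x
  proof -
    obtain y where y: "d k2 x = d (k2 + k) y" using ran by blast
    have "d k x = d (Suc k1) (d k2 x)" using dcomp[of "Suc k1" k2 x] by (simp add: k_def)
    also have "\<dots> = d (Suc k1 + (k2 + k)) y" by (simp only: y dcomp)
    also have "Suc k1 + (k2 + k) = k + k" by (simp add: k_def)
    finally show ?thesis using dcomp by metis
  qed
  have clk: "closed (range (d k))"
    unfolding d_def using b(1) A by (intro closed_range_id_minus_compact) blast
  have "\<exists>\<delta>>0. \<forall>x\<in>range (d k). \<delta> * norm x \<le> norm (x - b k x)"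
  proof (rule compact_bounded_below[OF _ csubspace_image[OF dbd csubspace_UNIV] clk])
    show "b k \<in> compact_ops" using b A by blast
    fix x assume "x \<in> range (d k)" "b k x = x"
    then obtain y where "x = d k y" "d k x = 0" by (auto simp: d_def blinfun.diff_left)
    then show "x = 0" using kk by simp
  qed
  moreover have "\<forall>x. \<exists>y. x - b k x = d k (d k y)"
    using rr by (simp add: d_def blinfun.diff_left)
  ultimately show ?thesis
    using b(1)[of k] b(2)[of k] unfolding D_def d_def
    by (intro exI[of _ k] conjI bexI[of _ "b k"]) (auto simp: k_def)
qed

text \<open>Says that \<open>1 + a\<close> is the two-sided inverse of \<open>1 - s b\<close>.
  Recording \<open>a\<close> keeps the statement inside \<open>A\<close>, which may lack the
  identity.\<close>

private definition resolvent_at :: "('a \<Rightarrow>\<^sub>L 'a) \<Rightarrow> complex \<Rightarrow> ('a \<Rightarrow>\<^sub>L 'a) \<Rightarrow> bool" where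
  "resolvent_at b s a \<longleftrightarrow> a \<in> A \<and> (\<forall>x. (x + a x) - s *\<^sub>C b (x + a x) = x)
     \<and> (\<forall>x. (x - s *\<^sub>C b x) + a (x - s *\<^sub>C b x) = x)"

text \<open>Perturbation of an inverse: \<open>(1 + a) (1 - t b) = 1 - \<beta>\<close> with
  \<open>\<beta> = (t - s) (1 + a) b\<close>. The lower bound \<open>m\<close> makes the norm of
  \<open>(1 + a) b\<close> at most \<open>norm b / m\<close>, so \<open>\<beta>\<close> is a strict
  contraction and the Neumann series applies.\<close>

private lemma resolvent_spread:
  assumes cl: "closed A" and b: "b \<in> A" and a: "resolvent_at b s a"
    and m: "m > 0" "\<And>x. m * norm x \<le> norm (x - s *\<^sub>C b x)" and t: "cmod (t - s) * norm b < m"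
  shows "\<exists>a'. resolvent_at b t a'"
proof -
  have aA: "a \<in> A" and ar: "\<And>x. (x + a x) - s *\<^sub>C b (x + a x) = x"
    and al: "\<And>x. (x - s *\<^sub>C b x) + a (x - s *\<^sub>C b x) = x"
    using a by (auto simp: resolvent_at_def)
  define \<beta> where "\<beta> = (t - s) *\<^sub>C (b + (a o\<^sub>L b))"
  have bA: "\<beta> \<in> A"
    unfolding \<beta>_def by (intro csubspace_scaleC[OF A_sub] csubspace_add[OF A_sub] A_comp b aA)
  have bx: "\<beta> x = (t - s) *\<^sub>C (b x + a (b x))" for x
    by (simp add: \<beta>_def blinfun.add_left)
  have "norm (\<beta> x) \<le> (cmod (t - s) * norm b / m) * norm x" for x
  proof -
    have "m * norm (b x + a (b x)) \<le> norm (b x)"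
      using m(2)[of "b x + a (b x)"] ar by simp
    also have "\<dots> \<le> norm b * norm x" by (rule norm_blinfun)
    finally have "norm (b x + a (b x)) \<le> norm b * norm x / m"
      using m(1) by (simp add: field_simps)
    then have "cmod (t - s) * norm (b x + a (b x)) \<le> cmod (t - s) * (norm b * norm x / m)"
      by (rule mult_left_mono) simp
    then show ?thesis by (simp add: bx norm_scaleC)
  qed
  then have "norm \<beta> \<le> cmod (t - s) * norm b / m"
    using m(1) by (intro norm_blinfun_bound) auto
  also have "\<dots> < 1" using t m(1) by simp
  finally obtain b' where b': "b' \<in> A" "\<And>x. (x + b' x) - \<beta> (x + b' x) = x"
      "\<And>x. (x - \<beta> x) + b' (x - \<beta> x) = x"
    using neumann_in_subalgebra[OF A(2) cl bA] by metis
  define a' where "a' = b' + a + (b' o\<^sub>L a)"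
  have a': "a' \<in> A"
    unfolding a'_def by (intro csubspace_add[OF A_sub] A_comp b' aA)
  have a'x: "x + a' x = (x + a x) + b' (x + a x)" for x
    by (simp add: a'_def blinfun.bilinear_simps algebra_simps)
  have left: "(x - t *\<^sub>C b x) + a (x - t *\<^sub>C b x) = x - \<beta> x" for x
  proof -
    have e: "x - t *\<^sub>C b x = (x - s *\<^sub>C b x) - (t - s) *\<^sub>C b x"
      by (simp add: cvs.scale_left_diff_distrib)
    show ?thesis
      unfolding e using al[of x]
      by (simp add: blinfun.diff_right bounded_opsD[OF A_bounded[OF aA]] bx scaleC_add_right algebra_simps)
  qed
  have right: "x - t *\<^sub>C b x = (x - \<beta> x) - s *\<^sub>C b (x - \<beta> x)" for x
    using ar[of "x - t *\<^sub>C b x"] unfolding left by simp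
  have "resolvent_at b t a'"
    unfolding resolvent_at_def
  proof (intro conjI allI a')
    fix x
    show "x + a' x - t *\<^sub>C b (x + a' x) = x"
      unfolding right[of "x + a' x"] unfolding a'x b'(2) by (rule ar)
    show "x - t *\<^sub>C b x + a' (x - t *\<^sub>C b x) = x"
      unfolding a'x left by (rule b'(3))
  qed
  then show ?thesis by blast
qed

text \<open>
  The idempotent is obtained as the limit of \<open>(1 - s) (1 - s b)\<^sup>-\<^sup>1\<close> at \<open>s = 1\<close>. That these
  resolvents lie in the unitization of \<open>A\<close> follows by continuation from \<open>s = 0\<close>: the exceptional
  set is discrete, so its complement is connected.
\<close>

lemma riesz_idempotent:
  assumes cl: "closed A" and c: "c \<in> A"
  shows "\<exists>e\<in>A. \<exists>k\<ge>1. (\<forall>x. blinfun_apply e (e x) = e x) \<and> (\<forall>x. blinfun_apply c x = x \<longrightarrow> e x = x)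
     \<and> (\<forall>x. ((\<lambda>x. x - blinfun_apply c x) ^^ k) (e x) = 0)"
proof -
  obtain k b \<delta> where k: "k \<ge> 1" and b: "b \<in> A"
    and pw: "\<And>x. ((\<lambda>x. x - blinfun_apply c x) ^^ k) x = x - blinfun_apply b x"
    and rr: "\<And>x. \<exists>y. x - blinfun_apply b x = (id_blinfun - b) ((id_blinfun - b) y)"
    and \<delta>: "\<delta> > 0" "\<And>x. x \<in> range (blinfun_apply (id_blinfun - b)) \<Longrightarrow> \<delta> * norm x \<le> norm (x - blinfun_apply b x)"
    using riesz_decomposition[OF c] by (elim exE bexE conjE) (rule that; blast)
  define d where "d = id_blinfun - b"
  have dx: "d x = x - b x" for x by (simp add: d_def blinfun.diff_left)
  have bC: "b (z *\<^sub>C x) = z *\<^sub>C b x" for z x using A_bounded[OF b] by (rule bounded_opsD)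
  have dC: "d (z *\<^sub>C x) = z *\<^sub>C d x" for z x by (simp add: dx bC cvs.scale_right_diff_distrib)
  define R where "R = range (blinfun_apply d)"
  have R: "csubspace R"
    unfolding R_def by (intro csubspace_image csubspace_UNIV bounded_opsI) (simp add: dC)
  have dR: "\<delta> * norm x \<le> norm (d x)" if "x \<in> R" for x
    using \<delta>(2)[of x] that by (simp add: R_def d_def blinfun.diff_left)
  \<comment> \<open>The parameters at which \<open>1 - s b\<close> is not injective, that is, the
    reciprocals of the nonzero eigenvalues of \<open>b\<close>.\<close>
  define \<Sigma> where "\<Sigma> = {s. \<exists>x. x \<noteq> 0 \<and> s *\<^sub>C b x = x}"
  have isolated: "\<exists>r>0. \<forall>s. s \<noteq> s0 \<and> cmod (s - s0) < r \<longrightarrow> s \<notin> \<Sigma>" for s0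
  proof (cases "s0 = 0")
    case True
    have "s \<notin> \<Sigma>" if "cmod s < 1 / (norm b + 1)" for s
    proof
      assume "s \<in> \<Sigma>"
      then obtain x where x: "x \<noteq> 0" "s *\<^sub>C b x = x" by (auto simp: \<Sigma>_def)
      have "norm x = cmod s * norm (b x)" using x(2) by (metis norm_scaleC)
      also have "\<dots> \<le> cmod s * (norm b * norm x)" by (intro mult_left_mono norm_blinfun) simp
      also have "\<dots> \<le> cmod s * ((norm b + 1) * norm x)" by (intro mult_left_mono mult_right_mono) auto
      also have "\<dots> < norm x"
      proof -
        have "cmod s * (norm b + 1) < 1"
          using that by (simp add: pos_less_divide_eq[OF add_nonneg_pos[OF norm_ge_zero zero_less_one]])
        then show ?thesis using x(1) by (simp flip: mult.assoc)
      qed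
      finally show False by simp
    qed
    then show ?thesis using True by (intro exI[of _ "1 / (norm b + 1)"]) (auto simp: add_nonneg_pos)
  next
    case False
    have "s0 *\<^sub>C b \<in> A" using b by (simp add: csubspace_scaleC[OF A_sub])
    from riesz_decomposition[OF this] obtain j b1 \<delta>1 where j: "j \<ge> (1::nat)" and b1: "b1 \<in> A"
      and pw1: "\<And>x. ((\<lambda>x. x - blinfun_apply (s0 *\<^sub>C b) x) ^^ j) x = x - blinfun_apply b1 x"
      and \<delta>1: "\<delta>1 > 0" "\<And>x. x \<in> range (blinfun_apply (id_blinfun - b1)) \<Longrightarrow> \<delta>1 * norm x \<le> norm (x - blinfun_apply b1 x)"
      by (elim exE bexE conjE) (rule that; blast)
    \<comment> \<open>The radius keeps \<open>cmod s\<close> above half of \<open>cmod s0\<close>,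
      so that \<open>\<epsilon> = 1 - s0 / s\<close> has modulus below
      \<open>min 1 \<delta>1\<close>. A vector with \<open>s b x = x\<close> is an eigenvector of
      \<open>1 - b1 = (1 - s0 b)^j\<close> for the eigenvalue \<open>\<epsilon>^j\<close>. It hence
      lies in the range of this power, where the bound below by \<open>\<delta>1\<close> excludes so
      small an eigenvalue.\<close>
    define r where "r = min (cmod s0 / 2) (cmod s0 / 2 * min 1 \<delta>1)"
    have r: "r > 0" using False \<delta>1(1) by (simp add: r_def)
    have "s \<notin> \<Sigma>" if s: "s \<noteq> s0" "cmod (s - s0) < r" for s
    proof
      assume "s \<in> \<Sigma>"
      then obtain x where x: "x \<noteq> 0" "s *\<^sub>C b x = x" by (auto simp: \<Sigma>_def)
      have s0: "cmod s > cmod s0 / 2"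
        using s(2) norm_triangle_ineq2[of s0 s] by (simp add: r_def norm_minus_commute)
      then have sn0: "s \<noteq> 0" using False by auto
      define \<epsilon> where "\<epsilon> = (s - s0) / s"
      have e0: "\<epsilon> \<noteq> 0" using s sn0 by (simp add: \<epsilon>_def)
      have "b x = (1 / s) *\<^sub>C x" using arg_cong[OF x(2), of "\<lambda>y. (1/s) *\<^sub>C y"] sn0 by (simp add: scaleC_scaleC)
      then have "x - (s0 *\<^sub>C b) x = (1 - s0 / s) *\<^sub>C x"
        by (simp add: scaleC_scaleC cvs.scale_left_diff_distrib)
      also have "1 - s0 / s = \<epsilon>" using sn0 by (simp add: \<epsilon>_def field_simps)
      finally have step: "x - (s0 *\<^sub>C b) x = \<epsilon> *\<^sub>C x" .
      have "((\<lambda>x. x - blinfun_apply (s0 *\<^sub>C b) x) ^^ i) x = (\<epsilon> ^ i) *\<^sub>C x" for i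
      proof (induction i)
        case (Suc i)
        have "(\<epsilon> ^ i) *\<^sub>C x - (s0 *\<^sub>C b) ((\<epsilon> ^ i) *\<^sub>C x) = (\<epsilon> ^ i) *\<^sub>C (x - (s0 *\<^sub>C b) x)"
          by (simp add: bC cvs.scale_right_diff_distrib cvs.scale_left_commute)
        then show ?case using Suc step by (simp add: scaleC_scaleC mult.commute)
      qed simp
      then have d1: "x - b1 x = (\<epsilon> ^ j) *\<^sub>C x" using pw1 by metis
      have "(id_blinfun - b1) ((1 / \<epsilon> ^ j) *\<^sub>C x) = (1 / \<epsilon> ^ j) *\<^sub>C (x - b1 x)"
        by (simp add: blinfun.diff_left bounded_opsD[OF A_bounded[OF b1]] cvs.scale_right_diff_distrib)
      also have "\<dots> = x" using e0 by (simp add: d1 scaleC_scaleC)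
      finally have "x \<in> range (blinfun_apply (id_blinfun - b1))" by (metis rangeI)
      then have "\<delta>1 * norm x \<le> cmod (\<epsilon> ^ j) * norm x" using \<delta>1(2)[of x] unfolding d1 norm_scaleC by blast
      then have "\<delta>1 \<le> cmod \<epsilon> ^ j" using x(1) by (simp add: norm_power)
      have "cmod \<epsilon> < min 1 \<delta>1"
      proof -
        have "cmod (s - s0) < cmod s0 / 2 * min 1 \<delta>1" using s(2) by (simp add: r_def)
        also have "\<dots> \<le> cmod s * min 1 \<delta>1" using s0 \<delta>1(1) by (intro mult_right_mono) auto
        finally have lt: "cmod (s - s0) < min 1 \<delta>1 * cmod s" by (simp only: mult.commute)
        have "cmod s > 0" using sn0 by simp
        then show ?thesis
          unfolding \<epsilon>_def norm_divide using lt by (simp only: pos_divide_less_eq)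
      qed
      moreover have "cmod \<epsilon> ^ j \<le> cmod \<epsilon> ^ 1" using calculation j by (intro power_decreasing) auto
      ultimately show False using \<open>\<delta>1 \<le> cmod \<epsilon> ^ j\<close> by simp
    qed
    then show ?thesis using r by blast
  qed
  have "\<Sigma> sparse_in UNIV"
    unfolding sparse_in_def
  proof
    fix s0 :: complex
    obtain r where r: "r > 0" "\<And>s. s \<noteq> s0 \<Longrightarrow> cmod (s - s0) < r \<Longrightarrow> s \<notin> \<Sigma>"
      using isolated by blast
    have "\<not> y islimpt \<Sigma>" if y: "y \<in> ball s0 r" for y
    proof (cases "y = s0")
      case True
      then show ?thesis using r by (auto simp: islimpt_approachable dist_norm)
    next
      case False
      have "open (ball s0 r - {s0})" by auto
      moreover have "y \<in> ball s0 r - {s0}" using y False by auto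
      moreover have "(ball s0 r - {s0}) \<inter> \<Sigma> = {}" using r(2) by (fastforce simp: dist_norm norm_minus_commute)
      ultimately show ?thesis by (meson disjoint_iff islimptE)
    qed
    then show "\<exists>B. s0 \<in> B \<and> open B \<and> (\<forall>y\<in>B. \<not> y islimpt \<Sigma>)"
      using r(1) by (intro exI[of _ "ball s0 r"]) auto
  qed
  then have conn: "connected (- \<Sigma>)"
    using sparse_imp_connected[of UNIV \<Sigma>] by (simp add: Compl_eq_Diff_UNIV connected_UNIV)
  have bbelow: "\<exists>m>0. \<forall>x. m * norm x \<le> norm (x - s *\<^sub>C b x)" if "s \<notin> \<Sigma>" for s
  proof -
    have "s *\<^sub>C b \<in> compact_ops" using b A(1) csubspace_scaleC[OF A_sub] by blast
    then show ?thesis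
      using compact_bounded_below[of "s *\<^sub>C b" UNIV] that by (auto simp: \<Sigma>_def)
  qed
  define U where "U = {s. \<exists>a. resolvent_at b s a}"
  \<comment> \<open>The radius depends on \<open>s0\<close> only, through the lower bound
    \<open>m\<close> for \<open>1 - s0 b\<close>; near \<open>s0\<close> the bound
    \<open>m / 2\<close> remains. Within the ball membership in \<open>U\<close> therefore spreads
    from any point to any other, which makes both \<open>U\<close> and its complement open away from
    \<open>\<Sigma>\<close>.\<close>
  have nbhd: "\<exists>r>0. \<forall>t s. s \<in> ball s0 r \<and> t \<in> ball s0 r \<and> s \<in> U \<longrightarrow> t \<in> U" if "s0 \<notin> \<Sigma>" for s0
  proof -
    obtain m where m: "m > 0" "\<And>x. m * norm x \<le> norm (x - s0 *\<^sub>C b x)" using bbelow[OF \<open>s0 \<notin> \<Sigma>\<close>] by blast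
    define r where "r = m / (4 * (norm b + 1))"
    have nb: "norm b + 1 > 0" using norm_ge_zero[of b] by linarith
    have r0: "r > 0" using m nb by (simp add: r_def)
    have rb: "r * norm b \<le> m / 4"
    proof -
      have "r * norm b \<le> r * (norm b + 1)" using r0 by simp
      also have "\<dots> = m / 4" using less_imp_neq[OF nb] by (simp add: r_def field_simps)
      finally show ?thesis .
    qed
    have "t \<in> U" if st: "s \<in> ball s0 r" "t \<in> ball s0 r" "s \<in> U" for s t
    proof -
      obtain a where a: "resolvent_at b s a" using st by (auto simp: U_def)
      have s: "cmod (s - s0) < r" using st by (simp add: dist_norm norm_minus_commute)
      have "m / 2 * norm x \<le> norm (x - s *\<^sub>C b x)" for x
      proof -
        have "x - s0 *\<^sub>C b x = (x - s *\<^sub>C b x) + (s - s0) *\<^sub>C b x"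
          by (simp add: cvs.scale_left_diff_distrib)
        then have "norm (x - s0 *\<^sub>C b x) \<le> norm (x - s *\<^sub>C b x) + cmod (s - s0) * norm (b x)"
          by (metis norm_scaleC norm_triangle_ineq)
        moreover have "cmod (s - s0) * norm (b x) \<le> r * (norm b * norm x)"
          using s r0 by (intro mult_mono norm_blinfun) auto
        moreover have "r * norm b * norm x \<le> m / 4 * norm x" using rb by (rule mult_right_mono) simp
        moreover have "0 \<le> m / 4 * norm x" using m(1) by simp
        ultimately show ?thesis using m(2)[of x] by (simp add: mult.assoc) 
      qed
      moreover have "cmod (t - s) * norm b < m / 2"
      proof -
        have "cmod (t - s) \<le> 2 * r"
          using st norm_triangle_ineq4[of "t - s0" "s - s0"] by (simp add: dist_norm norm_minus_commute)
        then have "cmod (t - s) * norm b \<le> 2 * r * norm b" by (rule mult_right_mono) simp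
        also have "\<dots> \<le> 2 * r * (norm b + 1) - 2 * r" by (simp add: algebra_simps)
        also have "\<dots> < 2 * r * (norm b + 1)" using r0 by simp
        also have "\<dots> = m / 2" using less_imp_neq[OF nb] by (simp add: r_def field_simps)
        finally show ?thesis .
      qed
      ultimately show ?thesis
        using resolvent_spread[OF cl b a, of "m / 2" t] m(1) by (auto simp: U_def)
    qed
    then show ?thesis using r0 by blast
  qed
  have U0: "0 \<in> U"
    using csubspace_0[OF A_sub] by (auto simp: U_def resolvent_at_def intro!: exI[of _ 0])
  have allU: "s \<in> U" if "s \<notin> \<Sigma>" for s
  proof -
    have "0 \<notin> \<Sigma>" by (auto simp: \<Sigma>_def)
    have cover: "s0 \<in> interior U \<or> s0 \<in> interior (- U)" if s0: "s0 \<notin> \<Sigma>" for s0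
    proof -
      obtain r where r: "r > 0" "\<And>s t. s \<in> ball s0 r \<Longrightarrow> t \<in> ball s0 r \<Longrightarrow> s \<in> U \<Longrightarrow> t \<in> U"
        using nbhd[OF s0] by blast
      then have "ball s0 r \<subseteq> U \<or> ball s0 r \<subseteq> - U" by blast
      then show ?thesis using r(1) by (meson centre_in_ball interior_maximal open_ball subsetD)
    qed
    have "interior U \<inter> - \<Sigma> = {} \<or> interior (- U) \<inter> - \<Sigma> = {}"
    proof (rule connectedD[OF conn])
      show "interior U \<inter> interior (- U) \<inter> - \<Sigma> = {}" using interior_subset by blast
    qed (use cover in auto)
    moreover have "0 \<in> interior U \<inter> - \<Sigma>"
      using cover[OF \<open>0 \<notin> \<Sigma>\<close>] \<open>0 \<notin> \<Sigma>\<close> U0 interior_subset by blast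
    ultimately have "s \<in> interior U" using cover[OF that] that by blast
    then show ?thesis using interior_subset by blast
  qed
  \<comment> \<open>The space is the direct sum of the kernel of \<open>d\<close> and its range
    \<open>R\<close>. \<open>\<rho>\<close> picks the component in \<open>R\<close>, so
    \<open>1 - \<rho>\<close> is the projection onto the kernel.\<close>
  define \<rho> where "\<rho> x = (SOME r. r \<in> R \<and> d r = d x)" for x
  have \<rho>: "\<rho> x \<in> R" "d (\<rho> x) = d x" for x
  proof -
    have "\<exists>r. r \<in> R \<and> d r = d x" using rr[of x] by (auto simp: R_def d_def blinfun.diff_left)
    then show "\<rho> x \<in> R" "d (\<rho> x) = d x" unfolding \<rho>_def by (metis (mono_tags, lifting) someI_ex)+
  qed
  have \<rho>_uniq: "\<rho> x = r" if "r \<in> R" "d r = d x" for x r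
  proof -
    have "\<rho> x - r \<in> R" using \<rho> that csubspace_diff[OF R] by blast
    then have "\<delta> * norm (\<rho> x - r) \<le> 0" using dR[of "\<rho> x - r"] \<rho> that by (simp add: blinfun.diff_right)
    then show ?thesis using \<delta>(1) by (simp add: mult_le_0_iff)
  qed
  have \<rho>_add: "\<rho> (x + y) = \<rho> x + \<rho> y" for x y
    by (rule \<rho>_uniq) (simp_all add: \<rho> csubspace_add[OF R] blinfun.add_right)
  have \<rho>_scale: "\<rho> (z *\<^sub>C x) = z *\<^sub>C \<rho> x" for z x
    by (rule \<rho>_uniq) (simp_all add: \<rho> csubspace_scaleC[OF R] dC)
  have \<rho>_norm: "norm (\<rho> x) \<le> norm d / \<delta> * norm x" for x
  proof -
    have "\<delta> * norm (\<rho> x) \<le> norm d * norm x"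
      using dR[OF \<rho>(1)[of x]] norm_blinfun[of d x] by (simp add: \<rho>)
    then show ?thesis using \<delta>(1) by (simp add: field_simps)
  qed
  have "norm (\<rho> x) \<le> norm x * norm d / \<delta>" for x using \<rho>_norm[of x] by (simp add: ac_simps)
  then have "bounded_linear (\<lambda>x. x - \<rho> x)"
    by (intro bounded_linear_sub bounded_linear_ident
        bounded_linear_intro[where f = \<rho> and K = "norm d / \<delta>"])
      (simp_all add: \<rho>_add \<rho>_scale scaleR_eq_scaleC)
  then have e: "Blinfun (\<lambda>x. x - \<rho> x) x = x - \<rho> x" for x by (simp add: bounded_linear_Blinfun_apply)
  define E where "E = Blinfun (\<lambda>x. x - \<rho> x)"
  have E: "E x = x - \<rho> x" for x by (simp add: E_def e)
  have dE: "d (E x) = 0" for x by (simp add: E blinfun.diff_right \<rho>)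
  have fix0: "E x = x" if "d x = 0" for x
    using \<rho>_uniq[of 0 x] that csubspace_0[OF R] by (simp add: E)
  obtain r where r: "r > 0" "\<And>s. s \<noteq> 1 \<Longrightarrow> cmod (s - 1) < r \<Longrightarrow> s \<notin> \<Sigma>"
    using isolated[of 1] by blast
  define r' where "r' = min r (\<delta> / (2 * (norm b + 1)))"
  have nb: "norm b + 1 > 0" using norm_ge_zero[of b] by linarith
  have r': "r' > 0" using r(1) \<delta>(1) nb by (simp add: r'_def)
  \<comment> \<open>At \<open>s = 1 - t\<close> the operator \<open>t (1 + a)\<close> is the
    identity on the kernel of \<open>d\<close>, while on \<open>R\<close> the inverse
    \<open>1 + a\<close> stays bounded as \<open>t\<close> tends to \<open>0\<close>. So
    \<open>t a\<close> tends to \<open>E\<close>, and the error collects the part on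
    \<open>R\<close> and the term \<open>t x\<close>.\<close>
  have approx: "\<exists>f\<in>A. norm (f - E) \<le> t * (2 * norm d / \<delta> / \<delta> + 1)" if t: "0 < t" "t < r'" for t :: real
  proof -
    define s where "s = 1 - complex_of_real t"
    have "s \<notin> \<Sigma>" by (rule r(2)) (use t in \<open>auto simp: s_def r'_def\<close>)
    then obtain a where aA: "a \<in> A" and ar: "\<And>x. (x + a x) - s *\<^sub>C b (x + a x) = x"
      and al: "\<And>x. (x - s *\<^sub>C b x) + a (x - s *\<^sub>C b x) = x"
      using allU unfolding U_def resolvent_at_def by blast
    have T: "x - s *\<^sub>C b x = d x + t *\<^sub>R b x" for x
      by (simp add: s_def dx cvs.scale_left_diff_distrib scaleR_eq_scaleC)
    have tb: "t * norm b \<le> \<delta> / 2"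
    proof -
      have "t * norm b \<le> t * (norm b + 1)" using t by simp
      also have "\<dots> \<le> \<delta> / (2 * (norm b + 1)) * (norm b + 1)"
        using t nb by (intro mult_right_mono) (auto simp: r'_def)
      also have "\<dots> = \<delta> / 2" using less_imp_neq[OF nb] by (simp add: field_simps)
      finally show ?thesis .
    qed
    have "norm ((t *\<^sub>R a - E) x) \<le> t * (2 * norm d / \<delta> / \<delta> + 1) * norm x" for x
    proof -
      define y where "y = \<rho> x + a (\<rho> x)"
      have Ty: "d y + t *\<^sub>R b y = \<rho> x" using ar[of "\<rho> x"] unfolding T y_def .
      have "y \<in> R"
      proof -
        have "t *\<^sub>R y = \<rho> x - (1 - t) *\<^sub>R d y"
          unfolding Ty[symmetric] by (simp add: dx algebra_simps)
        moreover have "d y \<in> R" by (simp add: R_def)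
        ultimately have "t *\<^sub>R y \<in> R"
          using csubspace_diff[OF R \<rho>(1) csubspace_scaleR[OF R]] by metis
        from csubspace_scaleR[OF R this, of "1 / t"] show ?thesis using t by simp
      qed
      have "\<delta> * norm y \<le> norm (d y)" by (rule dR) fact
      also have "\<dots> \<le> norm (\<rho> x) + norm (t *\<^sub>R b y)"
        using norm_triangle_ineq4[of "\<rho> x" "t *\<^sub>R b y"] by (simp flip: Ty)
      also have "norm (t *\<^sub>R b y) \<le> \<delta> / 2 * norm y"
      proof -
        have "t * norm (b y) \<le> t * (norm b * norm y)"
          using t by (intro mult_left_mono norm_blinfun) simp
        also have "\<dots> \<le> \<delta> / 2 * norm y"
          using mult_right_mono[OF tb norm_ge_zero[of y]] by (simp only: mult.assoc)
        finally show ?thesis using t by simp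
      qed
      finally have "norm y \<le> 2 / \<delta> * norm (\<rho> x)" using \<delta>(1) by (simp add: field_simps)
      also have "\<dots> \<le> 2 / \<delta> * (norm d / \<delta> * norm x)"
        using \<delta>(1) by (intro mult_left_mono \<rho>_norm) simp
      finally have ny: "norm y \<le> 2 * norm d / \<delta> / \<delta> * norm x" by simp
      have "E x - s *\<^sub>C b (E x) = t *\<^sub>R E x"
        unfolding T using dE[of x] by (simp add: dx)
      then have "t *\<^sub>R E x + t *\<^sub>R a (E x) = E x" using al[of "E x"] by (simp add: blinfun.scaleR_right)
      then have f1: "t *\<^sub>R a (E x) = E x - t *\<^sub>R E x" by (metis add_diff_cancel_left')
      have f2: "a x = a (E x) + a (\<rho> x)" unfolding blinfun.add_right[symmetric] E by simp
      have "(t *\<^sub>R a - E) x = t *\<^sub>R a (E x) + t *\<^sub>R a (\<rho> x) - E x"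
        by (simp only: f2 blinfun.diff_left blinfun.scaleR_left scaleR_add_right)
      also have "\<dots> = t *\<^sub>R y - t *\<^sub>R x"
        unfolding f1 by (simp add: y_def E algebra_simps)
      finally have "(t *\<^sub>R a - E) x = t *\<^sub>R y - t *\<^sub>R x" .
      then have "norm ((t *\<^sub>R a - E) x) \<le> norm (t *\<^sub>R y) + norm (t *\<^sub>R x)"
        by (simp only: norm_triangle_ineq4)
      also have "\<dots> = t * (norm y + norm x)" using t by (simp add: algebra_simps)
      also have "\<dots> \<le> t * (2 * norm d / \<delta> / \<delta> * norm x + norm x)"
        using t ny by (intro mult_left_mono) auto
      finally show ?thesis by (simp add: algebra_simps)
    qed
    then have "norm (t *\<^sub>R a - E) \<le> t * (2 * norm d / \<delta> / \<delta> + 1)"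
      using t \<delta>(1) by (intro norm_blinfun_bound) auto
    then show ?thesis using aA by (intro bexI[of _ "t *\<^sub>R a"] csubspace_scaleR[OF A_sub])
  qed
  have "E \<in> closure A"
    unfolding closure_approachable
  proof (intro allI impI)
    fix \<epsilon> :: real assume eps: "\<epsilon> > 0"
    define M where "M = 2 * norm d / \<delta> / \<delta> + 1"
    have M: "M > 0" using \<delta>(1) by (simp add: M_def add_nonneg_pos)
    define t where "t = min (r' / 2) (\<epsilon> / (2 * M))"
    have t: "0 < t" "t < r'" using r' eps M by (auto simp: t_def)
    have "t * M \<le> \<epsilon> / (2 * M) * M" using M by (intro mult_right_mono) (auto simp: t_def)
    also have "\<dots> < \<epsilon>" using M eps by simp
    finally have "t * M < \<epsilon>" .
    then show "\<exists>f\<in>A. dist f E < \<epsilon>"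
      using approx[OF t] unfolding dist_norm M_def by (meson order_le_less_trans)
  qed
  then have EA: "E \<in> A" using cl by simp
  have "((\<lambda>x. x - blinfun_apply c x) ^^ k) x = 0" if "c x = x" for x
    using k that by (induction k rule: dec_induct) simp_all
  then have "d x = 0" if "c x = x" for x using that pw[of x] by (simp add: dx)
  then show ?thesis
    using EA k fix0 dE pw by (intro bexI[OF _ EA] exI[of _ k]) (auto simp: dx)
qed

end

section \<open>Fixed points and Lomonosov's theorem\<close>

lemma simultaneous_convergent_subsequence:
  fixes t :: "nat \<Rightarrow> nat \<Rightarrow> real"
  assumes "\<And>p i. i < n \<Longrightarrow> \<bar>t p i\<bar> \<le> B"
  shows "\<exists>\<tau> r. strict_mono r \<and> (\<forall>i<n. (\<lambda>k. t (r k) i) \<longlonglongrightarrow> \<tau> i)"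
  using assms
proof (induction n)
  case 0
  then show ?case by (auto intro!: exI[of _ id] simp: strict_mono_def)
next
  case (Suc n)
  then obtain \<tau> r where r: "strict_mono (r :: nat \<Rightarrow> nat)" "\<forall>i<n. (\<lambda>k. t (r k) i) \<longlonglongrightarrow> \<tau> i"
    by (metis less_SucI)
  have "bounded (range (\<lambda>k. t (r k) n))"
    unfolding bounded_iff using Suc.prems by (auto intro!: exI[of _ B])
  then obtain l r' where r': "strict_mono (r' :: nat \<Rightarrow> nat)" "((\<lambda>k. t (r k) n) \<circ> r') \<longlonglongrightarrow> l"
    using bounded_imp_convergent_subsequence[of "\<lambda>k. t (r k) n"] by blast
  have "(\<lambda>k. t ((r \<circ> r') k) i) \<longlonglongrightarrow> (\<tau>(n := l)) i" if "i < Suc n" for i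
  proof (cases "i = n")
    case False
    then have "i < n" using that by simp
    then have "(\<lambda>k. t (r k) i) \<longlonglongrightarrow> \<tau> i" using r by blast
    from LIMSEQ_subseq_LIMSEQ[OF this r'(1)] False show ?thesis by (simp add: o_def)
  qed (use r' in \<open>simp add: o_def\<close>)
  moreover have "strict_mono (r \<circ> r')" using r r' by (simp add: strict_mono_o)
  ultimately show ?case by blast
qed

text \<open>Brouwer's theorem for a self-map of \<open>C\<close> whose values are given through
  barycentric weights \<open>w i\<close>. Kuhn's combinatorial lemma is applied to the weights
  themselves, so no coordinates on the span of the vertices are needed, and the vertices may be
  affinely dependent.\<close>

lemma brouwer_polytope:
  fixes y :: "nat \<Rightarrow> 'a::real_normed_vector" and w :: "nat \<Rightarrow> 'a \<Rightarrow> real"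
  assumes n: "n > 0" and C: "C = convex hull (y ` {..<n})"
    and cont: "\<And>i. i < n \<Longrightarrow> continuous_on C (w i)"
    and pos: "\<And>i x. i < n \<Longrightarrow> x \<in> C \<Longrightarrow> 0 \<le> w i x"
    and one: "\<And>x. x \<in> C \<Longrightarrow> (\<Sum>i<n. w i x) = 1"
  shows "\<exists>x\<in>C. (\<Sum>i<n. w i x *\<^sub>R y i) = x"
proof -
  define \<sigma> where "\<sigma> t = (\<Sum>i<n. t i)" for t :: "nat \<Rightarrow> real"
  \<comment> \<open>Kuhn's lemma works on a cube instead of a simplex. Weights of total mass above
    \<open>1\<close> are divided by the mass, and a deficit is placed on vertex \<open>0\<close>;
    weights of mass exactly \<open>1\<close> remain unchanged.\<close>
  define u where "u t i = t i / max 1 (\<sigma> t) + (if i = 0 then max 0 (1 - \<sigma> t) else 0)" for t i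
  define X where "X t = (\<Sum>i<n. u t i *\<^sub>R y i)" for t
  have XC: "X t \<in> C" if t: "\<And>i. i < n \<Longrightarrow> 0 \<le> t i" for t
  proof -
    have s0: "\<sigma> t \<ge> 0" unfolding \<sigma>_def using t by (intro sum_nonneg) auto
    have "(\<Sum>i<n. u t i) = \<sigma> t / max 1 (\<sigma> t) + max 0 (1 - \<sigma> t)"
      using n by (simp add: u_def sum.distrib \<sigma>_def sum_divide_distrib)
    also have "\<dots> = 1" by (auto simp: max_def)
    finally have "(\<Sum>i<n. u t i) = 1" .
    then show ?thesis
      unfolding X_def C using t
      by (intro convex_sum) (auto simp: u_def hull_inc)
  qed
  have w1: "w i x \<le> 1" if "i < n" "x \<in> C" for i x
  proof -
    have "w i x \<le> (\<Sum>i<n. w i x)" using that pos by (intro member_le_sum) auto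
    then show ?thesis using one that by simp
  qed
  \<comment> \<open>Label \<open>0\<close> means that the coordinate does not exceed the weight
    demanded by the map. The exception at \<open>x i = p\<close> is the boundary condition of Kuhn's
    lemma; it is harmless since all \<open>w i\<close> are at most \<open>1\<close>. Neighbouring
    grid points with labels \<open>0\<close> and \<open>1\<close> give both inequalities between
    \<open>\<tau> i\<close> and \<open>w i (X \<tau>)\<close> in the limit.\<close>
  define lab where "lab p x i = (if x i / p \<le> w i (X (\<lambda>j. x j / p)) \<and> x i \<noteq> p then 0 else 1::nat)"
    for p :: nat and x :: "nat \<Rightarrow> nat" and i
  have XpC: "X (\<lambda>j. real (x j) / real p) \<in> C" for x :: "nat \<Rightarrow> nat" and p by (rule XC) simp
  have lab0: "x i / p \<le> w i (X (\<lambda>j. x j / p))" if "lab p x i = 0" for p x i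
    using that by (auto simp: lab_def split: if_splits)
  have lab1: "w i (X (\<lambda>j. x j / p)) \<le> x i / p" if "lab p x i \<noteq> 0" "i < n" "p > 0" for p x i
    using that w1[OF that(2) XpC, of x p] by (auto simp: lab_def split: if_splits)
  have kuhn: "\<exists>q. (\<forall>i<n. q i < p) \<and> (\<forall>i<n. \<exists>r s. (\<forall>j<n. q j \<le> r j \<and> r j \<le> q j + 1) \<and>
       (\<forall>j<n. q j \<le> s j \<and> s j \<le> q j + 1) \<and> lab p r i = 0 \<and> lab p s i \<noteq> 0)" if p: "p > 0" for p
  proof -
    obtain q where q: "\<forall>i<n. q i < p"
      "\<forall>i<n. \<exists>r s. (\<forall>j<n. q j \<le> r j \<and> r j \<le> q j + 1) \<and> (\<forall>j<n. q j \<le> s j \<and> s j \<le> q j + 1) \<and> lab p r i \<noteq> lab p s i"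
    proof (rule kuhn_lemma[OF p, of n "lab p"])
      show "\<forall>x. (\<forall>i<n. x i \<le> p) \<longrightarrow> (\<forall>i<n. lab p x i = 0 \<or> lab p x i = 1)" by (simp add: lab_def)
      show "\<forall>x. (\<forall>i<n. x i \<le> p) \<longrightarrow> (\<forall>i<n. x i = 0 \<longrightarrow> lab p x i = 0)"
        using p pos[OF _ XpC] by (simp add: lab_def)
      show "\<forall>x. (\<forall>i<n. x i \<le> p) \<longrightarrow> (\<forall>i<n. x i = p \<longrightarrow> lab p x i = 1)" by (simp add: lab_def)
    qed
    have "\<exists>r s. (\<forall>j<n. q j \<le> r j \<and> r j \<le> q j + 1) \<and>
       (\<forall>j<n. q j \<le> s j \<and> s j \<le> q j + 1) \<and> lab p r i = 0 \<and> lab p s i \<noteq> 0" if i: "i < n" for i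
    proof -
      obtain r s where rs: "\<forall>j<n. q j \<le> r j \<and> r j \<le> q j + 1"
          "\<forall>j<n. q j \<le> s j \<and> s j \<le> q j + 1" "lab p r i \<noteq> lab p s i"
        using q(2) i by blast
      show ?thesis
      proof (cases "lab p r i = 0")
        case True
        then show ?thesis using rs by (intro exI[of _ r] exI[of _ s]) auto
      next
        case False
        moreover have "lab p s i = 0" using rs(3) False by (auto simp: lab_def split: if_splits)
        ultimately show ?thesis using rs by (intro exI[of _ s] exI[of _ r]) auto
      qed
    qed
    then show ?thesis using q(1) by blast
  qed
  define P where "P p q r s \<longleftrightarrow> (\<forall>i<n. q i < Suc p) \<and> (\<forall>i<n. (\<forall>j<n. q j \<le> r i j \<and> r i j \<le> q j + 1) \<and>
       (\<forall>j<n. q j \<le> s i j \<and> s i j \<le> q j + 1) \<and> lab (Suc p) (r i) i = 0 \<and> lab (Suc p) (s i) i \<noteq> 0)"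
    for p q r s
  have "\<exists>q r s. P p q r s" for p
  proof -
    obtain q where q: "\<forall>i<n. q i < Suc p" and rs: "\<forall>i<n. \<exists>r s. (\<forall>j<n. q j \<le> r j \<and> r j \<le> q j + 1) \<and>
       (\<forall>j<n. q j \<le> s j \<and> s j \<le> q j + 1) \<and> lab (Suc p) r i = 0 \<and> lab (Suc p) s i \<noteq> 0"
      using kuhn[of "Suc p"] by blast
    let ?P = "\<lambda>i r s. (\<forall>j<n. q j \<le> r j \<and> r j \<le> q j + 1) \<and>
       (\<forall>j<n. q j \<le> s j \<and> s j \<le> q j + 1) \<and> lab (Suc p) r i = 0 \<and> lab (Suc p) s i \<noteq> 0"
    have "\<forall>i. \<exists>rs. i < n \<longrightarrow> ?P i (fst rs) (snd rs)" using rs by auto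
    then obtain rs where "\<forall>i. i < n \<longrightarrow> ?P i (fst (rs i)) (snd (rs i))" by (rule choice[THEN exE])
    then show ?thesis
      using q unfolding P_def
      by (intro exI[of _ q] exI[of _ "\<lambda>i. fst (rs i)"] exI[of _ "\<lambda>i. snd (rs i)"]) auto
  qed
  then obtain q r s where P: "\<And>p. P p (q p) (r p) (s p)" by metis
  have q: "\<And>p i. i < n \<Longrightarrow> q p i < Suc p"
    and r: "\<And>p i j. i < n \<Longrightarrow> j < n \<Longrightarrow> q p j \<le> r p i j \<and> r p i j \<le> q p j + (1::nat)"
    and s: "\<And>p i j. i < n \<Longrightarrow> j < n \<Longrightarrow> q p j \<le> s p i j \<and> s p i j \<le> q p j + (1::nat)"
    and rl: "\<And>p i. i < n \<Longrightarrow> lab (Suc p) (r p i) i = 0"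
    and sl: "\<And>p i. i < n \<Longrightarrow> lab (Suc p) (s p i) i \<noteq> 0"
    using P unfolding P_def by blast+
  have "\<bar>q p i / real (Suc p)\<bar> \<le> 1" if "i < n" for p i
    using q[OF that, of p] by (simp add: divide_le_eq_1)
  from simultaneous_convergent_subsequence[of n "\<lambda>p i. q p i / real (Suc p)", OF this]
  obtain \<tau> h where h: "strict_mono (h :: nat \<Rightarrow> nat)"
    and \<tau>: "\<And>i. i < n \<Longrightarrow> (\<lambda>k. q (h k) i / real (Suc (h k))) \<longlonglongrightarrow> \<tau> i" by blast
  have inv0: "(\<lambda>k. 1 / real (Suc (h k))) \<longlonglongrightarrow> 0"
    using LIMSEQ_subseq_LIMSEQ[OF LIMSEQ_Suc[OF lim_1_over_n] h] by (simp add: o_def)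
  have near: "(\<lambda>k. f (h k) j / real (Suc (h k))) \<longlonglongrightarrow> \<tau> j"
    if f: "\<And>p. q p j \<le> f p j \<and> f p j \<le> q p j + (1::nat)" and j: "j < n" for f :: "nat \<Rightarrow> nat \<Rightarrow> nat" and j
  proof (rule tendsto_sandwich[OF _ _ \<tau>[OF j]])
    show "(\<lambda>k. q (h k) j / real (Suc (h k)) + 1 / real (Suc (h k))) \<longlonglongrightarrow> \<tau> j"
      using tendsto_add[OF \<tau>[OF j] inv0] by simp
    show "\<forall>\<^sub>F k in sequentially. q (h k) j / real (Suc (h k)) \<le> f (h k) j / real (Suc (h k))"
      using f by (intro always_eventually allI divide_right_mono) auto
    have "real (f p j) \<le> real (q p j) + 1" for p using f[of p] by linarith
    then show "\<forall>\<^sub>F k in sequentially. f (h k) j / real (Suc (h k))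
        \<le> q (h k) j / real (Suc (h k)) + 1 / real (Suc (h k))"
      unfolding add_divide_distrib[symmetric] by (intro always_eventually allI divide_right_mono) auto
  qed
  have \<tau>0: "0 \<le> \<tau> i" if "i < n" for i
    by (rule LIMSEQ_le_const[OF \<tau>[OF that]]) auto
  have Xlim: "(\<lambda>k. X (\<lambda>j. f (h k) j / real (Suc (h k)))) \<longlonglongrightarrow> X \<tau>"
    if f: "\<And>p j. j < n \<Longrightarrow> q p j \<le> f p j \<and> f p j \<le> q p j + (1::nat)" for f :: "nat \<Rightarrow> nat \<Rightarrow> nat"
  proof -
    have lim: "(\<lambda>k. f (h k) j / real (Suc (h k))) \<longlonglongrightarrow> \<tau> j" if "j < n" for j
      by (rule near[of j f, OF f[OF that] that])
    have sg: "(\<lambda>k. \<sigma> (\<lambda>j. f (h k) j / real (Suc (h k)))) \<longlonglongrightarrow> \<sigma> \<tau>"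
      unfolding \<sigma>_def by (intro tendsto_sum lim) simp
    have m0: "(\<lambda>k. if i = 0 then max 0 (1 - \<sigma> (\<lambda>j. f (h k) j / real (Suc (h k)))) else 0)
        \<longlonglongrightarrow> (if i = 0 then max 0 (1 - \<sigma> \<tau>) else 0)" for i :: nat
      by (cases "i = 0"; simp del: of_nat_Suc; intro tendsto_max tendsto_diff tendsto_const sg)
    have "(\<lambda>k. u (\<lambda>j. f (h k) j / real (Suc (h k))) i) \<longlonglongrightarrow> u \<tau> i" if "i < n" for i
      unfolding u_def
      by (rule tendsto_add[OF tendsto_divide[OF lim[OF that] tendsto_max[OF tendsto_const sg]] m0]) simp
    then show ?thesis unfolding X_def by (intro tendsto_sum tendsto_scaleR tendsto_const) simp
  qed
  have XtC: "X \<tau> \<in> C" by (rule XC) (rule \<tau>0)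
  have wlim: "(\<lambda>k. w i (X (\<lambda>j. f (h k) j / real (Suc (h k))))) \<longlonglongrightarrow> w i (X \<tau>)"
    if f: "\<And>p j. j < n \<Longrightarrow> q p j \<le> f p j \<and> f p j \<le> q p j + (1::nat)" and i: "i < n"
    for f :: "nat \<Rightarrow> nat \<Rightarrow> nat" and i
    using continuous_on_sequentially[THEN iffD1, OF cont[OF i], rule_format,
        of "X \<tau>" "\<lambda>k. X (\<lambda>j. f (h k) j / real (Suc (h k)))"] XtC XpC Xlim[OF f]
    by (simp add: o_def del: of_nat_Suc)
  have "\<tau> i = w i (X \<tau>)" if i: "i < n" for i
  proof (rule antisym)
    show "\<tau> i \<le> w i (X \<tau>)"
    proof (rule LIMSEQ_le[OF near[of i "\<lambda>p. r p i", OF r[OF i i] i] wlim[of "\<lambda>p. r p i", OF r[OF i] i]])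
      show "\<exists>N. \<forall>k\<ge>N. r (h k) i i / real (Suc (h k)) \<le> w i (X (\<lambda>j. r (h k) i j / real (Suc (h k))))"
        using lab0[OF rl[OF i]] by blast
    qed
    show "w i (X \<tau>) \<le> \<tau> i"
    proof (rule LIMSEQ_le[OF wlim[of "\<lambda>p. s p i", OF s[OF i] i] near[of i "\<lambda>p. s p i", OF s[OF i i] i]])
      show "\<exists>N. \<forall>k\<ge>N. w i (X (\<lambda>j. s (h k) i j / real (Suc (h k)))) \<le> s (h k) i i / real (Suc (h k))"
        using lab1[OF sl[OF i] i] by blast
    qed
  qed
  note tw = this
  then have "\<sigma> \<tau> = 1" using one[OF XtC] by (simp add: \<sigma>_def)
  then have "X \<tau> = (\<Sum>i<n. \<tau> i *\<^sub>R y i)"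
    unfolding X_def by (intro sum.cong) (auto simp: u_def)
  also have "\<dots> = (\<Sum>i<n. w i (X \<tau>) *\<^sub>R y i)" using tw by (intro sum.cong) auto
  finally show ?thesis using XtC by (intro bexI[of _ "X \<tau>"]) auto
qed

text \<open>The Schauder projection replaces \<open>\<Phi> x\<close> by a convex combination of
  points of a finite \<open>e\<close>-net close to it. The resulting self-map of a polytope has a
  fixed point, which \<open>\<Phi>\<close> moves by at most \<open>e\<close>; compactness of the
  image yields a limit of such points.\<close>

lemma schauder_fixed_point:
  fixes B :: "'a::real_normed_vector set"
  assumes B: "convex B" "closed B" "B \<noteq> {}" and \<Phi>: "continuous_on B \<Phi>" "\<Phi> ` B \<subseteq> B"
    and K: "compact K" "\<Phi> ` B \<subseteq> K"
  shows "\<exists>x\<in>B. \<Phi> x = x"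
proof -
  have clK: "compact (closure (\<Phi> ` B))"
    using K by (metis closure_minimal compact_imp_closed compact_Int_closed closed_closure inf.absorb_iff2)
  have approx: "\<exists>x\<in>B. norm (x - \<Phi> x) \<le> e" if e: "e > 0" for e :: real
  proof -
    have "closure (\<Phi> ` B) \<subseteq> (\<Union>z\<in>\<Phi> ` B. ball z e)"
    proof
      fix z assume "z \<in> closure (\<Phi> ` B)"
      then obtain v where "v \<in> \<Phi> ` B" "dist v z < e" using e unfolding closure_approachable by blast
      then show "z \<in> (\<Union>z\<in>\<Phi> ` B. ball z e)" by auto
    qed
    then obtain Y where Y: "Y \<subseteq> \<Phi> ` B" "finite Y" "closure (\<Phi> ` B) \<subseteq> (\<Union>z\<in>Y. ball z e)"
      using compactE_image[OF clK, of "\<Phi> ` B" "\<lambda>z. ball z e"] by auto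
    obtain n y where y: "Y = y ` {i::nat. i < n}"
      using finite_imp_nat_seg_image_inj_on[OF Y(2)] by blast
    then have yY: "y ` {..<n} = Y" by (simp add: lessThan_def)
    have "Y \<noteq> {}" using Y(3) B(3) closure_eq_empty[of "\<Phi> ` B"] by auto
    then have n: "n > 0" using y by auto
    define C where "C = convex hull (y ` {..<n})"
    have CB: "C \<subseteq> B"
      unfolding C_def yY using Y(1) \<Phi>(2) B(1) by (intro hull_minimal) auto
    define \<beta> where "\<beta> i x = max 0 (e - norm (\<Phi> x - y i))" for i x
    define T where "T x = (\<Sum>i<n. \<beta> i x)" for x
    have \<beta>0: "0 \<le> \<beta> i x" for i x by (simp add: \<beta>_def)
    have Tpos: "T x > 0" if "x \<in> B" for x
    proof -
      have "\<Phi> x \<in> closure (\<Phi> ` B)" by (rule closure_subset[THEN subsetD, OF imageI[OF that]])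
      then obtain i where i: "i < n" "dist (y i) (\<Phi> x) < e" using Y(3) unfolding yY[symmetric] by auto
      then have "0 < \<beta> i x" by (simp add: \<beta>_def dist_norm norm_minus_commute)
      also have "\<dots> \<le> T x" unfolding T_def using i \<beta>0 by (intro member_le_sum) auto
      finally show ?thesis .
    qed
    have c\<beta>: "continuous_on C (\<beta> i)" for i
      unfolding \<beta>_def by (intro continuous_intros continuous_on_subset[OF \<Phi>(1) CB])
    have "\<exists>x\<in>C. (\<Sum>i<n. (\<beta> i x / T x) *\<^sub>R y i) = x"
    proof (rule brouwer_polytope[OF n C_def])
      show "continuous_on C (\<lambda>x. \<beta> i x / T x)" for i
        using Tpos CB unfolding T_def
        by (intro continuous_intros c\<beta>) fastforce
      show "0 \<le> \<beta> i x / T x" if "x \<in> C" for i x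
        using Tpos[of x] CB that \<beta>0 by (auto intro!: divide_nonneg_nonneg simp: less_imp_le)
      show "(\<Sum>i<n. \<beta> i x / T x) = 1" if "x \<in> C" for x
        using Tpos[of x] CB that by (auto simp: sum_divide_distrib[symmetric] T_def)
    qed
    then obtain x where x: "x \<in> C" "(\<Sum>i<n. (\<beta> i x / T x) *\<^sub>R y i) = x" by blast
    have xB: "x \<in> B" using x CB by blast
    have T1: "(\<Sum>i<n. \<beta> i x / T x) = 1"
      using Tpos[OF xB] by (auto simp: sum_divide_distrib[symmetric] T_def)
    have "x - \<Phi> x = (\<Sum>i<n. (\<beta> i x / T x) *\<^sub>R (y i - \<Phi> x))"
      using x(2) T1 by (simp add: scaleR_diff_right sum_subtractf flip: scaleR_sum_left)
    also have "norm \<dots> \<le> (\<Sum>i<n. (\<beta> i x / T x) * e)"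
    proof (rule sum_norm_le)
      fix i assume "i \<in> {..<n}"
      show "norm ((\<beta> i x / T x) *\<^sub>R (y i - \<Phi> x)) \<le> (\<beta> i x / T x) * e"
      proof (cases "\<beta> i x = 0")
        case False
        then have "norm (y i - \<Phi> x) \<le> e"
          by (auto simp: \<beta>_def max_def norm_minus_commute split: if_splits)
        then show ?thesis
          using \<beta>0[of i x] Tpos[OF xB] by (auto intro!: divide_right_mono mult_left_mono)
      qed simp
    qed
    also have "\<dots> = e" unfolding sum_distrib_right[symmetric] T1 by simp
    finally show ?thesis using xB by blast
  qed
  have "\<forall>k. \<exists>x\<in>B. norm (x - \<Phi> x) \<le> 1 / real (Suc k)" using approx by simp
  then obtain x where x: "\<And>k. x k \<in> B" "\<And>k. norm (x k - \<Phi> (x k)) \<le> 1 / real (Suc k)" by metis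
  have "\<forall>k. \<Phi> (x k) \<in> K" using x K by blast
  then obtain z r where r: "strict_mono (r :: nat \<Rightarrow> nat)" "((\<lambda>k. \<Phi> (x k)) \<circ> r) \<longlonglongrightarrow> z"
    using K(1) unfolding compact_def by metis
  have "(\<lambda>k. x k - \<Phi> (x k)) \<longlonglongrightarrow> 0"
    by (rule Lim_null_comparison[OF _ LIMSEQ_Suc[OF lim_1_over_n]]) (use x in auto)
  from LIMSEQ_subseq_LIMSEQ[OF this r(1)]
  have "(\<lambda>k. x (r k) - \<Phi> (x (r k)) + \<Phi> (x (r k))) \<longlonglongrightarrow> 0 + z"
    by (intro tendsto_add) (use r(2) in \<open>simp_all add: o_def\<close>)
  then have xz: "(\<lambda>k. x (r k)) \<longlonglongrightarrow> z" by simp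
  have zB: "z \<in> B" using closed_sequentially[OF B(2) _ xz] x(1) by blast
  have "(\<lambda>k. \<Phi> (x (r k))) \<longlonglongrightarrow> \<Phi> z"
    using continuous_on_sequentially[THEN iffD1, OF \<Phi>(1), rule_format, of z "\<lambda>k. x (r k)"] zB x(1) xz
    by (simp add: o_def)
  then have "\<Phi> z = z" using r(2) LIMSEQ_unique by (auto simp: o_def)
  then show ?thesis using zB by blast
qed

text \<open>The image under \<open>b\<close> of a ball around \<open>x0\<close> is relatively
  compact and avoids \<open>0\<close>. By transitivity finitely many elements of \<open>D\<close>
  suffice to bring each of its points back into the ball, and a partition of unity glues them to a
  continuous map \<open>\<Psi>\<close>. Schauder's theorem gives a fixed point of
  \<open>\<Psi>\<close> after \<open>b\<close>.\<close>

lemma lomonosov: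
  fixes X :: "'a::chilbert_space set"
  assumes X: "subspace X" "closed X"
    and D: "subspace D" "\<And>S x. S \<in> D \<Longrightarrow> x \<in> X \<Longrightarrow> blinfun_apply S x \<in> X"
    and b: "b \<in> compact_ops" "\<And>x. x \<in> X \<Longrightarrow> blinfun_apply b x \<in> X"
    and nz: "x1 \<in> X" "blinfun_apply b x1 \<noteq> 0"
    and trans: "\<And>y x e. y \<in> X \<Longrightarrow> y \<noteq> 0 \<Longrightarrow> x \<in> X \<Longrightarrow> e > 0 \<Longrightarrow> \<exists>S\<in>D. norm (blinfun_apply S y - x) < e"
  shows "\<exists>S\<in>D. \<exists>z\<in>X. z \<noteq> 0 \<and> blinfun_apply S (b z) = z"
proof -
  \<comment> \<open>The scaling gives \<open>norm (b x0) = norm b + 1\<close>, so \<open>b\<close>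
    maps the unit ball around \<open>x0\<close> to vectors of norm at least
    \<open>1\<close>.\<close>
  define x0 where "x0 = ((norm b + 1) / norm (b x1)) *\<^sub>R x1"
  have x0: "x0 \<in> X" using nz X by (simp add: x0_def subspace_scale)
  have bx0: "norm (b x0) = norm b + 1" using nz(2) by (simp add: x0_def blinfun.scaleR_right)
  define B where "B = cball x0 1 \<inter> X"
  have B: "convex B" "closed B" "x0 \<in> B"
    unfolding B_def using X x0 convex_Int[OF convex_cball subspace_imp_convex[OF X(1)]] by auto
  have bB: "1 \<le> norm (b x)" if "x \<in> B" for x
  proof -
    have "norm (b x0 - b x) \<le> norm b * norm (x0 - x)" by (simp add: norm_blinfun flip: blinfun.diff_right)
    also have "\<dots> \<le> norm b * 1"
      using that by (intro mult_left_mono) (auto simp: B_def dist_norm)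
    finally show ?thesis using bx0 norm_triangle_ineq2[of "b x0" "b x"] by simp
  qed
  define K where "K = closure (b ` B)"
  define \<rho> where "\<rho> = norm x0 + 1"
  have \<rho>: "\<rho> > 0" by (simp add: \<rho>_def add_nonneg_pos)
  have "compact ((\<lambda>v. \<rho> *\<^sub>R v) ` closure (b ` cball 0 1))"
    using b(1) by (intro compact_scaling) (simp add: compact_ops_def)
  moreover have "b ` B \<subseteq> (\<lambda>v. \<rho> *\<^sub>R v) ` closure (b ` cball 0 1)"
  proof
    fix v assume "v \<in> b ` B"
    then obtain x where x: "x \<in> B" "v = b x" by blast
    have "norm x \<le> \<rho>" using x(1) norm_triangle_ineq2[of x x0]
      by (simp add: B_def dist_norm \<rho>_def norm_minus_commute)
    then have "x /\<^sub>R \<rho> \<in> cball 0 1" using \<rho> by (simp add: field_simps)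
    then have "b (x /\<^sub>R \<rho>) \<in> closure (b ` cball 0 1)" by (intro closure_subset[THEN subsetD] imageI)
    moreover have "v = \<rho> *\<^sub>R b (x /\<^sub>R \<rho>)" using \<rho> x(2) by (simp add: blinfun.scaleR_right)
    ultimately show "v \<in> (\<lambda>v. \<rho> *\<^sub>R v) ` closure (b ` cball 0 1)" by blast
  qed
  ultimately have K: "compact K"
    unfolding K_def
    by (metis closure_minimal compact_imp_closed compact_Int_closed closed_closure inf.absorb_iff2)
  have "b ` B \<subseteq> X \<inter> {v. 1 \<le> norm v}" using b(2) bB by (auto simp: B_def)
  moreover have "closed (X \<inter> {v. 1 \<le> norm v})"
    using X by (intro closed_Int closed_Collect_le continuous_intros)
  ultimately have KX: "K \<subseteq> X \<inter> {v. 1 \<le> norm v}" unfolding K_def by (rule closure_minimal)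
  have "\<exists>S\<in>D. norm (S y - x0) < 1" if "y \<in> K" for y
  proof -
    have "y \<in> X" "y \<noteq> 0" using KX that by auto
    then show ?thesis using trans[of y x0 1] x0 by simp
  qed
  then obtain S where S: "\<And>y. y \<in> K \<Longrightarrow> S y \<in> D" "\<And>y. y \<in> K \<Longrightarrow> norm (S y y - x0) < 1" by metis
  have "K \<subseteq> (\<Union>y\<in>K. {v. norm (S y v - x0) < 1})" using S(2) by blast
  moreover have "open {v. norm (S y v - x0) < 1}" for y
    by (intro open_Collect_less continuous_intros)
  ultimately obtain Y where Y: "Y \<subseteq> K" "finite Y" "K \<subseteq> (\<Union>y\<in>Y. {v. norm (S y v - x0) < 1})"
    using compactE_image[OF K, of K "\<lambda>y. {v. norm (S y v - x0) < 1}"] by auto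
  define \<beta> where "\<beta> y v = max 0 (1 - norm (S y v - x0))" for y v
  define T where "T v = (\<Sum>y\<in>Y. \<beta> y v)" for v
  have \<beta>0: "0 \<le> \<beta> y v" for y v by (simp add: \<beta>_def)
  have Tpos: "T v > 0" if "v \<in> K" for v
  proof -
    obtain y where y: "y \<in> Y" "norm (S y v - x0) < 1" using Y(3) \<open>v \<in> K\<close> by blast
    then have "0 < \<beta> y v" by (simp add: \<beta>_def)
    also have "\<dots> \<le> T v" unfolding T_def using y \<beta>0 Y(2) by (intro member_le_sum) auto
    finally show ?thesis .
  qed
  define \<Psi> where "\<Psi> v = (\<Sum>y\<in>Y. (\<beta> y v / T v) *\<^sub>R S y v)" for v
  have c\<Psi>: "continuous_on K \<Psi>"
    unfolding \<Psi>_def \<beta>_def T_def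
    using Tpos by (intro continuous_intros) (fastforce simp: T_def \<beta>_def)
  have \<Psi>: "\<Psi> v \<in> B" if v: "v \<in> K" for v
  proof -
    have vX: "v \<in> X" using KX v by blast
    have T1: "(\<Sum>y\<in>Y. \<beta> y v / T v) = 1"
      using Tpos[OF v] by (auto simp: sum_divide_distrib[symmetric] T_def)
    have "\<Psi> v - x0 = (\<Sum>y\<in>Y. (\<beta> y v / T v) *\<^sub>R (S y v - x0))"
      using T1 by (simp add: \<Psi>_def scaleR_diff_right sum_subtractf flip: scaleR_sum_left)
    also have "norm \<dots> \<le> (\<Sum>y\<in>Y. \<beta> y v / T v)"
    proof (rule sum_norm_le)
      fix y
      show "norm ((\<beta> y v / T v) *\<^sub>R (S y v - x0)) \<le> \<beta> y v / T v"
      proof (cases "\<beta> y v = 0")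
        case False
        then have "norm (S y v - x0) \<le> 1"
          by (auto simp: \<beta>_def max_def split: if_splits)
        then show ?thesis
          using \<beta>0[of y v] Tpos[OF v] by (auto intro!: divide_right_mono mult_left_le)
      qed simp
    qed
    finally have "dist x0 (\<Psi> v) \<le> 1" using T1 by (simp add: dist_norm norm_minus_commute)
    moreover have "\<Psi> v \<in> X"
      unfolding \<Psi>_def using Y(1) S(1) D(2) vX X(1) by (intro subspace_sum subspace_scale) blast+
    ultimately show ?thesis by (simp add: B_def)
  qed
  have bK: "b x \<in> K" if "x \<in> B" for x 
    unfolding K_def by (rule closure_subset[THEN subsetD, OF imageI[OF that]])
  have "\<exists>x\<in>B. \<Psi> (b x) = x"
  proof (rule schauder_fixed_point[where K = "\<Psi> ` K"])
    show "continuous_on B (\<lambda>x. \<Psi> (b x))"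
      by (rule continuous_on_compose2[OF c\<Psi>]) (use bK in \<open>auto intro!: continuous_intros\<close>)
    show "compact (\<Psi> ` K)" by (rule compact_continuous_image[OF c\<Psi> K])
  qed (use B \<Psi> bK in auto)
  then obtain z where z: "z \<in> B" "\<Psi> (b z) = z" by blast
  \<comment> \<open>Freezing the weights at the point \<open>b z\<close> turns the nonlinear
    \<open>\<Psi>\<close> into an element of \<open>D\<close> with the same value there.\<close>
  define R where "R = (\<Sum>y\<in>Y. (\<beta> y (b z) / T (b z)) *\<^sub>R S y)"
  have "R \<in> D"
    unfolding R_def using Y(1) S(1) D(1) by (intro subspace_sum subspace_scale) blast+
  moreover have "R (b z) = z"
    using z(2) by (simp add: R_def \<Psi>_def blinfun.sum_left blinfun.scaleR_left)
  moreover have "z \<noteq> 0" using bB[OF z(1)] by auto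
  ultimately show ?thesis using z(1) by (auto simp: B_def)
qed

section \<open>Lattices of subspaces without gaps\<close>

lemma norm_proj_mono:
  assumes "csubspace U" "closed U" "csubspace V" "closed V" "U \<subseteq> V"
  shows "norm (proj U x) \<le> norm (proj V x)"
proof -
  have "norm (x - proj V x) \<le> norm (x - proj U x)"
    using assms proj_in[of U x] by (intro norm_diff_proj_le_dist) auto
  then have "(norm (x - proj V x))\<^sup>2 \<le> (norm (x - proj U x))\<^sup>2" by (intro power_mono) auto
  then have "(norm (proj U x))\<^sup>2 \<le> (norm (proj V x))\<^sup>2"
    using proj_pythagoras[OF assms(1,2), of x] proj_pythagoras[OF assms(3,4), of x] by linarith
  then show ?thesis by (rule power2_le_imp_le) simp
qed

lemma norm_proj_diff:
  assumes U: "csubspace U" "closed U" and V: "csubspace V" "closed V" and UV: "U \<subseteq> V"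
  shows "(norm (proj V x - proj U x))\<^sup>2 = (norm (proj V x))\<^sup>2 - (norm (proj U x))\<^sup>2"
proof -
  have "proj U (proj V x) = proj U x"
  proof (rule proj_unique[OF U, symmetric])
    show "proj U (proj V x) \<in> U" by (rule proj_in[OF U])
    fix w assume w: "w \<in> U"
    then have "inner (x - proj V x) w = 0" "inner (proj V x - proj U (proj V x)) w = 0"
      using proj_orth[OF V] proj_orth[OF U] UV by auto
    then show "inner (x - proj U (proj V x)) w = 0" by (simp add: inner_diff_left)
  qed
  then show ?thesis using proj_pythagoras[OF U, of "proj V x"] by simp
qed

text \<open>Nonemptiness puts \<open>0\<close> into the union and keeps the intersection inside the
  members.\<close>

definition chain_of :: "'a set set \<Rightarrow> 'a set set \<Rightarrow> bool" where
  "chain_of L C \<longleftrightarrow> C \<subseteq> L \<and> C \<noteq> {} \<and> (\<forall>U\<in>C. \<forall>V\<in>C. U \<subseteq> V \<or> V \<subseteq> U)"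

lemma csubspace_Union_chain:
  assumes "chain_of L C" "\<And>V. V \<in> C \<Longrightarrow> csubspace V"
  shows "csubspace (\<Union>C)"
  unfolding csubspace_def
proof (intro conjI ballI allI)
  show "0 \<in> \<Union>C" using assms csubspace_0 unfolding chain_of_def by blast
  fix x assume "x \<in> \<Union>C"
  then obtain U where U: "U \<in> C" "x \<in> U" by blast
  show "c *\<^sub>C x \<in> \<Union>C" for c using U assms(2) csubspace_scaleC by blast
  fix y assume "y \<in> \<Union>C"
  then obtain V where V: "V \<in> C" "y \<in> V" by blast
  consider "U \<subseteq> V" | "V \<subseteq> U" using assms(1) U V unfolding chain_of_def by blast
  then show "x + y \<in> \<Union>C"
  proof cases
    case 1
    then show ?thesis using U V csubspace_add[OF assms(2)[OF V(1)]] by blast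
  next
    case 2
    then show ?thesis using U V csubspace_add[OF assms(2)[OF U(1)]] by blast
  qed
qed

text \<open>For one vector, its projection onto the closure lies close to some \<open>v\<close> in a
  member \<open>V\<close>, and projecting to \<open>V\<close> loses at most the squared distance.
  Finitely many vectors are handled by taking the larger of two comparable members.\<close>

lemma proj_Union_chain:
  fixes C :: "'a::chilbert_space set set"
  assumes C: "chain_of L C" and sub: "\<And>V. V \<in> C \<Longrightarrow> csubspace V \<and> closed V"
    and X: "finite X" and e: "e > 0"
  shows "\<exists>U\<in>C. \<forall>x\<in>X. (norm (proj (closure (\<Union>C)) x))\<^sup>2 \<le> (norm (proj U x))\<^sup>2 + e"
  using X
proof (induction X)
  case empty
  then show ?case using C by (auto simp: chain_of_def)
next
  case (insert x X)
  then obtain U where U: "U \<in> C"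
    "\<And>y. y \<in> X \<Longrightarrow> (norm (proj (closure (\<Union>C)) y))\<^sup>2 \<le> (norm (proj U y))\<^sup>2 + e" by blast
  let ?Z = "closure (\<Union>C)"
  have Z: "csubspace ?Z" "closed ?Z"
    using csubspace_Union_chain[OF C] sub by (auto intro: csubspace_closure)
  have "proj ?Z x \<in> ?Z" by (rule proj_in[OF Z])
  then obtain v where v: "v \<in> \<Union>C" "dist v (proj ?Z x) < sqrt e"
    using e unfolding closure_approachable by (meson real_sqrt_gt_zero)
  then obtain V where V: "V \<in> C" "v \<in> V" by blast
  have vZ: "v \<in> ?Z" using v(1) by (rule closure_subset[THEN subsetD])
  have V': "csubspace V" "closed V" using sub V by auto
  have "(norm (proj ?Z x))\<^sup>2 \<le> (norm (proj V x))\<^sup>2 + e"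
  proof -
    have "norm (x - proj V x) \<le> norm (x - v)" by (rule norm_diff_proj_le_dist[OF V' V(2)])
    then have "(norm (x - proj V x))\<^sup>2 \<le> (norm (x - v))\<^sup>2" by (intro power_mono) auto
    also have "x - v = (x - proj ?Z x) + (proj ?Z x - v)" by simp
    also have "(norm \<dots>)\<^sup>2 = (norm (x - proj ?Z x))\<^sup>2 + (norm (proj ?Z x - v))\<^sup>2"
      unfolding norm_add_sq
      using proj_orth[OF Z csubspace_diff[OF Z(1) proj_in[OF Z] vZ], of x x] by simp
    also have "(norm (proj ?Z x - v))\<^sup>2 \<le> (sqrt e)\<^sup>2"
      using v(2) by (intro power_mono) (auto simp: dist_norm norm_minus_commute)
    finally show ?thesis
      using proj_pythagoras[OF V', of x] proj_pythagoras[OF Z, of x] e by simp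
  qed
  note Vx = this
  have mono: "\<And>S T y. S \<in> C \<Longrightarrow> T \<in> C \<Longrightarrow> S \<subseteq> T \<Longrightarrow> (norm (proj S y))\<^sup>2 \<le> (norm (proj T y))\<^sup>2"
    by (intro power_mono norm_proj_mono) (use sub in auto)
  consider "U \<subseteq> V" | "V \<subseteq> U" using C U(1) V(1) unfolding chain_of_def by blast
  then show ?case
  proof cases
    case 1
    have "(norm (proj ?Z y))\<^sup>2 \<le> (norm (proj V y))\<^sup>2 + e" if "y \<in> insert x X" for y
    proof (cases "y = x")
      case False
      then have "y \<in> X" using that by blast
      then show ?thesis using U(2)[of y] mono[OF U(1) V(1) 1, of y] by linarith
    qed (use Vx in simp)
    then show ?thesis using V(1) by blast
  next
    case 2
    have "(norm (proj ?Z y))\<^sup>2 \<le> (norm (proj U y))\<^sup>2 + e" if "y \<in> insert x X" for y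
    proof (cases "y = x")
      case True
      then show ?thesis using Vx mono[OF V(1) U(1) 2, of x] by (simp del: power_mono_iff)
    qed (use that U(2)[of y] in simp)
    then show ?thesis using U(1) by blast
  qed
qed

text \<open>Orthogonal complements reverse inclusions and turn the intersection into a union, to
  which the preceding lemma applies.\<close>

lemma proj_Inter_chain:
  fixes C :: "'a::chilbert_space set set"
  assumes C: "chain_of L C" and sub: "\<And>V. V \<in> C \<Longrightarrow> csubspace V \<and> closed V"
    and X: "finite X" and e: "e > 0"
  shows "\<exists>U\<in>C. \<forall>x\<in>X. (norm (proj U x))\<^sup>2 \<le> (norm (proj (\<Inter>C) x))\<^sup>2 + e"
proof -
  let ?C = "ocomp ` C" and ?Z = "closure (\<Union>(ocomp ` C))"
  have C': "chain_of UNIV ?C"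
  proof -
    have "U \<subseteq> V \<or> V \<subseteq> U" if "U \<in> ?C" "V \<in> ?C" for U V
    proof -
      obtain U' V' where UV: "U' \<in> C" "V' \<in> C" "U = ocomp U'" "V = ocomp V'"
        using \<open>U \<in> _\<close> \<open>V \<in> _\<close> by blast
      then have "U' \<subseteq> V' \<or> V' \<subseteq> U'" using C by (simp add: chain_of_def)
      then show ?thesis unfolding UV(3,4) using ocomp_antimono by blast
    qed
    then show ?thesis using C by (simp add: chain_of_def)
  qed
  have sub': "csubspace V \<and> closed V" if "V \<in> ?C" for V
    using that csubspace_ocomp closed_ocomp by blast
  obtain V where V: "V \<in> ?C" "\<And>x. x \<in> X \<Longrightarrow> (norm (proj ?Z x))\<^sup>2 \<le> (norm (proj V x))\<^sup>2 + e"
    using proj_Union_chain[OF C' sub' X e] by blast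
  then obtain U where U: "U \<in> C" "V = ocomp U" by blast
  have I: "csubspace (\<Inter>C)" "closed (\<Inter>C)"
    using sub C by (auto simp: csubspace_def chain_of_def)
  have "csubspace (\<Union>?C)" using csubspace_Union_chain[OF C'] sub' by blast
  then have Z: "csubspace ?Z" "closed ?Z" by (auto intro: csubspace_closure)
  have "ocomp ?Z \<subseteq> \<Inter>C"
  proof
    fix x assume x: "x \<in> ocomp ?Z"
    have "x \<in> ocomp (ocomp U)" if "U \<in> C" for U
    proof -
      have "ocomp U \<subseteq> ?Z" using that by (intro order_trans[OF _ closure_subset]) blast
      then show ?thesis using x ocomp_antimono by blast
    qed
    then show "x \<in> \<Inter>C" using sub by (auto simp: ocomp_ocomp)
  qed
  from ocomp_antimono[OF this] have "ocomp (\<Inter>C) \<subseteq> ?Z" using ocomp_ocomp[OF Z] by simp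
  then have le: "norm (proj (ocomp (\<Inter>C)) x) \<le> norm (proj ?Z x)" for x
    by (intro norm_proj_mono csubspace_ocomp closed_ocomp Z)
  have "(norm (proj U x))\<^sup>2 \<le> (norm (proj (\<Inter>C) x))\<^sup>2 + e" if x: "x \<in> X" for x
  proof -
    have U': "csubspace U" "closed U" using sub U by auto
    have "(norm (proj (ocomp (\<Inter>C)) x))\<^sup>2 \<le> (norm (proj ?Z x))\<^sup>2" using le by (intro power_mono) auto
    then show ?thesis
      using V(2)[OF x] proj_pythagoras[OF U', of x] proj_pythagoras[OF I, of x]
      unfolding U(2) proj_ocomp[OF U'] proj_ocomp[OF I] by linarith
  qed
  then show ?thesis using U(1) by blast
qed

lemma zorn_maximal:
  assumes "S \<noteq> {}" "\<And>C. chain_of S C \<Longrightarrow> \<exists>U\<in>S. \<forall>V\<in>C. V \<subseteq> U"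
  shows "\<exists>M\<in>S. \<forall>V\<in>S. M \<subseteq> V \<longrightarrow> V = M"
proof (rule subset_Zorn)
  fix C assume C: "subset.chain S C"
  show "\<exists>U\<in>S. \<forall>V\<in>C. V \<subseteq> U"
  proof (cases "C = {}")
    case False
    then have "chain_of S C" using C unfolding chain_of_def subset_chain_def by blast
    then show ?thesis by (rule assms(2))
  qed (use assms(1) in auto)
qed

lemma zorn_minimal:
  assumes "S \<noteq> {}" "\<And>C. chain_of S C \<Longrightarrow> \<exists>U\<in>S. \<forall>V\<in>C. U \<subseteq> V"
  shows "\<exists>M\<in>S. \<forall>V\<in>S. V \<subseteq> M \<longrightarrow> V = M"
proof -
  \<comment> \<open>Set complements reverse inclusion, so minimal members become maximal
    ones.\<close>
  have "\<exists>M\<in>uminus ` S. \<forall>V\<in>uminus ` S. M \<subseteq> V \<longrightarrow> V = M"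
  proof (rule zorn_maximal)
    fix C assume C: "chain_of (uminus ` S) C"
    have "uminus ` C \<subseteq> S" using C by (auto simp: chain_of_def)
    moreover have "U \<subseteq> V \<or> V \<subseteq> U" if "U \<in> uminus ` C" "V \<in> uminus ` C" for U V
    proof -
      obtain U' V' where "U' \<in> C" "V' \<in> C" "U = - U'" "V = - V'"
        using \<open>U \<in> _\<close> \<open>V \<in> _\<close> by blast
      moreover from this have "U' \<subseteq> V' \<or> V' \<subseteq> U'" using C by (simp add: chain_of_def)
      ultimately show ?thesis by blast
    qed
    ultimately have "chain_of S (uminus ` C)" using C by (simp add: chain_of_def)
    from assms(2)[OF this] obtain U where "U \<in> S" "\<forall>V\<in>uminus ` C. U \<subseteq> V" by blast
    then show "\<exists>U\<in>uminus ` S. \<forall>V\<in>C. V \<subseteq> U" by (intro bexI[of _ "- U"]) auto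
  qed (use assms(1) in auto)
  then obtain N where N: "N \<in> uminus ` S" "\<forall>V\<in>uminus ` S. N \<subseteq> V \<longrightarrow> V = N" by (rule bexE)
  from N(1) obtain M where M: "M \<in> S" "N = - M" by blast
  have "V = M" if "V \<in> S" "V \<subseteq> M" for V
  proof -
    have "- M \<subseteq> - V" using that(2) by blast
    then have "- V = - M" using N(2)[rule_format, OF imageI[OF that(1)]] M(2) by simp
    then show ?thesis by simp
  qed
  then show ?thesis using M(1) by blast
qed

text \<open>
  In a complete lattice of closed subspaces without gaps, the top is reached from \<open>0\<close> in finitely
  many steps across each of which the projections of finitely many given vectors change little.
\<close>

lemma gapless_induct:
  fixes L :: "'a::chilbert_space set set"
  assumes sub: "\<And>V. V \<in> L \<Longrightarrow> csubspace V \<and> closed V \<and> V \<subseteq> W"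
    and L0: "{0} \<in> L" and LW: "W \<in> L"
    and sup: "\<And>C. chain_of L C \<Longrightarrow> closure (\<Union>C) \<in> L"
    and inf: "\<And>C. chain_of L C \<Longrightarrow> \<Inter>C \<in> L"
    and nogap: "\<And>U V. U \<in> L \<Longrightarrow> V \<in> L \<Longrightarrow> U \<subset> V \<Longrightarrow> \<exists>V'\<in>L. U \<subset> V' \<and> V' \<subset> V"
    and X: "finite X" and e: "e > 0"
    and base: "Q {0}"
    and step: "\<And>U V. U \<in> L \<Longrightarrow> V \<in> L \<Longrightarrow> U \<subseteq> V \<Longrightarrow>
        (\<And>x. x \<in> X \<Longrightarrow> (norm (proj V x))\<^sup>2 - (norm (proj U x))\<^sup>2 \<le> e) \<Longrightarrow> Q U \<Longrightarrow> Q V"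
  shows "Q W"
proof -
  \<comment> \<open>The progress measure: it is monotone, and by \<open>gsup\<close> and
    \<open>ginf\<close> continuous along chains. Every round of the construction raises it by
    \<open>e\<close>, and it never exceeds \<open>g W\<close>.\<close>
  define g where "g V = (\<Sum>x\<in>X. (norm (proj V x))\<^sup>2)" for V
  have mono1: "(norm (proj U x))\<^sup>2 \<le> (norm (proj V x))\<^sup>2" if "U \<in> L" "V \<in> L" "U \<subseteq> V" for U V x
    by (intro power_mono norm_proj_mono) (use that sub in auto)
  have mono: "g U \<le> g V" if "U \<in> L" "V \<in> L" "U \<subseteq> V" for U V
    unfolding g_def by (intro sum_mono mono1 that)
  have step': "Q V" if UV: "U \<in> L" "V \<in> L" "U \<subseteq> V" "g V \<le> g U + e" "Q U" for U V
  proof (rule step[OF UV(1,2,3) _ UV(5)])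
    fix x assume x: "x \<in> X"
    have "(norm (proj V x))\<^sup>2 - (norm (proj U x))\<^sup>2
        \<le> (\<Sum>x\<in>X. (norm (proj V x))\<^sup>2 - (norm (proj U x))\<^sup>2)"
      using x X mono1[OF UV(1,2,3)] by (intro member_le_sum) auto
    also have "\<dots> = g V - g U" by (simp add: g_def sum_subtractf)
    finally show "(norm (proj V x))\<^sup>2 - (norm (proj U x))\<^sup>2 \<le> e" using UV(4) by simp
  qed
  have chains: "C \<subseteq> L" "chain_of L C" if "chain_of S C" "S \<subseteq> L" for S C
    using that by (auto simp: chain_of_def)
  have subC: "csubspace V \<and> closed V" if "chain_of L C" "V \<in> C" for C V
    using that sub by (auto simp: chain_of_def)
  have gsup: "g (closure (\<Union>C)) \<le> c" if C: "chain_of L C" and le: "\<And>U. U \<in> C \<Longrightarrow> g U \<le> c" for C c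
  proof (rule field_le_epsilon)
    fix \<eta> :: real assume \<eta>: "\<eta> > 0"
    define \<eta>' where "\<eta>' = \<eta> / (real (card X) + 1)"
    have "\<eta>' > 0" using \<eta> by (simp add: \<eta>'_def)
    from proj_Union_chain[OF C subC[OF C] X this] obtain U
      where U: "U \<in> C" "\<And>x. x \<in> X \<Longrightarrow> (norm (proj (closure (\<Union>C)) x))\<^sup>2 \<le> (norm (proj U x))\<^sup>2 + \<eta>'"
      by blast
    have "g (closure (\<Union>C)) \<le> (\<Sum>x\<in>X. (norm (proj U x))\<^sup>2 + \<eta>')"
      unfolding g_def by (intro sum_mono U)
    also have "\<dots> = g U + real (card X) * \<eta>'" by (simp add: sum.distrib g_def)
    also have "real (card X) * \<eta>' \<le> \<eta>" using \<eta> by (simp add: \<eta>'_def field_simps)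
    finally show "g (closure (\<Union>C)) \<le> c + \<eta>" using le[OF U(1)] by simp
  qed
  have ginf: "c \<le> g (\<Inter>C)" if C: "chain_of L C" and le: "\<And>U. U \<in> C \<Longrightarrow> c \<le> g U" for C c
  proof (rule field_le_epsilon)
    fix \<eta> :: real assume \<eta>: "\<eta> > 0"
    define \<eta>' where "\<eta>' = \<eta> / (real (card X) + 1)"
    have "\<eta>' > 0" using \<eta> by (simp add: \<eta>'_def)
    from proj_Inter_chain[OF C subC[OF C] X this] obtain U
      where U: "U \<in> C" "\<And>x. x \<in> X \<Longrightarrow> (norm (proj U x))\<^sup>2 \<le> (norm (proj (\<Inter>C) x))\<^sup>2 + \<eta>'"
      by blast
    have "g U \<le> (\<Sum>x\<in>X. (norm (proj (\<Inter>C) x))\<^sup>2 + \<eta>')"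
      unfolding g_def by (intro sum_mono U)
    also have "\<dots> = g (\<Inter>C) + real (card X) * \<eta>'" by (simp add: sum.distrib g_def)
    also have "real (card X) * \<eta>' \<le> \<eta>" using \<eta> by (simp add: \<eta>'_def field_simps)
    finally show "c \<le> g (\<Inter>C) + \<eta>" using le[OF U(1)] by simp
  qed
  have "\<exists>V\<in>L. Q V \<and> (V = W \<or> real n * e \<le> g V)" for n
  proof (induction n)
    case 0
    then show ?case using L0 base by (auto simp: g_def sum_nonneg intro!: bexI[of _ "{0}"])
  next
    case (Suc n)
    then obtain V where V: "V \<in> L" "Q V" "V = W \<or> real n * e \<le> g V" by blast
    show ?case
    proof (cases "V = W")
      case False
      then have gV: "real n * e \<le> g V" using V by blast
      \<comment> \<open>A maximal member \<open>M\<close> exceeds the level of \<open>V\<close> by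
        at most \<open>e\<close>. Either it is \<open>W\<close>, or it gains exactly
        \<open>e\<close>, as the absence of gaps will show.\<close>
      define S where "S = {V'\<in>L. V \<subseteq> V' \<and> g V' \<le> g V + e}"
      have "\<exists>M\<in>S. \<forall>V'\<in>S. M \<subseteq> V' \<longrightarrow> V' = M"
      proof (rule zorn_maximal)
        show "S \<noteq> {}" using V e by (auto simp: S_def)
        fix C assume C: "chain_of S C"
        then have CL: "chain_of L C" by (rule chains) (auto simp: S_def)
        obtain U where U: "U \<in> C" using C by (auto simp: chain_of_def)
        have "V \<subseteq> U" using C U by (auto simp: chain_of_def S_def)
        then have "V \<subseteq> closure (\<Union>C)" using U by (intro order_trans[OF _ closure_subset]) blast
        moreover have "g (closure (\<Union>C)) \<le> g V + e"
          using C by (intro gsup[OF CL]) (auto simp: S_def chain_of_def)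
        ultimately have "closure (\<Union>C) \<in> S" using sup[OF CL] by (simp add: S_def)
        moreover have "U \<subseteq> closure (\<Union>C)" if "U \<in> C" for U
          using that by (intro order_trans[OF _ closure_subset]) blast
        ultimately show "\<exists>U\<in>S. \<forall>V\<in>C. V \<subseteq> U" by blast
      qed
      then obtain M where M: "M \<in> L" "V \<subseteq> M" "g M \<le> g V + e"
        and Mmax: "\<And>V'. V' \<in> L \<Longrightarrow> M \<subseteq> V' \<Longrightarrow> g V' \<le> g V + e \<Longrightarrow> V' = M"
        unfolding S_def by (smt (verit) mem_Collect_eq order_trans)
      have PM: "Q M" by (rule step'[OF V(1) M(1,2,3) V(2)])
      show ?thesis
      proof (cases "M = W \<or> g M = g V + e")
        case True
        then show ?thesis using M(1) PM gV by (intro bexI[of _ M]) (auto simp: algebra_simps)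
      next
        case False
        \<comment> \<open>If \<open>M\<close> fell short of the level \<open>g V + e\<close>,
          everything strictly above it would belong to \<open>S'\<close>; a minimal member
          \<open>M'\<close> of \<open>S'\<close> would then form a gap with
          \<open>M\<close>.\<close>
        define S' where "S' = {V'\<in>L. M \<subseteq> V' \<and> g V + e \<le> g V'}"
        have above: "V' \<in> S'" if "V' \<in> L" "M \<subset> V'" for V'
        proof -
          have "\<not> g V' \<le> g V + e" using Mmax[OF that(1)] that(2) by blast
          then show ?thesis using that by (auto simp: S'_def)
        qed
        have "\<exists>M'\<in>S'. \<forall>V'\<in>S'. V' \<subseteq> M' \<longrightarrow> V' = M'"
        proof (rule zorn_minimal)
          have "M \<subset> W" using False sub M(1) by blast
          then show "S' \<noteq> {}" using above[OF LW] by blast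
          fix C assume C: "chain_of S' C"
          then have CL: "chain_of L C" by (rule chains) (auto simp: S'_def)
          have "M \<subseteq> \<Inter>C" using C by (auto simp: chain_of_def S'_def)
          moreover have "g V + e \<le> g (\<Inter>C)"
            using C by (intro ginf[OF CL]) (auto simp: S'_def chain_of_def)
          ultimately have "\<Inter>C \<in> S'" using inf[OF CL] by (simp add: S'_def)
          then show "\<exists>U\<in>S'. \<forall>V\<in>C. U \<subseteq> V" by blast
        qed
        then obtain M' where M': "M' \<in> L" "M \<subseteq> M'" "g V + e \<le> g M'"
            and Mmin: "\<And>V'. V' \<in> S' \<Longrightarrow> V' \<subseteq> M' \<Longrightarrow> V' = M'"
          unfolding S'_def by blast
        have "M \<subset> M'" using M(3) M' False by force
        then obtain V' where "V' \<in> L" "M \<subset> V'" "V' \<subset> M'" using nogap[OF M(1) M'(1)] by blast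
        then show ?thesis using above Mmin by blast
      qed
    qed (use V in auto)
  qed
  note reach = this
  obtain n where n: "g W < real n * e" using ex_less_of_nat_mult[OF e] by blast
  obtain V where V: "V \<in> L" "Q V" "V = W \<or> real n * e \<le> g V" using reach by blast
  have "g V \<le> g W" using V sub by (intro mono LW) auto
  then show ?thesis using V n by auto
qed

text \<open>Across one small step of a fine chain, \<open>a\<close> maps into the larger subspace
  only up to a small error modulo the smaller one. One \<open>d\<close> accounts for the distance to
  the net, the other for the component of the net vector between \<open>U\<close> and
  \<open>V\<close>.\<close>

lemma compact_step_small:
  assumes U: "csubspace U" "closed U" and V: "csubspace V" "closed V" and UV: "U \<subseteq> V"
    and net: "\<And>x. norm x \<le> 1 \<Longrightarrow> \<exists>y\<in>X. norm (blinfun_apply a x - y) < d"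
    and close: "\<And>y. y \<in> X \<Longrightarrow> (norm (proj V y))\<^sup>2 - (norm (proj U y))\<^sup>2 \<le> d\<^sup>2"
    and w: "blinfun_apply a w \<in> V"
  shows "norm (blinfun_apply a w - proj U (blinfun_apply a w)) \<le> 2 * d * norm (w::'a::chilbert_space)"
proof (cases "w = 0")
  case True
  then show ?thesis using proj_ident[OF U csubspace_0[OF U(1)]] by simp
next
  case False
  define u where "u = w /\<^sub>R norm w"
  have u: "norm u = 1" "w = norm w *\<^sub>R u" using False by (simp_all add: u_def)
  obtain y where y: "y \<in> X" "norm (a u - y) < d" using net[of u] u by auto
  have d0: "d > 0" using y(2) norm_ge_zero[of "a u - y"] by linarith
  let ?E = "\<lambda>z. proj V z - proj U z"
  have E2: "(norm (?E z))\<^sup>2 = (norm (proj V z))\<^sup>2 - (norm (proj U z))\<^sup>2" for z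
    by (rule norm_proj_diff[OF U V UV])
  have "norm (?E y) \<le> d" 
    by (rule power2_le_imp_le[OF _ less_imp_le[OF d0]]) (use close[OF y(1)] in \<open>simp add: E2\<close>)
  moreover have "norm (?E (a u - y)) \<le> norm (a u - y)"
  proof (rule power2_le_imp_le)
    have "(norm (proj V (a u - y)))\<^sup>2 \<le> (norm (a u - y))\<^sup>2"
      by (intro power_mono norm_proj_le V) simp
    then show "(norm (?E (a u - y)))\<^sup>2 \<le> (norm (a u - y))\<^sup>2"
      unfolding E2 using zero_le_power2[of "norm (proj U (a u - y))"] by linarith
  qed simp
  moreover have "?E (a u) = ?E (a u - y) + ?E y"
    by (simp add: proj_diff[OF U] proj_diff[OF V])
  ultimately have "norm (?E (a u)) \<le> 2 * d"
    using norm_triangle_ineq[of "?E (a u - y)" "?E y"] y(2) by simp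
  moreover have "a w - proj U (a w) = norm w *\<^sub>R ?E (a u)"
  proof -
    have aw: "a w = norm w *\<^sub>R a u" by (subst u(2)) (simp add: blinfun.scaleR_right)
    have "a w - proj U (a w) = ?E (a w)" by (simp add: proj_ident[OF V w])
    also have "\<dots> = norm w *\<^sub>R ?E (a u)"
      unfolding aw by (simp add: scaleR_eq_scaleC proj_scaleC[OF U] proj_scaleC[OF V] cvs.scale_right_diff_distrib)
    finally show ?thesis .
  qed
  ultimately show ?thesis by (simp add: mult.commute mult_left_mono)
qed

text \<open>The signs are picked one after the other so that each cross term with the partial sum is
  nonpositive; \<open>signs_lower\<close> reverses this choice. The two lemmas take the place of
  averaging over all signs.\<close>

lemma signs_upper:
  fixes x :: "nat \<Rightarrow> 'a::real_inner"
  shows "\<exists>s. (\<forall>k. s k = 1 \<or> s k = (-1::real)) \<and> (norm (\<Sum>k<n. s k *\<^sub>R x k))\<^sup>2 \<le> (\<Sum>k<n. (norm (x k))\<^sup>2)"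
proof (induction n)
  case (Suc n)
  then obtain s where s: "\<forall>k. s k = 1 \<or> s k = (-1::real)"
      "(norm (\<Sum>k<n. s k *\<^sub>R x k))\<^sup>2 \<le> (\<Sum>k<n. (norm (x k))\<^sup>2)" by blast
  define \<sigma> where "\<sigma> = (if inner (\<Sum>k<n. s k *\<^sub>R x k) (x n) \<le> 0 then 1 else -1 :: real)"
  have "(\<Sum>k<Suc n. (s(n := \<sigma>)) k *\<^sub>R x k) = (\<Sum>k<n. s k *\<^sub>R x k) + \<sigma> *\<^sub>R x n" by simp
  moreover have "\<sigma> * inner (\<Sum>k<n. s k *\<^sub>R x k) (x n) \<le> 0" "\<bar>\<sigma>\<bar> = 1" by (auto simp: \<sigma>_def)
  ultimately have "(norm (\<Sum>k<Suc n. (s(n := \<sigma>)) k *\<^sub>R x k))\<^sup>2 \<le> (\<Sum>k<Suc n. (norm (x k))\<^sup>2)"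
    using s(2) by (simp add: norm_add_sq)
  moreover have "\<forall>k. (s(n := \<sigma>)) k = 1 \<or> (s(n := \<sigma>)) k = -1" using s(1) by (simp add: \<sigma>_def)
  ultimately show ?case by blast
qed (auto intro!: exI[of _ "\<lambda>_. 1"])

lemma signs_lower:
  fixes x :: "nat \<Rightarrow> 'a::real_inner"
  shows "\<exists>s. (\<forall>k. s k = 1 \<or> s k = (-1::real)) \<and> (\<Sum>k<n. (norm (x k))\<^sup>2) \<le> (norm (\<Sum>k<n. s k *\<^sub>R x k))\<^sup>2"
proof (induction n)
  case (Suc n)
  then obtain s where s: "\<forall>k. s k = 1 \<or> s k = (-1::real)"
      "(\<Sum>k<n. (norm (x k))\<^sup>2) \<le> (norm (\<Sum>k<n. s k *\<^sub>R x k))\<^sup>2" by blast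
  define \<sigma> where "\<sigma> = (if inner (\<Sum>k<n. s k *\<^sub>R x k) (x n) \<ge> 0 then 1 else -1 :: real)"
  have "(\<Sum>k<Suc n. (s(n := \<sigma>)) k *\<^sub>R x k) = (\<Sum>k<n. s k *\<^sub>R x k) + \<sigma> *\<^sub>R x n" by simp
  moreover have "\<sigma> * inner (\<Sum>k<n. s k *\<^sub>R x k) (x n) \<ge> 0" "\<bar>\<sigma>\<bar> = 1" by (auto simp: \<sigma>_def)
  ultimately have "(\<Sum>k<Suc n. (norm (x k))\<^sup>2) \<le> (norm (\<Sum>k<Suc n. (s(n := \<sigma>)) k *\<^sub>R x k))\<^sup>2"
    using s(2) by (simp add: norm_add_sq)
  moreover have "\<forall>k. (s(n := \<sigma>)) k = 1 \<or> (s(n := \<sigma>)) k = -1" using s(1) by (simp add: \<sigma>_def)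
  ultimately show ?case by blast
qed (auto intro!: exI[of _ "\<lambda>_. 1"])

section \<open>Modules without eigenvectors\<close>

lift_definition slot :: "nat \<Rightarrow> 'a::chilbert_space \<Rightarrow> 'a ell2"
  is "\<lambda>i x j. if j = i then x else 0"
proof -
  fix i and x :: 'a
  show "summable (\<lambda>j. (norm (if j = i then x else 0))\<^sup>2)"
    by (rule summable_finite[of "{i}"]) auto
qed

lemma ell2_nth_slot: "ell2_nth (slot i x) j = (if j = i then x else 0)"
  by (simp add: slot.rep_eq)

lemma norm_sum_slots:
  assumes "finite I"
  shows "(norm (\<Sum>i\<in>I. slot i (x i)))\<^sup>2 = (\<Sum>i\<in>I. (norm (x i))\<^sup>2)"
proof -
  have nth: "ell2_nth (\<Sum>i\<in>J. slot i (x i)) j = (if j \<in> J then x j else 0)" if "finite J" for J j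
    using that by (induction J) (auto simp: zero_ell2.rep_eq plus_ell2.rep_eq ell2_nth_slot)
  have "(norm (\<Sum>i\<in>I. slot i (x i)))\<^sup>2 = (\<Sum>j. (norm (if j \<in> I then x j else 0))\<^sup>2)"
    by (simp add: norm_ell2_eq nth[OF assms] suminf_nonneg summable_finite[of I] assms)
  also have "\<dots> = (\<Sum>j\<in>I. (norm (if j \<in> I then x j else 0))\<^sup>2)"
    by (rule suminf_finite[OF assms]) simp
  finally show ?thesis by simp
qed

lemma norm_slot [simp]: "norm (slot i x) = norm x"
  using norm_sum_slots[of "{i}" "\<lambda>_. x"] by simp

lemma slot_simps:
  shows slot_add: "slot i (x + y) = slot i x + slot i y"
    and slot_zero [simp]: "slot i 0 = 0"
    and slot_scaleC: "slot i (c *\<^sub>C x) = c *\<^sub>C slot i x"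
    and slot_amplify: "slot i (blinfun_apply T x) = amplify T (slot i x)"
  by (transfer; auto simp: fun_eq_iff)+

lemma slot_sum: "slot i (sum f J) = (\<Sum>j\<in>J. slot i (f j))"
  by (induction J rule: infinite_finite_induct) (auto simp: slot_add)

lemma bounded_linear_ell2_nth: "bounded_linear (\<lambda>x. ell2_nth x i)"
  by (rule bounded_linear_intro[where K = 1])
    (simp_all add: plus_ell2.rep_eq scaleR_ell2.rep_eq norm_ell2_nth_le)

text \<open>The property enters from here on only through the uniform constant \<open>K\<close>. It
  refers to submodules of the whole amplification and so controls every finite power of
  \<open>H\<close> at once.\<close>

locale crp_algebra =
  fixes A :: "('h::chilbert_space \<Rightarrow>\<^sub>L 'h) set" and K :: real
  assumes A_compact: "A \<subseteq> compact_ops"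
    and A_alg: "op_subalgebra A"
    and A_closed: "closed A"
    and uniform: "is_submodule A V \<Longrightarrow> \<exists>P. module_proj A V P \<and> norm P \<le> K"
begin

lemma A_bounded: "a \<in> A \<Longrightarrow> a \<in> bounded_ops"
  using A_alg by (auto simp: op_subalgebra_def)

lemma A_csubspace: "csubspace A" using A_alg by (simp add: op_subalgebra_def)

lemma A_compose: "a \<in> A \<Longrightarrow> b \<in> A \<Longrightarrow> a o\<^sub>L b \<in> A"
  using A_alg by (simp add: op_subalgebra_def)

lemma A_scaleC: "a \<in> A \<Longrightarrow> blinfun_apply a (c *\<^sub>C x) = c *\<^sub>C blinfun_apply a x"
  using A_bounded by (rule bounded_opsD)

definition submod :: "'h set \<Rightarrow> bool" where
  "submod V \<longleftrightarrow> csubspace V \<and> closed V \<and> (\<forall>a\<in>A. \<forall>x\<in>V. blinfun_apply a x \<in> V)"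

definition mproj :: "'h set \<Rightarrow> ('h \<Rightarrow>\<^sub>L 'h) \<Rightarrow> bool" where
  "mproj V P \<longleftrightarrow> P \<in> bounded_ops \<and> (\<forall>x. P x \<in> V) \<and> (\<forall>x\<in>V. P x = x) \<and>
     (\<forall>a\<in>A. \<forall>x. P (blinfun_apply a x) = a (P x)) \<and> norm P \<le> K"

lemma submodD:
  assumes "submod V"
  shows "csubspace V" "closed V" "a \<in> A \<Longrightarrow> x \<in> V \<Longrightarrow> blinfun_apply a x \<in> V"
  using assms by (auto simp: submod_def)

lemma mprojD:
  assumes "mproj V P"
  shows "P \<in> bounded_ops" "blinfun_apply P x \<in> V" "x \<in> V \<Longrightarrow> blinfun_apply P x = x"
    "a \<in> A \<Longrightarrow> P (blinfun_apply a x) = a (P x)" "norm (blinfun_apply P x) \<le> K * norm x"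
proof -
  show "norm (blinfun_apply P x) \<le> K * norm x"
    using assms by (intro order_trans[OF norm_blinfun mult_right_mono]) (auto simp: mproj_def)
qed (use assms in \<open>auto simp: mproj_def\<close>)

text \<open>A submodule of \<open>H\<close> is lifted to the sequences whose coordinate
  \<open>0\<close> belongs to it, and the projection found there is compressed back to that
  coordinate.\<close>

lemma mproj_exists:
  assumes V: "submod V"
  shows "\<exists>P. mproj V P"
proof -
  define V' where "V' = {x. ell2_nth x 0 \<in> V}"
  have "csubspace V'"
    using submodD(1)[OF V]
    by (auto simp: V'_def csubspace_def zero_ell2.rep_eq plus_ell2.rep_eq scaleC_ell2.rep_eq)
  moreover have "closed V'"
  proof -
    have "V' = (\<lambda>x. ell2_nth x 0) -` V" by (auto simp: V'_def)
    then show ?thesis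
      using closed_vimage[OF submodD(2)[OF V] linear_continuous_on[OF bounded_linear_ell2_nth]] by simp
  qed
  moreover have "amplify a x \<in> V'" if "a \<in> A" "x \<in> V'" for a x
    using that V by (simp add: V'_def amplify.rep_eq submod_def)
  ultimately have "is_submodule A V'" by (simp add: is_submodule_def)
  then obtain P where P: "module_proj A V' P" "norm P \<le> K" using uniform by blast
  have Pb: "P \<in> bounded_ops" using P by (simp add: module_proj_def)
  define p where "p x = ell2_nth (P (slot 0 x)) 0" for x
  have padd: "p (x + y) = p x + p y" and psc: "p (c *\<^sub>C x) = c *\<^sub>C p x" for x y c
    by (simp_all add: p_def slot_add slot_scaleC blinfun.add_right bounded_opsD[OF Pb]
        plus_ell2.rep_eq scaleC_ell2.rep_eq)
  have pn: "norm (p x) \<le> norm P * norm x" for x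
    unfolding p_def using norm_ell2_nth_le norm_blinfun[of P "slot 0 x"] by (metis norm_slot order_trans)
  have "bounded_linear p"
    by (rule bounded_linear_intro[where K = "norm P"])
      (use pn in \<open>simp_all add: padd psc scaleR_eq_scaleC mult.commute\<close>)
  note ap = bounded_linear_Blinfun_apply[OF this]
  have "mproj V (Blinfun p)"
    unfolding mproj_def ap
  proof (intro conjI ballI allI)
    show "Blinfun p \<in> bounded_ops" by (rule bounded_opsI) (simp add: ap psc)
    show "p x \<in> V" for x using P by (auto simp: module_proj_def V'_def p_def)
    show "p x = x" if "x \<in> V" for x
    proof -
      have "slot 0 x \<in> V'" using that by (simp add: V'_def ell2_nth_slot)
      then show ?thesis using P by (simp add: module_proj_def p_def ell2_nth_slot)
    qed
    show "p (a x) = a (p x)" if "a \<in> A" for a x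
      using P that by (simp add: p_def slot_amplify module_proj_def amplify.rep_eq)
    have "norm (Blinfun p) \<le> norm P"
      by (rule norm_blinfun_bound) (use pn in \<open>simp_all add: ap\<close>)
    then show "norm (Blinfun p) \<le> K" using P(2) by simp
  qed
  then show ?thesis by blast
qed

lemma submod_UNIV: "submod UNIV" by (simp add: submod_def)

lemma submod_zero: "submod {0}" by (simp add: submod_def)

lemma K_nonneg: "0 \<le> K"
proof -
  obtain P where "mproj UNIV P" using mproj_exists[OF submod_UNIV] by blast
  then show ?thesis unfolding mproj_def by (meson norm_ge_zero order_trans)
qed

lemma submod_Int: "submod V \<Longrightarrow> submod W \<Longrightarrow> submod (V \<inter> W)"
  by (simp add: submod_def csubspace_Int closed_Int)

lemma submod_kernel:
  assumes "P \<in> bounded_ops" "\<And>a x. a \<in> A \<Longrightarrow> P (blinfun_apply a x) = a (P x)"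
  shows "submod {x. blinfun_apply P x = 0}"
  using assms by (simp add: submod_def csubspace_kernel closed_kernel)

lemma closure_invariant:
  assumes "x \<in> closure V" "\<And>v. v \<in> V \<Longrightarrow> blinfun_apply T v \<in> V"
  shows "blinfun_apply T x \<in> closure V"
proof -
  obtain f where f: "\<And>n. f n \<in> V" "f \<longlonglongrightarrow> x" using assms(1) unfolding closure_sequential by blast
  have "(\<lambda>n. T (f n)) \<longlonglongrightarrow> T x" by (intro tendsto_intros f)
  then show ?thesis
    unfolding closure_sequential using f(1) assms(2) by (intro exI[of _ "\<lambda>n. T (f n)"]) auto
qed

lemma submod_closure_Union:
  assumes C: "chain_of {V. submod V} C" shows "submod (closure (\<Union>C))"
  unfolding submod_def
proof (intro conjI ballI)
  have sub: "submod V" if "V \<in> C" for V using C that by (auto simp: chain_of_def)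
  show "csubspace (closure (\<Union>C))"
    using csubspace_Union_chain[OF C] submodD(1)[OF sub] by (intro csubspace_closure) blast
  fix a x assume a: "a \<in> A" and x: "x \<in> closure (\<Union>C)"
  show "a x \<in> closure (\<Union>C)"
    by (rule closure_invariant[OF x]) (use submodD(3)[OF sub] a in blast)
qed simp

lemma submod_Inter:
  assumes "\<And>V. V \<in> C \<Longrightarrow> submod V" shows "submod (\<Inter>C)"
  using assms by (auto simp: submod_def csubspace_def)

text \<open>As \<open>A\<close> may lack a unit, \<open>x\<close> itself can lie outside
  \<open>cyclic x\<close>; on the nondegenerate part \<open>cyclic_self\<close> repairs
  this.\<close>

definition cyclic :: "'h \<Rightarrow> 'h set" where "cyclic x = closure ((\<lambda>a. blinfun_apply a x) ` A)"

lemma submod_cyclic: "submod (cyclic x)"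
  unfolding submod_def cyclic_def
proof (intro conjI ballI)
  show "csubspace (closure ((\<lambda>a. blinfun_apply a x) ` A))"
  proof (rule csubspace_closure, unfold csubspace_def, intro conjI ballI allI)
    show "0 \<in> (\<lambda>a. blinfun_apply a x) ` A"
      using csubspace_0[OF A_csubspace] by (intro image_eqI[of _ _ 0]) simp_all
    show "u + v \<in> (\<lambda>a. blinfun_apply a x) ` A"
      if "u \<in> (\<lambda>a. blinfun_apply a x) ` A" "v \<in> (\<lambda>a. blinfun_apply a x) ` A" for u v
      using that csubspace_add[OF A_csubspace] by (auto simp flip: blinfun.add_left)
    show "c *\<^sub>C u \<in> (\<lambda>a. blinfun_apply a x) ` A"
      if "u \<in> (\<lambda>a. blinfun_apply a x) ` A" for c u
      using that csubspace_scaleC[OF A_csubspace] by (auto simp flip: blinfun_scaleC)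
  qed
  fix a v assume "a \<in> A" "v \<in> closure ((\<lambda>a. blinfun_apply a x) ` A)"
  then show "a v \<in> closure ((\<lambda>a. blinfun_apply a x) ` A)"
    by (elim closure_invariant) (auto simp flip: blinfun_apply_blinfun_compose intro!: imageI A_compose)
qed simp

lemma cyclic_base: "a \<in> A \<Longrightarrow> blinfun_apply a x \<in> cyclic x"
  unfolding cyclic_def by (intro closure_subset[THEN subsetD] imageI)

lemma cyclic_least: "submod V \<Longrightarrow> x \<in> V \<Longrightarrow> cyclic x \<subseteq> V"
  unfolding cyclic_def by (rule closure_minimal) (auto simp: submod_def)

lemma cyclic_approx:
  assumes "y \<in> cyclic x" "e > 0" shows "\<exists>a\<in>A. norm (blinfun_apply a x - y) < e"
  using assms unfolding cyclic_def closure_approachable by (auto simp: dist_norm)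

end

text \<open>The situation to be refuted. Eigenvalue \<open>1\<close> stands for all nonzero
  eigenvalues, since \<open>A\<close> is stable under scaling; every element of \<open>A\<close>
  then acts on \<open>W\<close> like a Volterra operator. The conclusion is
  \<open>volterra_trivial\<close>.\<close>

locale volterra_module = crp_algebra +
  fixes W :: "'a set"
  assumes W: "submod W"
    and nondegenerate: "x \<in> W \<Longrightarrow> (\<And>a. a \<in> A \<Longrightarrow> blinfun_apply a x = 0) \<Longrightarrow> x = 0"
    and no_eigenvector: "a \<in> A \<Longrightarrow> z \<in> W \<Longrightarrow> blinfun_apply a z = z \<Longrightarrow> z = 0"
begin

definition subs :: "'a set set" where "subs = {V. submod V \<and> V \<subseteq> W}"

definition endos :: "('a \<Rightarrow>\<^sub>L 'a) set" where
  "endos = {T\<in>bounded_ops. (\<forall>a\<in>A. \<forall>x. T (blinfun_apply a x) = a (T x)) \<and> (\<forall>x\<in>W. T x \<in> W)}"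

definition hypersubs :: "'a set set" where
  "hypersubs = {V\<in>subs. \<forall>T\<in>endos. \<forall>x\<in>V. blinfun_apply T x \<in> V}"

lemma endosD:
  assumes "T \<in> endos"
  shows "T \<in> bounded_ops" "a \<in> A \<Longrightarrow> T (blinfun_apply a x) = a (T x)" "x \<in> W \<Longrightarrow> blinfun_apply T x \<in> W"
  using assms by (auto simp: endos_def)

lemma endos_id: "id_blinfun \<in> endos"
  and endos_compose: "S \<in> endos \<Longrightarrow> T \<in> endos \<Longrightarrow> (S o\<^sub>L T) \<in> endos"
  and endos_add: "S \<in> endos \<Longrightarrow> T \<in> endos \<Longrightarrow> S + T \<in> endos"
  and endos_scaleC: "S \<in> endos \<Longrightarrow> c *\<^sub>C S \<in> endos"
  using submodD(1)[OF W]
  by (auto simp: endos_def bounded_ops_closure blinfun.bilinear_simps A_scaleC csubspace_add csubspace_scaleC)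

lemma mproj_endos: "mproj V P \<Longrightarrow> V \<subseteq> W \<Longrightarrow> P \<in> endos"
  by (auto simp: endos_def mproj_def)

text \<open>The set in question is \<open>U + N\<close>. Written as a preimage under
  \<open>1 - P\<close> it is closed without an argument about sums of closed subspaces.\<close>

lemma gap_complement:
  assumes U: "mproj U P" and N: "submod N" "N \<subseteq> V" "\<And>x. x \<in> N \<Longrightarrow> P x = 0"
    and V: "submod V" "U \<subseteq> V"
  shows "submod {x\<in>V. x - blinfun_apply P x \<in> N}" "U \<subseteq> {x\<in>V. x - blinfun_apply P x \<in> N}"
    "N \<subseteq> {x\<in>V. x - blinfun_apply P x \<in> N}"
proof -
  have "closed {x\<in>V. x - blinfun_apply P x \<in> N}"
  proof -
    have "{x\<in>V. x - blinfun_apply P x \<in> N} = V \<inter> (\<lambda>x. x - P x) -` N" by auto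
    then show ?thesis
      using submodD(2)[OF V(1)] submodD(2)[OF N(1)]
      by (auto intro!: closed_Int closed_vimage continuous_intros)
  qed
  moreover have add: "x + y - P (x + y) = (x - P x) + (y - P y)" for x y by (simp add: blinfun.add_right)
  have "x + y - P (x + y) \<in> N" if "x - P x \<in> N" "y - P y \<in> N" for x y
    unfolding add by (intro csubspace_add[OF submodD(1)[OF N(1)]] that)
  moreover have "c *\<^sub>C x - P (c *\<^sub>C x) = c *\<^sub>C (x - P x)" for c x
    by (simp add: bounded_opsD[OF mprojD(1)[OF U]] cvs.scale_right_diff_distrib)
  moreover have "a x - P (a x) = a (x - P x)" if "a \<in> A" for a x
    using that by (simp add: mprojD(4)[OF U] blinfun.diff_right)
  ultimately show "submod {x\<in>V. x - blinfun_apply P x \<in> N}"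
    using submodD[OF V(1)] submodD[OF N(1)] unfolding submod_def csubspace_def by simp
  show "U \<subseteq> {x\<in>V. x - blinfun_apply P x \<in> N}"
    using V(2) mprojD(3)[OF U] csubspace_0[OF submodD(1)[OF N(1)]] by auto
  show "N \<subseteq> {x\<in>V. x - blinfun_apply P x \<in> N}" using N by auto
qed

text \<open>Across a gap the kernel \<open>Y\<close> of \<open>P\<close> in \<open>V\<close> is
  irreducible: by \<open>gap_complement\<close> each of its nonzero vectors generates it.
  Lomonosov's theorem then produces a product \<open>S b\<close> in \<open>A\<close> with a nonzero
  fixed vector.\<close>

lemma subs_no_gap:
  assumes U: "U \<in> subs" and V: "V \<in> subs" and UV: "U \<subset> V"
  shows "\<exists>V'\<in>subs. U \<subset> V' \<and> V' \<subset> V"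
proof (rule ccontr)
  assume gap: "\<not> ?thesis"
  have sU: "submod U" and sV: "submod V" "V \<subseteq> W" using U V by (auto simp: subs_def)
  obtain P where P: "mproj U P" using mproj_exists[OF sU] by blast
  define Y where "Y = V \<inter> {x. P x = 0}"
  have Y: "submod Y"
    unfolding Y_def using P by (intro submod_Int submod_kernel sV(1)) (auto simp: mproj_def)
  obtain v where v: "v \<in> V" "v \<notin> U" using UV by blast
  define y where "y = v - P v"
  have y: "y \<in> Y" "y \<noteq> 0"
    using v UV mprojD(2)[OF P, of v] csubspace_diff[OF submodD(1)[OF sV(1)]]
    by (auto simp: y_def Y_def blinfun.diff_right mprojD(3)[OF P])
  have YW: "Y \<subseteq> W" using sV by (auto simp: Y_def)
  have nz: "\<exists>a\<in>A. a z \<noteq> 0" if "z \<in> Y" "z \<noteq> 0" for z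
    using nondegenerate[of z] that YW by blast
  obtain b where b: "b \<in> A" "b y \<noteq> 0" using nz[OF y] by blast
  have full: "Y \<subseteq> cyclic z" if z: "z \<in> Y" "z \<noteq> 0" for z
  proof -
    have cY: "cyclic z \<subseteq> Y" by (rule cyclic_least[OF Y z(1)])
    then have c: "cyclic z \<subseteq> V" "\<And>x. x \<in> cyclic z \<Longrightarrow> P x = 0" by (auto simp: Y_def)
    let ?V' = "{x\<in>V. x - P x \<in> cyclic z}"
    note V' = gap_complement[OF P submod_cyclic c sV(1) psubset_imp_subset[OF UV]]
    obtain a where a: "a \<in> A" "a z \<noteq> 0" using nz[OF z] by blast
    have "a z \<in> cyclic z" by (rule cyclic_base[OF a(1)])
    moreover have "a z \<notin> U" using mprojD(3)[OF P] c(2)[OF calculation] a(2) by force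
    ultimately have "U \<subset> ?V'" using V' by blast
    moreover have "?V' \<in> subs" using V'(1) sV(2) by (auto simp: subs_def)
    ultimately have V'V: "?V' = V" using gap by blast
    show ?thesis
    proof
      fix x assume "x \<in> Y"
      then have "x \<in> ?V'" "P x = 0" unfolding V'V by (auto simp: Y_def)
      then show "x \<in> cyclic z" by simp
    qed
  qed
  have "\<exists>S\<in>A. \<exists>z\<in>Y. z \<noteq> 0 \<and> S (b z) = z"
  proof (rule lomonosov)
    show "subspace Y" "closed Y" using Y by (auto simp: submod_def csubspace_imp_subspace)
    show "subspace A" by (rule csubspace_imp_subspace[OF A_csubspace])
    show "b \<in> compact_ops" using b A_compact by blast
    show "\<exists>S\<in>A. norm (S u - x) < e" if "u \<in> Y" "u \<noteq> 0" "x \<in> Y" "e > 0" for u x e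
      using full[OF that(1,2)] that(3,4) by (intro cyclic_approx) auto
  qed (use submodD(3)[OF Y] b y in auto)
  then obtain S z where z: "S \<in> A" "z \<in> Y" "z \<noteq> 0" "S (b z) = z" by blast
  then show False using no_eigenvector[OF A_compose[OF z(1) b(1)], of z] YW by auto
qed

lemma subs_zero: "{0} \<in> subs" and subs_W: "W \<in> subs"
  using submod_zero W csubspace_0[OF submodD(1)[OF W]] by (auto simp: subs_def)

lemma subs_chain:
  assumes C: "chain_of subs C"
  shows "closure (\<Union>C) \<in> subs" "\<Inter>C \<in> subs"
proof -
  have "chain_of {V. submod V} C" using C by (auto simp: chain_of_def subs_def)
  moreover have "closure (\<Union>C) \<subseteq> W"
    using C submodD(2)[OF W] by (intro closure_minimal) (auto simp: chain_of_def subs_def)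
  ultimately show "closure (\<Union>C) \<in> subs" using submod_closure_Union by (simp add: subs_def)
  obtain V where "V \<in> C" "V \<subseteq> W" using C by (auto simp: chain_of_def subs_def)
  then have "\<Inter>C \<subseteq> W" by blast
  then show "\<Inter>C \<in> subs"
    using C submod_Inter[of C] by (auto simp: chain_of_def subs_def)
qed

lemma finite_net_family:
  assumes "finite F" "F \<subseteq> A" "d > 0"
  shows "\<exists>X. finite X \<and> (\<forall>a\<in>F. \<forall>x. norm x \<le> 1 \<longrightarrow> (\<exists>y\<in>X. norm (blinfun_apply a x - y) < d))"
  using assms
proof (induction F)
  case (insert a F)
  then obtain X where X: "finite X" "\<forall>a\<in>F. \<forall>x. norm x \<le> 1 \<longrightarrow> (\<exists>y\<in>X. norm (blinfun_apply a x - y) < d)"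
    by auto
  have "a \<in> compact_ops" using insert A_compact by blast
  then obtain Y where "finite Y" "\<forall>x. norm x \<le> 1 \<longrightarrow> (\<exists>y\<in>Y. norm (blinfun_apply a x - y) < d)"
    using compact_ops_finite_net[OF _ \<open>d > 0\<close>] by blast
  then show ?case using X by (intro exI[of _ "X \<union> Y"]) blast
qed auto

text \<open>In effect a norm equivalent to the original one, with lower constant normalized to
  \<open>1\<close>.\<close>

definition seminorm_on :: "'a set \<Rightarrow> real \<Rightarrow> ('a \<Rightarrow> real) \<Rightarrow> bool" where
  "seminorm_on V C \<nu> \<longleftrightarrow> (\<forall>x\<in>V. \<forall>y\<in>V. \<nu> (x + y) \<le> \<nu> x + \<nu> y) \<and> (\<forall>c. \<forall>x\<in>V. \<nu> (c *\<^sub>C x) = cmod c * \<nu> x)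
     \<and> (\<forall>x\<in>V. norm x \<le> \<nu> x \<and> \<nu> x \<le> C * norm x)"

text \<open>Along a fine chain the elements of \<open>F\<close> are almost strictly triangular.
  Weighting every new layer much more heavily than the earlier ones makes the entries that lead into
  earlier layers negligible, so all of \<open>F\<close> contracts at once.\<close>

lemma contracting_norm:
  assumes F: "finite F" "F \<subseteq> A" and e: "e > 0"
  shows "\<exists>C \<nu>. seminorm_on W C \<nu> \<and> (\<forall>a\<in>F. \<forall>x\<in>W. \<nu> (blinfun_apply a x) \<le> e * \<nu> x)"
proof -
  \<comment> \<open>The diagonal error \<open>2 * d\<close> of \<open>compact_step_small\<close>
    uses up half of \<open>e\<close>; the other half is left for the part of \<open>a w\<close> that
    falls into \<open>U\<close>.\<close>
  define d where "d = e / 4"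
  have d: "d > 0" using e by (simp add: d_def)
  obtain X where X: "finite X" "\<And>a x. a \<in> F \<Longrightarrow> norm x \<le> 1 \<Longrightarrow> \<exists>y\<in>X. norm (blinfun_apply a x - y) < d"
    using finite_net_family[OF F d] by blast
  define Q where "Q V \<longleftrightarrow> (\<exists>C \<nu>. seminorm_on V C \<nu> \<and> (\<forall>a\<in>F. \<forall>x\<in>V. \<nu> (blinfun_apply a x) \<le> e * \<nu> x))" for V
  have "Q W"
  proof (rule gapless_induct[where L = subs and X = X and e = "d\<^sup>2"])
    show "csubspace V \<and> closed V \<and> V \<subseteq> W" if "V \<in> subs" for V
      using that by (auto simp: subs_def submod_def)
    show "Q {0}" unfolding Q_def seminorm_on_def
      by (rule exI[of _ 1], rule exI[of _ norm]) (auto simp: norm_scaleC cvs.scale_zero_right)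
    fix U V assume U: "U \<in> subs" and V: "V \<in> subs" and UV: "U \<subseteq> V"
      and close: "\<And>x. x \<in> X \<Longrightarrow> (norm (proj V x))\<^sup>2 - (norm (proj U x))\<^sup>2 \<le> d\<^sup>2" and "Q U"
    from \<open>Q U\<close> obtain C \<nu> where
      nadd: "\<And>x y. x \<in> U \<Longrightarrow> y \<in> U \<Longrightarrow> \<nu> (x + y) \<le> \<nu> x + \<nu> y"
      and nsc: "\<And>c x. x \<in> U \<Longrightarrow> \<nu> (c *\<^sub>C x) = cmod c * \<nu> x"
      and nlo: "\<And>x. x \<in> U \<Longrightarrow> norm x \<le> \<nu> x" and nup0: "\<And>x. x \<in> U \<Longrightarrow> \<nu> x \<le> C * norm x"
      and nc: "\<And>a x. a \<in> F \<Longrightarrow> x \<in> U \<Longrightarrow> \<nu> (blinfun_apply a x) \<le> e * \<nu> x"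
      unfolding Q_def seminorm_on_def by blast
    have nup: "\<nu> x \<le> \<bar>C\<bar> * norm x" if "x \<in> U" for x
      using nup0[OF that] by (rule order_trans) (intro mult_right_mono; simp)
    have sU: "csubspace U" "closed U" "\<And>a x. a \<in> A \<Longrightarrow> x \<in> U \<Longrightarrow> blinfun_apply a x \<in> U"
      and sV: "csubspace V" "closed V" "\<And>a x. a \<in> A \<Longrightarrow> x \<in> V \<Longrightarrow> blinfun_apply a x \<in> V"
      using U V by (auto simp: subs_def submod_def)
    \<comment> \<open>The weight is large enough that the part of \<open>a w\<close> inside
      \<open>U\<close>, of size at most \<open>\<bar>C\<bar> * norm a * norm w\<close> in the old
      norm, costs no more than half of \<open>e * M * norm w\<close>.\<close>
    define M where "M = 1 + (\<Sum>a\<in>F. 2 * \<bar>C\<bar> * norm a / e)"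
    have M: "1 \<le> M" "\<And>a. a \<in> F \<Longrightarrow> \<bar>C\<bar> * norm a \<le> M * e / 2"
    proof -
      have nn: "\<And>a. a \<in> F \<Longrightarrow> 0 \<le> 2 * \<bar>C\<bar> * norm a / e" using e by simp
      then show "1 \<le> M" unfolding M_def by (simp add: sum_nonneg)
      fix a assume a: "a \<in> F"
      have "2 * \<bar>C\<bar> * norm a / e \<le> (\<Sum>a\<in>F. 2 * \<bar>C\<bar> * norm a / e)"
        using a F nn by (intro member_le_sum) auto
      then have "2 * \<bar>C\<bar> * norm a / e \<le> M" by (simp add: M_def)
      then show "\<bar>C\<bar> * norm a \<le> M * e / 2" using e by (simp add: field_simps)
    qed
    define \<mu> where "\<mu> x = \<nu> (proj U x) + M * norm (x - proj U x)" for x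
    note pr = proj_in[OF sU(1,2)] proj_add[OF sU(1,2)] proj_scaleC[OF sU(1,2)]
    have "seminorm_on V (\<bar>C\<bar> + M) \<mu>"
      unfolding seminorm_on_def
    proof (intro conjI ballI allI)
      fix x y
      have "norm (x + y - proj U (x + y)) \<le> norm (x - proj U x) + norm (y - proj U y)"
        using norm_triangle_ineq[of "x - proj U x" "y - proj U y"] by (simp add: pr algebra_simps)
      then have "M * norm (x + y - proj U (x + y)) \<le> M * (norm (x - proj U x) + norm (y - proj U y))"
        using M(1) by (intro mult_left_mono) auto
      then show "\<mu> (x + y) \<le> \<mu> x + \<mu> y"
        using nadd[OF pr(1) pr(1), of x y] by (simp add: \<mu>_def pr algebra_simps)
    next
      fix c x
      show "\<mu> (c *\<^sub>C x) = cmod c * \<mu> x"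
        by (simp add: \<mu>_def pr nsc norm_scaleC algebra_simps flip: cvs.scale_right_diff_distrib)
    next
      fix x
      have "norm x \<le> norm (proj U x) + norm (x - proj U x)"
        using norm_triangle_ineq[of "proj U x" "x - proj U x"] by simp
      also have "\<dots> \<le> \<nu> (proj U x) + M * norm (x - proj U x)"
        using nlo[OF pr(1)] M(1) mult_right_mono[OF M(1), of "norm (x - proj U x)"]
        by (intro add_mono) auto
      finally show "norm x \<le> \<mu> x" by (simp add: \<mu>_def)
      have "\<nu> (proj U x) \<le> \<bar>C\<bar> * norm x"
        using nup[OF pr(1), of x] mult_left_mono[OF norm_proj_le[OF sU(1,2), of x], of "\<bar>C\<bar>"] by linarith
      moreover have "M * norm (x - proj U x) \<le> M * norm x"
        using M(1) norm_diff_proj_le[OF sU(1,2)] by (intro mult_left_mono) auto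
      ultimately show "\<mu> x \<le> (\<bar>C\<bar> + M) * norm x" by (simp add: \<mu>_def algebra_simps)
    qed
    moreover have "\<mu> (a x) \<le> e * \<mu> x" if a: "a \<in> F" and x: "x \<in> V" for a x
    proof -
      define u where "u = proj U x"
      define w where "w = x - u"
      have aA: "a \<in> A" using a F by blast
      have u: "u \<in> U" "w \<in> V" "x = u + w"
        using pr(1) x UV csubspace_diff[OF sV(1)] by (auto simp: u_def w_def)
      have au: "a u \<in> U" by (rule sU(3)[OF aA u(1)])
      have pax: "proj U (a x) = a u + proj U (a w)"
        unfolding u(3) blinfun.add_right pr(2) by (simp add: proj_ident[OF sU(1,2) au])
      have "norm (a w - proj U (a w)) \<le> 2 * d * norm w"
        by (rule compact_step_small[OF sU(1,2) sV(1,2) UV X(2)[OF a] close sV(3)[OF aA u(2)]])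
      then have w1: "M * norm (a w - proj U (a w)) \<le> M * (e / 2 * norm w)"
        using M(1) by (intro mult_left_mono) (auto simp: d_def)
      have "\<nu> (proj U (a w)) \<le> \<bar>C\<bar> * norm (proj U (a w))" by (rule nup[OF pr(1)])
      also have "\<dots> \<le> \<bar>C\<bar> * (norm a * norm w)"
        by (intro mult_left_mono order_trans[OF norm_proj_le[OF sU(1,2)] norm_blinfun]) simp
      also have "\<dots> \<le> M * e / 2 * norm w"
        using mult_right_mono[OF M(2)[OF a], of "norm w"] by (simp add: mult.assoc)
      finally have w2: "\<nu> (proj U (a w)) \<le> M * e / 2 * norm w" .
      have axp: "a x - proj U (a x) = a w - proj U (a w)"
        unfolding pax unfolding u(3) by (simp add: blinfun.add_right)
      have "\<mu> (a x) = \<nu> (a u + proj U (a w)) + M * norm (a w - proj U (a w))"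
        unfolding \<mu>_def axp unfolding pax ..

      also have "\<dots> \<le> \<nu> (a u) + \<nu> (proj U (a w)) + M * norm (a w - proj U (a w))"
        using nadd[OF au pr(1)] by simp
      also have "\<dots> \<le> e * \<nu> u + M * e / 2 * norm w + M * (e / 2 * norm w)"
        using nc[OF a u(1)] w1 w2 by (intro add_mono)
      also have "\<dots> = e * \<mu> x" by (simp add: \<mu>_def u_def w_def algebra_simps)
      finally show ?thesis .
    qed
    ultimately show "Q V" unfolding Q_def by blast
  qed (use subs_zero subs_W subs_chain subs_no_gap X(1) d in auto)
  then show ?thesis by (simp add: Q_def)
qed

end

section \<open>Submodules invariant under the commutant\<close>

context volterra_module
begin

text \<open>Replaces \<open>A\<close> in the second use of Lomonosov's theorem: closures of its
  orbits are invariant under \<open>A\<close> and under the commutant.\<close>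

definition twisted :: "('a \<Rightarrow>\<^sub>L 'a) set" where
  "twisted = cvs.span {a o\<^sub>L T | a T. a \<in> A \<and> T \<in> endos}"

lemma twisted_base: "a \<in> A \<Longrightarrow> T \<in> endos \<Longrightarrow> (a o\<^sub>L T) \<in> twisted"
  unfolding twisted_def by (intro cvs.span_base) blast

lemma A_twisted: "a \<in> A \<Longrightarrow> a \<in> twisted"
proof -
  assume "a \<in> A"
  moreover have "(a o\<^sub>L id_blinfun) = a" by (rule blinfun_eqI) simp
  ultimately show ?thesis using twisted_base[OF _ endos_id, of a] by simp
qed

lemma twisted_induct [consumes 1, case_names zero add base]:
  assumes "S \<in> twisted" "P 0" "\<And>S T. P S \<Longrightarrow> P T \<Longrightarrow> P (S + T)"
    "\<And>c a T. a \<in> A \<Longrightarrow> T \<in> endos \<Longrightarrow> P (c *\<^sub>C (a o\<^sub>L T))"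
  shows "P S"
  using assms(1) unfolding twisted_def
  by (induction rule: cvs.span_induct_alt) (use assms in blast)+

text \<open>
  The supremum over the unit ball of the commutant turns a norm contracted by finitely many elements
  of \<open>A\<close> into one for which the commutant is bounded as well.
\<close>

lemma twisted_no_eigenvector:
  assumes S: "S \<in> twisted" and b: "b \<in> A" and z: "z \<in> W" and eq: "blinfun_apply S (b z) = z"
  shows "z = 0"
proof (rule ccontr)
  assume z0: "z \<noteq> 0"
  obtain t r where t: "finite t" "t \<subseteq> {a o\<^sub>L T | a T. a \<in> A \<and> T \<in> endos}" "S = (\<Sum>s\<in>t. r s *\<^sub>C s)"
    using S unfolding twisted_def cvs.span_explicit by blast
  have "\<forall>s\<in>t. \<exists>p. fst p \<in> A \<and> snd p \<in> endos \<and> s = (fst p o\<^sub>L snd p)"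
    using t(2) by fastforce
  then obtain p where p: "\<And>s. s \<in> t \<Longrightarrow> fst (p s) \<in> A \<and> snd (p s) \<in> endos \<and> s = (fst (p s) o\<^sub>L snd (p s))"
    by metis
  \<comment> \<open>The factor \<open>b\<close> commutes with the commutant elements and is absorbed
    into those of \<open>A\<close>. Hence \<open>S (b z)\<close> is a combination of the vectors
    \<open>\<alpha> s (\<tau> s z)\<close>.\<close>
  define \<alpha> where "\<alpha> s = (fst (p s) o\<^sub>L b)" for s
  define \<tau> where "\<tau> s = snd (p s)" for s
  have \<alpha>: "\<alpha> s \<in> A" and \<tau>: "\<tau> s \<in> endos" if "s \<in> t" for s
    using p[OF that] A_compose b by (auto simp: \<alpha>_def \<tau>_def)
  have sb: "s (b z) = \<alpha> s (\<tau> s z)" if "s \<in> t" for s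
  proof -
    have "s (b z) = fst (p s) (snd (p s) (b z))"
      using p[OF that] by (metis blinfun_apply_blinfun_compose)
    then show ?thesis using p[OF that] b by (simp add: \<alpha>_def \<tau>_def endosD(2))
  qed
  have zsum: "z = (\<Sum>s\<in>t. r s *\<^sub>C \<alpha> s (\<tau> s z))"
  proof -
    have "z = (\<Sum>s\<in>t. r s *\<^sub>C s (b z))" by (subst eq[symmetric]) (simp add: t(3) blinfun.sum_left)
    also have "\<dots> = (\<Sum>s\<in>t. r s *\<^sub>C \<alpha> s (\<tau> s z))" using sb by (intro sum.cong) auto
    finally show ?thesis .
  qed
  define D where "D = (\<Sum>s\<in>t. cmod (r s) * norm (\<tau> s))"
  have D: "D \<ge> 0" unfolding D_def by (intro sum_nonneg) auto
  \<comment> \<open>\<open>D\<close> bounds the contribution of the coefficients and commutant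
    factors, so \<open>D * e < 1\<close> makes \<open>z\<close> shorter than itself in the norm
    \<open>\<mu>\<close>.\<close>
  define e where "e = 1 / (2 * (D + 1))"
  have e: "e > 0" "D * e < 1" using D by (auto simp: e_def field_simps)
  obtain C \<nu> where \<nu>: "seminorm_on W C \<nu>" and con: "\<And>a x. a \<in> \<alpha> ` t \<Longrightarrow> x \<in> W \<Longrightarrow> \<nu> (blinfun_apply a x) \<le> e * \<nu> x"
    using contracting_norm[of "\<alpha> ` t" e] t(1) \<alpha> e(1) by blast
  have n1: "\<nu> (x + y) \<le> \<nu> x + \<nu> y" and n2: "\<nu> (c *\<^sub>C x) = cmod c * \<nu> x" and n3: "norm x \<le> \<nu> x" "\<nu> x \<le> C * norm x"
    if "x \<in> W" "y \<in> W" for x y c using \<nu> that by (auto simp: seminorm_on_def)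
  define E where "E = {T\<in>endos. norm T \<le> 1}"
  define \<mu> where "\<mu> x = (SUP T\<in>E. \<nu> (blinfun_apply T x))" for x
  have idE: "id_blinfun \<in> E" using endos_id norm_blinfun_bound[of 1 "id_blinfun :: 'a \<Rightarrow>\<^sub>L 'a"] by (simp add: E_def)
  have EW: "T x \<in> W" if "T \<in> E" "x \<in> W" for T x using that endosD(3) by (simp add: E_def)
  have bdd: "bdd_above ((\<lambda>T. \<nu> (blinfun_apply T x)) ` E)" if x: "x \<in> W" for x
  proof (rule bdd_aboveI2)
    fix T assume T: "T \<in> E"
    have "\<nu> (T x) \<le> C * norm (T x)" using n3(2) EW[OF T x] by blast
    also have "\<dots> \<le> \<bar>C\<bar> * norm (T x)" by (intro mult_right_mono) auto
    also have "\<dots> \<le> \<bar>C\<bar> * (norm T * norm x)" by (intro mult_left_mono norm_blinfun) auto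
    also have "\<dots> \<le> \<bar>C\<bar> * (1 * norm x)" using T by (intro mult_left_mono mult_right_mono) (auto simp: E_def)
    finally show "\<nu> (T x) \<le> \<bar>C\<bar> * (1 * norm x)" .
  qed
  have up: "\<nu> (T x) \<le> \<mu> x" if "T \<in> E" "x \<in> W" for T x
    unfolding \<mu>_def by (rule cSUP_upper[OF that(1) bdd[OF that(2)]])
  have least: "\<mu> x \<le> c" if "\<And>T. T \<in> E \<Longrightarrow> \<nu> (T x) \<le> c" for x c
    unfolding \<mu>_def by (rule cSUP_least) (use idE that in auto)
  have mpos: "norm x \<le> \<mu> x" if "x \<in> W" for x
    using up[OF idE that] n3(1)[OF that that] by simp
  have madd: "\<mu> (x + y) \<le> \<mu> x + \<mu> y" if "x \<in> W" "y \<in> W" for x y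
  proof (rule least)
    fix T assume T: "T \<in> E"
    have "\<nu> (T (x + y)) \<le> \<nu> (T x) + \<nu> (T y)"
      using n1 EW T that by (simp add: blinfun.add_right)
    then show "\<nu> (T (x + y)) \<le> \<mu> x + \<mu> y" using up[OF T that(1)] up[OF T that(2)] by linarith
  qed
  have mscale: "\<mu> (c *\<^sub>C x) \<le> cmod c * \<mu> x" if "x \<in> W" for c x
  proof (rule least)
    fix T assume T: "T \<in> E"
    then have "T (c *\<^sub>C x) = c *\<^sub>C T x" by (simp add: E_def endos_def bounded_opsD)
    then have "\<nu> (T (c *\<^sub>C x)) = cmod c * \<nu> (T x)" using n2[OF EW[OF T that] EW[OF T that]] by simp
    then show "\<nu> (T (c *\<^sub>C x)) \<le> cmod c * \<mu> x" using up[OF T that] by (simp add: mult_left_mono)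
  qed
  have mA: "\<mu> (a x) \<le> e * \<mu> x" if a: "a \<in> \<alpha> ` t" and x: "x \<in> W" for a x
  proof (rule least)
    fix T assume T: "T \<in> E"
    have "a \<in> A" using a \<alpha> by blast
    have "T \<in> endos" using T by (simp add: E_def)
    have "\<nu> (T (a x)) = \<nu> (a (T x))" by (simp only: endosD(2)[OF \<open>T \<in> endos\<close> \<open>a \<in> A\<close>])
    also have "\<dots> \<le> e * \<nu> (T x)" by (rule con[OF a EW[OF T x]])
    also have "\<dots> \<le> e * \<mu> x" using e up[OF T x] by (intro mult_left_mono) auto
    finally show "\<nu> (T (a x)) \<le> e * \<mu> x" .
  qed
  have mT: "\<mu> (T x) \<le> norm T * \<mu> x" if T: "T \<in> endos" and x: "x \<in> W" for T x
  proof (rule least)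
    fix T' assume T': "T' \<in> E"
    show "\<nu> (T' (T x)) \<le> norm T * \<mu> x"
    proof (cases "norm T = 0")
      case True
      then have "T' (T x) = 0 *\<^sub>C x" by (simp add: cvs.scale_zero_left)
      then show ?thesis using n2[OF x x, of 0] True by simp
    next
      case False
      define U where "U = complex_of_real (1 / norm T) *\<^sub>C (T' o\<^sub>L T)"
      have "norm (T' o\<^sub>L T) \<le> norm T' * norm T" by (rule norm_blinfun_compose)
      also have "\<dots> \<le> 1 * norm T" using T' by (intro mult_right_mono) (auto simp: E_def)
      finally have "norm U \<le> 1" using False by (simp add: U_def norm_scaleC norm_divide field_simps)
      then have U: "U \<in> E" using T T' by (simp add: E_def U_def endos_scaleC endos_compose)
      have "T' (T x) = complex_of_real (norm T) *\<^sub>C U x"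
        using False by (simp add: U_def scaleC_scaleC)
      then have "\<nu> (T' (T x)) = norm T * \<nu> (U x)" using n2[OF EW[OF U x] EW[OF U x]] by simp
      then show ?thesis using up[OF U x] by (simp add: mult_left_mono)
    qed
  qed
  have sumW: "(\<Sum>s\<in>J. r s *\<^sub>C \<alpha> s (\<tau> s z)) \<in> W
      \<and> \<mu> (\<Sum>s\<in>J. r s *\<^sub>C \<alpha> s (\<tau> s z)) \<le> (\<Sum>s\<in>J. cmod (r s) * norm (\<tau> s)) * (e * \<mu> z)" if "J \<subseteq> t" for J
  proof -
    have "finite J" using that t(1) by (rule finite_subset)
    then show ?thesis using that
    proof (induction J)
      case empty
      have "0 \<in> W" using submodD(1)[OF W] by (rule csubspace_0)
      then show ?case using mscale[of 0 0] by (simp add: cvs.scale_zero_left)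
    next
      case (insert s J)
      have s: "s \<in> t" using insert by blast
      have \<tau>W: "\<tau> s z \<in> W" using endosD(3)[OF \<tau>[OF s] z] .
      have \<alpha>W: "\<alpha> s (\<tau> s z) \<in> W" by (rule submodD(3)[OF W \<alpha>[OF s] \<tau>W])
      have rW: "r s *\<^sub>C \<alpha> s (\<tau> s z) \<in> W" using \<alpha>W submodD(1)[OF W] by (rule csubspace_scaleC[rotated])
      have "\<mu> (r s *\<^sub>C \<alpha> s (\<tau> s z)) \<le> cmod (r s) * \<mu> (\<alpha> s (\<tau> s z))" by (rule mscale[OF \<alpha>W])
      also have "\<dots> \<le> cmod (r s) * (e * \<mu> (\<tau> s z))" using mA[OF _ \<tau>W] s by (intro mult_left_mono) auto
      also have "\<dots> \<le> cmod (r s) * (e * (norm (\<tau> s) * \<mu> z))"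
        using mT[OF \<tau>[OF s] z] e by (intro mult_left_mono) auto
      finally have *: "\<mu> (r s *\<^sub>C \<alpha> s (\<tau> s z)) \<le> cmod (r s) * norm (\<tau> s) * (e * \<mu> z)"
        by (simp add: ac_simps)
      show ?case
        using insert rW * madd[OF rW, of "\<Sum>s\<in>J. r s *\<^sub>C \<alpha> s (\<tau> s z)"] submodD(1)[OF W]
        by (auto simp: distrib_right intro: csubspace_add)
    qed
  qed
  have "\<mu> z \<le> D * (e * \<mu> z)" using sumW[of t] zsum by (simp add: D_def)
  also have "\<dots> = (D * e) * \<mu> z" by simp
  also have "\<dots> < 1 * \<mu> z"
  proof (rule mult_strict_right_mono[OF e(2)])
    have "norm z > 0" using z0 by simp
    then show "0 < \<mu> z" using mpos[OF z] by linarith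
  qed
  finally show False by simp
qed

lemma hypersubsD:
  assumes "V \<in> hypersubs"
  shows "submod V" "V \<subseteq> W" "T \<in> endos \<Longrightarrow> x \<in> V \<Longrightarrow> blinfun_apply T x \<in> V"
  using assms by (auto simp: hypersubs_def subs_def)

text \<open>
  If \<open>X = P T (1 - P)\<close> were nonzero, the graphs of \<open>l X\<close> over the kernel of \<open>P\<close> would be submodules
  whose module projections are unbounded as \<open>l\<close> grows.
\<close>

lemma hyper_projection_central:
  assumes U: "U \<in> hypersubs" and P: "mproj U P" and T: "T \<in> endos" and x: "x \<in> W"
  shows "P (blinfun_apply T x) = T (P x)"
proof -
  note hU = hypersubsD[OF U]
  have Pe: "P \<in> endos" by (rule mproj_endos[OF P hU(2)])
  define X where "X = (P o\<^sub>L T) - (P o\<^sub>L (T o\<^sub>L P))"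
  have X: "X y = P (T (y - P y))" for y by (simp add: X_def blinfun.diff_left blinfun.diff_right)
  have Xe: "X \<in> bounded_ops" unfolding X_def
    using Pe T by (intro bounded_ops_diff bounded_ops_compose) (auto simp: endosD)
  have XA: "X (a y) = a (X y)" if "a \<in> A" for a y
    by (simp add: X_def blinfun.diff_left blinfun.diff_right endosD(2)[OF Pe that] endosD(2)[OF T that])
  have XU: "X y \<in> U" for y unfolding X by (rule mprojD(2)[OF P])
  have XX: "X u = 0" if "u \<in> U" for u using mprojD(3)[OF P that] by (simp add: X)
  define w where "w = x - P x"
  have w: "w \<in> W" "P w = 0"
    using x endosD(3)[OF Pe x] csubspace_diff[OF submodD(1)[OF W]] mprojD(2,3)[OF P]
    by (auto simp: w_def blinfun.diff_right)
  have bound: "l * norm (X w) \<le> (K + 1) * norm w" if l: "l > 0" for l :: real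
  proof -
    define V where "V = W \<inter> {y. (P - complex_of_real l *\<^sub>C X) y = 0}"
    have "submod V"
      unfolding V_def
    proof (intro submod_Int W submod_kernel)
      show "P - complex_of_real l *\<^sub>C X \<in> bounded_ops"
        using Pe Xe by (intro bounded_ops_diff bounded_ops_scaleC) (auto simp: endosD)
      fix a y assume "a \<in> A"
      then show "(P - complex_of_real l *\<^sub>C X) (a y) = a ((P - complex_of_real l *\<^sub>C X) y)"
        by (simp add: blinfun.diff_left blinfun.diff_right endosD(2)[OF Pe] XA A_scaleC)
    qed
    then obtain R where R: "mproj V R" using mproj_exists by blast
    have VW: "V \<subseteq> W" by (simp add: V_def)
    have Re: "R \<in> endos" by (rule mproj_endos[OF R VW])
    have V: "P y = complex_of_real l *\<^sub>C X y" if "y \<in> V" for y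
      using that by (simp add: V_def blinfun.diff_left)
    \<comment> \<open>\<open>R u\<close> lies in \<open>V\<close>, and also in \<open>U\<close>
      because \<open>U\<close> is invariant under the commutant. The graph \<open>V\<close> meets
      \<open>U\<close> only in \<open>0\<close>.\<close>
    have RU: "R u = 0" if u: "u \<in> U" for u
    proof -
      have "R u \<in> U" by (rule hU(3)[OF Re u])
      then have "R u = P (R u)" "X (R u) = 0" using mprojD(3)[OF P] XX by auto
      then show ?thesis using V[OF mprojD(2)[OF R]] by (simp add: cvs.scale_zero_right)
    qed
    have lX: "complex_of_real l *\<^sub>C X w \<in> U" by (rule csubspace_scaleC[OF submodD(1)[OF hU(1)] XU])
    have v: "w + complex_of_real l *\<^sub>C X w \<in> V"
    proof -
      have "w + complex_of_real l *\<^sub>C X w \<in> W"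
        using w lX hU(2) csubspace_add[OF submodD(1)[OF W]] by blast
      moreover have "P (w + complex_of_real l *\<^sub>C X w) = complex_of_real l *\<^sub>C X w"
        using w mprojD(3)[OF P lX] by (simp add: blinfun.add_right)
      moreover have "X (w + complex_of_real l *\<^sub>C X w) = X w"
        using XX[OF lX] by (simp add: blinfun.add_right)
      ultimately show ?thesis by (simp add: V_def blinfun.diff_left)
    qed
    \<comment> \<open>The graph vector over \<open>w\<close> is fixed by \<open>R\<close>, while
      \<open>R\<close> kills its component in \<open>U\<close>. So that component equals
      \<open>R w - w\<close>, whose size does not depend on \<open>l\<close>.\<close>
    have "w + complex_of_real l *\<^sub>C X w = R (w + complex_of_real l *\<^sub>C X w)"
      using mprojD(3)[OF R v] by simp
    also have "\<dots> = R w" using RU[OF lX] by (simp add: blinfun.add_right)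
    finally have "complex_of_real l *\<^sub>C X w = R w - w" by (metis add_diff_cancel_left')
    then have "norm (complex_of_real l *\<^sub>C X w) \<le> norm (R w) + norm w" by (simp add: norm_triangle_ineq4)
    then show ?thesis using mprojD(5)[OF R, of w] l by (simp add: norm_scaleC algebra_simps)
  qed
  have "norm (X w) = 0"
  proof (rule ccontr)
    assume "norm (X w) \<noteq> 0"
    then have "norm (X w) > 0" by simp
    then obtain n where n: "(K + 1) * norm w < real n * norm (X w)" using ex_less_of_nat_mult by blast
    have "0 \<le> (K + 1) * norm w" using K_nonneg by simp
    then have "real n > 0" using n by (cases "n = 0") auto
    then show False using bound[of "real n"] n by linarith
  qed
  then have "P (T (w - P w)) = 0" by (simp add: X)
  then have "P (T x) = P (T (P x))" using w by (simp add: w_def blinfun.diff_right)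
  also have "\<dots> = T (P x)" by (rule mprojD(3)[OF P hU(3)[OF T mprojD(2)[OF P]]])
  finally show ?thesis .
qed

lemma twisted_closed:
  assumes "S \<in> twisted"
  shows "a \<in> A \<Longrightarrow> (a o\<^sub>L S) \<in> twisted" "T \<in> endos \<Longrightarrow> (T o\<^sub>L S) \<in> twisted"
proof -
  have sub: "csubspace twisted" by (simp add: twisted_def)
  show "(a o\<^sub>L S) \<in> twisted" if a: "a \<in> A" for a
    using assms
  proof (induction rule: twisted_induct)
    case zero
    then show ?case by (simp add: csubspace_0[OF sub])
  next
    case (add S T)
    have "(a o\<^sub>L (S + T)) = (a o\<^sub>L S) + (a o\<^sub>L T)"
      by (rule blinfun_eqI) (simp add: blinfun.add_left blinfun.add_right)
    then show ?case using add csubspace_add[OF sub] by metis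
  next
    case (base c b T)
    have "(a o\<^sub>L (c *\<^sub>C (b o\<^sub>L T))) = c *\<^sub>C ((a o\<^sub>L b) o\<^sub>L T)"
      by (rule blinfun_eqI) (simp add: A_scaleC[OF a])
    then show ?case
      using csubspace_scaleC[OF sub twisted_base[OF A_compose[OF a base(1)] base(2)]] by metis
  qed
  show "(T o\<^sub>L S) \<in> twisted" if T: "T \<in> endos" for T
    using assms
  proof (induction rule: twisted_induct)
    case zero
    then show ?case by (simp add: csubspace_0[OF sub])
  next
    case (add S R)
    have "(T o\<^sub>L (S + R)) = (T o\<^sub>L S) + (T o\<^sub>L R)"
      by (rule blinfun_eqI) (simp add: blinfun.add_left blinfun.add_right)
    then show ?case using add csubspace_add[OF sub] by metis
  next
    case (base c b R)
    have "(T o\<^sub>L (c *\<^sub>C (b o\<^sub>L R))) = c *\<^sub>C (b o\<^sub>L (T o\<^sub>L R))"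
      by (rule blinfun_eqI) (simp add: bounded_opsD[OF endosD(1)[OF T]] endosD(2)[OF T base(1)])
    then show ?case
      using csubspace_scaleC[OF sub twisted_base[OF base(1) endos_compose[OF T base(2)]]] by metis
  qed
qed

text \<open>The argument of \<open>subs_no_gap\<close> with \<open>twisted\<close> in place of
  \<open>A\<close>. Centrality of \<open>P\<close> makes the kernel of \<open>P\<close> in
  \<open>V\<close> invariant under the commutant, and it makes the intermediate submodules built
  from orbits invariant as well.\<close>

lemma hypersubs_no_gap:
  assumes U: "U \<in> hypersubs" and V: "V \<in> hypersubs" and UV: "U \<subset> V"
  shows "\<exists>V'\<in>hypersubs. U \<subset> V' \<and> V' \<subset> V"
proof (rule ccontr)
  assume gap: "\<not> ?thesis"
  note hU = hypersubsD[OF U] and hV = hypersubsD[OF V]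
  obtain P where P: "mproj U P" using mproj_exists[OF hU(1)] by blast
  have central: "P (T x) = T (P x)" if "T \<in> endos" "x \<in> W" for T x
    by (rule hyper_projection_central[OF U P that])
  define Y where "Y = V \<inter> {x. P x = 0}"
  have Y: "submod Y"
    unfolding Y_def using P by (intro submod_Int submod_kernel hV(1)) (auto simp: mproj_def)
  have YT: "T x \<in> Y" if "T \<in> endos" "x \<in> Y" for T x
    using that hV central[of T x] by (auto simp: Y_def)
  have YS: "S x \<in> Y" if "S \<in> twisted" "x \<in> Y" for S x
    using that(1)
  proof (induction rule: twisted_induct)
    case zero
    then show ?case using csubspace_0[OF submodD(1)[OF Y]] by simp
  next
    case (add S T)
    then show ?case using csubspace_add[OF submodD(1)[OF Y]] by (simp add: blinfun.add_left)
  next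
    case (base c a T)
    then show ?case
      using csubspace_scaleC[OF submodD(1)[OF Y] submodD(3)[OF Y _ YT]] that(2) by simp
  qed
  obtain v where v: "v \<in> V" "v \<notin> U" using UV by blast
  define y where "y = v - P v"
  have y: "y \<in> Y" "y \<noteq> 0"
    using v UV mprojD(2)[OF P, of v] csubspace_diff[OF submodD(1)[OF hV(1)]]
    by (auto simp: y_def Y_def blinfun.diff_right mprojD(3)[OF P])
  have YW: "Y \<subseteq> W" using hV by (auto simp: Y_def)
  have nz: "\<exists>a\<in>A. a z \<noteq> 0" if "z \<in> Y" "z \<noteq> 0" for z
    using nondegenerate[of z] that YW by blast
  obtain b where b: "b \<in> A" "b y \<noteq> 0" using nz[OF y] by blast
  have sub: "csubspace twisted" by (simp add: twisted_def)
  have full: "Y \<subseteq> closure ((\<lambda>S. blinfun_apply S z) ` twisted)" if z: "z \<in> Y" "z \<noteq> 0" for z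
  proof -
    let ?I = "(\<lambda>S. blinfun_apply S z) ` twisted"
    define N where "N = closure ?I"
    have I: "csubspace ?I"
      unfolding csubspace_def
    proof (intro conjI ballI allI)
      show "0 \<in> ?I" using csubspace_0[OF sub] by (intro image_eqI[of _ _ 0]) simp_all
      show "u + v \<in> ?I" if "u \<in> ?I" "v \<in> ?I" for u v
        using that csubspace_add[OF sub] by (auto simp flip: blinfun.add_left)
      show "c *\<^sub>C u \<in> ?I" if "u \<in> ?I" for c u
        using that csubspace_scaleC[OF sub] by (auto simp flip: blinfun_scaleC)
    qed
    have inv: "T u \<in> N" if u: "u \<in> N" and T: "T \<in> A \<or> T \<in> endos" for T u
      unfolding N_def
    proof (rule closure_invariant[OF u[unfolded N_def]])
      fix v assume "v \<in> ?I"
      then obtain S where S: "S \<in> twisted" "v = S z" by blast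
      then have "T v = (T o\<^sub>L S) z" by simp
      moreover have "(T o\<^sub>L S) \<in> twisted" using T twisted_closed[OF S(1)] by blast
      ultimately show "T v \<in> ?I" by blast
    qed
    have N: "submod N"
      unfolding submod_def using csubspace_closure[OF I] inv by (auto simp: N_def)
    have NY: "N \<subseteq> Y"
      unfolding N_def using YS z submodD(2)[OF Y] by (intro closure_minimal) auto
    then have c: "N \<subseteq> V" "\<And>x. x \<in> N \<Longrightarrow> P x = 0" by (auto simp: Y_def)
    let ?V' = "{x\<in>V. x - P x \<in> N}"
    note V' = gap_complement[OF P N c hV(1) psubset_imp_subset[OF UV]]
    obtain a where a: "a \<in> A" "a z \<noteq> 0" using nz[OF z] by blast
    have "a z \<in> N" unfolding N_def
      by (rule closure_subset[THEN subsetD, OF imageI[OF A_twisted[OF a(1)]]])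
    moreover have "a z \<notin> U" using mprojD(3)[OF P] c(2)[OF calculation] a(2) by force
    ultimately have "U \<subset> ?V'" using V' by blast
    moreover have "?V' \<in> hypersubs"
    proof -
      have "T x - P (T x) \<in> N" if "T \<in> endos" "x \<in> V" "x - P x \<in> N" for T x
      proof -
        have "T x - P (T x) = T (x - P x)"
          using central[of T x] that hV(2) by (auto simp: blinfun.diff_right)
        then show ?thesis using inv[OF that(3), of T] that(1) by simp
      qed
      then show ?thesis using V'(1) hV by (auto simp: hypersubs_def subs_def)
    qed
    ultimately have V'V: "?V' = V" using gap by blast
    show ?thesis
      unfolding N_def[symmetric]
    proof
      fix x assume "x \<in> Y"
      then have "x \<in> ?V'" "P x = 0" unfolding V'V by (auto simp: Y_def)
      then show "x \<in> N" by simp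
    qed
  qed
  have "\<exists>S\<in>twisted. \<exists>z\<in>Y. z \<noteq> 0 \<and> S (b z) = z"
  proof (rule lomonosov)
    show "subspace Y" "closed Y" using Y by (auto simp: submod_def csubspace_imp_subspace)
    show "subspace twisted" by (rule csubspace_imp_subspace[OF sub])
    show "b \<in> compact_ops" using b A_compact by blast
    show "\<exists>S\<in>twisted. norm (S u - x) < e" if "u \<in> Y" "u \<noteq> 0" "x \<in> Y" "e > 0" for u x e
      using full[OF that(1,2)] that(3,4) unfolding closure_approachable subset_iff dist_norm by blast
  qed (use submodD(3)[OF Y] b y YS in auto)
  then show False using twisted_no_eigenvector[OF _ b(1)] YW by blast
qed

lemma hypersubs_zero: "{0} \<in> hypersubs" and hypersubs_W: "W \<in> hypersubs"
  using subs_zero subs_W by (auto simp: hypersubs_def endos_def)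

lemma hypersubs_chain:
  assumes C: "chain_of hypersubs C"
  shows "closure (\<Union>C) \<in> hypersubs" "\<Inter>C \<in> hypersubs"
proof -
  have C': "chain_of subs C" using C by (auto simp: chain_of_def hypersubs_def)
  have inv: "T x \<in> V" if "V \<in> C" "T \<in> endos" "x \<in> V" for T x V
    using C that by (auto simp: chain_of_def hypersubs_def)
  have "T x \<in> closure (\<Union>C)" if "T \<in> endos" "x \<in> closure (\<Union>C)" for T x
    by (rule closure_invariant[OF that(2)]) (use inv that(1) in blast)
  then show "closure (\<Union>C) \<in> hypersubs" using subs_chain(1)[OF C'] by (simp add: hypersubs_def)
  show "\<Inter>C \<in> hypersubs" using subs_chain(2)[OF C'] inv by (auto simp: hypersubs_def)
qed

section \<open>Signed sums of central projections\<close>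

definition central_family :: "nat \<Rightarrow> (nat \<Rightarrow> 'a \<Rightarrow>\<^sub>L 'a) \<Rightarrow> bool" where
  "central_family n f \<longleftrightarrow> (\<forall>k<n. f k \<in> endos) \<and> (\<forall>k<n. \<forall>T\<in>endos. \<forall>x\<in>W. f k (blinfun_apply T x) = T (f k x))
     \<and> (\<forall>j<n. \<forall>k<n. \<forall>x\<in>W. f j (f k x) = (if j = k then f k x else 0))"

text \<open>A partial sum \<open>g\<close> acts on \<open>W\<close> as an idempotent that commutes
  with the commutant. It therefore commutes with the module projection onto its own range, and the
  two agree on \<open>W\<close>; so \<open>K\<close> bounds it. A signed sum is a difference of two
  partial sums.\<close>

lemma central_family_bound:
  assumes f: "central_family n f" and s: "\<And>k. s k = 1 \<or> s k = (-1::real)" and x: "x \<in> W"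
  shows "norm (\<Sum>k<n. s k *\<^sub>R blinfun_apply (f k) x) \<le> 2 * K * norm x"
proof -
  have half: "norm (\<Sum>k\<in>J. f k x) \<le> K * norm x" if J: "J \<subseteq> {..<n}" for J
  proof -
    have fin: "finite J" using J finite_subset by blast
    have fe: "\<And>k. k \<in> J \<Longrightarrow> f k \<in> endos"
      and fc: "\<And>k T x. k \<in> J \<Longrightarrow> T \<in> endos \<Longrightarrow> x \<in> W \<Longrightarrow> f k (blinfun_apply T x) = T (f k x)"
      and ff: "\<And>j k x. j \<in> J \<Longrightarrow> k \<in> J \<Longrightarrow> x \<in> W \<Longrightarrow> f j (f k x) = (if j = k then f k x else 0)"
      using f J unfolding central_family_def by blast+
    define g where "g = (\<Sum>k\<in>J. f k)"
    have g: "g y = (\<Sum>k\<in>J. f k y)" for y by (simp add: g_def blinfun.sum_left)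
    have ge: "g \<in> endos"
      unfolding g_def using fin fe
    proof (induction J)
      case empty
      then show ?case using endos_scaleC[OF endos_id, of 0] by (simp add: cvs.scale_zero_left)
    next
      case (insert k J)
      then show ?case by (auto intro: endos_add)
    qed
    have gc: "g (T y) = T (g y)" if "T \<in> endos" "y \<in> W" for T y
      unfolding g blinfun.sum_right by (intro sum.cong refl fc that)
    have gg: "g (g y) = g y" if y: "y \<in> W" for y
    proof -
      have "f j (g y) = f j y" if j: "j \<in> J" for j
      proof -
        have "f j (g y) = (\<Sum>k\<in>J. if j = k then f k y else 0)"
          unfolding g blinfun.sum_right by (intro sum.cong refl ff y j)
        then show ?thesis using fin j by simp
      qed
      then have "(\<Sum>j\<in>J. f j (g y)) = (\<Sum>j\<in>J. f j y)" by (intro sum.cong) auto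
      then show ?thesis by (metis g)
    qed
    define G where "G = W \<inter> {y. (id_blinfun - g) y = 0}"
    have G: "y \<in> G \<longleftrightarrow> y \<in> W \<and> g y = y" for y by (auto simp: G_def blinfun.diff_left)
    have "submod G"
      unfolding G_def
    proof (intro submod_Int W submod_kernel)
      show "id_blinfun - g \<in> bounded_ops" by (intro bounded_ops_diff bounded_ops_id endosD(1)[OF ge])
    qed (simp add: blinfun.diff_left blinfun.diff_right endosD(2)[OF ge])
    then have hG: "G \<in> hypersubs"
      using gc by (auto simp: hypersubs_def subs_def G endosD)
    obtain P where P: "mproj G P" using mproj_exists[OF \<open>submod G\<close>] by blast
    have "g x \<in> G" using gg[OF x] endosD(3)[OF ge x] by (simp add: G)
    then have P1: "P (g x) = g x" by (rule mprojD(3)[OF P])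
    have xg: "x - g x \<in> W" using x endosD(3)[OF ge x] csubspace_diff[OF submodD(1)[OF W]] by blast
    have "P (x - g x) = g (P (x - g x))" using mprojD(2)[OF P, of "x - g x"] by (simp add: G)
    also have "\<dots> = P (g (x - g x))"
      by (rule gc[OF mproj_endos[OF P] xg]) (simp add: G subset_iff)
    also have "\<dots> = 0" using gg[OF x] by (simp add: blinfun.diff_right)
    finally have "P x = g x" using P1 by (simp add: blinfun.diff_right)
    then show ?thesis using mprojD(5)[OF P, of x] by (simp add: g)
  qed
  define J where "J = {k\<in>{..<n}. s k = 1}"
  have "(\<Sum>k<n. s k *\<^sub>R f k x) = (\<Sum>k\<in>J. s k *\<^sub>R f k x) + (\<Sum>k\<in>{..<n} - J. s k *\<^sub>R f k x)"
    by (subst sum.subset_diff[of J]) (auto simp: J_def)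
  also have "(\<Sum>k\<in>J. s k *\<^sub>R f k x) = (\<Sum>k\<in>J. f k x)" by (intro sum.cong) (auto simp: J_def)
  also have "(\<Sum>k\<in>{..<n} - J. s k *\<^sub>R f k x) = - (\<Sum>k\<in>{..<n} - J. f k x)"
    unfolding sum_negf[symmetric]
  proof (rule sum.cong)
    fix k assume "k \<in> {..<n} - J"
    then have "s k = - 1" using s[of k] by (auto simp: J_def)
    then show "s k *\<^sub>R f k x = - f k x" by simp
  qed simp
  finally have "norm (\<Sum>k<n. s k *\<^sub>R f k x) \<le> norm (\<Sum>k\<in>J. f k x) + norm (\<Sum>k\<in>{..<n} - J. f k x)"
    by (simp add: norm_triangle_ineq4)
  also have "\<dots> \<le> K * norm x + K * norm x" by (intro add_mono half) (auto simp: J_def)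
  finally show ?thesis by simp
qed

text \<open>A fine chain splits \<open>W\<close> into layers by a central family such that
  \<open>b\<close> is bounded by \<open>\<eta>\<close> on each layer. With suitable signs the norm
  of a vector is compared with the square sum of its layers, in both directions and at the cost of a
  factor \<open>2 * K\<close> each. So \<open>b\<close> is bounded by
  \<open>4 * K\<^sup>2 * \<eta>\<close> on \<open>W\<close> for every positive
  \<open>\<eta>\<close>.\<close>

theorem volterra_trivial: "W = {0}"
proof -
  have "b x = 0" if b: "b \<in> A" and x: "x \<in> W" for b x
  proof -
    have small: "norm (b x) \<le> 4 * K\<^sup>2 * \<eta> * norm x" if \<eta>: "\<eta> > 0" for \<eta>
    proof -
      \<comment> \<open>\<open>compact_step_small\<close> contributes the factor \<open>2\<close>.
        The factor \<open>K + 1\<close> arises because it estimates the orthogonal residual, to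
        which \<open>1 - P\<close> still has to be applied.\<close>
      define d where "d = \<eta> / (2 * (K + 1))"
      have d: "d > 0" using \<eta> K_nonneg by (simp add: d_def)
      have "b \<in> compact_ops" using b A_compact by blast
      then obtain X where X: "finite X" "\<And>x. norm x \<le> 1 \<Longrightarrow> \<exists>y\<in>X. norm (b x - y) < d"
        using compact_ops_finite_net[OF _ d] by blast
      define Q where "Q V \<longleftrightarrow> (\<exists>n f. central_family n f \<and> (\<forall>k<n. \<forall>x\<in>W. f k x \<in> V)
        \<and> (\<forall>k<n. \<forall>x\<in>W. norm (b (f k x)) \<le> \<eta> * norm (f k x)) \<and> (\<forall>x\<in>V. (\<Sum>k<n. f k x) = x))" for V
      have "Q W"
      proof (rule gapless_induct[where L = hypersubs and X = X and e = "d\<^sup>2"])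
        show "csubspace V \<and> closed V \<and> V \<subseteq> W" if "V \<in> hypersubs" for V
          using that by (auto simp: hypersubs_def subs_def submod_def)
        show "Q {0}" unfolding Q_def by (rule exI[of _ 0]) (auto simp: central_family_def)
        fix U V assume U: "U \<in> hypersubs" and V: "V \<in> hypersubs" and UV: "U \<subseteq> V"
          and close: "\<And>x. x \<in> X \<Longrightarrow> (norm (proj V x))\<^sup>2 - (norm (proj U x))\<^sup>2 \<le> d\<^sup>2" and "Q U"
        note hU = hypersubsD[OF U] and hV = hypersubsD[OF V]
        note sU = submodD[OF hU(1)] and sV = submodD[OF hV(1)]
        obtain n f where f: "central_family n f" and fU: "\<And>k x. k < n \<Longrightarrow> x \<in> W \<Longrightarrow> f k x \<in> U"
          and fb: "\<And>k x. k < n \<Longrightarrow> x \<in> W \<Longrightarrow> norm (b (f k x)) \<le> \<eta> * norm (f k x)"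
          and fs: "\<And>x. x \<in> U \<Longrightarrow> (\<Sum>k<n. f k x) = x"
          using \<open>Q U\<close> unfolding Q_def by blast
        have fe: "\<And>k. k < n \<Longrightarrow> f k \<in> endos"
          and fc: "\<And>k T x. k < n \<Longrightarrow> T \<in> endos \<Longrightarrow> x \<in> W \<Longrightarrow> f k (blinfun_apply T x) = T (f k x)"
          and ff: "\<And>j k x. j < n \<Longrightarrow> k < n \<Longrightarrow> x \<in> W \<Longrightarrow> f j (f k x) = (if j = k then f k x else 0)"
          using f unfolding central_family_def by blast+
        obtain P where P: "mproj U P" using mproj_exists[OF hU(1)] by blast
        obtain R where R: "mproj V R" using mproj_exists[OF hV(1)] by blast
        have Pe: "P \<in> endos" and Re: "R \<in> endos" using mproj_endos P R hU hV by auto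
        \<comment> \<open>\<open>(1 - P) R\<close> projects onto the new layer, a complement of
          \<open>U\<close> in \<open>V\<close>; it extends the family.\<close>
        define q where "q = R - (P o\<^sub>L R)"
        have q: "q x = R x - P (R x)" for x by (simp add: q_def blinfun.diff_left)
        have qe: "q \<in> endos"
          using endos_add[OF Re endos_scaleC[OF endos_compose[OF Pe Re], of "-1"]] by (simp add: q_def)
        have qV: "q x \<in> V" for x
          unfolding q using mprojD(2)[OF R] mprojD(2)[OF P] UV by (intro csubspace_diff[OF sV(1)]) auto
        have Pq: "P (q x) = 0" for x
          unfolding q using mprojD(2,3)[OF P] by (simp add: blinfun.diff_right)
        have qc: "q (T x) = T (q x)" if T: "T \<in> endos" and x: "x \<in> W" for T x
          using hyper_projection_central[OF V R T x]
            hyper_projection_central[OF U P T, of "R x"] endosD(3)[OF Re x]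
          by (simp add: q blinfun.diff_right)
        have fq: "f k (q x) = 0" if k: "k < n" and x: "x \<in> W" for k x
        proof -
          have qx: "q x \<in> W" using endosD(3)[OF qe x] .
          have "f k (q x) = P (f k (q x))" using mprojD(3)[OF P fU[OF k qx]] by simp
          also have "\<dots> = f k (P (q x))" using fc[OF k Pe qx] by simp
          finally show ?thesis by (simp add: Pq)
        qed
        have qf: "q (f k x) = 0" if k: "k < n" and x: "x \<in> W" for k x
          using fU[OF k x] UV mprojD(3)[OF R, of "f k x"] mprojD(3)[OF P, of "f k x"] by (auto simp: q)
        have qq: "q (q x) = q x" for x
          using mprojD(3)[OF R qV[of x]] Pq[of x] by (simp add: q[of "q x"])
        define f' where "f' = f(n := q)"
        have "central_family (Suc n) f'"
          unfolding central_family_def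
        proof (intro conjI allI impI ballI)
          fix k assume k: "k < Suc n"
          then consider "k < n" "f' k = f k" | "k = n" "f' k = q" by (auto simp: f'_def less_Suc_eq)
          note kc = this
          show "f' k \<in> endos" using kc fe qe by cases auto
          show "f' k (T x) = T (f' k x)" if "T \<in> endos" "x \<in> W" for T x
            using kc fc[OF _ that, of k] qc[OF that] by cases auto
          fix j x assume j: "j < Suc n" and x: "x \<in> W"
          then consider "j < n" "f' j = f j" | "j = n" "f' j = q" by (auto simp: f'_def less_Suc_eq)
          then show "f' j (f' k x) = (if j = k then f' k x else 0)"
            using kc
          proof cases
            case 1
            show ?thesis using kc 1 ff[OF 1(1) _ x, of k] fq[OF 1(1) x] by cases auto
          next
            case 2
            show ?thesis using kc 2 qf[OF _ x, of k] qq[of x] by cases auto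
          qed
        qed
        moreover have "f' k x \<in> V" if "k < Suc n" "x \<in> W" for k x
          using that fU UV qV by (auto simp: f'_def less_Suc_eq)
        moreover have "norm (b (f' k x)) \<le> \<eta> * norm (f' k x)" if k: "k < Suc n" and x: "x \<in> W" for k x
        proof (cases "k = n")
          case True
          define y where "y = q x"
          have yV: "y \<in> V" by (simp add: y_def qV)
          have bV: "b y \<in> V" by (rule sV(3)[OF b yV])
          have "P (b y) = 0" using mprojD(4)[OF P b, of y] by (simp add: y_def Pq)
          moreover have "P (proj U (b y)) = proj U (b y)" by (rule mprojD(3)[OF P proj_in[OF sU(1,2)]])
          ultimately have "b y = (b y - proj U (b y)) - P (b y - proj U (b y))"
            by (simp add: blinfun.diff_right)
          then have "norm (b y) \<le> norm (b y - proj U (b y)) + norm (P (b y - proj U (b y)))"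
            by (metis norm_triangle_ineq4)
          also have "\<dots> \<le> norm (b y - proj U (b y)) + K * norm (b y - proj U (b y))"
            using mprojD(5)[OF P] by (intro add_left_mono)
          also have "\<dots> = (K + 1) * norm (b y - proj U (b y))" by (simp add: algebra_simps)
          also have "\<dots> \<le> (K + 1) * (2 * d * norm y)"
            using K_nonneg compact_step_small[OF sU(1,2) sV(1,2) UV X(2) close bV]
            by (intro mult_left_mono) auto
          also have "\<dots> = \<eta> * norm y" using K_nonneg by (simp add: d_def field_simps)
          finally show ?thesis using True by (simp add: f'_def y_def)
        next
          case False
          then show ?thesis using k fb[OF _ x, of k] by (simp add: f'_def)
        qed
        moreover have "(\<Sum>k<Suc n. f' k x) = x" if x: "x \<in> V" for x
        proof -
          have xW: "x \<in> W" using x hV by blast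
          have "f k x = f k (P x)" if k: "k < n" for k
          proof -
            have "f k x = P (f k x)" using mprojD(3)[OF P fU[OF k xW]] by simp
            then show ?thesis using fc[OF k Pe xW] by simp
          qed
          then have "(\<Sum>k<n. f k x) = (\<Sum>k<n. f k (P x))" by (intro sum.cong) auto
          also have "\<dots> = P x" by (rule fs[OF mprojD(2)[OF P]])
          finally show ?thesis using mprojD(3)[OF R x] by (simp add: f'_def q)
        qed
        ultimately show "Q V" unfolding Q_def by blast
      qed (use hypersubs_zero hypersubs_W hypersubs_chain hypersubs_no_gap X(1) d in auto)
      then obtain n f where f: "central_family n f"
        and fb: "\<And>k x. k < n \<Longrightarrow> x \<in> W \<Longrightarrow> norm (b (f k x)) \<le> \<eta> * norm (f k x)"
        and fs: "\<And>x. x \<in> W \<Longrightarrow> (\<Sum>k<n. f k x) = x"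
        unfolding Q_def by blast
      have bW: "b x \<in> W" by (rule submodD(3)[OF W b x])
      have fe: "\<And>k. k < n \<Longrightarrow> f k \<in> endos"
        and ff: "\<And>j k x. j < n \<Longrightarrow> k < n \<Longrightarrow> x \<in> W \<Longrightarrow> f j (f k x) = (if j = k then f k x else 0)"
        using f unfolding central_family_def by blast+
      let ?N = "\<lambda>z. \<Sum>k<n. (norm (f k z))\<^sup>2"
      obtain s where s: "\<And>k. s k = 1 \<or> s k = (-1::real)" "(norm (\<Sum>k<n. s k *\<^sub>R f k (b x)))\<^sup>2 \<le> ?N (b x)"
        using signs_upper[where n = n and x = "\<lambda>k. f k (b x)"] by blast
      obtain s' where s': "\<And>k. s' k = 1 \<or> s' k = (-1::real)" "?N x \<le> (norm (\<Sum>k<n. s' k *\<^sub>R f k x))\<^sup>2"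
        using signs_lower[where n = n and x = "\<lambda>k. f k x"] by blast
      \<comment> \<open>Applying the same signs once more recovers \<open>b x\<close>, since they
        square to \<open>1\<close>. So the norm of \<open>b x\<close> is bounded by that of
        \<open>y\<close>, whose signs were chosen to make it small.\<close>
      define y where "y = (\<Sum>k<n. s k *\<^sub>R f k (b x))"
      have yW: "y \<in> W"
        unfolding y_def using endosD(3)[OF fe bW] submodD(1)[OF W]
        by (intro csubspace_sum csubspace_scaleR) auto
      have fy: "f j y = s j *\<^sub>R f j (b x)" if j: "j < n" for j
      proof -
        have "f j y = (\<Sum>k<n. s k *\<^sub>R f j (f k (b x)))"
          by (simp add: y_def blinfun.sum_right blinfun.scaleR_right)
        also have "\<dots> = (\<Sum>k<n. if j = k then s k *\<^sub>R f k (b x) else 0)"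
          using ff[OF j _ bW] by (intro sum.cong) auto
        also have "\<dots> = s j *\<^sub>R f j (b x)" using j by simp
        finally show ?thesis .
      qed
      have "b x = (\<Sum>k<n. f k (b x))" using fs[OF bW] by simp
      also have "\<dots> = (\<Sum>k<n. s k *\<^sub>R f k y)"
      proof (rule sum.cong)
        fix k assume "k \<in> {..<n}"
        moreover have "s k * s k = 1" using s(1)[of k] by auto
        ultimately show "f k (b x) = s k *\<^sub>R f k y" using fy[of k] by simp
      qed simp
      also have "norm \<dots> \<le> 2 * K * norm y" by (rule central_family_bound[OF f s(1) yW])
      finally have "(norm (b x))\<^sup>2 \<le> (2 * K * norm y)\<^sup>2" by (intro power_mono) auto
      also have "\<dots> = (2 * K)\<^sup>2 * (norm y)\<^sup>2" by (simp add: power_mult_distrib)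
      also have "\<dots> \<le> (2 * K)\<^sup>2 * ?N (b x)" using s(2) by (intro mult_left_mono) (auto simp: y_def)
      also have "?N (b x) \<le> (\<Sum>k<n. \<eta>\<^sup>2 * (norm (f k x))\<^sup>2)"
      proof (rule sum_mono)
        fix k assume k: "k \<in> {..<n}"
        have "norm (f k (b x)) \<le> \<eta> * norm (f k x)"
          using fb[of k x] endosD(2)[OF fe b, of k x] k x by simp
        then show "(norm (f k (b x)))\<^sup>2 \<le> \<eta>\<^sup>2 * (norm (f k x))\<^sup>2"
          unfolding power_mult_distrib[symmetric] by (intro power_mono) auto
      qed
      also have "\<dots> = \<eta>\<^sup>2 * ?N x" by (simp add: sum_distrib_left)
      also have "?N x \<le> (2 * K * norm x)\<^sup>2"
        by (rule order_trans[OF s'(2)]) (intro power_mono central_family_bound[OF f s'(1) x], simp)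
      finally have "(norm (b x))\<^sup>2 \<le> (2 * K)\<^sup>2 * (\<eta>\<^sup>2 * (2 * K * norm x)\<^sup>2)"
        by (simp add: mult_left_mono)
      also have "\<dots> = (4 * K\<^sup>2 * \<eta> * norm x)\<^sup>2" by (simp add: power2_eq_square)
      finally show ?thesis
        by (rule power2_le_imp_le) (use \<eta> in simp)
    qed
    have "norm (b x) \<le> 0 + e" if "e > 0" for e
    proof -
      define M where "M = 4 * K\<^sup>2 * norm x + 1"
      have M: "M > 0" by (simp add: M_def add_nonneg_pos)
      have "norm (b x) \<le> 4 * K\<^sup>2 * (e / M) * norm x" using small[of "e / M"] M that by simp
      also have "\<dots> = (4 * K\<^sup>2 * norm x) * (e / M)" by simp
      also have "\<dots> \<le> M * (e / M)" using M that by (intro mult_right_mono) (auto simp: M_def)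
      also have "\<dots> = e" using M by simp
      finally show ?thesis by simp
    qed
    then have "norm (b x) \<le> 0" by (rule field_le_epsilon)
    then show ?thesis by simp
  qed
  then show ?thesis using nondegenerate csubspace_0[OF submodD(1)[OF W]] by blast
qed

end

section \<open>Minimal idempotents\<close>

text \<open>Otherwise orthonormal systems in \<open>X\<close> could be enlarged forever. The vectors
  added have mutual distance \<open>sqrt 2\<close> and are fixed by the compact \<open>p\<close>,
  which is impossible.\<close>

lemma compact_fixed_onb:
  fixes X :: "'a::chilbert_space set"
  assumes p: "p \<in> compact_ops" and X: "csubspace X" and fix_p: "\<And>x. x \<in> X \<Longrightarrow> blinfun_apply p x = x"
  shows "\<exists>F. finite F \<and> orthonormal F \<and> F \<subseteq> X \<and> (\<forall>x\<in>X. x = (\<Sum>f\<in>F. cinner x f *\<^sub>C f))"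
proof (rule ccontr)
  assume neg: "\<not> ?thesis"
  define Q where "Q F \<longleftrightarrow> finite F \<and> orthonormal F \<and> F \<subseteq> X" for F
  have "\<exists>e. e \<notin> F \<and> Q (insert e F)" if F: "Q F" for F
  proof -
    obtain x where x: "x \<in> X" "x \<noteq> (\<Sum>f\<in>F. cinner x f *\<^sub>C f)" using neg F unfolding Q_def by blast
    show ?thesis using orthonormal_insert[OF _ _ x(2) X _ x(1)] F unfolding Q_def by blast
  qed
  then have step: "\<exists>G. Q G \<and> (\<exists>e. e \<notin> F \<and> G = insert e F)" if "Q F" for F using that by blast
  have "Q {}" by (simp add: Q_def orthonormal_def)
  have "\<exists>F. \<forall>n. Q (F n) \<and> (\<exists>e. e \<notin> F n \<and> F (Suc n) = insert e (F n))"
    by (rule dependent_nat_choice) (use \<open>Q {}\<close> step in blast)+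
  then obtain F where F: "\<And>n. Q (F n)" "\<And>n. \<exists>e. e \<notin> F n \<and> F (Suc n) = insert e (F n)"
    by blast
  have "\<exists>e. \<forall>n. e n \<notin> F n \<and> F (Suc n) = insert (e n) (F n)"
    by (rule choice) (use F(2) in blast)
  then obtain e where e: "\<And>n. e n \<notin> F n" "\<And>n. F (Suc n) = insert (e n) (F n)" by blast
  have mono: "F m \<subseteq> F n" if "m \<le> n" for m n
    using that by (rule lift_Suc_mono_le[of F, rotated]) (use e(2) in auto)
  have eF: "e n \<in> F (Suc n)" for n using e(2) by simp
  have eX: "e n \<in> X" and en: "cinner (e n) (e n) = 1" for n
    using F(1)[of "Suc n"] eF[of n] by (auto simp: Q_def orthonormal_def)
  have n1: "norm (e n) = 1" for n
  proof -
    have "(norm (e n))\<^sup>2 = 1\<^sup>2" using en[of n] unfolding cinner_self by (metis of_real_eq_1_iff one_power2)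
    then show ?thesis by (rule power2_eq_imp_eq) simp_all
  qed
  show False
  proof (rule compact_ops_not_separated[OF p, of e 1 1])
    fix m n :: nat assume mn: "m < n"
    have m: "e m \<in> F (Suc n)" using mono[of "Suc m" "Suc n"] eF[of m] mn by auto
    have "e m \<in> F n" using mono[of "Suc m" n] eF[of m] mn by auto
    then have "e m \<noteq> e n" using e(1)[of n] by metis
    then have "cinner (e m) (e n) = 0"
      using F(1)[of "Suc n"] eF[of n] m by (auto simp: Q_def orthonormal_def)
    then have "inner (e m) (- e n) = 0" by (simp add: inner_eq_Re_cinner cinner_uminus_right)
    then have "(norm (e m - e n))\<^sup>2 = 2" using norm_add_sq[of "e m" "- e n"] n1 by simp
    then have "1\<^sup>2 \<le> (norm (e m - e n))\<^sup>2" by simp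
    then have "1 \<le> norm (e m - e n)" by (rule power2_le_imp_le) simp
    then show "1 \<le> norm (p (e m) - p (e n))" using fix_p eX by simp
  qed (use n1 in auto)
qed

lemma compact_fixed_closed:
  fixes X :: "'a::chilbert_space set"
  assumes p: "p \<in> compact_ops" and X: "csubspace X" and fix_p: "\<And>x. x \<in> X \<Longrightarrow> blinfun_apply p x = x"
  shows "closed X"
proof -
  obtain F where F: "F \<subseteq> X" "\<And>x. x \<in> X \<Longrightarrow> x = (\<Sum>f\<in>F. cinner x f *\<^sub>C f)"
    using compact_fixed_onb[OF assms] by blast
  have "x \<in> X" if "x = (\<Sum>f\<in>F. cinner x f *\<^sub>C f)" for x
    by (subst that) (use F(1) in \<open>auto intro!: csubspace_sum[OF X] csubspace_scaleC[OF X]\<close>)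
  then have "X = {x. x = (\<Sum>f\<in>F. cinner x f *\<^sub>C f)}" using F(2) by blast
  then show ?thesis using closed_orthonormal_expansion[of F] by simp
qed

text \<open>A nontrivial linear relation between the first \<open>n + 1\<close> iterates of
  \<open>v\<close> is a polynomial \<open>q\<close> with \<open>q(x) v = 0\<close>. If
  \<open>q\<close> has a root \<open>\<mu>\<close> with quotient \<open>r\<close>, then
  \<open>r(x) v\<close> is either an eigenvector or \<open>0\<close>, and in the latter case
  \<open>r\<close> is a relation of smaller degree.\<close>

lemma eigenvector_exists:
  fixes x :: "'a::chilbert_space \<Rightarrow>\<^sub>L 'a"
  assumes x: "x \<in> bounded_ops" and F: "finite F" and X: "csubspace X" "X \<subseteq> cvs.span F"
    and inv: "\<And>v. v \<in> X \<Longrightarrow> blinfun_apply x v \<in> X" and v: "v \<in> X" "v \<noteq> 0"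
  shows "\<exists>\<mu> u. u \<in> X \<and> u \<noteq> 0 \<and> x u = \<mu> *\<^sub>C u"
proof -
  define n where "n = card F"
  define g where "g i = (blinfun_apply x ^^ i) v" for i
  have gX: "g i \<in> X" for i by (induction i) (auto simp: g_def v inv)
  have gS: "g (Suc i) = x (g i)" for i by (simp add: g_def)
  have "\<exists>c. (\<exists>i\<le>n. c i \<noteq> 0) \<and> (\<Sum>i\<le>n. c i *\<^sub>C g i) = 0"
  proof (cases "inj_on g {..n}")
    case True
    have "cvs.dependent (g ` {..n})"
    proof (rule ccontr)
      assume "cvs.independent (g ` {..n})"
      then have "card (g ` {..n}) \<le> card F"
        using cvs.independent_span_bound[OF F] gX X(2) by blast
      then show False using card_image[OF True] by (simp add: n_def)
    qed
    then obtain u where u: "\<exists>v\<in>g ` {..n}. u v \<noteq> 0" "(\<Sum>v\<in>g ` {..n}. u v *\<^sub>C v) = 0"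
      using cvs.dependent_finite[of "g ` {..n}"] by auto
    then show ?thesis
      using sum.reindex[OF True, of "\<lambda>v. u v *\<^sub>C v"] by (intro exI[of _ "\<lambda>i. u (g i)"]) auto
  next
    case False
    then obtain i j where ij: "i \<le> n" "j \<le> n" "i \<noteq> j" "g i = g j" by (auto simp: inj_on_def)
    \<comment> \<open>Dependence is a property of the set of iterates and can be lost when two of
      them coincide; then their difference is itself a relation.\<close>
    let ?c = "\<lambda>k. if k = i then 1 else if k = j then -1 else 0 :: complex"
    have "(\<Sum>k\<le>n. ?c k *\<^sub>C g k) = (\<Sum>k\<in>{i, j}. ?c k *\<^sub>C g k)"
      using ij by (intro sum.mono_neutral_right) (auto simp: cvs.scale_zero_left)
    also have "\<dots> = 0" using ij by simp
    finally show ?thesis using ij by (intro exI[of _ ?c]) auto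
  qed
  then obtain c where c: "\<exists>i\<le>n. c i \<noteq> 0" "(\<Sum>i\<le>n. c i *\<^sub>C g i) = 0" by blast
  \<comment> \<open>Evaluation of \<open>q(x)\<close> at \<open>v\<close>, for polynomials of degree
    at most \<open>n\<close>.\<close>
  define ev where "ev q = (\<Sum>i\<le>n. poly.coeff q i *\<^sub>C g i)" for q
  have main: "\<exists>\<mu> u. u \<in> X \<and> u \<noteq> 0 \<and> x u = \<mu> *\<^sub>C u"
    if "q \<noteq> 0" "degree q \<le> n" "ev q = 0" for q :: "complex poly"
    using that
  proof (induction "degree q" arbitrary: q rule: less_induct)
    case less
    show ?case
    proof (cases "degree q = 0")
      case True
      then obtain a where a: "q = [:a:]" by (rule degree_eq_zeroE)
      have "ev q = (\<Sum>i\<le>n. if i = 0 then a *\<^sub>C g 0 else 0)"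
        unfolding ev_def a by (intro sum.cong) (auto simp: coeff_pCons split: nat.splits)
      also have "\<dots> = a *\<^sub>C v" by (simp add: g_def)
      finally show ?thesis using less.prems v(2) a by simp
    next
      case False
      then obtain \<mu> where "poly q \<mu> = 0" 
        using Fundamental_Theorem_Algebra.fundamental_theorem_of_algebra[of q] by (auto simp: constant_degree)
      then obtain r where r: "q = [:-\<mu>, 1:] * r" by (auto simp: poly_eq_0_iff_dvd)
      have r0: "r \<noteq> 0" using less.prems r by auto
      then have deg: "degree q = Suc (degree r)" unfolding r by (subst degree_mult_eq) auto
      have qr: "q = pCons 0 r - smult \<mu> r" unfolding r by simp
      obtain m where m: "n = Suc m" using deg less.prems by (cases n) auto
      have cn: "poly.coeff r n = 0" using deg less.prems by (intro coeff_eq_0) auto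
      have "(\<Sum>i\<le>n. poly.coeff (pCons 0 r) i *\<^sub>C g i) = (\<Sum>i\<le>m. poly.coeff r i *\<^sub>C g (Suc i))"
        unfolding m by (subst sum.atMost_Suc_shift) (simp add: cvs.scale_zero_left)
      also have "\<dots> = x (\<Sum>i\<le>m. poly.coeff r i *\<^sub>C g i)"
        by (simp add: blinfun.sum_right bounded_opsD[OF x] gS)
      also have "(\<Sum>i\<le>m. poly.coeff r i *\<^sub>C g i) = ev r"
        using cn by (simp add: ev_def m cvs.scale_zero_left)
      finally have "ev (pCons 0 r) = x (ev r)" by (simp add: ev_def)
      moreover have "ev q = ev (pCons 0 r) - \<mu> *\<^sub>C ev r"
        unfolding qr by (simp add: ev_def cvs.scale_left_diff_distrib sum_subtractf cvs.scale_sum_right scaleC_scaleC)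
      ultimately have eq: "x (ev r) = \<mu> *\<^sub>C ev r" using less.prems by simp
      show ?thesis
      proof (cases "ev r = 0")
        case True
        then show ?thesis using less.hyps[of r] r0 deg less.prems by simp
      next
        case False
        moreover have "ev r \<in> X"
          unfolding ev_def by (intro csubspace_sum[OF X(1)] csubspace_scaleC[OF X(1)] gX)
        ultimately show ?thesis using eq by blast
      qed
    qed
  qed
  define q where "q = (\<Sum>i\<le>n. monom (c i) i)"
  have cq: "poly.coeff q i = (if i \<le> n then c i else 0)" for i
  proof -
    have "poly.coeff q i = (\<Sum>j\<le>n. if j = i then c j else 0)"
      unfolding q_def coeff_sum by (intro sum.cong) (auto simp: coeff_monom)
    then show ?thesis by simp
  qed
  show ?thesis
  proof (rule main[of q])
    obtain i where "i \<le> n" "c i \<noteq> 0" using c(1) by blast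
    then have "poly.coeff q i \<noteq> 0" by (simp add: cq)
    then show "q \<noteq> 0" by auto
    show "degree q \<le> n" by (rule degree_le) (simp add: cq)
    show "ev q = 0" using c(2) by (simp add: ev_def cq)
  qed
qed

section \<open>Idempotents and their corners\<close>

context crp_algebra
begin

definition idem :: "('h \<Rightarrow>\<^sub>L 'h) \<Rightarrow> bool" where
  "idem p \<longleftrightarrow> p \<in> A \<and> (\<forall>x. p (blinfun_apply p x) = p x)"

definition minimal_idem :: "('h \<Rightarrow>\<^sub>L 'h) \<Rightarrow> bool" where
  "minimal_idem p \<longleftrightarrow> idem p \<and> p \<noteq> 0 \<and> (\<forall>a\<in>A. \<exists>c. \<forall>x. p (blinfun_apply a (p x)) = c *\<^sub>C p x)"

text \<open>The corner \<open>p A p\<close>, described by equations so that it is visibly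
  closed.\<close>

definition corner :: "('h \<Rightarrow>\<^sub>L 'h) \<Rightarrow> ('h \<Rightarrow>\<^sub>L 'h) set" where
  "corner p = {x\<in>A. \<forall>v. p (blinfun_apply x v) = x v \<and> x (blinfun_apply p v) = x v}"

lemma idem_compact: "idem p \<Longrightarrow> p \<in> compact_ops"
  using A_compact by (auto simp: idem_def)

lemma cornerI: "idem p \<Longrightarrow> a \<in> A \<Longrightarrow> (p o\<^sub>L (a o\<^sub>L p)) \<in> corner p"
  by (auto simp: corner_def idem_def intro!: A_compose)

lemma corner_algebra:
  assumes p: "idem p"
  shows "corner p \<subseteq> compact_ops" "op_subalgebra (corner p)" "closed (corner p)" "p \<in> corner p"
proof -
  have pA: "p \<in> A" using p by (simp add: idem_def)
  show "corner p \<subseteq> compact_ops" using A_compact by (auto simp: corner_def)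
  show "op_subalgebra (corner p)"
    unfolding op_subalgebra_def csubspace_def
    using csubspaceD[OF A_csubspace] A_compose A_bounded
    by (auto simp: corner_def blinfun.add_left blinfun.add_right A_scaleC[OF pA])
  show "p \<in> corner p" using p by (simp add: corner_def idem_def)
  have "closed {x. p (blinfun_apply x v) = x v}" "closed {x. blinfun_apply x (p v) = blinfun_apply x v}" for v
    by (intro closed_Collect_eq continuous_intros)+
  moreover have "corner p = A \<inter> (\<Inter>v. {x. p (blinfun_apply x v) = x v}) \<inter> (\<Inter>v. {x. blinfun_apply x (p v) = blinfun_apply x v})"
    by (auto simp: corner_def)
  ultimately show "closed (corner p)" using A_closed by auto
qed

lemma idem_range:
  assumes "idem p"
  shows "range (blinfun_apply p) = {x. blinfun_apply p x = x}" "csubspace {x. blinfun_apply p x = x}"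
    "closed {x. blinfun_apply p x = x}"
proof -
  have pA: "p \<in> A" using assms by (simp add: idem_def)
  show "range (blinfun_apply p) = {x. blinfun_apply p x = x}"
    using assms unfolding idem_def by (auto, metis rangeI)
  show "csubspace {x. blinfun_apply p x = x}"
    by (auto simp: csubspace_def blinfun.add_right A_scaleC[OF pA])
  show "closed {x. blinfun_apply p x = x}" by (intro closed_Collect_eq continuous_intros)
qed

text \<open>A strictly descending sequence of idempotents has strictly decreasing ranges. Unit
  vectors orthogonal to the next range are separated and all fixed by the first idempotent, against
  compactness.\<close>

lemma idem_descending:
  assumes S: "S \<noteq> {}" "\<And>p. p \<in> S \<Longrightarrow> idem p"
  shows "\<exists>p\<in>S. \<forall>q\<in>S. q \<in> corner p \<longrightarrow> q = p"
proof (rule ccontr)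
  assume "\<not> ?thesis"
  then have step: "\<exists>q. q \<in> S \<and> (q \<in> corner p \<and> q \<noteq> p)" if "p \<in> S" for p using that by blast
  obtain p0 where "p0 \<in> S" using S(1) by blast
  have "\<exists>e. \<forall>n. e n \<in> S \<and> (e (Suc n) \<in> corner (e n) \<and> e (Suc n) \<noteq> e n)"
    by (rule dependent_nat_choice) (use \<open>p0 \<in> S\<close> step in blast)+
  then obtain e where e: "\<And>n. e n \<in> S" "\<And>n. e (Suc n) \<in> corner (e n) \<and> e (Suc n) \<noteq> e n"
    by blast
  define R where "R n = {x. blinfun_apply (e n) x = x}" for n
  have ide: "idem (e n)" for n using e S by blast
  note Rn = idem_range[OF ide]
  have dec: "R (Suc n) \<subseteq> R n" for n
  proof
    fix x assume "x \<in> R (Suc n)"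
    then have "x = e (Suc n) x" by (simp add: R_def)
    then show "x \<in> R n" using e(2)[of n] unfolding R_def corner_def by (metis (no_types, lifting) mem_Collect_eq)
  qed
  have ne: "R (Suc n) \<noteq> R n" for n
  proof
    assume eq: "R (Suc n) = R n"
    have "e (Suc n) x = e n x" for x
    proof -
      have "e n x \<in> R n" using ide[of n] by (simp add: R_def idem_def)
      then have "e (Suc n) (e n x) = e n x" using eq by (auto simp: R_def)
      moreover have "e (Suc n) (e n x) = e (Suc n) x" using e(2)[of n] by (simp add: corner_def)
      ultimately show ?thesis by simp
    qed
    then have "e (Suc n) = e n" by (rule blinfun_eqI)
    then show False using e(2) by blast
  qed
  have mono: "R n \<subseteq> R m" if "m \<le> n" for m n
    using that by (rule lift_Suc_antimono_le[of R, rotated]) (rule dec)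
  have "\<exists>x\<in>R n. norm x = 1 \<and> (\<forall>v\<in>R (Suc n). 1 \<le> norm (x - v))" for n
    using dec ne unfolding R_def by (intro unit_vector_orthogonal Rn(2,3))
  then obtain x where x: "\<And>n. x n \<in> R n" "\<And>n. norm (x n) = 1" "\<And>n v. v \<in> R (Suc n) \<Longrightarrow> 1 \<le> norm (x n - v)"
    by metis
  show False
  proof (rule compact_ops_not_separated[OF idem_compact[OF ide[of 0]], of x 1 1])
    fix m n :: nat assume "m < n"
    then have "x n \<in> R (Suc m)" using x(1)[of n] mono[of "Suc m" n] by auto
    then have "1 \<le> norm (x m - x n)" by (rule x(3))
    moreover have "e 0 (x k) = x k" for k using x(1)[of k] mono[of 0 k] by (auto simp: R_def)
    ultimately show "1 \<le> norm (e 0 (x m) - e 0 (x n))" by simp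
  qed (use x in auto)
qed

text \<open>If \<open>\<mu>\<close> were nonzero, \<open>\<mu> p + m\<close> with nilpotent
  \<open>m\<close> would be injective on the range of \<open>p\<close>. Then \<open>n\<close> would
  be injective there as well, contrary to its nilpotency.\<close>

lemma left_multiple_nilpotent:
  assumes p: "idem p" and n: "n \<in> corner p" "\<And>v. (blinfun_apply n ^^ k) (p v) = 0"
    and x: "x \<in> corner p" and dec: "\<And>v. blinfun_apply x (n v) = \<mu> *\<^sub>C p v + blinfun_apply m v"
    and m: "m \<in> corner p" "\<And>v. (blinfun_apply m ^^ j) (p v) = 0" and p0: "p \<noteq> 0"
  shows "\<mu> = 0"
proof (rule ccontr)
  assume \<mu>: "\<mu> \<noteq> 0"
  have mA: "m \<in> A" using m by (simp add: corner_def)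
  have inj: "v = 0" if v: "p v = v" "n v = 0" for v
  proof -
    have "\<mu> *\<^sub>C v + m v = 0" using dec[of v] v by simp
    then have mv: "m v = (- \<mu>) *\<^sub>C v" by (simp add: add_eq_0_iff)
    have "(blinfun_apply m ^^ i) v = ((- \<mu>) ^ i) *\<^sub>C v" for i
      by (induction i) (auto simp: A_scaleC[OF mA] mv scaleC_scaleC ac_simps)
    then have "((- \<mu>) ^ j) *\<^sub>C v = 0" using m(2)[of v] v by simp
    then have "((- \<mu>) ^ j) = 0 \<or> v = 0" by (simp only: cvs.scale_eq_0_iff)
    then show ?thesis using \<mu> by simp
  qed
  have pn: "p ((blinfun_apply n ^^ i) (p v)) = (blinfun_apply n ^^ i) (p v)" for i v
    using n(1) p by (cases i) (auto simp: corner_def idem_def)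
  have "p v = 0" for v
  proof (rule ccontr)
    assume "p v \<noteq> 0"
    then have "(blinfun_apply n ^^ i) (p v) \<noteq> 0" for i
      by (induction i) (use inj pn in auto)
    then show False using n(2) by blast
  qed
  then have "p = 0" by (intro blinfun_eqI) simp
  then show False using p0 by blast
qed

text \<open>
  Write \<open>x = \<mu> p + n\<close> with \<open>n\<close> nilpotent and let \<open>P\<close> be a module projection onto the submodule
  generated by \<open>n y\<close>. Then \<open>P y = n' y\<close> for a left multiple \<open>n'\<close> of \<open>n\<close>, which is nilpotent as well,
  and \<open>n y = n n' y = n n'\<^sup>2 y = \<dots> = 0\<close>.
\<close>

lemma corner_scalar:
  assumes p: "idem p" "p \<noteq> 0" and min: "\<And>q. q \<in> corner p \<Longrightarrow> idem q \<Longrightarrow> q = 0 \<or> q = p"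
    and x: "x \<in> corner p"
  shows "\<exists>\<mu>. \<forall>v. blinfun_apply x v = \<mu> *\<^sub>C p v"
proof -
  note alg = corner_algebra[OF p(1)]
  have pA: "p \<in> A" and pp: "\<And>v. p (p v) = p v" using p by (auto simp: idem_def)
  have cA: "y \<in> A" and cl: "p (y v) = y v" and cr: "y (p v) = y v" if "y \<in> corner p" for y v
    using that by (auto simp: corner_def)
  obtain F where F: "finite F" "F \<subseteq> {x. p x = x}" "\<And>x. p x = x \<Longrightarrow> x = (\<Sum>f\<in>F. cinner x f *\<^sub>C f)"
    using compact_fixed_onb[OF idem_compact[OF p(1)] idem_range(2)[OF p(1)]] by auto
  have spanF: "{x. p x = x} \<subseteq> cvs.span F"
  proof
    fix x assume "x \<in> {x. p x = x}"
    then have "x = (\<Sum>f\<in>F. cinner x f *\<^sub>C f)" using F(3) by blast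
    also have "\<dots> \<in> cvs.span F" by (intro cvs.span_sum cvs.span_scale cvs.span_base)
    finally show "x \<in> cvs.span F" .
  qed
  obtain v0 where v0: "p v0 \<noteq> 0" using p(2) by (metis blinfun_eqI blinfun.zero_left)
  \<comment> \<open>Take an eigenvalue \<open>\<mu>\<close> of \<open>y\<close> on the
    finite-dimensional range of \<open>p\<close> and put \<open>m = y - \<mu> p\<close>. The Riesz
    idempotent of \<open>p - m\<close> for the eigenvalue \<open>1\<close> is nonzero, hence equal
    to \<open>p\<close> by minimality; so a power of \<open>p - (p - m) = m\<close> vanishes on the
    range of \<open>p\<close>.\<close>
  have decomp: "\<exists>\<mu> m k. m \<in> corner p \<and> (\<forall>v. (blinfun_apply m ^^ k) (p v) = 0) \<and> (\<forall>v. y v = \<mu> *\<^sub>C p v + m v)"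
    if y: "y \<in> corner p" for y
  proof -
    obtain \<mu> u where u: "p u = u" "u \<noteq> 0" "y u = \<mu> *\<^sub>C u"
      using eigenvector_exists[OF A_bounded[OF cA[OF y]] F(1) idem_range(2)[OF p(1)] spanF, of "p v0"]
        cl[OF y] pp v0 by auto
    define m where "m = y - \<mu> *\<^sub>C p"
    have sub: "csubspace (corner p)" using alg(2) by (simp add: op_subalgebra_def)
    have m: "m \<in> corner p"
      unfolding m_def by (intro csubspace_diff[OF sub] csubspace_scaleC[OF sub] y alg(4))
    have c: "p - m \<in> corner p" by (intro csubspace_diff[OF sub] m alg(4))
    have "(p - m) u = u" using u by (simp add: m_def blinfun.diff_left)
    moreover obtain e k where e: "e \<in> corner p" "\<And>v. e (e v) = e v" "\<And>v. (p - m) v = v \<Longrightarrow> e v = v"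
      "\<And>v. ((\<lambda>v. v - blinfun_apply (p - m) v) ^^ k) (e v) = 0"
      using riesz_idempotent[OF alg(1,2,3) c] by blast
    ultimately have "e u = u" by blast
    then have "e \<noteq> 0" using u by auto
    moreover have "idem e" using e(1,2) cA by (simp add: idem_def)
    ultimately have ep: "e = p" using min e(1) by blast
    have "((\<lambda>v. v - blinfun_apply (p - m) v) ^^ i) (p v) = (blinfun_apply m ^^ i) (p v)
        \<and> p ((blinfun_apply m ^^ i) (p v)) = (blinfun_apply m ^^ i) (p v)" for i v
      by (induction i) (simp_all add: pp blinfun.diff_left cl[OF m])
    then have "(blinfun_apply m ^^ k) (p v) = 0" for v using e(4)[of v] unfolding ep by metis
    moreover have "y v = \<mu> *\<^sub>C p v + m v" for v by (simp add: m_def blinfun.diff_left)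
    ultimately show ?thesis using m by blast
  qed
  obtain \<mu> n k where n: "n \<in> corner p" "\<And>v. (blinfun_apply n ^^ k) (p v) = 0" "\<And>v. x v = \<mu> *\<^sub>C p v + n v"
    using decomp[OF x] by blast
  have "n y = 0" if y: "p y = y" for y
  proof -
    define V where "V = cyclic (n y)"
    have V: "submod V" unfolding V_def by (rule submod_cyclic)
    obtain P where P: "mproj V P" using mproj_exists[OF V] by blast
    \<comment> \<open>\<open>V\<close> is only the closure of an orbit. Its compression by
      \<open>p\<close> lies in the finite-dimensional, hence closed, space \<open>Z\<close>, so
      \<open>P y\<close> is exactly a corner multiple of \<open>n y\<close>.\<close>
    define Z where "Z = (\<lambda>z. blinfun_apply z (n y)) ` corner p"
    have sub: "csubspace (corner p)" using alg(2) by (simp add: op_subalgebra_def)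
    have Z: "csubspace Z"
      unfolding csubspace_def Z_def
    proof (intro conjI ballI allI)
      show "0 \<in> (\<lambda>z. blinfun_apply z (n y)) ` corner p"
        using csubspace_0[OF sub] by (intro image_eqI[of _ _ 0]) simp_all
      show "u + v \<in> (\<lambda>z. blinfun_apply z (n y)) ` corner p"
        if "u \<in> (\<lambda>z. blinfun_apply z (n y)) ` corner p" "v \<in> (\<lambda>z. blinfun_apply z (n y)) ` corner p" for u v
        using that csubspace_add[OF sub] by (auto simp flip: blinfun.add_left)
      show "c *\<^sub>C u \<in> (\<lambda>z. blinfun_apply z (n y)) ` corner p"
        if "u \<in> (\<lambda>z. blinfun_apply z (n y)) ` corner p" for c u
        using that csubspace_scaleC[OF sub] by (auto simp flip: blinfun_scaleC)
    qed
    have clZ: "closed Z"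
      by (rule compact_fixed_closed[OF idem_compact[OF p(1)] Z]) (auto simp: Z_def cl)
    have pV: "p v \<in> Z" if "v \<in> V" for v
    proof -
      have "V \<subseteq> blinfun_apply p -` Z"
        unfolding V_def cyclic_def
      proof (rule closure_minimal)
        show "(\<lambda>a. blinfun_apply a (n y)) ` A \<subseteq> blinfun_apply p -` Z"
        proof clarsimp
          fix a assume "a \<in> A"
          then have "(p o\<^sub>L (a o\<^sub>L p)) (n y) \<in> Z" unfolding Z_def by (intro imageI cornerI p(1))
          then show "p (a (n y)) \<in> Z" by (simp add: cl[OF n(1)])
        qed
        show "closed (blinfun_apply p -` Z)"
          by (intro closed_vimage clZ continuous_intros)
      qed
      then show ?thesis using that by blast
    qed
    have "P y = p (P y)" using mprojD(4)[OF P pA, of y] y by simp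
    then have "P y \<in> Z" using pV[OF mprojD(2)[OF P]] by metis
    then obtain z where z: "z \<in> corner p" "P y = z (n y)" by (auto simp: Z_def)
    have zn: "(z o\<^sub>L n) \<in> corner p" using alg(2) z(1) n(1) by (simp add: op_subalgebra_def)
    obtain \<nu> m j where m: "m \<in> corner p" "\<And>v. (blinfun_apply m ^^ j) (p v) = 0" "\<And>v. (z o\<^sub>L n) v = \<nu> *\<^sub>C p v + m v"
      using decomp[OF zn] by blast
    have "\<nu> = 0"
      by (rule left_multiple_nilpotent[OF p(1) n(1,2) z(1) _ m(1,2) p(2)]) (use m(3) in simp)
    then have zm: "z (n v) = m v" for v using m(3)[of v] by (simp add: cvs.scale_zero_left)
    have nV: "n v \<in> V \<Longrightarrow> n v = n (P v)" for v
      using mprojD(3,4)[OF P] cA[OF n(1)] by metis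
    \<comment> \<open>The left factor \<open>w\<close> is needed because \<open>n y\<close> itself
      is not known to belong to the module it generates.\<close>
    have key: "w (n y) = w (n (m y))" if w: "w \<in> corner p" for w
    proof -
      have "w (n y) \<in> V" unfolding V_def by (rule cyclic_base[OF cA[OF w]])
      then have "w (n y) = P (w (n y))" using mprojD(3)[OF P] by simp
      also have "\<dots> = w (n (P y))" using mprojD(4)[OF P] cA[OF w] cA[OF n(1)] by simp
      finally show ?thesis using z(2) zm by simp
    qed
    have "w (n y) = w (n ((blinfun_apply m ^^ i) y))" if "w \<in> corner p" for w i
      using that
    proof (induction i arbitrary: w)
      case (Suc i)
      have "w (n y) = w (n (m y))" by (rule key[OF Suc.prems])
      also have "\<dots> = (w o\<^sub>L (n o\<^sub>L z)) (n y)" by (simp add: zm)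
      also have "(w o\<^sub>L (n o\<^sub>L z)) \<in> corner p"
        using alg(2) z(1) n(1) Suc.prems by (simp add: op_subalgebra_def)
      from Suc.IH[OF this] have "(w o\<^sub>L (n o\<^sub>L z)) (n y) = w (n (z (n ((blinfun_apply m ^^ i) y))))" by simp
      also have "\<dots> = w (n ((blinfun_apply m ^^ Suc i) y))" by (simp add: zm)
      finally show ?case .
    qed simp
    from this[OF alg(4), of j] have "p (n y) = p (n 0)" using m(2)[of y] y by simp
    then show ?thesis by (simp add: cl[OF n(1)])
  qed
  then have "n v = 0" for v using cr[OF n(1), of v] pp[of v] by metis
  then show ?thesis using n(3) by auto
qed

text \<open>Refuting \<open>volterra_module\<close> gives \<open>c z = z\<close> for some nonzero
  \<open>z\<close>, and the Riesz idempotent of \<open>c\<close> fixes \<open>z\<close>. A minimal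
  element is then sought only among idempotents that act nontrivially on \<open>W\<close>.\<close>

theorem minimal_idem_exists:
  assumes W: "submod W" and nd: "\<And>x. x \<in> W \<Longrightarrow> (\<And>a. a \<in> A \<Longrightarrow> blinfun_apply a x = 0) \<Longrightarrow> x = 0"
    and W0: "W \<noteq> {0}"
  shows "\<exists>p. minimal_idem p \<and> (\<exists>x\<in>W. p x \<noteq> 0)"
proof -
  have "\<exists>c\<in>A. \<exists>z\<in>W. c z = z \<and> z \<noteq> 0"
  proof (rule ccontr)
    assume "\<not> ?thesis"
    then interpret volterra_module A K W
      by unfold_locales (use W nd in auto)
    show False using volterra_trivial W0 by blast
  qed
  then obtain c z where c: "c \<in> A" "z \<in> W" "c z = z" "z \<noteq> 0" by blast
  define S where "S = {e. idem e \<and> (\<exists>x\<in>W. e x \<noteq> 0)}"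
  obtain e where "e \<in> A" "\<And>x. e (e x) = e x" "e z = z"
    using riesz_idempotent[OF A_compact A_alg A_closed c(1)] c(3) by blast
  then have "e \<in> S" using c by (auto simp: S_def idem_def intro!: bexI[of _ z])
  then have "\<exists>p\<in>S. \<forall>q\<in>S. q \<in> corner p \<longrightarrow> q = p"
    by (intro idem_descending) (auto simp: S_def)
  then obtain p where p: "p \<in> S" "\<And>q. q \<in> S \<Longrightarrow> q \<in> corner p \<Longrightarrow> q = p"
    by blast
  have pi: "idem p" and p0: "p \<noteq> 0" using p(1) by (auto simp: S_def)
  \<comment> \<open>If \<open>q\<close> vanishes on \<open>W\<close>, the complementary idempotent
    \<open>p - q\<close> does not and must equal \<open>p\<close>. So minimality holds among all
    idempotents of the corner, including those outside \<open>S\<close>.\<close>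
  have min: "q = 0 \<or> q = p" if q: "q \<in> corner p" "idem q" for q
  proof (cases "\<exists>x\<in>W. q x \<noteq> 0")
    case True
    then show ?thesis using p(2)[of q] q by (simp add: S_def)
  next
    case False
    have sub: "csubspace (corner p)" using corner_algebra(2)[OF pi] by (simp add: op_subalgebra_def)
    have r: "p - q \<in> corner p" by (intro csubspace_diff[OF sub] corner_algebra(4)[OF pi] q(1))
    moreover have "idem (p - q)"
      using q pi r by (auto simp: idem_def corner_def blinfun.diff_left blinfun.diff_right)
    moreover have "\<exists>x\<in>W. (p - q) x \<noteq> 0"
      using False p(1) by (auto simp: S_def blinfun.diff_left)
    ultimately have "p - q = p" using p(2)[of "p - q"] by (simp add: S_def)
    then show ?thesis by simp
  qed
  have "\<exists>c. \<forall>x. p (a (p x)) = c *\<^sub>C p x" if "a \<in> A" for a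
    using corner_scalar[OF pi p0 min cornerI[OF pi that]] by simp
  then have "minimal_idem p" using pi p0 by (simp add: minimal_idem_def)
  then show ?thesis using p(1) by (auto simp: S_def)
qed

end

section \<open>Comparison of a module with a Hilbert space tensor product\<close>

text \<open>A scalar matrix keeps its norm when it acts on tuples of vectors: expand the vectors in
  one finite orthonormal system and use the scalar bound for each coordinate.\<close>

lemma matrix_tensor_bound:
  fixes v :: "'i \<Rightarrow> 'a::chilbert_space"
  assumes B: "finite B"
    and bd: "\<And>c. (\<Sum>j\<in>B. (cmod (\<Sum>i\<in>B. \<gamma> j i * c i))\<^sup>2) \<le> D * (\<Sum>i\<in>B. (cmod (c i))\<^sup>2)"
  shows "(\<Sum>j\<in>B. (norm (\<Sum>i\<in>B. \<gamma> j i *\<^sub>C v i))\<^sup>2) \<le> D * (\<Sum>i\<in>B. (norm (v i))\<^sup>2)"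
proof -
  obtain F where F: "finite F" "orthonormal F" "\<And>x. x \<in> v ` B \<Longrightarrow> x = (\<Sum>f\<in>F. cinner x f *\<^sub>C f)"
    using gram_schmidt[of "v ` B"] B by blast
  have sq: "(norm w)\<^sup>2 = (\<Sum>f\<in>F. (cmod (cinner w f))\<^sup>2)" if "w = (\<Sum>f\<in>F. cinner w f *\<^sub>C f)" for w
    by (subst that) (rule norm_sum_orthonormal[OF F(1,2)])
  have comb: "(\<Sum>i\<in>B. \<gamma> j i *\<^sub>C v i) = (\<Sum>f\<in>F. cinner (\<Sum>i\<in>B. \<gamma> j i *\<^sub>C v i) f *\<^sub>C f)" for j
  proof -
    have "(\<Sum>f\<in>F. cinner (\<Sum>i\<in>B. \<gamma> j i *\<^sub>C v i) f *\<^sub>C f)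
        = (\<Sum>f\<in>F. \<Sum>i\<in>B. \<gamma> j i *\<^sub>C (cinner (v i) f *\<^sub>C f))"
      by (simp add: cinner_sum_left cinner_scaleC_left cvs.scale_sum_left scaleC_scaleC)
    also have "\<dots> = (\<Sum>i\<in>B. \<gamma> j i *\<^sub>C (\<Sum>f\<in>F. cinner (v i) f *\<^sub>C f))"
      by (subst sum.swap) (simp add: cvs.scale_sum_right)
    also have "\<dots> = (\<Sum>i\<in>B. \<gamma> j i *\<^sub>C v i)"
      using F(3) by (intro sum.cong) auto
    finally show ?thesis by simp
  qed
  have "(\<Sum>j\<in>B. (norm (\<Sum>i\<in>B. \<gamma> j i *\<^sub>C v i))\<^sup>2)
      = (\<Sum>f\<in>F. \<Sum>j\<in>B. (cmod (\<Sum>i\<in>B. \<gamma> j i * cinner (v i) f))\<^sup>2)"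
    by (subst sum.swap) (simp add: sq[OF comb] cinner_sum_left cinner_scaleC_left)
  also have "\<dots> \<le> (\<Sum>f\<in>F. D * (\<Sum>i\<in>B. (cmod (cinner (v i) f))\<^sup>2))"
    by (intro sum_mono bd)
  also have "\<dots> = D * (\<Sum>i\<in>B. \<Sum>f\<in>F. (cmod (cinner (v i) f))\<^sup>2)"
    by (subst sum.swap) (simp add: sum_distrib_left)
  also have "(\<Sum>i\<in>B. \<Sum>f\<in>F. (cmod (cinner (v i) f))\<^sup>2) = (\<Sum>i\<in>B. (norm (v i))\<^sup>2)"
    using sq[OF F(3)] by (intro sum.cong) auto
  finally show ?thesis .
qed

lemma cinner_slot: "cinner (slot i x) (slot j y) = (if i = j then cinner x y else 0)"
proof -
  have "cinner (slot i x) (slot j y) = (\<Sum>n. cinner (if n = i then x else 0) (if n = j then y else 0))"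
    by (simp add: cinner_ell2.rep_eq slot.rep_eq)
  also have "\<dots> = (\<Sum>n\<in>{i}. cinner (if n = i then x else 0) (if n = j then y else 0))"
    by (rule suminf_finite) auto
  finally show ?thesis by simp
qed

lemma sqrt_sum_norm_add:
  fixes u v :: "nat \<Rightarrow> 'a::chilbert_space"
  shows "sqrt (\<Sum>i<m. (norm (u i + v i))\<^sup>2) \<le> sqrt (\<Sum>i<m. (norm (u i))\<^sup>2) + sqrt (\<Sum>i<m. (norm (v i))\<^sup>2)"
proof -
  have n: "sqrt (\<Sum>i<m. (norm (w i))\<^sup>2) = norm (\<Sum>i<m. slot i (w i))" for w :: "nat \<Rightarrow> 'a"
    by (subst norm_sum_slots[symmetric]) auto
  have "(\<Sum>i<m. slot i (u i + v i)) = (\<Sum>i<m. slot i (u i)) + (\<Sum>i<m. slot i (v i))"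
    by (simp add: slot_add sum.distrib)
  then show ?thesis unfolding n by (simp only: norm_triangle_ineq)
qed

text \<open>A finite piece of the intended decomposition. \<open>theta\<close> forms the vector,
  \<open>nsq\<close> is the squared norm of its orthogonal coordinates, and
  \<open>theta_upper\<close> and \<open>theta_lower\<close> compare the two with constants
  independent of \<open>m\<close>.\<close>

locale theta_system = crp_algebra +
  fixes m :: nat and p :: "nat \<Rightarrow> 'a \<Rightarrow>\<^sub>L 'a" and \<xi> \<zeta> :: "nat \<Rightarrow> 'a"
  assumes minimal: "i < m \<Longrightarrow> minimal_idem (p i)"
    and xi: "i < m \<Longrightarrow> p i (\<xi> i) = \<xi> i" "i < m \<Longrightarrow> norm (\<xi> i) = 1"
    and zeta: "i < m \<Longrightarrow> p i (\<zeta> i) = \<zeta> i"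
    and disjoint: "i < m \<Longrightarrow> j < m \<Longrightarrow> p i \<noteq> p j \<Longrightarrow> a \<in> A \<Longrightarrow> p i (blinfun_apply a (p j x)) = 0"
    and xi_eq: "i < m \<Longrightarrow> j < m \<Longrightarrow> p i = p j \<Longrightarrow> \<xi> i = \<xi> j"
    and zeta_orth: "i < m \<Longrightarrow> j < m \<Longrightarrow> p i = p j \<Longrightarrow> cinner (\<zeta> i) (\<zeta> j) = (if i = j then 1 else 0)"
begin

definition blk :: "nat \<Rightarrow> nat set" where "blk j = {i\<in>{..<m}. p i = p j}"

text \<open>\<open>\<gamma>\<close> acts as a scalar matrix that is block diagonal with respect to
  equality of the idempotents \<open>p i\<close>.\<close>

definition act :: "(nat \<Rightarrow> nat \<Rightarrow> complex) \<Rightarrow> (nat \<Rightarrow> 'a \<Rightarrow>\<^sub>L 'a) \<Rightarrow> nat \<Rightarrow> 'a \<Rightarrow>\<^sub>L 'a" where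
  "act \<gamma> a j = (\<Sum>i\<in>blk j. \<gamma> j i *\<^sub>C a i)"

definition nsq :: "(nat \<Rightarrow> 'a \<Rightarrow>\<^sub>L 'a) \<Rightarrow> real" where "nsq a = (\<Sum>i<m. (norm (a i (\<xi> i)))\<^sup>2)"

definition theta :: "(nat \<Rightarrow> 'a \<Rightarrow>\<^sub>L 'a) \<Rightarrow> 'a" where "theta a = (\<Sum>i<m. a i (\<zeta> i))"

definition fam :: "(nat \<Rightarrow> 'a \<Rightarrow>\<^sub>L 'a) \<Rightarrow> bool" where "fam a \<longleftrightarrow> (\<forall>i<m. a i \<in> A)"

lemma nsq_nonneg: "0 \<le> nsq a" unfolding nsq_def by (intro sum_nonneg) auto

lemma act_fam: "fam a \<Longrightarrow> fam (act \<gamma> a)"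
  unfolding fam_def act_def
  by (auto simp: blk_def intro!: csubspace_sum[OF A_csubspace] csubspace_scaleC[OF A_csubspace])

text \<open>All \<open>\<xi> i\<close> within a block coincide, so evaluation at them commutes with
  the matrix and \<open>matrix_tensor_bound\<close> applies block by block.\<close>

lemma nsq_act:
  assumes bd: "\<And>j c. j < m \<Longrightarrow> (\<Sum>k\<in>blk j. (cmod (\<Sum>i\<in>blk j. \<gamma> k i * c i))\<^sup>2) \<le> D * (\<Sum>i\<in>blk j. (cmod (c i))\<^sup>2)"
  shows "nsq (act \<gamma> a) \<le> D * nsq a"
proof -
  have group: "(\<Sum>i<m. h i) = (\<Sum>q\<in>p ` {..<m}. \<Sum>i\<in>{i\<in>{..<m}. p i = q}. h i)" for h :: "nat \<Rightarrow> real"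
    by (rule sum.group[symmetric]) auto
  have "(\<Sum>k\<in>{i\<in>{..<m}. p i = q}. (norm (act \<gamma> a k (\<xi> k)))\<^sup>2)
      \<le> D * (\<Sum>i\<in>{i\<in>{..<m}. p i = q}. (norm (a i (\<xi> i)))\<^sup>2)" if "q \<in> p ` {..<m}" for q
  proof -
    obtain j where j: "j < m" "q = p j" using \<open>q \<in> p ` {..<m}\<close> by auto
    have B: "{i\<in>{..<m}. p i = q} = blk j" using j by (simp add: blk_def)
    have "act \<gamma> a k (\<xi> k) = (\<Sum>i\<in>blk j. \<gamma> k i *\<^sub>C a i (\<xi> i))" if k: "k \<in> blk j" for k
    proof -
      have bk: "blk k = blk j" and km: "k < m" using k by (auto simp: blk_def)
      have "\<xi> k = \<xi> i" if "i \<in> blk j" for i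
        using xi_eq[OF km, of i] that k by (auto simp: blk_def)
      then show ?thesis unfolding act_def bk blinfun.sum_left by (intro sum.cong) auto
    qed
    then have "(\<Sum>k\<in>blk j. (norm (act \<gamma> a k (\<xi> k)))\<^sup>2) = (\<Sum>k\<in>blk j. (norm (\<Sum>i\<in>blk j. \<gamma> k i *\<^sub>C a i (\<xi> i)))\<^sup>2)"
      by (intro sum.cong) auto
    also have "\<dots> \<le> D * (\<Sum>i\<in>blk j. (norm (a i (\<xi> i)))\<^sup>2)"
      by (rule matrix_tensor_bound[OF _ bd[OF j(1)]]) (simp add: blk_def)
    finally show ?thesis unfolding B .
  qed
  note blockwise = this
  have "nsq (act \<gamma> a) = (\<Sum>q\<in>p ` {..<m}. \<Sum>k\<in>{i\<in>{..<m}. p i = q}. (norm (act \<gamma> a k (\<xi> k)))\<^sup>2)"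
    unfolding nsq_def by (rule group)
  also have "\<dots> \<le> (\<Sum>q\<in>p ` {..<m}. D * (\<Sum>i\<in>{i\<in>{..<m}. p i = q}. (norm (a i (\<xi> i)))\<^sup>2))"
    by (rule sum_mono) (rule blockwise)
  also have "\<dots> = D * nsq a" unfolding nsq_def group[of "\<lambda>i. (norm (a i (\<xi> i)))\<^sup>2"] by (rule sum_distrib_left[symmetric])
  finally show ?thesis .
qed

text \<open>
  Let \<open>P\<close> be a module projection onto the closed submodule generated by the vectors
  \<open>g i = (\<xi> i in slot i, l \<zeta> i in slot m)\<close>. As \<open>p i\<close> is minimal, \<open>P\<close> sends both components of \<open>g i\<close>
  to scalar combinations of the \<open>g j\<close> with \<open>p j = p i\<close>; their coefficients are \<open>\<alpha>\<close> and \<open>\<beta>\<close>.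
\<close>

lemma theta_split:
  fixes l :: real
  assumes l: "l > 0"
  shows "\<exists>\<alpha> \<beta>. \<forall>a. fam a \<longrightarrow>
      l * norm (theta (act \<alpha> a)) \<le> K * sqrt (nsq a)
    \<and> sqrt (nsq (act \<beta> a)) \<le> K * norm (theta a)
    \<and> (\<forall>j<m. a j = act \<alpha> a j + complex_of_real l *\<^sub>C act \<beta> a j)
    \<and> nsq (act \<alpha> a) \<le> K\<^sup>2 / (1 + l\<^sup>2) * nsq a
    \<and> nsq (act \<beta> a) \<le> K\<^sup>2 / (1 + l\<^sup>2) * nsq a
    \<and> (m = 1 \<longrightarrow> (\<exists>s t. act \<alpha> a 0 = s *\<^sub>C a 0 \<and> act \<beta> a 0 = t *\<^sub>C a 0 \<and> s + complex_of_real l * t = 1 \<and> (cmod t)\<^sup>2 \<le> K\<^sup>2 / (1 + l\<^sup>2)))"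
proof -
  define h where "h i = slot i (\<xi> i)" for i
  define k where "k i = slot m (\<zeta> i)" for i
  define g where "g i = h i + complex_of_real l *\<^sub>C k i" for i
  define cmb where "cmb v a = (\<Sum>i<m. amplify (a i) (v i))" for v :: "nat \<Rightarrow> 'a ell2" and a :: "nat \<Rightarrow> 'a \<Rightarrow>\<^sub>L 'a"
  have pA: "p i \<in> A" and pp: "p i (p i x) = p i x" if "i < m" for i x
    using minimal[OF that] by (auto simp: minimal_idem_def idem_def)
  have cmb_h: "cmb h a = (\<Sum>i<m. slot i (a i (\<xi> i)))" for a
    by (simp add: cmb_def h_def slot_amplify)
  have cmb_k: "cmb k a = slot m (theta a)" for a
    by (simp add: cmb_def k_def theta_def slot_amplify slot_sum)
  have cmb_g: "cmb g a = cmb h a + complex_of_real l *\<^sub>C cmb k a" if "fam a" for a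
    using that by (simp add: cmb_def g_def fam_def amplify_add amplify_scaleC A_bounded sum.distrib cvs.scale_sum_right)
  have n_h: "norm (cmb h a) = sqrt (nsq a)" for a
    unfolding cmb_h nsq_def using norm_sum_slots[of "{..<m}" "\<lambda>i. a i (\<xi> i)"] by (metis finite_lessThan real_sqrt_abs abs_norm_cancel)
  have n_k: "norm (cmb k a) = norm (theta a)" for a by (simp add: cmb_k)
  have n_g: "(norm (cmb g a))\<^sup>2 = nsq a + l\<^sup>2 * (norm (theta a))\<^sup>2" if a: "fam a" for a
  proof -
    define w where "w i = (if i < m then a i (\<xi> i) else complex_of_real l *\<^sub>C theta a)" for i
    have "cmb g a = (\<Sum>i<Suc m. slot i (w i))"
      by (simp add: cmb_g[OF a] cmb_h cmb_k w_def slot_scaleC)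
    then have "(norm (cmb g a))\<^sup>2 = (\<Sum>i<Suc m. (norm (w i))\<^sup>2)"
      by (simp only: norm_sum_slots[OF finite_lessThan])
    then show ?thesis by (simp add: w_def nsq_def norm_scaleC power_mult_distrib)
  qed
  define G0 where "G0 = cmb g ` {a. fam a}"
  define G where "G = closure G0"
  have addG: "cmb v (\<lambda>i. a i + b i) = cmb v a + cmb v b" for v a b
    by (simp add: cmb_def amplify_op_add sum.distrib)
  have sclG: "cmb v (\<lambda>i. c *\<^sub>C a i) = c *\<^sub>C cmb v a" for v a c
    by (simp add: cmb_def amplify_op_scaleC cvs.scale_sum_right)
  have cG0: "csubspace G0"
    unfolding csubspace_def G0_def
  proof (intro conjI ballI allI)
    show "0 \<in> cmb g ` {a. fam a}"
      by (rule image_eqI[of _ _ "\<lambda>_. 0"]) (simp_all add: cmb_def fam_def csubspace_0[OF A_csubspace])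
    fix x assume "x \<in> cmb g ` {a. fam a}"
    then obtain a where a: "fam a" "x = cmb g a" by blast
    show "c *\<^sub>C x \<in> cmb g ` {a. fam a}" for c
      using a by (intro image_eqI[of _ _ "\<lambda>i. c *\<^sub>C a i"]) (auto simp: sclG fam_def csubspace_scaleC[OF A_csubspace])
    fix y assume "y \<in> cmb g ` {a. fam a}"
    then obtain b where b: "fam b" "y = cmb g b" by blast
    show "x + y \<in> cmb g ` {a. fam a}"
      using a b by (intro image_eqI[of _ _ "\<lambda>i. a i + b i"]) (auto simp: addG fam_def csubspace_add[OF A_csubspace])
  qed
  have subG: "is_submodule A G"
    unfolding is_submodule_def
  proof (intro conjI ballI)
    show "csubspace G" unfolding G_def by (rule csubspace_closure[OF cG0])
    fix T x assume T: "T \<in> A" and x: "x \<in> G"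
    obtain f where f: "\<And>n. f n \<in> G0" "f \<longlonglongrightarrow> x" using x unfolding G_def closure_sequential by blast
    have "amplify T (f n) \<in> G0" for n
    proof -
      obtain a where a: "fam a" "f n = cmb g a" using f(1)[of n] by (auto simp: G0_def)
      have "amplify T (cmb g a) = cmb g (\<lambda>i. T o\<^sub>L a i)"
        using bounded_linear.linear[OF bounded_linear_amplify[OF A_bounded[OF T]]]
        by (simp add: cmb_def linear_sum amplify_compose)
      then show ?thesis using a T by (auto simp: G0_def fam_def A_compose intro!: image_eqI[of _ _ "\<lambda>i. T o\<^sub>L a i"])
    qed
    moreover have "(\<lambda>n. amplify T (f n)) \<longlonglongrightarrow> amplify T x"
      by (rule bounded_linear.tendsto[OF bounded_linear_amplify[OF A_bounded[OF T]] f(2)])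
    ultimately show "amplify T x \<in> G"
      unfolding G_def closure_sequential by (intro exI[of _ "\<lambda>n. amplify T (f n)"]) auto
  qed (simp add: G_def)
  obtain P where P: "module_proj A G P" "norm P \<le> K" using uniform[OF subG] by blast
  have Pb: "P \<in> bounded_ops" and PG: "\<And>x. P x \<in> G" and Pid: "\<And>x. x \<in> G \<Longrightarrow> P x = x"
    and Pcom: "\<And>T x. T \<in> A \<Longrightarrow> P (amplify T x) = amplify T (P x)"
    using P(1) by (auto simp: module_proj_def)
  have Pn: "norm (P x) \<le> K * norm x" for x
    by (rule order_trans[OF norm_blinfun mult_right_mono[OF P(2)]]) simp
  have pg: "amplify (p i) (h i) = h i" "amplify (p i) (k i) = k i" if "i < m" for i
    using xi(1)[OF that] zeta[OF that] by (simp_all add: h_def k_def flip: slot_amplify)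
  have pg': "amplify (p i) (g i) = g i" if "i < m" for i
    using pg[OF that] A_bounded[OF pA[OF that]] by (simp add: g_def amplify_add amplify_scaleC)
  have gG: "g i \<in> G" if i: "i < m" for i
  proof -
    define b where "b j = (if j = i then p i else 0)" for j
    have "cmb g b = (\<Sum>j<m. if j = i then amplify (p i) (g i) else 0)"
      unfolding cmb_def b_def by (intro sum.cong) auto
    also have "\<dots> = g i" using i pg'[OF i] by simp
    finally have "g i = cmb g b" by simp
    moreover have "fam b" using pA[OF i] by (simp add: fam_def b_def csubspace_0[OF A_csubspace])
    ultimately show ?thesis unfolding G_def G0_def by (intro closure_subset[THEN subsetD]) auto
  qed
  have blk_if: "(\<Sum>j<m. if j \<in> blk i then f j else 0) = (\<Sum>j\<in>blk i. f j)"
    for f :: "nat \<Rightarrow> 'b::comm_monoid_add" and i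
  proof -
    have "{..<m} \<inter> blk i = blk i" by (auto simp: blk_def)
    then show ?thesis using sum.inter_restrict[of "{..<m}" f "blk i"] by simp
  qed
  define q where "q = complex_of_real (1 + l\<^sup>2)"
  have chh: "cinner (g i) (g j) = (if i = j then q else 0)" if ij: "i < m" "j < m" "p i = p j" for i j
  proof -
    have "cinner (g i) (g j) = cinner (h i) (h j) + complex_of_real (l * l) * cinner (k i) (k j)"
      using ij by (simp add: g_def h_def k_def cinner_add_left cinner_add_right cinner_scaleC_left cinner_scaleC_right cinner_slot)
    moreover have "cinner (h i) (h j) = (if i = j then 1 else 0)"
      using xi(2)[OF ij(1)] xi(2)[OF ij(2)] by (simp add: h_def cinner_slot cinner_self)
    moreover have "cinner (k i) (k j) = (if i = j then 1 else 0)"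
      using zeta_orth[OF ij] by (simp add: k_def cinner_slot)
    ultimately show ?thesis by (simp add: power2_eq_square q_def)
  qed
  have l2: "1 + l\<^sup>2 > 0" by (simp add: add_pos_nonneg)
  have q0: "q \<noteq> 0"
  proof
    assume "q = 0"
    then have "1 + l\<^sup>2 = 0" unfolding q_def by (rule of_real_eq_0_iff[THEN iffD1])
    with l2 show False by linarith
  qed
  define cf where "cf x j = cinner x (g j) / q" for x j
  have cf_g: "cf (g i) j = (if i = j then 1 else 0)" if "i < m" "j < m" "p i = p j" for i j
    using chh[OF that] q0 by (simp add: cf_def)
  have cfl: "cf (x + y) j = cf x j + cf y j" "cf (c *\<^sub>C x) j = c * cf x j" "cf 0 j = 0" for x y c j
    by (simp_all add: cf_def cinner_add_left cinner_scaleC_left add_divide_distrib)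
  have cfsum: "cf (sum f J) j = (\<Sum>i\<in>J. cf (f i) j)" for f J j
    by (simp add: cf_def cinner_sum_left sum_divide_distrib)
  \<comment> \<open>On generators \<open>p i\<close> leaves only multiples of the \<open>g j\<close>
    in the block of \<open>i\<close>: minimality gives scalars inside the block and inequivalence
    gives \<open>0\<close> outside. The span of these \<open>g j\<close> is closed, so passing to
    the closure \<open>G\<close> adds nothing.\<close>
  have expand: "x = (\<Sum>j\<in>blk i. cf x j *\<^sub>C g j)" if x: "x \<in> G" "amplify (p i) x = x" and i: "i < m" for x i
  proof -
    define Z where "Z = {y. y = (\<Sum>j\<in>blk i. cf y j *\<^sub>C g j)}"
    have "continuous_on UNIV (\<lambda>y. cf y j *\<^sub>C g j)" for j
      unfolding continuous_on_def cf_def using q0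
      by (auto intro!: tendsto_scaleC tendsto_divide tendsto_cinner tendsto_ident_at tendsto_const)
    then have "closed Z" unfolding Z_def by (intro closed_Collect_eq continuous_intros) auto
    moreover have "amplify (p i) y \<in> Z" if y: "y \<in> G0" for y
    proof -
      obtain a where a: "fam a" "y = cmb g a" using y by (auto simp: G0_def)
      have ex: "\<forall>j. \<exists>c. j < m \<longrightarrow> (\<forall>v. p j (a j (p j v)) = c *\<^sub>C p j v)"
        using a(1) minimal unfolding fam_def minimal_idem_def by blast
      obtain c where c: "\<And>j v. j < m \<Longrightarrow> p j (a j (p j v)) = c j *\<^sub>C p j v"
        using choice[OF ex] by blast
      have "amplify (p i) y = (\<Sum>j<m. amplify (p i) (amplify (a j) (g j)))"
        using bounded_linear.linear[OF bounded_linear_amplify[OF A_bounded[OF pA[OF i]]]]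
        by (simp add: a(2) cmb_def linear_sum)
      also have "\<dots> = (\<Sum>j<m. if j \<in> blk i then c j *\<^sub>C g j else 0)"
      proof (rule sum.cong)
        fix j assume "j \<in> {..<m}"
        then have j: "j < m" by simp
        have aj: "a j \<in> A" using a(1) j by (simp add: fam_def)
        have e: "amplify (p i) (amplify (a j) (g j)) = amplify (p i o\<^sub>L (a j o\<^sub>L p j)) (g j)"
          by (simp add: amplify_compose pg'[OF j])
        show "amplify (p i) (amplify (a j) (g j)) = (if j \<in> blk i then c j *\<^sub>C g j else 0)"
        proof (cases "p j = p i")
          case True
          have "(p i o\<^sub>L (a j o\<^sub>L p j)) = c j *\<^sub>C p j"
            by (rule blinfun_eqI) (simp add: c[OF j] flip: True)
          then show ?thesis
            unfolding e using True j pg'[OF j] by (simp add: blk_def amplify_op_scaleC)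
        next
          case False
          have "(p i o\<^sub>L (a j o\<^sub>L p j)) = 0"
            by (rule blinfun_eqI) (use disjoint[OF i j _ aj] False in auto)
          then show ?thesis unfolding e using False by (simp add: blk_def)
        qed
      qed simp
      also have "\<dots> = (\<Sum>j\<in>blk i. c j *\<^sub>C g j)"
        by (rule blk_if)
      finally have py: "amplify (p i) y = (\<Sum>j\<in>blk i. c j *\<^sub>C g j)" .
      have "cf (\<Sum>j\<in>blk i. c j *\<^sub>C g j) n = c n" if n: "n \<in> blk i" for n
      proof -
        have "cf (\<Sum>j\<in>blk i. c j *\<^sub>C g j) n = (\<Sum>j\<in>blk i. if j = n then c j else 0)"
          unfolding cfsum cfl using n cf_g by (intro sum.cong) (auto simp: blk_def)
        then show ?thesis using n by (simp add: blk_def)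
      qed
      then have "(\<Sum>n\<in>blk i. cf (amplify (p i) y) n *\<^sub>C g n) = (\<Sum>j\<in>blk i. c j *\<^sub>C g j)"
        unfolding py by (intro sum.cong) auto
      then show ?thesis unfolding Z_def using py by simp
    qed
    then have "G0 \<subseteq> amplify (p i) -` Z" by blast
    moreover have "closed (amplify (p i) -` Z)"
      by (intro closed_vimage \<open>closed Z\<close> linear_continuous_on bounded_linear_amplify A_bounded pA i)
    ultimately have "G \<subseteq> amplify (p i) -` Z" unfolding G_def by (intro closure_minimal)
    then have "amplify (p i) x \<in> Z" using x(1) by blast
    then show ?thesis unfolding x(2) by (simp add: Z_def)
  qed
  define \<alpha> where "\<alpha> j i = cf (P (h i)) j" for j i
  define \<beta> where "\<beta> j i = cf (P (k i)) j" for j i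
  have Ph: "P (h i) = (\<Sum>j\<in>blk i. \<alpha> j i *\<^sub>C g j)" if i: "i < m" for i
    unfolding \<alpha>_def by (rule expand[OF PG _ i]) (simp add: pg(1)[OF i] flip: Pcom[OF pA[OF i]])
  have Pk: "P (k i) = (\<Sum>j\<in>blk i. \<beta> j i *\<^sub>C g j)" if i: "i < m" for i
    unfolding \<beta>_def by (rule expand[OF PG _ i]) (simp add: pg(2)[OF i] flip: Pcom[OF pA[OF i]])
  have ab: "\<alpha> j i + complex_of_real l * \<beta> j i = (if i = j then 1 else 0)" if ij: "i < m" "j \<in> blk i" for i j
  proof -
    have "\<alpha> j i + complex_of_real l * \<beta> j i = cf (P (g i)) j"
      by (simp add: \<alpha>_def \<beta>_def g_def blinfun.add_right bounded_opsD[OF Pb] cfl)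
    also have "P (g i) = g i" by (rule Pid[OF gG[OF ij(1)]])
    finally show ?thesis using cf_g[OF ij(1), of j] ij by (auto simp: blk_def)
  qed
  have blk_sym: "j \<in> blk i \<longleftrightarrow> i \<in> blk j" if "i < m" "j < m" for i j using that by (auto simp: blk_def)
  have Pcmb: "P (cmb v a) = cmb g (act \<gamma> a)"
    if v: "\<And>i. i < m \<Longrightarrow> P (v i) = (\<Sum>j\<in>blk i. \<gamma> j i *\<^sub>C g j)" and a: "fam a" for v \<gamma> a
  proof -
    have "P (cmb v a) = (\<Sum>i<m. amplify (a i) (\<Sum>j\<in>blk i. \<gamma> j i *\<^sub>C g j))"
      using a v by (simp add: cmb_def blinfun.sum_right Pcom fam_def)
    also have "\<dots> = (\<Sum>i<m. \<Sum>j\<in>blk i. \<gamma> j i *\<^sub>C amplify (a i) (g j))"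
    proof (rule sum.cong)
      fix i assume "i \<in> {..<m}"
      then have ai: "a i \<in> bounded_ops" using a A_bounded by (simp add: fam_def)
      show "amplify (a i) (\<Sum>j\<in>blk i. \<gamma> j i *\<^sub>C g j) = (\<Sum>j\<in>blk i. \<gamma> j i *\<^sub>C amplify (a i) (g j))"
        by (subst linear_sum[OF bounded_linear.linear[OF bounded_linear_amplify[OF ai]]])
          (simp add: amplify_scaleC[OF ai])
    qed simp
    also have "\<dots> = (\<Sum>i<m. \<Sum>j<m. if j \<in> blk i then \<gamma> j i *\<^sub>C amplify (a i) (g j) else 0)"
      by (simp add: blk_if)
    also have "\<dots> = (\<Sum>j<m. \<Sum>i<m. if j \<in> blk i then \<gamma> j i *\<^sub>C amplify (a i) (g j) else 0)"
      by (rule sum.swap)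
    also have "\<dots> = (\<Sum>j<m. \<Sum>i\<in>blk j. \<gamma> j i *\<^sub>C amplify (a i) (g j))"
    proof (rule sum.cong)
      fix j assume "j \<in> {..<m}"
      then have "(\<Sum>i<m. if j \<in> blk i then \<gamma> j i *\<^sub>C amplify (a i) (g j) else 0)
          = (\<Sum>i<m. if i \<in> blk j then \<gamma> j i *\<^sub>C amplify (a i) (g j) else 0)"
        by (intro sum.cong) (auto simp: blk_def)
      also have "\<dots> = (\<Sum>i\<in>blk j. \<gamma> j i *\<^sub>C amplify (a i) (g j))" by (rule blk_if)
      finally show "(\<Sum>i<m. if j \<in> blk i then \<gamma> j i *\<^sub>C amplify (a i) (g j) else 0)
          = (\<Sum>i\<in>blk j. \<gamma> j i *\<^sub>C amplify (a i) (g j))" .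
    qed simp
    also have "\<dots> = cmb g (act \<gamma> a)"
    proof -
      have am_sum: "amplify (\<Sum>i\<in>J. T i) x = (\<Sum>i\<in>J. amplify (T i) x)" if "finite J" for J and T :: "nat \<Rightarrow> 'a \<Rightarrow>\<^sub>L 'a" and x
        using that by (induction J) (auto simp: amplify_op_add)
      show ?thesis unfolding cmb_def act_def
        by (intro sum.cong refl) (simp add: am_sum blk_def amplify_op_scaleC)
    qed
    finally show ?thesis .
  qed
  \<comment> \<open>Within a block the \<open>g j\<close> are orthogonal of squared norm
    \<open>1 + l\<^sup>2\<close>, while the \<open>v i\<close> are orthonormal and \<open>P\<close>
    is bounded by \<open>K\<close>; comparing norms gives the factor.\<close>
  have mat: "(\<Sum>k\<in>blk j. (cmod (\<Sum>i\<in>blk j. \<gamma> k i * c i))\<^sup>2) \<le> K\<^sup>2 / (1 + l\<^sup>2) * (\<Sum>i\<in>blk j. (cmod (c i))\<^sup>2)"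
    if v: "\<And>i. i < m \<Longrightarrow> P (v i) = (\<Sum>j\<in>blk i. \<gamma> j i *\<^sub>C g j)" and j: "j < m"
      and on: "\<And>i n. i \<in> blk j \<Longrightarrow> n \<in> blk j \<Longrightarrow> cinner (v i) (v n) = (if i = n then 1 else 0)" for v \<gamma> j c
  proof -
    have fb: "finite (blk j)" by (simp add: blk_def)
    have sg: "sqrt (1 + l\<^sup>2) > 0" using l2 by simp
    have bi: "blk i = blk j" "i < m" if "i \<in> blk j" for i using that by (auto simp: blk_def)
    have "P (\<Sum>i\<in>blk j. c i *\<^sub>C v i) = (\<Sum>i\<in>blk j. c i *\<^sub>C (\<Sum>k\<in>blk j. \<gamma> k i *\<^sub>C g k))"
      unfolding blinfun.sum_right using bi v by (intro sum.cong) (auto simp: bounded_opsD[OF Pb])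
    also have "\<dots> = (\<Sum>k\<in>blk j. \<Sum>i\<in>blk j. (\<gamma> k i * c i) *\<^sub>C g k)"
      by (subst sum.swap) (simp add: cvs.scale_sum_right scaleC_scaleC mult.commute)
    also have "\<dots> = (\<Sum>k\<in>blk j. ((\<Sum>i\<in>blk j. \<gamma> k i * c i) * sqrt (1 + l\<^sup>2)) *\<^sub>C ((1 / complex_of_real (sqrt (1 + l\<^sup>2))) *\<^sub>C g k))"
      using sg by (intro sum.cong) (auto simp: cvs.scale_sum_left scaleC_scaleC)
    finally have eq: "P (\<Sum>i\<in>blk j. c i *\<^sub>C v i) = \<dots>" .
    have on': "cinner ((1 / complex_of_real (sqrt (1 + l\<^sup>2))) *\<^sub>C g i) ((1 / complex_of_real (sqrt (1 + l\<^sup>2))) *\<^sub>C g n) = (if i = n then 1 else 0)"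
      if "i \<in> blk j" "n \<in> blk j" for i n
    proof -
      have "complex_of_real (sqrt (1 + l\<^sup>2)) * complex_of_real (sqrt (1 + l\<^sup>2)) = q"
        unfolding q_def using l2 by (metis of_real_mult real_sqrt_mult_self abs_of_pos)
      moreover have "cinner (g i) (g n) = (if i = n then q else 0)"
        using chh[of i n] that by (auto simp: blk_def)
      ultimately show ?thesis using q0 by (simp add: cinner_scaleC_left cinner_scaleC_right)
    qed
    have "(norm (P (\<Sum>i\<in>blk j. c i *\<^sub>C v i)))\<^sup>2 = (\<Sum>k\<in>blk j. (cmod ((\<Sum>i\<in>blk j. \<gamma> k i * c i) * sqrt (1 + l\<^sup>2)))\<^sup>2)"
      unfolding eq by (rule norm_sum_indexed_orthonormal[OF fb on'])
    also have "\<dots> = (1 + l\<^sup>2) * (\<Sum>k\<in>blk j. (cmod (\<Sum>i\<in>blk j. \<gamma> k i * c i))\<^sup>2)"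
      unfolding norm_mult power_mult_distrib sum_distrib_left using l2 by (simp del: sum_distrib_right add: mult.commute)
    finally have "(1 + l\<^sup>2) * (\<Sum>k\<in>blk j. (cmod (\<Sum>i\<in>blk j. \<gamma> k i * c i))\<^sup>2)
        = (norm (P (\<Sum>i\<in>blk j. c i *\<^sub>C v i)))\<^sup>2" by simp
    also have "\<dots> \<le> (K * norm (\<Sum>i\<in>blk j. c i *\<^sub>C v i))\<^sup>2" by (intro power_mono Pn) simp
    also have "\<dots> = K\<^sup>2 * (\<Sum>i\<in>blk j. (cmod (c i))\<^sup>2)"
      using norm_sum_indexed_orthonormal[OF fb, of v c] on by (simp add: power_mult_distrib)
    finally show ?thesis using l2 by (simp add: field_simps)
  qed
  have on_h: "cinner (h i) (h n) = (if i = n then 1 else 0)" and on_k: "cinner (k i) (k n) = (if i = n then 1 else 0)"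
    if "j < m" "i \<in> blk j" "n \<in> blk j" for i n j
  proof -
    have ijm: "i < m" "n < m" "p i = p n" using that by (auto simp: blk_def)
    show "cinner (h i) (h n) = (if i = n then 1 else 0)"
      using xi(2)[OF ijm(1)] xi(2)[OF ijm(2)] by (simp add: h_def cinner_slot cinner_self)
    show "cinner (k i) (k n) = (if i = n then 1 else 0)"
      using zeta_orth[OF ijm] by (simp add: k_def cinner_slot)
  qed
  have main: "l * norm (theta (act \<alpha> a)) \<le> K * sqrt (nsq a)
    \<and> sqrt (nsq (act \<beta> a)) \<le> K * norm (theta a)
    \<and> (\<forall>j<m. a j = act \<alpha> a j + complex_of_real l *\<^sub>C act \<beta> a j)
    \<and> nsq (act \<alpha> a) \<le> K\<^sup>2 / (1 + l\<^sup>2) * nsq a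
    \<and> nsq (act \<beta> a) \<le> K\<^sup>2 / (1 + l\<^sup>2) * nsq a
    \<and> (m = 1 \<longrightarrow> (\<exists>s t. act \<alpha> a 0 = s *\<^sub>C a 0 \<and> act \<beta> a 0 = t *\<^sub>C a 0 \<and> s + complex_of_real l * t = 1 \<and> (cmod t)\<^sup>2 \<le> K\<^sup>2 / (1 + l\<^sup>2)))"
    if a: "fam a" for a
  proof (intro conjI impI allI)
    \<comment> \<open>\<open>P\<close> sends \<open>cmb h a\<close> to
      \<open>cmb g (act \<alpha> a)\<close>, whose component in slot \<open>m\<close> is
      \<open>l\<close> times \<open>theta (act \<alpha> a)\<close>. The estimate for
      \<open>\<beta>\<close> reads off the other slots of the image of
      \<open>cmb k a\<close>.\<close>
    have "(l * norm (theta (act \<alpha> a)))\<^sup>2 \<le> (norm (cmb g (act \<alpha> a)))\<^sup>2"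
      unfolding n_g[OF act_fam[OF a]] using nsq_nonneg by (simp add: power_mult_distrib)
    then have "l * norm (theta (act \<alpha> a)) \<le> norm (cmb g (act \<alpha> a))" by (rule power2_le_imp_le) simp
    also have "\<dots> \<le> K * norm (cmb h a)" using Pn[of "cmb h a"] Pcmb[OF Ph a] by simp
    finally show "l * norm (theta (act \<alpha> a)) \<le> K * sqrt (nsq a)" by (simp add: n_h)
    have "(sqrt (nsq (act \<beta> a)))\<^sup>2 \<le> (norm (cmb g (act \<beta> a)))\<^sup>2"
      unfolding n_g[OF act_fam[OF a]] using nsq_nonneg by simp
    then have "sqrt (nsq (act \<beta> a)) \<le> norm (cmb g (act \<beta> a))" by (rule power2_le_imp_le) simp
    also have "\<dots> \<le> K * norm (cmb k a)" using Pn[of "cmb k a"] Pcmb[OF Pk a] by simp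
    finally show "sqrt (nsq (act \<beta> a)) \<le> K * norm (theta a)" by (simp add: n_k)
    show "nsq (act \<alpha> a) \<le> K\<^sup>2 / (1 + l\<^sup>2) * nsq a"
      by (rule nsq_act) (rule mat[OF Ph _ on_h])
    show "nsq (act \<beta> a) \<le> K\<^sup>2 / (1 + l\<^sup>2) * nsq a"
      by (rule nsq_act) (rule mat[OF Pk _ on_k])
    show "a j = act \<alpha> a j + complex_of_real l *\<^sub>C act \<beta> a j" if j: "j < m" for j
    proof -
      have "act \<alpha> a j + complex_of_real l *\<^sub>C act \<beta> a j = (\<Sum>i\<in>blk j. (\<alpha> j i + complex_of_real l * \<beta> j i) *\<^sub>C a i)"
        by (simp add: act_def cvs.scale_sum_right scaleC_scaleC scaleC_add_left sum.distrib)
      also have "\<dots> = (\<Sum>i\<in>blk j. if i = j then a i else 0)"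
        using ab blk_sym[OF j] by (intro sum.cong) (auto simp: blk_def cvs.scale_zero_left)
      also have "\<dots> = a j" using j by (simp add: blk_def)
      finally show ?thesis by simp
    qed
    \<comment> \<open>For one pair the matrices are scalars. This allows solving for
      \<open>a 0\<close> while no bound on \<open>theta\<close> is available yet.\<close>
    assume m1: "m = 1"
    have b0: "blk 0 = {0}" unfolding blk_def using m1 by auto
    have "(cmod (\<beta> 0 0))\<^sup>2 \<le> K\<^sup>2 / (1 + l\<^sup>2)"
    proof -
      have "(\<Sum>k\<in>blk 0. (cmod (\<Sum>i\<in>blk 0. \<beta> k i * 1))\<^sup>2) \<le> K\<^sup>2 / (1 + l\<^sup>2) * (\<Sum>i\<in>blk 0. (cmod 1)\<^sup>2)"
        by (rule mat[OF Pk _ on_k]) (use m1 in auto)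
      then show ?thesis by (simp add: b0)
    qed
    moreover have "\<alpha> 0 0 + complex_of_real l * \<beta> 0 0 = 1" using ab[of 0 0] m1 b0 by simp
    ultimately show "\<exists>s t. act \<alpha> a 0 = s *\<^sub>C a 0 \<and> act \<beta> a 0 = t *\<^sub>C a 0 \<and> s + complex_of_real l * t = 1 \<and> (cmod t)\<^sup>2 \<le> K\<^sup>2 / (1 + l\<^sup>2)"
      by (intro exI[of _ "\<alpha> 0 0"] exI[of _ "\<beta> 0 0"]) (simp add: act_def b0)
  qed
  then show ?thesis by blast
qed

lemma theta_decompose:
  assumes "\<forall>j<m. a j = act \<alpha> a j + complex_of_real l *\<^sub>C act \<beta> a j"
  shows "theta a = theta (act \<alpha> a) + complex_of_real l *\<^sub>C theta (act \<beta> a)"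
proof -
  have "a j (\<zeta> j) = act \<alpha> a j (\<zeta> j) + complex_of_real l *\<^sub>C act \<beta> a j (\<zeta> j)" if "j < m" for j
    using assms that by (metis blinfun.add_left blinfun_scaleC)
  then show ?thesis by (simp add: theta_def sum.distrib cvs.scale_sum_right)
qed

text \<open>With \<open>l = 1 / (2 * (K + 1))\<close> the number \<open>l * t\<close> has modulus at
  most \<open>1 / 2\<close>, hence so large is \<open>cmod s\<close>, and the bound for
  \<open>theta (act \<alpha> a) = s *\<^sub>C theta a\<close> can be divided by
  \<open>s\<close>.\<close>

lemma theta_upper_single:
  assumes m: "m = 1" and a: "fam a"
  shows "norm (theta a) \<le> 4 * (K + 1)\<^sup>2 * sqrt (nsq a)"
proof -
  define k where "k = K + 1"
  have k: "k > 0" "K \<le> k" using K_nonneg by (auto simp: k_def)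
  define l where "l = 1 / (2 * k)"
  have l: "l > 0" using k by (simp add: l_def)
  obtain \<alpha> \<beta> where ab: "\<And>a. fam a \<Longrightarrow> l * norm (theta (act \<alpha> a)) \<le> K * sqrt (nsq a)"
    "\<And>a. fam a \<Longrightarrow> (\<exists>s t. act \<alpha> a 0 = s *\<^sub>C a 0 \<and> act \<beta> a 0 = t *\<^sub>C a 0 \<and> s + complex_of_real l * t = 1 \<and> (cmod t)\<^sup>2 \<le> K\<^sup>2 / (1 + l\<^sup>2))"
    using theta_split[OF l] m by blast
  obtain s t where st: "act \<alpha> a 0 = s *\<^sub>C a 0" "s + complex_of_real l * t = 1" "(cmod t)\<^sup>2 \<le> K\<^sup>2 / (1 + l\<^sup>2)"
    using ab(2)[OF a] by blast
  have "K\<^sup>2 / (1 + l\<^sup>2) \<le> K\<^sup>2 / 1" by (rule divide_left_mono) (auto intro: add_pos_nonneg)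
  then have "cmod t \<le> K" using st(3) K_nonneg by (intro power2_le_imp_le[OF _ K_nonneg]) linarith
  then have "l * cmod t \<le> l * k" using l k by (intro mult_left_mono) auto
  then have lt: "cmod (complex_of_real l * t) \<le> 1 / 2"
    using l k unfolding norm_mult norm_of_real by (simp add: l_def)
  have "s = 1 - complex_of_real l * t" using st(2) by (simp add: algebra_simps)
  then have s: "cmod s \<ge> 1 / 2" using norm_triangle_ineq2[of 1 "complex_of_real l * t"] lt by simp
  have "theta (act \<alpha> a) = s *\<^sub>C theta a" unfolding theta_def using m st(1) by simp
  then have "l * (cmod s * norm (theta a)) \<le> K * sqrt (nsq a)" using ab(1)[OF a] by (simp add: norm_scaleC)
  moreover have "l * (1 / 2 * norm (theta a)) \<le> l * (cmod s * norm (theta a))"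
    using l s by (intro mult_left_mono mult_right_mono) auto
  moreover have "K * sqrt (nsq a) \<le> k * sqrt (nsq a)" using k nsq_nonneg by (intro mult_right_mono) auto
  ultimately have "l * (1 / 2 * norm (theta a)) \<le> k * sqrt (nsq a)" by linarith
  then show ?thesis unfolding k_def[symmetric] using k by (simp add: l_def field_simps power2_eq_square)
qed

end

context crp_algebra
begin

lemma minimal_idem_comparison:
  assumes p: "minimal_idem p" and \<xi>: "p \<xi> = \<xi>" "norm \<xi> = 1" and \<zeta>: "p \<zeta> = \<zeta>" "norm \<zeta> = 1" and a: "a \<in> A"
  shows "norm (blinfun_apply a \<zeta>) \<le> 4 * (K + 1)\<^sup>2 * norm (blinfun_apply a \<xi>)"
proof -
  interpret t: theta_system A K 1 "\<lambda>_. p" "\<lambda>_. \<xi>" "\<lambda>_. \<zeta>"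
    using assms by unfold_locales (auto simp: cinner_self)
  show ?thesis using t.theta_upper_single[of "\<lambda>_. a"] a unfolding t.theta_def t.nsq_def t.fam_def by simp
qed

end

context theta_system
begin

lemma norm_zeta: "i < m \<Longrightarrow> norm (\<zeta> i) = 1"
proof -
  assume i: "i < m"
  have "complex_of_real ((norm (\<zeta> i))\<^sup>2) = 1" using zeta_orth[OF i i] by (simp only: cinner_self) simp
  then have "(norm (\<zeta> i))\<^sup>2 = 1" by (simp only: of_real_eq_1_iff)
  then show ?thesis using norm_ge_zero[of "\<zeta> i"] by (simp add: power2_eq_1_iff)
qed

text \<open>
  For \<open>l = 1 / (2 (K + 1))\<close> the splitting improves any bound \<open>J\<close> to \<open>2 (K + 1)\<^sup>2 + J / 2\<close>.
  The single vector case provides the first \<open>J\<close>, which may depend on \<open>m\<close>.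
\<close>

lemma theta_upper:
  assumes a: "fam a"
  shows "norm (theta a) \<le> 4 * (K + 1)\<^sup>2 * sqrt (nsq a)"
proof -
  define k where "k = K + 1"
  have k: "k > 0" "K \<le> k" using K_nonneg by (auto simp: k_def)
  define l where "l = 1 / (2 * k)"
  have l: "l > 0" using k by (simp add: l_def)
  obtain \<alpha> \<beta> where ab: "\<And>a. fam a \<Longrightarrow> l * norm (theta (act \<alpha> a)) \<le> K * sqrt (nsq a)"
      "\<And>a. fam a \<Longrightarrow> \<forall>j<m. a j = act \<alpha> a j + complex_of_real l *\<^sub>C act \<beta> a j"
      "\<And>a. fam a \<Longrightarrow> nsq (act \<beta> a) \<le> K\<^sup>2 / (1 + l\<^sup>2) * nsq a"
    using theta_split[OF l] by blast
  \<comment> \<open>The triangle inequality over the single vector bounds costs a factor of at most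
    \<open>m\<close>, which the iteration then removes.\<close>
  define J where "J = 4 * k\<^sup>2 * real m"
  have J0: "J \<ge> 0" by (simp add: J_def)
  have start: "norm (theta b) \<le> J * sqrt (nsq b)" if b: "fam b" for b
  proof -
    have "norm (theta b) \<le> (\<Sum>i<m. norm (b i (\<zeta> i)))" unfolding theta_def by (rule norm_sum)
    also have "\<dots> \<le> (\<Sum>i<m. 4 * k\<^sup>2 * sqrt (nsq b))"
    proof (rule sum_mono)
      fix i assume "i \<in> {..<m}"
      then have i: "i < m" by simp
      have "norm (b i (\<zeta> i)) \<le> 4 * k\<^sup>2 * norm (b i (\<xi> i))"
        unfolding k_def using b i by (intro minimal_idem_comparison[OF minimal[OF i] xi[OF i] zeta[OF i] norm_zeta[OF i]]) (auto simp: fam_def)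
      also have "(norm (b i (\<xi> i)))\<^sup>2 \<le> nsq b" unfolding nsq_def using i by (intro member_le_sum) auto
      then have "norm (b i (\<xi> i)) \<le> sqrt (nsq b)" by (rule real_le_rsqrt)
      finally show "norm (b i (\<zeta> i)) \<le> 4 * k\<^sup>2 * sqrt (nsq b)" by (simp add: mult_left_mono)
    qed
    finally show ?thesis by (simp add: J_def mult_ac)
  qed
  have iter: "norm (theta b) \<le> (4 * k\<^sup>2 + J / 2 ^ n) * sqrt (nsq b)" if "fam b" for b n
    using that
  proof (induction n arbitrary: b)
    case 0
    have "J * sqrt (nsq b) \<le> (4 * k\<^sup>2 + J) * sqrt (nsq b)" using nsq_nonneg by (intro mult_right_mono) auto
    then show ?case using start[OF 0] by simp
  next
    case (Suc n)
    define r where "r = sqrt (nsq b)"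
    have r0: "r \<ge> 0" using nsq_nonneg by (simp add: r_def)
    have "nsq (act \<beta> b) \<le> K\<^sup>2 / 1 * nsq b"
      by (rule order_trans[OF ab(3)[OF Suc.prems] mult_right_mono[OF divide_left_mono]]) (auto simp: nsq_nonneg add_pos_nonneg)
    then have "sqrt (nsq (act \<beta> b)) \<le> K * r"
      unfolding r_def using K_nonneg by (metis real_sqrt_le_mono real_sqrt_mult real_sqrt_unique div_by_1)
    also have "\<dots> \<le> k * r" using k r0 by (intro mult_right_mono) auto
    finally have "(4 * k\<^sup>2 + J / 2 ^ n) * sqrt (nsq (act \<beta> b)) \<le> (4 * k\<^sup>2 + J / 2 ^ n) * (k * r)"
      using J0 by (intro mult_left_mono) auto
    then have "norm (theta (act \<beta> b)) \<le> (4 * k\<^sup>2 + J / 2 ^ n) * (k * r)"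
      using Suc.IH[OF act_fam[OF Suc.prems], of \<beta>] by linarith
    then have "l * norm (theta (act \<beta> b)) \<le> l * ((4 * k\<^sup>2 + J / 2 ^ n) * (k * r))"
      using l by (intro mult_left_mono) auto
    also have "\<dots> = (2 * k\<^sup>2 + J / 2 ^ Suc n) * r" using k by (simp add: l_def field_simps)
    finally have 1: "l * norm (theta (act \<beta> b)) \<le> (2 * k\<^sup>2 + J / 2 ^ Suc n) * r" .
    have "l * norm (theta (act \<alpha> b)) \<le> k * r"
      using ab(1)[OF Suc.prems] mult_right_mono[OF k(2) r0] by (simp add: r_def)
    then have 2: "norm (theta (act \<alpha> b)) \<le> 2 * k\<^sup>2 * r" using k by (simp add: l_def field_simps power2_eq_square)
    have "norm (theta b) \<le> norm (theta (act \<alpha> b)) + l * norm (theta (act \<beta> b))"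
      unfolding theta_decompose[OF ab(2)[OF Suc.prems]]
      by (rule order_trans[OF norm_triangle_ineq]) (use l in \<open>simp add: norm_scaleC\<close>)
    also have "\<dots> \<le> 2 * k\<^sup>2 * r + (2 * k\<^sup>2 + J / 2 ^ Suc n) * r" using 1 2 by linarith
    also have "\<dots> = (4 * k\<^sup>2 + J / 2 ^ Suc n) * r" by (simp add: algebra_simps)
    finally show ?case by (simp add: r_def)
  qed
  have "(\<lambda>n. (4 * k\<^sup>2 + J * (1 / 2) ^ n) * sqrt (nsq a)) \<longlonglongrightarrow> (4 * k\<^sup>2 + J * 0) * sqrt (nsq a)"
    by (intro tendsto_intros LIMSEQ_power_zero) simp
  then have "norm (theta a) \<le> (4 * k\<^sup>2 + J * 0) * sqrt (nsq a)"
    by (rule LIMSEQ_le_const) (use iter[OF a] in \<open>simp add: power_divide\<close>)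
  then show ?thesis by (simp add: k_def)
qed

text \<open>For \<open>l = 2 * (K + 1)\<close> the factor \<open>K\<^sup>2 / (1 + l\<^sup>2)\<close>
  is at most \<open>1 / 4\<close>, so the \<open>\<alpha>\<close> part is absorbed into the left
  side. What remains is the \<open>\<beta>\<close> part, which \<open>theta a\<close>
  controls.\<close>

lemma theta_lower:
  assumes a: "fam a"
  shows "sqrt (nsq a) \<le> 4 * (K + 1)\<^sup>2 * norm (theta a)"
proof -
  define k where "k = K + 1"
  have k: "k > 0" "K \<le> k" using K_nonneg by (auto simp: k_def)
  define l where "l = 2 * k"
  have l: "l > 0" using k by (simp add: l_def)
  obtain \<alpha> \<beta> where ab: "sqrt (nsq (act \<beta> a)) \<le> K * norm (theta a)"
      "\<forall>j<m. a j = act \<alpha> a j + complex_of_real l *\<^sub>C act \<beta> a j"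
      "nsq (act \<alpha> a) \<le> K\<^sup>2 / (1 + l\<^sup>2) * nsq a"
    using theta_split[OF l] a by blast
  have "4 * K\<^sup>2 \<le> 4 * k\<^sup>2" using power_mono[OF k(2) K_nonneg, of 2] by simp
  then have "4 * K\<^sup>2 \<le> 1 + l\<^sup>2" by (simp add: l_def power_mult_distrib)
  then have "K\<^sup>2 / (1 + l\<^sup>2) \<le> (1 / 2)\<^sup>2" by (simp add: divide_simps add_pos_nonneg)
  then have "nsq (act \<alpha> a) \<le> (1 / 2)\<^sup>2 * nsq a"
    using ab(3) nsq_nonneg by (meson mult_right_mono order_trans)
  then have half: "sqrt (nsq (act \<alpha> a)) \<le> 1 / 2 * sqrt (nsq a)"
    by (metis real_sqrt_le_mono real_sqrt_mult real_sqrt_unique zero_le_divide_1_iff zero_le_numeral)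
  have "sqrt (nsq a) = sqrt (\<Sum>i<m. (norm (act \<alpha> a i (\<xi> i) + complex_of_real l *\<^sub>C act \<beta> a i (\<xi> i)))\<^sup>2)"
  proof -
    have "a i (\<xi> i) = act \<alpha> a i (\<xi> i) + complex_of_real l *\<^sub>C act \<beta> a i (\<xi> i)" if "i < m" for i
      using ab(2) that by (metis blinfun.add_left blinfun_scaleC)
    then show ?thesis by (simp add: nsq_def)
  qed
  also have "\<dots> \<le> sqrt (nsq (act \<alpha> a)) + sqrt (\<Sum>i<m. (norm (complex_of_real l *\<^sub>C act \<beta> a i (\<xi> i)))\<^sup>2)"
    unfolding nsq_def by (rule sqrt_sum_norm_add)
  also have "sqrt (\<Sum>i<m. (norm (complex_of_real l *\<^sub>C act \<beta> a i (\<xi> i)))\<^sup>2) = l * sqrt (nsq (act \<beta> a))"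
    using l by (simp add: norm_scaleC power_mult_distrib nsq_def real_sqrt_mult flip: sum_distrib_left)
  finally have "sqrt (nsq a) \<le> 2 * l * sqrt (nsq (act \<beta> a))" using half by linarith
  also have "\<dots> \<le> 2 * l * (k * norm (theta a))"
    using ab(1) k l by (intro mult_left_mono order_trans[OF ab(1)] mult_right_mono) auto
  finally show ?thesis by (simp add: l_def k_def power2_eq_square mult_ac)
qed

end

section \<open>A maximal family of inequivalent minimal idempotents\<close>

context crp_algebra
begin

definition annihilated :: "'h set" where "annihilated = {x. \<forall>a\<in>A. blinfun_apply a x = 0}"

lemma submod_annihilated: "submod annihilated"
proof -
  have "annihilated = (\<Inter>a\<in>A. {x. blinfun_apply a x = 0})" by (auto simp: annihilated_def)
  moreover have "closed \<dots>" by (intro closed_INT ballI closed_kernel)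
  ultimately have "closed annihilated" by simp
  then show ?thesis
    unfolding submod_def
    by (auto simp: annihilated_def csubspace_def blinfun.add_right A_scaleC csubspace_0[OF A_csubspace])
qed

lemma minimal_idemD:
  assumes "minimal_idem p"
  shows "p \<in> A" "blinfun_apply p (p x) = p x" "p \<noteq> 0" "a \<in> A \<Longrightarrow> \<exists>c. \<forall>x. p (blinfun_apply a (p x)) = c *\<^sub>C p x"
  using assms by (auto simp: minimal_idem_def idem_def)

end

text \<open>\<open>H\<close> is the direct sum of the annihilated vectors and the kernel
  \<open>R\<close> of \<open>P\<close>. All further work takes place on \<open>R\<close>, where
  \<open>A\<close> acts without annihilated vectors.\<close>

locale split_module = crp_algebra A K for A :: "('h::chilbert_space \<Rightarrow>\<^sub>L 'h) set" and K +
  fixes P :: "'h \<Rightarrow>\<^sub>L 'h"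
  assumes P: "mproj annihilated P"
begin

definition R :: "'h set" where "R = {x. blinfun_apply P x = 0}"

lemma submod_R: "submod R"
  unfolding R_def by (rule submod_kernel[OF mprojD(1)[OF P]]) (simp add: mprojD(4)[OF P])

lemma kill_P: "a \<in> A \<Longrightarrow> blinfun_apply a (P x) = 0"
  using mprojD(2)[OF P, of x] by (simp add: annihilated_def)

lemma range_R: "a \<in> A \<Longrightarrow> blinfun_apply a x \<in> R"
  using mprojD(4)[OF P] kill_P by (simp add: R_def)

lemma nondegenerate_R: "x \<in> R \<Longrightarrow> (\<And>a. a \<in> A \<Longrightarrow> blinfun_apply a x = 0) \<Longrightarrow> x = 0"
  using mprojD(3)[OF P, of x] by (simp add: annihilated_def R_def)

text \<open>Complementation replaces the missing unit: for a module projection \<open>U\<close> onto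
  \<open>cyclic x\<close> the vector \<open>x - U x\<close> lies in \<open>R\<close> and is
  annihilated by \<open>A\<close>.\<close>

lemma cyclic_self:
  assumes x: "x \<in> R" shows "x \<in> cyclic x"
proof -
  obtain U where U: "mproj (cyclic x) U" using mproj_exists[OF submod_cyclic] by blast
  have "cyclic x \<subseteq> R" by (rule cyclic_least[OF submod_R x])
  then have "x - U x \<in> R" using x mprojD(2)[OF U] csubspace_diff[OF submodD(1)[OF submod_R]] by blast
  moreover have "a (x - U x) = 0" if a: "a \<in> A" for a
    using mprojD(3)[OF U cyclic_base[OF a]] mprojD(4)[OF U a] by (simp add: blinfun.diff_right)
  ultimately have "x - U x = 0" by (rule nondegenerate_R)
  then show ?thesis using mprojD(2)[OF U, of x] by simp
qed

text \<open>The projection \<open>U\<close> onto \<open>cyclic w\<close> satisfies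
  \<open>U \<eta> = U (p \<eta>) = p (U \<eta>) = 0\<close>, so it vanishes on
  \<open>cyclic \<eta>\<close>. But \<open>w\<close> lies there and is fixed by
  \<open>U\<close>.\<close>

lemma cyclic_irreducible:
  assumes p: "minimal_idem p" and \<eta>: "p \<eta> = \<eta>" and w: "w \<in> cyclic \<eta>" and kill: "\<And>a. a \<in> A \<Longrightarrow> p (blinfun_apply a w) = 0"
  shows "w = 0"
proof -
  have pA: "p \<in> A" using minimal_idemD[OF p] by simp
  have \<eta>R: "\<eta> \<in> R" using range_R[OF pA, of \<eta>] \<eta> by simp
  have cR: "cyclic \<eta> \<subseteq> R" by (rule cyclic_least[OF submod_R \<eta>R])
  obtain U where U: "mproj (cyclic w) U" using mproj_exists[OF submod_cyclic] by blast
  have "cyclic w \<subseteq> {v. p v = 0}"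
    unfolding cyclic_def by (rule closure_minimal) (use kill closed_kernel in auto)
  then have "p (U \<eta>) = 0" using mprojD(2)[OF U, of \<eta>] by auto
  then have "U \<eta> = 0" using mprojD(4)[OF U pA, of \<eta>] \<eta> by simp
  then have "\<eta> \<in> {v. U v = 0}" by simp
  then have "cyclic \<eta> \<subseteq> {v. U v = 0}"
    by (intro cyclic_least submod_kernel[OF mprojD(1)[OF U]] mprojD(4)[OF U])
  moreover have "cyclic w \<subseteq> cyclic \<eta>" by (rule cyclic_least[OF submod_cyclic w])
  moreover have "w \<in> cyclic w" by (rule cyclic_self[OF subsetD[OF cR w]])
  ultimately show ?thesis using mprojD(3)[OF U, of w] by auto
qed

text \<open>The vector \<open>p a q x\<close> lies in the module generated by \<open>q x\<close>,
  yet \<open>q A\<close> kills it; irreducibility makes it \<open>0\<close>.\<close>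

lemma inequivalent_symmetric:
  assumes p: "minimal_idem p" and q: "minimal_idem q" and qp: "\<And>a x. a \<in> A \<Longrightarrow> q (blinfun_apply a (p x)) = 0"
    and a: "a \<in> A"
  shows "p (blinfun_apply a (q x)) = 0"
proof -
  define w where "w = p (blinfun_apply a (q x))"
  have "w \<in> cyclic (q x)" unfolding w_def
    using minimal_idemD(1)[OF p] submodD(3)[OF submod_cyclic] cyclic_base[OF a] by simp
  moreover have "q (blinfun_apply b w) = 0" if "b \<in> A" for b
    unfolding w_def by (rule qp[OF that])
  ultimately have "w = 0" by (rule cyclic_irreducible[OF q minimal_idemD(2)[OF q]])
  then show ?thesis by (simp add: w_def)
qed

text \<open>By \<open>minimal_idem_comparison\<close> the values of \<open>b\<close> at any two unit
  vectors in the range of \<open>p\<close> have comparable norms, so one zero forces all.\<close>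

lemma minimal_idem_kill:
  assumes p: "minimal_idem p" and \<eta>: "p \<eta> = \<eta>" "\<eta> \<noteq> 0" and b: "b \<in> A" "blinfun_apply b \<eta> = 0"
  shows "blinfun_apply b (p x) = 0"
proof (cases "p x = 0")
  case False
  define u where "u v = complex_of_real (1 / norm v) *\<^sub>C v" for v :: 'h
  have pu: "p (u v) = u v" "norm (u v) = 1" if "p v = v" "v \<noteq> 0" for v
    using that by (simp_all add: u_def A_scaleC[OF minimal_idemD(1)[OF p]] norm_scaleC norm_divide)
  have "b (u \<eta>) = 0" using b by (simp add: u_def A_scaleC[OF b(1)] cvs.scale_zero_right)
  then have "norm (b (u (p x))) \<le> 0"
    using minimal_idem_comparison[OF p pu(1)[OF \<eta>] pu(2)[OF \<eta>] pu(1)[OF _ False] pu(2)[OF _ False] b(1)] minimal_idemD(2)[OF p]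
    by simp
  then show ?thesis using False by (simp add: u_def A_scaleC[OF b(1)])
qed simp

text \<open>If \<open>V\<close> contains the ranges of all \<open>q\<close> but not
  \<open>R\<close>, the part of \<open>R\<close> killed by a projection onto \<open>V\<close> is a
  nonzero nondegenerate module. It supplies a minimal idempotent inequivalent to the whole family,
  against maximality.\<close>

lemma maximal_inequivalent_family:
  "\<exists>Q :: ('h \<Rightarrow>\<^sub>L 'h) set. (\<forall>q\<in>Q. minimal_idem q) \<and> (\<forall>q\<in>Q. \<forall>q'\<in>Q. q \<noteq> q' \<longrightarrow> (\<forall>a\<in>A. \<forall>x. blinfun_apply q (blinfun_apply a (blinfun_apply q' x)) = 0))
     \<and> (\<forall>V. submod V \<longrightarrow> (\<forall>q\<in>Q. \<forall>x. blinfun_apply q x \<in> V) \<longrightarrow> R \<subseteq> V)"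
proof -
  define ineq where "ineq q q' \<longleftrightarrow> (\<forall>a\<in>A. \<forall>x. q (blinfun_apply a (q' x)) = 0)" for q q' :: "'h \<Rightarrow>\<^sub>L 'h"
  define good where "good = {Q. (\<forall>q\<in>Q. minimal_idem q) \<and> (\<forall>q\<in>Q. \<forall>q'\<in>Q. q \<noteq> q' \<longrightarrow> ineq q q')}"
  have "\<exists>M\<in>good. \<forall>X\<in>good. M \<subseteq> X \<longrightarrow> X = M"
  proof (rule subset_Zorn)
    fix C assume C: "subset.chain good C"
    have "\<Union>C \<in> good"
      unfolding good_def
    proof (intro CollectI conjI ballI impI)
      have Cg: "C \<subseteq> good" using C by (simp add: subset.chain_def)
      fix q assume "q \<in> \<Union>C" then show "minimal_idem q" using Cg by (auto simp: good_def)
    next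
      have Cg: "C \<subseteq> good" using C by (simp add: subset.chain_def)
      fix q q' assume "q \<in> \<Union>C" "q' \<in> \<Union>C" and ne: "q \<noteq> q'"
      then obtain X Y where XY: "X \<in> C" "q \<in> X" "Y \<in> C" "q' \<in> Y" by blast
      then have "X \<subseteq> Y \<or> Y \<subseteq> X" using subset.chain_total[OF C] by blast
      then obtain Z where "Z \<in> C" "q \<in> Z" "q' \<in> Z" using XY by blast
      then show "ineq q q'" using ne Cg by (auto simp: good_def)
    qed
    then show "\<exists>U\<in>good. \<forall>X\<in>C. X \<subseteq> U" by blast
  qed
  then obtain Q where Q: "Q \<in> good" "\<And>X. X \<in> good \<Longrightarrow> Q \<subseteq> X \<Longrightarrow> X = Q" by blast
  have minQ: "\<And>q. q \<in> Q \<Longrightarrow> minimal_idem q" using Q(1) by (auto simp: good_def)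
  have "R \<subseteq> V" if V: "submod V" and QV: "\<And>q x. q \<in> Q \<Longrightarrow> blinfun_apply q x \<in> V" for V
  proof -
    obtain U where U: "mproj V U" using mproj_exists[OF V] by blast
    define W where "W = R \<inter> {x. U x = 0}"
    have W: "submod W" unfolding W_def
      by (intro submod_Int submod_R submod_kernel[OF mprojD(1)[OF U]] mprojD(4)[OF U])
    have QW: "q x = 0" if "q \<in> Q" "x \<in> W" for q x
    proof -
      have "q x \<in> W" using submodD(3)[OF W] minimal_idemD(1)[OF minQ] that by blast
      then show ?thesis using QV[OF that(1), of x] mprojD(3)[OF U] by (simp add: W_def)
    qed
    have "W = {0}"
    proof (rule ccontr)
      assume "W \<noteq> {0}"
      have nd: "z = 0" if z: "z \<in> W" and kz: "\<And>a. a \<in> A \<Longrightarrow> blinfun_apply a z = 0" for z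
        by (rule nondegenerate_R[OF _ kz]) (use z in \<open>simp_all add: W_def\<close>)
      have "\<exists>p. minimal_idem p \<and> (\<exists>x\<in>W. p x \<noteq> 0)"
      proof (rule minimal_idem_exists[OF W])
        show "W \<noteq> {0}" by fact
        show "x = 0" if "x \<in> W" "\<And>a. a \<in> A \<Longrightarrow> blinfun_apply a x = 0" for x using that by (rule nd)
      qed
      then obtain p x where p: "minimal_idem p" and x: "x \<in> W" "p x \<noteq> 0" by blast
      have pA: "p \<in> A" using minimal_idemD[OF p] by simp
      have pxW: "p x \<in> W" using submodD(3)[OF W pA x(1)] .
      \<comment> \<open>Every \<open>q\<close> in \<open>Q\<close> vanishes on \<open>W\<close>, so
        \<open>q a\<close> kills the single nonzero vector \<open>p x\<close>, and
        \<open>minimal_idem_kill\<close> extends this to the whole range of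
        \<open>p\<close>.\<close>
      have qp: "ineq q p" if q: "q \<in> Q" for q
        unfolding ineq_def
      proof (intro ballI allI)
        fix a y assume a: "a \<in> A"
        have "(q o\<^sub>L a) (p x) = 0" using QW[OF q submodD(3)[OF W a pxW]] by simp
        then have "(q o\<^sub>L a) (p y) = 0"
          by (rule minimal_idem_kill[OF p minimal_idemD(2)[OF p] x(2) A_compose[OF minimal_idemD(1)[OF minQ[OF q]] a]])
        then show "q (a (p y)) = 0" by simp
      qed
      moreover have "ineq p q" if q: "q \<in> Q" for q
        using inequivalent_symmetric[OF p minQ[OF q]] qp[OF q] by (simp add: ineq_def)
      ultimately have "insert p Q \<in> good" using Q(1) p by (auto simp: good_def)
      then have "p \<in> Q" using Q(2) by blast
      then show False using QW x by blast
    qed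
    show "R \<subseteq> V"
    proof
      fix x assume x: "x \<in> R"
      \<comment> \<open>\<open>U\<close> commutes with \<open>A\<close> and the range of every
        element of \<open>A\<close> lies in \<open>R\<close>, so \<open>U\<close> maps
        \<open>cyclic x\<close> into \<open>R\<close>; and \<open>x\<close> belongs to
        \<open>cyclic x\<close>.\<close>
      have "U x \<in> R"
      proof -
        have "P (U x) = 0"
        proof -
          have "x \<in> cyclic x" by (rule cyclic_self[OF x])
          moreover have "cyclic x \<subseteq> {y. U y \<in> R}"
            unfolding cyclic_def
          proof (rule closure_minimal)
            show "(\<lambda>a. blinfun_apply a x) ` A \<subseteq> {y. U y \<in> R}"
              by (auto simp: mprojD(4)[OF U] range_R)
            have "closed (blinfun_apply U -` R)"
              by (intro closed_vimage submodD(2)[OF submod_R] linear_continuous_on blinfun.bounded_linear_right)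
            then show "closed {y. U y \<in> R}" by (simp add: vimage_def)
          qed
          ultimately show ?thesis by (auto simp: R_def)
        qed
        then show ?thesis by (simp add: R_def)
      qed
      then have "x - U x \<in> W"
        using x mprojD(2,3)[OF U] csubspace_diff[OF submodD(1)[OF submod_R]]
        by (simp add: W_def blinfun.diff_right)
      then have "x = U x" using \<open>W = {0}\<close> by simp
      then show "x \<in> V" using mprojD(2)[OF U, of x] by simp
    qed
  qed
  then have total: "\<forall>V. submod V \<longrightarrow> (\<forall>q\<in>Q. \<forall>x. blinfun_apply q x \<in> V) \<longrightarrow> R \<subseteq> V" by simp
  have "\<forall>q\<in>Q. \<forall>q'\<in>Q. q \<noteq> q' \<longrightarrow> ineq q q'" using Q(1) unfolding good_def by simp
  with total minQ show ?thesis unfolding ineq_def by (intro exI[of _ Q] conjI ballI) simp_all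
qed

end

section \<open>An equivalent inner product adapted to the algebra\<close>

text \<open>Nothing is known about \<open>B\<close> off \<open>D\<close>. The form is extended by
  continuity to the closure of \<open>D\<close> and then precomposed with the orthogonal projection
  onto it; \<open>s x\<close> is a sequence in \<open>D\<close> approximating that projection of
  \<open>x\<close>.\<close>

lemma extend_form:
  fixes B :: "'a::chilbert_space \<Rightarrow> 'a \<Rightarrow> complex"
  assumes D: "csubspace D"
    and add: "\<And>x x' y. x \<in> D \<Longrightarrow> x' \<in> D \<Longrightarrow> y \<in> D \<Longrightarrow> B (x + x') y = B x y + B x' y"
    and scale: "\<And>c x y. x \<in> D \<Longrightarrow> y \<in> D \<Longrightarrow> B (c *\<^sub>C x) y = c * B x y"
    and herm: "\<And>x y. x \<in> D \<Longrightarrow> y \<in> D \<Longrightarrow> B y x = cnj (B x y)"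
    and bd: "\<And>x y. x \<in> D \<Longrightarrow> y \<in> D \<Longrightarrow> cmod (B x y) \<le> K * norm x * norm y" and K: "K \<ge> 0"
  shows "\<exists>G\<in>bounded_ops. \<forall>x\<in>D. \<forall>y\<in>D. B x y = cinner x (blinfun_apply G y)"
proof -
  note cl = csubspace_closure[OF D] closed_closure[of D]
  have "\<forall>x. \<exists>s. (\<forall>n. s n \<in> D) \<and> s \<longlonglongrightarrow> proj (closure D) x"
    using proj_in[OF cl] by (simp add: closure_sequential)
  then obtain s where sD: "\<And>x n. s x n \<in> D" and s: "\<And>x. s x \<longlonglongrightarrow> proj (closure D) x"
    by metis
  have diff: "B (x - x') y = B x y - B x' y" if "x \<in> D" "x' \<in> D" "y \<in> D" for x x' y
    using add[of x "(-1) *\<^sub>C x'" y] scale[of x' y "-1"] that csubspace_uminus[OF D] by simp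
  have diff2: "B y (x - x') = B y x - B y x'" if "x \<in> D" "x' \<in> D" "y \<in> D" for x x' y
    using diff[OF that] herm[of "x - x'" y] herm[of x y] herm[of x' y] that csubspace_diff[OF D] by simp
  have step: "cmod (B x y - B x' y') \<le> K * norm (x - x') * norm y + K * norm x' * norm (y - y')"
    if "x \<in> D" "x' \<in> D" "y \<in> D" "y' \<in> D" for x x' y y'
  proof -
    have "B x y - B x' y' = B (x - x') y + B x' (y - y')" using that by (simp add: diff diff2)
    then have "cmod (B x y - B x' y') \<le> cmod (B (x - x') y) + cmod (B x' (y - y'))"
      by (simp only: norm_triangle_ineq)
    also have "\<dots> \<le> K * norm (x - x') * norm y + K * norm x' * norm (y - y')"
      using that csubspace_diff[OF D] by (intro add_mono bd) auto
    finally show ?thesis .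
  qed
  have "convergent (\<lambda>n. B (s x n) (s y n))" for x y
  proof (rule Cauchy_convergent, rule CauchyI)
    fix e :: real assume e: "0 < e"
    obtain M where M: "M > 0" "\<And>n. norm (s x n) \<le> M" "\<And>n. norm (s y n) \<le> M"
    proof -
      obtain M1 where "M1 > 0" "\<And>n. norm (s x n) \<le> M1"
        using convergent_imp_Bseq[OF convergentI[OF s[of x]]] by (auto simp: Bseq_def)
      moreover obtain M2 where "M2 > 0" "\<And>n. norm (s y n) \<le> M2"
        using convergent_imp_Bseq[OF convergentI[OF s[of y]]] by (auto simp: Bseq_def)
      ultimately show thesis by (intro that[of "M1 + M2"]) (auto intro: add_increasing add_increasing2 less_imp_le)
    qed
    define d where "d = e / (2 * (K * M + 1))"
    have KM: "K * M + 1 > 0" using K M(1) by (intro add_nonneg_pos mult_nonneg_nonneg) auto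
    then have d: "d > 0" using e by (simp add: d_def)
    obtain N1 where N1: "\<And>m n. m \<ge> N1 \<Longrightarrow> n \<ge> N1 \<Longrightarrow> norm (s x m - s x n) < d"
      using CauchyD[OF LIMSEQ_imp_Cauchy[OF s[of x]] d] by blast
    obtain N2 where N2: "\<And>m n. m \<ge> N2 \<Longrightarrow> n \<ge> N2 \<Longrightarrow> norm (s y m - s y n) < d"
      using CauchyD[OF LIMSEQ_imp_Cauchy[OF s[of y]] d] by blast
    have "cmod (B (s x m) (s y m) - B (s x n) (s y n)) < e" if "m \<ge> max N1 N2" "n \<ge> max N1 N2" for m n
    proof -
      have "cmod (B (s x m) (s y m) - B (s x n) (s y n)) \<le> K * norm (s x m - s x n) * norm (s y m) + K * norm (s x n) * norm (s y m - s y n)"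
        by (intro step sD)
      also have "\<dots> \<le> K * d * M + K * M * d"
        using K M d N1[of m n] N2[of m n] that by (intro add_mono mult_mono mult_left_mono) auto
      also have "\<dots> = 2 * (K * M) * d" by simp
      also have "\<dots> < 2 * (K * M + 1) * d" using d by simp
      also have "\<dots> = e" using KM by (simp add: d_def)
      finally show ?thesis .
    qed
    then show "\<exists>M. \<forall>m\<ge>M. \<forall>n\<ge>M. cmod (B (s x m) (s y m) - B (s x n) (s y n)) < e" by blast
  qed
  then obtain B' where B': "\<And>x y. (\<lambda>n. B (s x n) (s y n)) \<longlonglongrightarrow> B' x y"
    unfolding convergent_def by metis
  have null: "(\<lambda>n. B (w n) (v n)) \<longlonglongrightarrow> 0" if "\<And>n. w n \<in> D" "\<And>n. v n \<in> D" "w \<longlonglongrightarrow> 0" "v \<longlonglongrightarrow> z" for w v z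
  proof (rule Lim_null_comparison)
    show "\<forall>\<^sub>F n in sequentially. norm (B (w n) (v n)) \<le> K * norm (w n) * norm (v n)" using bd that by simp
    have "(\<lambda>n. K * norm (w n) * norm (v n)) \<longlonglongrightarrow> K * norm (0::'a) * norm z" by (intro tendsto_intros that)
    then show "(\<lambda>n. K * norm (w n) * norm (v n)) \<longlonglongrightarrow> 0" by simp
  qed
  have herm': "B' y x = cnj (B' x y)" for x y
  proof -
    have "(\<lambda>n. B (s y n) (s x n)) = (\<lambda>n. cnj (B (s x n) (s y n)))" by (rule ext, rule herm[OF sD sD])
    then have "(\<lambda>n. B (s y n) (s x n)) \<longlonglongrightarrow> cnj (B' x y)" using tendsto_cnj[OF B'[of x y]] by simp
    then show ?thesis by (rule LIMSEQ_unique[OF B'])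
  qed
  have add': "B' (x + x') y = B' x y + B' x' y" for x x' y
  proof -
    have "(\<lambda>n. B (s (x + x') n - (s x n + s x' n)) (s y n)) \<longlonglongrightarrow> 0"
    proof (rule null[OF _ sD _ s])
      show "s (x + x') n - (s x n + s x' n) \<in> D" for n by (intro csubspace_diff[OF D] csubspace_add[OF D] sD)
      show "(\<lambda>n. s (x + x') n - (s x n + s x' n)) \<longlonglongrightarrow> 0"
        using tendsto_diff[OF s[of "x + x'"] tendsto_add[OF s[of x] s[of x']]] by (simp add: proj_add[OF cl])
    qed
    moreover have "B (s (x + x') n - (s x n + s x' n)) (s y n) = B (s (x + x') n) (s y n) - (B (s x n) (s y n) + B (s x' n) (s y n))" for n
      by (simp add: diff add sD csubspace_add[OF D])
    ultimately have "(\<lambda>n. B (s (x + x') n) (s y n) - (B (s x n) (s y n) + B (s x' n) (s y n))) \<longlonglongrightarrow> 0" by simp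
    moreover have "(\<lambda>n. B (s (x + x') n) (s y n) - (B (s x n) (s y n) + B (s x' n) (s y n))) \<longlonglongrightarrow> B' (x + x') y - (B' x y + B' x' y)"
      by (intro tendsto_intros B')
    ultimately show ?thesis using LIMSEQ_unique by fastforce
  qed
  have scale': "B' (c *\<^sub>C x) y = c * B' x y" for c x y
  proof -
    have "(\<lambda>n. B (s (c *\<^sub>C x) n - c *\<^sub>C s x n) (s y n)) \<longlonglongrightarrow> 0"
    proof (rule null[OF _ sD _ s])
      show "s (c *\<^sub>C x) n - c *\<^sub>C s x n \<in> D" for n by (intro csubspace_diff[OF D] csubspace_scaleC[OF D] sD)
      show "(\<lambda>n. s (c *\<^sub>C x) n - c *\<^sub>C s x n) \<longlonglongrightarrow> 0"
        using tendsto_diff[OF s[of "c *\<^sub>C x"] tendsto_scaleC[OF tendsto_const[of c] s[of x]]] by (simp add: proj_scaleC[OF cl])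
    qed
    moreover have "B (s (c *\<^sub>C x) n - c *\<^sub>C s x n) (s y n) = B (s (c *\<^sub>C x) n) (s y n) - c * B (s x n) (s y n)" for n
      by (simp add: diff scale sD csubspace_scaleC[OF D])
    ultimately have "(\<lambda>n. B (s (c *\<^sub>C x) n) (s y n) - c * B (s x n) (s y n)) \<longlonglongrightarrow> 0" by simp
    moreover have "(\<lambda>n. B (s (c *\<^sub>C x) n) (s y n) - c * B (s x n) (s y n)) \<longlonglongrightarrow> B' (c *\<^sub>C x) y - c * B' x y"
      by (intro tendsto_intros B')
    ultimately show ?thesis using LIMSEQ_unique by fastforce
  qed
  have bd': "cmod (B' x y) \<le> K * norm x * norm y" for x y
  proof -
    have "cmod (B' x y) \<le> K * norm (proj (closure D) x) * norm (proj (closure D) y)"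
      by (rule LIMSEQ_le[OF tendsto_norm[OF B'] tendsto_mult[OF tendsto_mult[OF tendsto_const tendsto_norm[OF s]] tendsto_norm[OF s]]])
        (use bd sD in blast)
    also have "\<dots> \<le> K * norm x * norm y"
      using K by (intro mult_mono norm_proj_le[OF cl]) auto
    finally show ?thesis .
  qed
  have agree: "B' x y = B x y" if x: "x \<in> D" and y: "y \<in> D" for x y
  proof -
    have id: "proj (closure D) z = z" if "z \<in> D" for z
      by (rule proj_ident[OF cl]) (use that closure_subset in auto)
    have z: "(\<lambda>n. s z n - z) \<longlonglongrightarrow> 0" if "z \<in> D" for z
      using tendsto_diff[OF s[of z] tendsto_const[of z]] by (simp add: id[OF that])
    have "(\<lambda>n. B (s x n - x) (s y n)) \<longlonglongrightarrow> 0"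
      by (rule null[OF _ sD z[OF x] s]) (intro csubspace_diff[OF D] sD x)
    moreover have "(\<lambda>n. B x (s y n - y)) \<longlonglongrightarrow> cnj 0"
      unfolding herm[OF csubspace_diff[OF D sD y] x]
      by (intro tendsto_cnj null[where z = x] csubspace_diff[OF D] sD x y z tendsto_const)
    ultimately have "(\<lambda>n. B (s x n - x) (s y n) + B x (s y n - y)) \<longlonglongrightarrow> 0 + cnj 0" by (rule tendsto_add)
    then have "(\<lambda>n. B (s x n) (s y n) - B x y) \<longlonglongrightarrow> 0" using x y by (simp add: diff diff2 sD)
    moreover have "(\<lambda>n. B (s x n) (s y n) - B x y) \<longlonglongrightarrow> B' x y - B x y" by (intro tendsto_intros B')
    ultimately show ?thesis using LIMSEQ_unique by fastforce
  qed
  have "\<exists>G\<in>bounded_ops. \<forall>x y. B' x y = cinner x (blinfun_apply G y)"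
  proof (rule riesz_form[OF add' scale' _ _ bd'])
    show "B' x (y + y') = B' x y + B' x y'" for x y y' using herm' add' by (metis complex_cnj_add)
    show "B' x (c *\<^sub>C y) = cnj c * B' x y" for c x y using herm' scale' by (metis complex_cnj_mult)
  qed
  then show ?thesis using agree by metis
qed

lemma bessel:
  assumes "finite F" "orthonormal F"
  shows "norm (\<Sum>v\<in>F. cinner x v *\<^sub>C v) \<le> norm x"
proof -
  define s where "s = (\<Sum>v\<in>F. cinner x v *\<^sub>C v)"
  have "cinner s v = cinner x v" if "v \<in> F" for v
    unfolding s_def by (rule cinner_orthonormal_sum[OF assms that])
  then have "cinner s s = cinner x s" unfolding s_def by (simp add: cinner_sum_right cinner_scaleC_right)
  then have "complex_of_real ((norm s)\<^sup>2) = cinner x s" by (simp only: cinner_self)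
  then have "(norm s)\<^sup>2 \<le> norm x * norm s"
    using norm_cinner_le[of x s] by (metis norm_of_real abs_of_nonneg zero_le_power2)
  then show ?thesis unfolding s_def[symmetric] power2_eq_square
    by (cases "s = 0") simp_all
qed

locale atoms = split_module +
  fixes Q :: "('a \<Rightarrow>\<^sub>L 'a) set" and bas :: "('a \<Rightarrow>\<^sub>L 'a) \<Rightarrow> 'a set" and \<xi> :: "('a \<Rightarrow>\<^sub>L 'a) \<Rightarrow> 'a"
  assumes minimal: "q \<in> Q \<Longrightarrow> minimal_idem q"
    and inequivalent: "q \<in> Q \<Longrightarrow> q' \<in> Q \<Longrightarrow> q \<noteq> q' \<Longrightarrow> a \<in> A \<Longrightarrow> blinfun_apply q (blinfun_apply a (blinfun_apply q' x)) = 0"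
    and total: "submod V \<Longrightarrow> (\<And>q x. q \<in> Q \<Longrightarrow> blinfun_apply q x \<in> V) \<Longrightarrow> R \<subseteq> V"
    and bas: "q \<in> Q \<Longrightarrow> finite (bas q)" "q \<in> Q \<Longrightarrow> orthonormal (bas q)" "q \<in> Q \<Longrightarrow> e \<in> bas q \<Longrightarrow> blinfun_apply q e = e"
      "q \<in> Q \<Longrightarrow> blinfun_apply q x = x \<Longrightarrow> x = (\<Sum>e\<in>bas q. cinner x e *\<^sub>C e)"
    and xi_bas: "q \<in> Q \<Longrightarrow> \<xi> q \<in> bas q"
begin

lemma minQ: "q \<in> Q \<Longrightarrow> q \<in> A" "q \<in> Q \<Longrightarrow> blinfun_apply q (q x) = q x"
  using minimal_idemD[OF minimal] by auto

lemma xi: "q \<in> Q \<Longrightarrow> blinfun_apply q (\<xi> q) = \<xi> q" "q \<in> Q \<Longrightarrow> norm (\<xi> q) = 1"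
proof -
  assume q: "q \<in> Q"
  show "blinfun_apply q (\<xi> q) = \<xi> q" by (rule bas(3)[OF q xi_bas[OF q]])
  have "cinner (\<xi> q) (\<xi> q) = 1" using bas(2)[OF q] xi_bas[OF q] by (auto simp: orthonormal_def)
  then have "complex_of_real ((norm (\<xi> q))\<^sup>2) = 1" by (simp only: cinner_self)
  then have "(norm (\<xi> q))\<^sup>2 = 1" by (simp only: of_real_eq_1_iff)
  then show "norm (\<xi> q) = 1" using norm_ge_zero[of "\<xi> q"] by (simp add: power2_eq_1_iff)
qed

definition idx :: "(('a \<Rightarrow>\<^sub>L 'a) \<times> 'a) set" where "idx = {t. fst t \<in> Q \<and> snd t \<in> bas (fst t)}"

text \<open>Finite supports represent the algebraic direct sum. No completion is formed: by
  \<open>R_dense\<close> the vectors \<open>syn f\<close> are dense in \<open>R\<close>.\<close>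

definition fams :: "((('a \<Rightarrow>\<^sub>L 'a) \<times> 'a) \<Rightarrow> ('a \<Rightarrow>\<^sub>L 'a)) set" where
  "fams = {f. finite {t. f t \<noteq> 0} \<and> (\<forall>t. f t \<in> A) \<and> (\<forall>t. f t \<noteq> 0 \<longrightarrow> t \<in> idx)}"

text \<open>
  The pairs \<open>(q, e)\<close> index a decomposition of the module: a family \<open>f\<close> represents the vector
  \<open>syn f\<close>, the sum of the \<open>f (q, e) e\<close>, and \<open>ev f (q, e) = f (q, e) (\<xi> q)\<close> is the coordinate of this
  vector in the copy of \<open>cyclic (\<xi> q)\<close> attached to \<open>(q, e)\<close>. The new inner product \<open>frm\<close> makes
  these copies orthogonal.
\<close>

definition ev :: "((('a \<Rightarrow>\<^sub>L 'a) \<times> 'a) \<Rightarrow> ('a \<Rightarrow>\<^sub>L 'a)) \<Rightarrow> ('a \<Rightarrow>\<^sub>L 'a) \<times> 'a \<Rightarrow> 'a" where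
  "ev f t = blinfun_apply (f t) (\<xi> (fst t))"

definition syn :: "((('a \<Rightarrow>\<^sub>L 'a) \<times> 'a) \<Rightarrow> ('a \<Rightarrow>\<^sub>L 'a)) \<Rightarrow> 'a" where
  "syn f = (\<Sum>t | f t \<noteq> 0. blinfun_apply (f t) (snd t))"

definition nrm :: "((('a \<Rightarrow>\<^sub>L 'a) \<times> 'a) \<Rightarrow> ('a \<Rightarrow>\<^sub>L 'a)) \<Rightarrow> real" where
  "nrm f = L2_set (\<lambda>t. norm (ev f t)) {t. f t \<noteq> 0}"

definition frm :: "((('a \<Rightarrow>\<^sub>L 'a) \<times> 'a) \<Rightarrow> ('a \<Rightarrow>\<^sub>L 'a)) \<Rightarrow> ((('a \<Rightarrow>\<^sub>L 'a) \<times> 'a) \<Rightarrow> ('a \<Rightarrow>\<^sub>L 'a)) \<Rightarrow> complex" where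
  "frm f g = (\<Sum>t | f t \<noteq> 0. cinner (ev f t) (ev g t))"

definition C :: real where "C = 4 * (K + 1)\<^sup>2"

lemma C_ge_1: "C \<ge> 1"
proof -
  have "1 \<le> (K + 1)\<^sup>2" using K_nonneg by (intro one_le_power) simp
  then show ?thesis unfolding C_def by linarith
qed

lemma ev_zero: "f t = 0 \<Longrightarrow> ev f t = 0" by (simp add: ev_def)

lemma syn_on: "finite F \<Longrightarrow> {t. f t \<noteq> 0} \<subseteq> F \<Longrightarrow> syn f = (\<Sum>t\<in>F. blinfun_apply (f t) (snd t))"
  unfolding syn_def by (rule sum.mono_neutral_left) auto

lemma nrm_on: "finite F \<Longrightarrow> {t. f t \<noteq> 0} \<subseteq> F \<Longrightarrow> nrm f = L2_set (\<lambda>t. norm (ev f t)) F"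
  unfolding nrm_def L2_set_def by (subst sum.mono_neutral_left[of F]) (auto simp: ev_zero)

lemma frm_on: "finite F \<Longrightarrow> {t. f t \<noteq> 0} \<subseteq> F \<Longrightarrow> frm f g = (\<Sum>t\<in>F. cinner (ev f t) (ev g t))"
  unfolding frm_def by (rule sum.mono_neutral_left) (auto simp: ev_zero)

lemma fams_add: "f \<in> fams \<Longrightarrow> g \<in> fams \<Longrightarrow> (\<lambda>t. f t + g t) \<in> fams"
  and fams_scale: "f \<in> fams \<Longrightarrow> (\<lambda>t. c *\<^sub>C f t) \<in> fams"
  and fams_act: "a \<in> A \<Longrightarrow> f \<in> fams \<Longrightarrow> (\<lambda>t. a o\<^sub>L f t) \<in> fams"
  and fams_zero: "(\<lambda>t. 0) \<in> fams"
  and fams_single: "q \<in> Q \<Longrightarrow> e \<in> bas q \<Longrightarrow> a \<in> A \<Longrightarrow> (\<lambda>t. if t = (q, e) then a else 0) \<in> fams"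
proof -
  assume f: "f \<in> fams"
  show "(\<lambda>t. c *\<^sub>C f t) \<in> fams" using f csubspace_scaleC[OF A_csubspace]
    by (auto simp: fams_def cvs.scale_zero_right elim: rev_finite_subset)
  show "(\<lambda>t. a o\<^sub>L f t) \<in> fams" if "a \<in> A"
  proof -
    have "f t \<noteq> 0" if "a o\<^sub>L f t \<noteq> 0" for t using that by auto
    then show ?thesis using f that A_compose
      by (auto simp: fams_def simp del: split_paired_All elim: rev_finite_subset)
  qed
  assume g: "g \<in> fams"
  have "finite ({t. f t \<noteq> 0} \<union> {t. g t \<noteq> 0})" using f g by (auto simp: fams_def)
  then have "finite {t. f t + g t \<noteq> 0}" by (rule rev_finite_subset) auto
  then show "(\<lambda>t. f t + g t) \<in> fams" 
    using f g csubspace_add[OF A_csubspace] unfolding fams_def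
    by (simp del: split_paired_All) (metis add_0)
next
  show "(\<lambda>t. 0) \<in> fams" by (simp add: fams_def csubspace_0[OF A_csubspace])
  assume "q \<in> Q" "e \<in> bas q" "a \<in> A"
  moreover have "finite {t. (if t = (q, e) then a else 0) \<noteq> 0}"
    by (rule finite_subset[of _ "{(q, e)}"]) auto
  ultimately show "(\<lambda>t. if t = (q, e) then a else 0) \<in> fams"
    by (auto simp: fams_def idx_def csubspace_0[OF A_csubspace])
qed

lemma fams_diff: "f \<in> fams \<Longrightarrow> g \<in> fams \<Longrightarrow> (\<lambda>t. f t - g t) \<in> fams"
  using fams_add[OF _ fams_scale[of g "-1"], of f] by simp

lemma fams_sum: "(\<And>i. i \<in> I \<Longrightarrow> f i \<in> fams) \<Longrightarrow> (\<lambda>t. \<Sum>i\<in>I. f i t) \<in> fams"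
  by (induction I rule: infinite_finite_induct) (auto simp: fams_zero intro: fams_add)

lemma famsD: "f \<in> fams \<Longrightarrow> finite {t. f t \<noteq> 0}" "f \<in> fams \<Longrightarrow> f t \<in> A" "f \<in> fams \<Longrightarrow> f t \<noteq> 0 \<Longrightarrow> t \<in> idx"
  by (simp_all add: fams_def del: split_paired_All)

lemma ev_add: "ev (\<lambda>t. f t + g t) t = ev f t + ev g t"
  and ev_diff: "ev (\<lambda>t. f t - g t) t = ev f t - ev g t"
  and ev_scale: "ev (\<lambda>t. c *\<^sub>C f t) t = c *\<^sub>C ev f t"
  and ev_act: "ev (\<lambda>t. a o\<^sub>L f t) t = a (ev f t)"
  by (simp_all add: ev_def blinfun.bilinear_simps)

lemma common_support:
  assumes "f \<in> fams" "g \<in> fams"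
  obtains F where "finite F" "{t. f t \<noteq> 0} \<subseteq> F" "{t. g t \<noteq> 0} \<subseteq> F"
  using famsD(1)[OF assms(1)] famsD(1)[OF assms(2)] by (meson Un_upper1 Un_upper2 finite_UnI)

lemma syn_add: "f \<in> fams \<Longrightarrow> g \<in> fams \<Longrightarrow> syn (\<lambda>t. f t + g t) = syn f + syn g"
  and syn_scale: "f \<in> fams \<Longrightarrow> syn (\<lambda>t. c *\<^sub>C f t) = c *\<^sub>C syn f"
  and syn_act: "a \<in> A \<Longrightarrow> f \<in> fams \<Longrightarrow> syn (\<lambda>t. a o\<^sub>L f t) = blinfun_apply a (syn f)"
proof -
  assume f: "f \<in> fams"
  let ?F = "{t. f t \<noteq> 0}"
  show "syn (\<lambda>t. c *\<^sub>C f t) = c *\<^sub>C syn f"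
    using famsD(1)[OF f] by (subst syn_on[of ?F]) (auto simp: syn_def cvs.scale_zero_right cvs.scale_sum_right)
  show "syn (\<lambda>t. a o\<^sub>L f t) = blinfun_apply a (syn f)"
    using famsD(1)[OF f] by (subst syn_on[of ?F]) (auto simp: syn_def blinfun.sum_right)
  assume g: "g \<in> fams"
  obtain F where F: "finite F" "{t. f t \<noteq> 0} \<subseteq> F" "{t. g t \<noteq> 0} \<subseteq> F" using common_support[OF f g] .
  have "{t. f t + g t \<noteq> 0} \<subseteq> F" using F by force
  then show "syn (\<lambda>t. f t + g t) = syn f + syn g"
    using F by (simp add: syn_on[of F] blinfun.add_left sum.distrib)
qed

lemma syn_diff: "f \<in> fams \<Longrightarrow> g \<in> fams \<Longrightarrow> syn (\<lambda>t. f t - g t) = syn f - syn g"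
  using syn_add[OF _ fams_scale[of g "-1"], of f] syn_scale[of g "-1"] by simp

lemma syn_zero: "syn (\<lambda>t. 0) = 0" by (simp add: syn_def)

lemma syn_sum: "(\<And>i. i \<in> I \<Longrightarrow> f i \<in> fams) \<Longrightarrow> syn (\<lambda>t. \<Sum>i\<in>I. f i t) = (\<Sum>i\<in>I. syn (f i))"
  by (induction I rule: infinite_finite_induct) (simp_all add: syn_zero syn_add fams_sum)

lemma syn_single: "q \<in> Q \<Longrightarrow> syn (\<lambda>t. if t = (q, e) then a else 0) = blinfun_apply a e"
  by (subst syn_on[of "{(q, e)}"]) auto

text \<open>Enumerating the support turns a family into a \<open>theta_system\<close>. That
  \<open>C\<close> does not depend on the size of the support is what allows limits later
  on.\<close>

lemma syn_upper: "f \<in> fams \<Longrightarrow> norm (syn f) \<le> C * nrm f"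
  and syn_lower: "f \<in> fams \<Longrightarrow> nrm f \<le> C * norm (syn f)"
proof -
  assume f: "f \<in> fams"
  define m where "m = card {t. f t \<noteq> 0}"
  obtain h where h: "bij_betw h {..<m} {t. f t \<noteq> 0}"
    unfolding m_def using ex_bij_betw_nat_finite[OF famsD(1)[OF f]] by (auto simp: atLeast0LessThan)
  have ht: "fst (h i) \<in> Q" "snd (h i) \<in> bas (fst (h i))" if "i < m" for i
    using bij_betwE[OF h] famsD(3)[OF f] that by (auto simp: idx_def)
  interpret t: theta_system A K m "\<lambda>i. fst (h i)" "\<lambda>i. \<xi> (fst (h i))" "\<lambda>i. snd (h i)"
  proof unfold_locales
    fix i assume i: "i < m"
    show "minimal_idem (fst (h i))" by (rule minimal[OF ht(1)[OF i]])
    show "fst (h i) (\<xi> (fst (h i))) = \<xi> (fst (h i))" "norm (\<xi> (fst (h i))) = 1" by (rule xi[OF ht(1)[OF i]])+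
    show "fst (h i) (snd (h i)) = snd (h i)" by (rule bas(3)[OF ht[OF i]])
    fix j assume j: "j < m"
    show "fst (h i) (blinfun_apply a (fst (h j) x)) = 0" if "fst (h i) \<noteq> fst (h j)" "a \<in> A" for a x
      by (rule inequivalent[OF ht(1)[OF i] ht(1)[OF j] that])
    assume e: "fst (h i) = fst (h j)"
    then show "\<xi> (fst (h i)) = \<xi> (fst (h j))" by simp
    have "i = j \<longleftrightarrow> snd (h i) = snd (h j)"
      using bij_betw_imp_inj_on[OF h] i j e by (auto simp: inj_on_def prod_eq_iff)
    then show "cinner (snd (h i)) (snd (h j)) = (if i = j then 1 else 0)"
      using bas(2)[OF ht(1)[OF i]] ht(2)[OF i] ht(2)[OF j] e by (simp add: orthonormal_def)
  qed
  have fam: "t.fam (\<lambda>i. f (h i))" by (simp add: t.fam_def famsD(2)[OF f])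
  have th: "t.theta (\<lambda>i. f (h i)) = syn f"
    unfolding t.theta_def syn_def by (rule sum.reindex_bij_betw[OF h])
  have ns: "sqrt (t.nsq (\<lambda>i. f (h i))) = nrm f"
    unfolding t.nsq_def nrm_def L2_set_def ev_def
    using sum.reindex_bij_betw[OF h, of "\<lambda>t. (norm (blinfun_apply (f t) (\<xi> (fst t))))\<^sup>2"] by simp
  show "norm (syn f) \<le> C * nrm f" "nrm f \<le> C * norm (syn f)"
    using t.theta_upper[OF fam] t.theta_lower[OF fam] by (simp_all add: th ns C_def)
qed

lemma nrm_zeroD: "f \<in> fams \<Longrightarrow> nrm f = 0 \<Longrightarrow> ev f t = 0"
  by (cases "f t = 0") (simp_all add: nrm_def L2_set_eq_0_iff famsD(1) ev_zero del: split_paired_All)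

lemma nrm_nonneg: "0 \<le> nrm f" by (simp add: nrm_def L2_set_nonneg)

lemma nrm_sq: "f \<in> fams \<Longrightarrow> frm f f = complex_of_real ((nrm f)\<^sup>2)"
  by (simp add: frm_def nrm_def L2_set_def cinner_self sum_nonneg del: of_real_power)

text \<open>A vector determines its coordinates, although not the family that represents it. Hence
  \<open>frm\<close> descends to a form on vectors.\<close>

lemma syn_eq_iff:
  assumes "f \<in> fams" "g \<in> fams"
  shows "syn f = syn g \<longleftrightarrow> ev f = ev g"
proof
  note d = fams_diff[OF assms]
  assume "syn f = syn g"
  then have "nrm (\<lambda>t. f t - g t) = 0"
    using syn_lower[OF d] nrm_nonneg by (simp add: syn_diff assms order_antisym)
  then show "ev f = ev g" using nrm_zeroD[OF d] by (auto simp: ev_diff fun_eq_iff)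
next
  note d = fams_diff[OF assms]
  assume "ev f = ev g"
  then have "nrm (\<lambda>t. f t - g t) = 0" by (simp add: nrm_def ev_diff L2_set_def)
  then show "syn f = syn g" using syn_upper[OF d] by (simp add: syn_diff assms)
qed

lemma frm_cong:
  assumes "f \<in> fams" "f' \<in> fams" "ev f = ev f'" "ev g = ev g'"
  shows "frm f g = frm f' g'"
proof -
  obtain F where "finite F" "{t. f t \<noteq> 0} \<subseteq> F" "{t. f' t \<noteq> 0} \<subseteq> F" using common_support[OF assms(1,2)] .
  then show ?thesis using assms by (simp add: frm_on[of F])
qed

lemma frm_herm:
  assumes "f \<in> fams" "g \<in> fams" shows "frm g f = cnj (frm f g)"
proof -
  obtain F where F: "finite F" "{t. f t \<noteq> 0} \<subseteq> F" "{t. g t \<noteq> 0} \<subseteq> F" using common_support[OF assms] .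
  have "(\<Sum>t\<in>F. cinner (ev g t) (ev f t)) = cnj (\<Sum>t\<in>F. cinner (ev f t) (ev g t))"
    unfolding cnj_sum by (intro sum.cong refl cinner_commute)
  then show ?thesis using F by (simp add: frm_on[of F])
qed

lemma frm_bound:
  assumes "f \<in> fams" "g \<in> fams" shows "cmod (frm f g) \<le> nrm f * nrm g"
proof -
  obtain F where F: "finite F" "{t. f t \<noteq> 0} \<subseteq> F" "{t. g t \<noteq> 0} \<subseteq> F" using common_support[OF assms] .
  have "cmod (\<Sum>t\<in>F. cinner (ev f t) (ev g t)) \<le> (\<Sum>t\<in>F. \<bar>norm (ev f t)\<bar> * \<bar>norm (ev g t)\<bar>)"
    by (rule sum_norm_le) (simp add: norm_cinner_le)
  also have "\<dots> \<le> L2_set (\<lambda>t. norm (ev f t)) F * L2_set (\<lambda>t. norm (ev g t)) F" by (rule L2_set_mult_ineq)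
  finally show ?thesis using F by (simp add: frm_on[of F] nrm_on[of F])
qed

lemma syn_imageI: "f \<in> fams \<Longrightarrow> x = syn f \<Longrightarrow> x \<in> syn ` fams" by (rule image_eqI)

lemma csubspace_syn: "csubspace (syn ` fams)"
  unfolding csubspace_def
proof (intro conjI ballI allI)
  show "0 \<in> syn ` fams" by (rule syn_imageI[OF fams_zero syn_zero[symmetric]])
  fix x assume "x \<in> syn ` fams"
  then obtain f where f: "f \<in> fams" "x = syn f" by blast
  show "c *\<^sub>C x \<in> syn ` fams" for c
    unfolding f(2) by (rule syn_imageI[OF fams_scale[OF f(1)] syn_scale[OF f(1), symmetric]])
  fix y assume "y \<in> syn ` fams"
  then obtain g where g: "g \<in> fams" "y = syn g" by blast
  show "x + y \<in> syn ` fams" 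
    unfolding f(2) g(2) by (rule syn_imageI[OF fams_add[OF f(1) g(1)] syn_add[OF f(1) g(1), symmetric]])
qed

lemma R_dense: "R \<subseteq> closure (syn ` fams)"
proof (rule total)
  show "submod (closure (syn ` fams))"
    unfolding submod_def
  proof (intro conjI ballI csubspace_closure csubspace_syn closed_closure)
    fix a x assume a: "a \<in> A" and x: "x \<in> closure (syn ` fams)"
    show "a x \<in> closure (syn ` fams)"
    proof (rule closure_invariant[OF x])
      fix v assume "v \<in> syn ` fams"
      then obtain f where f: "f \<in> fams" "v = syn f" by blast
      show "a v \<in> syn ` fams"
        unfolding f(2) by (rule syn_imageI[OF fams_act[OF a f(1)] syn_act[OF a f(1), symmetric]])
    qed
  qed
  fix q x assume q: "q \<in> Q"
  have "e \<in> syn ` fams" if e: "e \<in> bas q" for e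
    by (rule syn_imageI[OF fams_single[OF q e minQ(1)[OF q]]]) (simp only: syn_single[OF q] bas(3)[OF q e])
  then have "(\<Sum>e\<in>bas q. cinner (q x) e *\<^sub>C e) \<in> syn ` fams"
    by (intro csubspace_sum[OF csubspace_syn] csubspace_scaleC[OF csubspace_syn])
  then show "blinfun_apply q x \<in> closure (syn ` fams)"
    using bas(4)[OF q minQ(2)[OF q, of x]] closure_subset[of "syn ` fams"] by (metis subsetD)
qed

text \<open>Representatives of vectors are chosen arbitrarily and \<open>frm_cong\<close> removes
  the ambiguity. The lower estimates for \<open>syn\<close> bound the form by \<open>C * C\<close>,
  so it extends and is represented by an operator.\<close>

lemma form_operator: "\<exists>G\<in>bounded_ops. \<forall>f\<in>fams. \<forall>g\<in>fams. cinner (syn f) (blinfun_apply G (syn g)) = frm f g"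
proof -
  define rep where "rep x = (SOME f. f \<in> fams \<and> syn f = x)" for x
  have rep: "rep x \<in> fams" "syn (rep x) = x" if "x \<in> syn ` fams" for x
    using someI_ex[of "\<lambda>f. f \<in> fams \<and> syn f = x"] that unfolding rep_def by auto
  define B where "B x y = frm (rep x) (rep y)" for x y
  have B: "B (syn f) (syn g) = frm f g" if "f \<in> fams" "g \<in> fams" for f g
    unfolding B_def using that rep[of "syn f"] rep[of "syn g"] by (intro frm_cong) (auto simp flip: syn_eq_iff)
  have "\<exists>G\<in>bounded_ops. \<forall>x\<in>syn ` fams. \<forall>y\<in>syn ` fams. B x y = cinner x (blinfun_apply G y)"
  proof (rule extend_form[OF csubspace_syn, where K = "C * C"])
    show "0 \<le> C * C" using C_ge_1 by simp
    fix x y assume "x \<in> syn ` fams" "y \<in> syn ` fams"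
    then obtain f g where f: "f \<in> fams" "x = syn f" and g: "g \<in> fams" "y = syn g" by blast
    show "B y x = cnj (B x y)"
      unfolding f(2) g(2) B[OF f(1) g(1)] B[OF g(1) f(1)] by (rule frm_herm[OF f(1) g(1)])
    show "B (c *\<^sub>C x) y = c * B x y" for c
    proof -
      have "B (c *\<^sub>C x) y = frm (\<lambda>t. c *\<^sub>C f t) g" using f g by (simp add: B fams_scale flip: syn_scale)
      also have "\<dots> = (\<Sum>t | f t \<noteq> 0. c * cinner (ev f t) (ev g t))"
        using famsD(1)[OF f(1)] by (subst frm_on[of "{t. f t \<noteq> 0}"]) (auto simp: ev_scale cinner_scaleC_left cvs.scale_zero_right)
      finally show ?thesis using f g by (simp add: B frm_def sum_distrib_left)
    qed
    show "cmod (B x y) \<le> C * C * norm x * norm y"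
    proof -
      have "cmod (B x y) \<le> nrm f * nrm g" using f g by (simp add: B frm_bound)
      also have "\<dots> \<le> (C * norm x) * (C * norm y)"
        using f g C_ge_1 syn_lower nrm_nonneg by (intro mult_mono) auto
      finally show ?thesis by (simp add: mult_ac)
    qed
    fix x' assume "x' \<in> syn ` fams"
    then obtain f' where f': "f' \<in> fams" "x' = syn f'" by blast
    obtain F where F: "finite F" "{t. f t \<noteq> 0} \<subseteq> F" "{t. f' t \<noteq> 0} \<subseteq> F" using common_support[OF f(1) f'(1)] .
    have F': "{t. f t + f' t \<noteq> 0} \<subseteq> F" using F by force
    have "B (x + x') y = frm (\<lambda>t. f t + f' t) g" using f f' g by (simp add: B fams_add flip: syn_add)
    also have "\<dots> = frm f g + frm f' g" using F F' by (simp add: frm_on[of F] ev_add cinner_add_left sum.distrib)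
    finally show "B (x + x') y = B x y + B x' y" using f f' g by (simp add: B)
  qed
  then show ?thesis using B by auto
qed

end

section \<open>Rank one operators in the new coordinates\<close>

locale atoms_form = atoms +
  fixes G :: "'a \<Rightarrow>\<^sub>L 'a"
  assumes G: "G \<in> bounded_ops"
    and form: "f \<in> fams \<Longrightarrow> g \<in> fams \<Longrightarrow> cinner (syn f) (blinfun_apply G (syn g)) = frm f g"
begin

definition M :: real where "M = 1 + K"

lemma M_pos: "M > 0" using K_nonneg by (simp add: M_def)

lemma R_eq_on:
  assumes x: "x \<in> R" and u: "continuous_on UNIV u" and v: "continuous_on UNIV v"
    and eq: "\<And>f. f \<in> fams \<Longrightarrow> u (syn f) = (v (syn f) :: 'c::t2_space)"
  shows "u x = v x"
proof -
  have "closure (syn ` fams) \<subseteq> {x. u x = v x}"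
    by (rule closure_minimal) (use eq closed_Collect_eq[OF u v] in auto)
  then show ?thesis using R_dense x by blast
qed

lemma split: "x - P x \<in> R" "norm (x - P x) \<le> M * norm x"
proof -
  show "x - P x \<in> R" using mprojD(2,3)[OF P] by (simp add: R_def blinfun.diff_right)
  have "norm (x - P x) \<le> norm x + norm (P x)" by (rule norm_triangle_ineq4)
  also have "\<dots> \<le> M * norm x" using mprojD(5)[OF P, of x] by (simp add: M_def algebra_simps)
  finally show "norm (x - P x) \<le> M * norm x" .
qed

lemma act_split: "a \<in> A \<Longrightarrow> blinfun_apply a (x - P x) = a x"
  by (simp add: blinfun.diff_right kill_P)

text \<open>\<open>T\<close> vanishes on the range of \<open>P\<close>, so its norm is decided on
  \<open>R\<close>, where the vectors \<open>syn f\<close> are dense; \<open>M\<close> bounds the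
  norm of \<open>1 - P\<close>.\<close>

lemma op_bound:
  assumes T: "T \<in> A" and c: "c \<ge> 0" and bd: "\<And>f. f \<in> fams \<Longrightarrow> norm (blinfun_apply T (syn f)) \<le> c * norm (syn f)"
  shows "norm T \<le> c * M"
proof (rule norm_blinfun_bound)
  show "0 \<le> c * M" using c M_pos by simp
  fix x
  have cl: "closed {y. norm (blinfun_apply T y) \<le> c * norm y}"
    by (intro closed_Collect_le continuous_intros)
  have "closure (syn ` fams) \<subseteq> {y. norm (blinfun_apply T y) \<le> c * norm y}"
    by (rule closure_minimal[OF _ cl]) (use bd in auto)
  then have "norm (T (x - P x)) \<le> c * norm (x - P x)" using R_dense split(1) by blast
  also have "\<dots> \<le> c * (M * norm x)" using c split(2) by (intro mult_left_mono)
  finally show "norm (T x) \<le> c * M * norm x" by (simp add: act_split[OF T] mult_ac)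
qed

text \<open>In coordinates, \<open>is_rank_one q b w T\<close> says that \<open>T\<close> is \<open>v \<mapsto> cinner v w *\<^sub>C b (\<xi> q)\<close> on all copies of \<open>cyclic (\<xi> q)\<close>.\<close>

definition rank_one_fam :: "('a \<Rightarrow>\<^sub>L 'a) \<Rightarrow> ('a \<Rightarrow>\<^sub>L 'a) \<Rightarrow> 'a \<Rightarrow> (('a \<Rightarrow>\<^sub>L 'a) \<times> 'a \<Rightarrow> 'a \<Rightarrow>\<^sub>L 'a) \<Rightarrow> ('a \<Rightarrow>\<^sub>L 'a) \<times> 'a \<Rightarrow> 'a \<Rightarrow>\<^sub>L 'a" where
  "rank_one_fam q b w f t = (if fst t = q then cinner (ev f t) w *\<^sub>C b else 0)"

definition is_rank_one :: "('a \<Rightarrow>\<^sub>L 'a) \<Rightarrow> ('a \<Rightarrow>\<^sub>L 'a) \<Rightarrow> 'a \<Rightarrow> ('a \<Rightarrow>\<^sub>L 'a) \<Rightarrow> bool" where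
  "is_rank_one q b w T \<longleftrightarrow> T \<in> A \<and> (\<forall>f\<in>fams. T (syn f) = syn (rank_one_fam q b w f))"

lemma rank_one_fam_support: "{t. rank_one_fam q b w f t \<noteq> 0} \<subseteq> {t. f t \<noteq> 0}"
  by (auto simp: rank_one_fam_def ev_zero cvs.scale_zero_left)

lemma rank_one_fam_fams: "b \<in> A \<Longrightarrow> f \<in> fams \<Longrightarrow> rank_one_fam q b w f \<in> fams"
proof -
  assume b: "b \<in> A" and f: "f \<in> fams"
  have "rank_one_fam q b w f t \<in> A" for t
    using b csubspace_scaleC[OF A_csubspace] csubspace_0[OF A_csubspace] by (simp add: rank_one_fam_def)
  moreover have "t \<in> idx" if "rank_one_fam q b w f t \<noteq> 0" for t
    using rank_one_fam_support that famsD(3)[OF f] by blast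
  ultimately show ?thesis
    using finite_subset[OF rank_one_fam_support famsD(1)[OF f]] unfolding fams_def by blast
qed

lemma ev_rank_one_fam: "ev (rank_one_fam q b w f) t = (if fst t = q then cinner (ev f t) w *\<^sub>C blinfun_apply b (\<xi> q) else 0)"
  by (simp add: ev_def rank_one_fam_def)

lemma syn_rank_one_fam: "f \<in> fams \<Longrightarrow> syn (rank_one_fam q b w f) = (\<Sum>t | f t \<noteq> 0. if fst t = q then cinner (ev f t) w *\<^sub>C blinfun_apply b (snd t) else 0)"
  by (subst syn_on[OF _ rank_one_fam_support]) (auto simp: famsD(1) rank_one_fam_def intro!: sum.cong)

lemma nrm_rank_one_fam:
  assumes f: "f \<in> fams"
  shows "nrm (rank_one_fam q b w f) \<le> norm w * norm (blinfun_apply b (\<xi> q)) * nrm f"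
proof -
  have "nrm (rank_one_fam q b w f) \<le> L2_set (\<lambda>t. norm w * norm (blinfun_apply b (\<xi> q)) * norm (ev f t)) {t. f t \<noteq> 0}"
    unfolding nrm_on[OF famsD(1)[OF f] rank_one_fam_support]
  proof (rule L2_set_mono)
    fix t
    have "cmod (cinner (ev f t) w) * norm (blinfun_apply b (\<xi> q)) \<le> norm (ev f t) * norm w * norm (blinfun_apply b (\<xi> q))"
      by (intro mult_right_mono norm_cinner_le norm_ge_zero)
    then show "norm (ev (rank_one_fam q b w f) t) \<le> norm w * norm (blinfun_apply b (\<xi> q)) * norm (ev f t)"
      by (simp add: ev_rank_one_fam norm_scaleC mult_ac)
  qed simp
  also have "\<dots> = norm w * norm (blinfun_apply b (\<xi> q)) * nrm f"
    unfolding nrm_def by (rule L2_set_right_distrib[symmetric]) simp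
  finally show ?thesis .
qed

text \<open>Each passage between vectors and coordinates costs a factor \<open>C\<close>, and
  \<open>op_bound\<close> adds \<open>M\<close>.\<close>

lemma is_rank_one_norm:
  assumes V: "is_rank_one q b w T" and b: "b \<in> A"
  shows "norm T \<le> C * C * M * norm (blinfun_apply b (\<xi> q)) * norm w"
proof -
  define k where "k = norm w * norm (blinfun_apply b (\<xi> q))"
  have k: "k \<ge> 0" by (simp add: k_def)
  have "norm T \<le> (C * k * C) * M"
  proof (rule op_bound)
    show "T \<in> A" using V by (simp add: is_rank_one_def)
    show "0 \<le> C * k * C" using C_ge_1 k by simp
    fix f assume f: "f \<in> fams"
    have "norm (T (syn f)) \<le> C * nrm (rank_one_fam q b w f)"
      using V f syn_upper[OF rank_one_fam_fams[OF b f]] by (simp add: is_rank_one_def)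
    also have "\<dots> \<le> C * (k * nrm f)" using nrm_rank_one_fam[OF f] C_ge_1 by (intro mult_left_mono) (auto simp: k_def)
    also have "\<dots> \<le> C * (k * (C * norm (syn f)))" using syn_lower[OF f] k C_ge_1 by (intro mult_left_mono) auto
    finally show "norm (T (syn f)) \<le> C * k * C * norm (syn f)" by (simp add: mult_ac)
  qed
  then show ?thesis by (simp add: k_def mult_ac)
qed

lemma is_rank_one_diff:
  assumes "is_rank_one q b w T" "is_rank_one q b w' T'" "b \<in> A" shows "is_rank_one q b (w - w') (T - T')"
  unfolding is_rank_one_def
proof (intro conjI ballI)
  show "T - T' \<in> A" using assms csubspace_diff[OF A_csubspace] by (simp add: is_rank_one_def)
  fix f assume f: "f \<in> fams"
  have "rank_one_fam q b (w - w') f = (\<lambda>t. rank_one_fam q b w f t - rank_one_fam q b w' f t)"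
    by (auto simp: rank_one_fam_def cinner_diff_right cvs.scale_left_diff_distrib fun_eq_iff)
  then show "(T - T') (syn f) = syn (rank_one_fam q b (w - w') f)"
    using assms f by (simp add: is_rank_one_def blinfun.diff_left syn_diff rank_one_fam_fams)
qed

text \<open>The operator depends on \<open>w\<close> in a Lipschitz way, so a convergent sequence of
  vectors gives a Cauchy sequence of operators, whose limit remains in the closed set
  \<open>A\<close>.\<close>

lemma is_rank_one_limit:
  assumes V: "\<And>n. is_rank_one q b (w n) (T n)" and w: "w \<longlonglongrightarrow> z" and b: "b \<in> A"
  shows "\<exists>T'. is_rank_one q b z T' \<and> T \<longlonglongrightarrow> T'"
proof -
  define k where "k = C * C * M * norm (blinfun_apply b (\<xi> q)) + 1"
  have k: "k > 0" using C_ge_1 M_pos by (auto simp: k_def intro!: add_nonneg_pos)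
  have bd: "norm (T m - T n) \<le> k * norm (w m - w n)" for m n
    by (rule order_trans[OF is_rank_one_norm[OF is_rank_one_diff[OF V V b] b]]) (auto simp: k_def intro!: mult_right_mono)
  have "Cauchy T"
  proof (rule CauchyI)
    fix e :: real assume e: "0 < e"
    obtain N where N: "\<And>m n. m \<ge> N \<Longrightarrow> n \<ge> N \<Longrightarrow> norm (w m - w n) < e / k"
      using CauchyD[OF LIMSEQ_imp_Cauchy[OF w], of "e / k"] e k by auto
    have "norm (T m - T n) < e" if "m \<ge> N" "n \<ge> N" for m n
      using bd[of m n] mult_strict_left_mono[OF N[OF that] k] k by simp
    then show "\<exists>N. \<forall>m\<ge>N. \<forall>n\<ge>N. norm (T m - T n) < e" by blast
  qed
  then obtain T' where T': "T \<longlonglongrightarrow> T'" using Cauchy_convergent by (auto simp: convergent_def)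
  have "T' \<in> A" using A_closed V T' by (auto simp: closed_sequential_limits is_rank_one_def)
  moreover have "T' (syn f) = syn (rank_one_fam q b z f)" if f: "f \<in> fams" for f
  proof (rule LIMSEQ_unique)
    show "(\<lambda>n. T n (syn f)) \<longlonglongrightarrow> T' (syn f)" by (rule tendsto_blinfun_apply[OF T'])
    have "(\<lambda>n. if fst t = q then cinner (ev f t) (w n) *\<^sub>C blinfun_apply b (snd t) else 0)
        \<longlonglongrightarrow> (if fst t = q then cinner (ev f t) z *\<^sub>C blinfun_apply b (snd t) else 0)" for t
      by (cases "fst t = q") (auto intro!: tendsto_scaleC tendsto_cinner w)
    then have "(\<lambda>n. syn (rank_one_fam q b (w n) f)) \<longlonglongrightarrow> syn (rank_one_fam q b z f)"
      unfolding syn_rank_one_fam[OF f] by (intro tendsto_sum)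
    then show "(\<lambda>n. T n (syn f)) \<longlonglongrightarrow> syn (rank_one_fam q b z f)" using V f by (simp add: is_rank_one_def)
  qed
  ultimately show ?thesis using T' by (auto simp: is_rank_one_def)
qed

text \<open>By minimality \<open>q c\<close> maps the module generated by \<open>\<xi> q\<close>
  into the line of \<open>\<xi> q\<close>. The coefficient is a bounded functional; the adjoint
  represents it, and projecting the representing vector moves it into the module.\<close>

lemma coefficient_functional:
  assumes q: "q \<in> Q" and c: "c \<in> A"
  shows "\<exists>z\<in>cyclic (\<xi> q). \<forall>v\<in>cyclic (\<xi> q). q (blinfun_apply c v) = cinner v z *\<^sub>C \<xi> q"
proof -
  note L = submodD(1,2)[OF submod_cyclic[of "\<xi> q"]]
  obtain T where T: "\<And>x y. cinner ((q o\<^sub>L c) x) y = cinner x (blinfun_apply T y)"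
    using adjoint_exists[OF bounded_ops_compose[OF A_bounded[OF minQ(1)[OF q]] A_bounded[OF c]]] by (auto simp: is_adjoint_def)
  define z where "z = proj (cyclic (\<xi> q)) (T (\<xi> q))"
  have z: "cinner v z = cinner (q (c v)) (\<xi> q)" if "v \<in> cyclic (\<xi> q)" for v
  proof -
    have "cinner (T (\<xi> q) - z) v = 0" unfolding z_def by (rule proj_corth[OF L that])
    then have "cinner v (T (\<xi> q) - z) = 0" by (simp add: cinner_eq_0_commute)
    then show ?thesis using T[of v "\<xi> q"] by (simp add: cinner_diff_right)
  qed
  have x1: "cinner (\<xi> q) (\<xi> q) = 1" using xi(2)[OF q] by (simp add: cinner_self)
  have cont: "continuous_on UNIV (\<lambda>v. cinner (q (c v)) (\<xi> q) *\<^sub>C \<xi> q)"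
    unfolding continuous_on_def
    by (auto intro!: tendsto_scaleC tendsto_cinner blinfun.tendsto tendsto_ident_at tendsto_const)
  have "cyclic (\<xi> q) \<subseteq> {v. q (c v) = cinner (q (c v)) (\<xi> q) *\<^sub>C \<xi> q}"
    unfolding cyclic_def
  proof (rule closure_minimal)
    show "closed {v. q (c v) = cinner (q (c v)) (\<xi> q) *\<^sub>C \<xi> q}"
      by (intro closed_Collect_eq cont continuous_intros)
    have "q (c (blinfun_apply a (\<xi> q))) = cinner (q (c (a (\<xi> q)))) (\<xi> q) *\<^sub>C \<xi> q" if a: "a \<in> A" for a
    proof -
      obtain k where "\<And>x. q ((c o\<^sub>L a) (q x)) = k *\<^sub>C q x"
        using minimal_idemD(4)[OF minimal[OF q] A_compose[OF c a]] by blast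
      from this[of "\<xi> q"] show ?thesis by (simp add: xi(1)[OF q] cinner_scaleC_left x1)
    qed
    then show "(\<lambda>a. blinfun_apply a (\<xi> q)) ` A \<subseteq> {v. q (c v) = cinner (q (c v)) (\<xi> q) *\<^sub>C \<xi> q}" by auto
  qed
  then have "\<forall>v\<in>cyclic (\<xi> q). q (c v) = cinner v z *\<^sub>C \<xi> q" using z by auto
  moreover have "z \<in> cyclic (\<xi> q)" unfolding z_def by (rule proj_in[OF L])
  ultimately show ?thesis by blast
qed

text \<open>On the range of \<open>q\<close> the operator \<open>q c (f t)\<close> is a scalar
  \<open>k\<close>. It is the same at \<open>\<xi> q\<close> and at every basis vector
  \<open>e\<close>, which is why a single element of \<open>A\<close> acts alike on all copies; on
  copies belonging to other idempotents it vanishes by inequivalence.\<close>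

lemma is_rank_one_coefficient:
  assumes q: "q \<in> Q" and c: "c \<in> A" and b: "b \<in> A"
    and z: "\<And>v. v \<in> cyclic (\<xi> q) \<Longrightarrow> q (blinfun_apply c v) = cinner v z *\<^sub>C \<xi> q"
  shows "is_rank_one q b z (b o\<^sub>L (q o\<^sub>L c))"
  unfolding is_rank_one_def
proof (intro conjI ballI)
  show "(b o\<^sub>L (q o\<^sub>L c)) \<in> A" by (intro A_compose b c minQ(1)[OF q])
  fix f assume f: "f \<in> fams"
  have "b (q (c (f t (snd t)))) = (if fst t = q then cinner (ev f t) z *\<^sub>C blinfun_apply b (snd t) else 0)" if t: "f t \<noteq> 0" for t
  proof -
    have fA: "(c o\<^sub>L f t) \<in> A" by (intro A_compose c famsD(2)[OF f])
    have ti: "fst t \<in> Q" "snd t \<in> bas (fst t)" using famsD(3)[OF f t] by (auto simp: idx_def)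
    have e: "fst t (snd t) = snd t" by (rule bas(3)[OF ti])
    show ?thesis
    proof (cases "fst t = q")
      case True
      obtain k where k: "\<And>x. q ((c o\<^sub>L f t) (q x)) = k *\<^sub>C q x"
        using minimal_idemD(4)[OF minimal[OF q] fA] by blast
      have "cinner (ev f t) z *\<^sub>C \<xi> q = k *\<^sub>C \<xi> q"
        using k[of "\<xi> q"] z[of "ev f t"] cyclic_base[OF famsD(2)[OF f, of t], of "\<xi> q"]
        by (auto simp: xi(1)[OF q] ev_def True)
      moreover have "\<xi> q \<noteq> 0" using xi(2)[OF q] by auto
      ultimately have "cinner (ev f t) z = k" using cvs.scale_right_imp_eq by blast
      then show ?thesis using k[of "snd t"] e True A_scaleC[OF b] by simp
    next
      case False
      then show ?thesis using inequivalent[OF q ti(1) _ fA, of "snd t"] e by auto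
    qed
  qed
  then show "(b o\<^sub>L (q o\<^sub>L c)) (syn f) = syn (rank_one_fam q b z f)"
    unfolding syn_rank_one_fam[OF f] by (auto simp: syn_def blinfun.sum_right intro!: sum.cong)
qed

text \<open>The vectors \<open>w\<close> obtained from coefficients form a subspace
  \<open>Z\<close>. A vector of the module orthogonal to \<open>Z\<close> is killed by
  \<open>q A\<close>, hence is \<open>0\<close> by \<open>cyclic_irreducible\<close>; so
  \<open>Z\<close> is dense, and limits are covered by \<open>is_rank_one_limit\<close>.\<close>

lemma is_rank_one_exists:
  assumes q: "q \<in> Q" and b: "b \<in> A" and w: "w \<in> cyclic (\<xi> q)"
  shows "\<exists>T. is_rank_one q b w T"
proof -
  define L where "L = cyclic (\<xi> q)"
  have L: "csubspace L" "closed L" unfolding L_def using submodD[OF submod_cyclic] by auto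
  define Z where "Z = {z\<in>L. \<exists>c\<in>A. \<forall>v\<in>L. q (blinfun_apply c v) = cinner v z *\<^sub>C \<xi> q}"
  have Z: "csubspace Z"
    unfolding csubspace_def
  proof (intro conjI ballI allI)
    show "0 \<in> Z" unfolding Z_def using csubspace_0[OF L(1)] csubspace_0[OF A_csubspace]
      by (auto intro!: bexI[of _ 0] simp: cvs.scale_zero_left)
    fix x assume "x \<in> Z"
    then obtain c where x: "x \<in> L" and c: "c \<in> A" "\<And>v. v \<in> L \<Longrightarrow> q (c v) = cinner v x *\<^sub>C \<xi> q" by (auto simp: Z_def)
    show "k *\<^sub>C x \<in> Z" for k
      unfolding Z_def using x c csubspace_scaleC[OF L(1)] csubspace_scaleC[OF A_csubspace]
      by (auto intro!: bexI[of _ "cnj k *\<^sub>C c"] simp: A_scaleC[OF minQ(1)[OF q]] cinner_scaleC_right scaleC_scaleC)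
    fix y assume "y \<in> Z"
    then obtain d where y: "y \<in> L" and d: "d \<in> A" "\<And>v. v \<in> L \<Longrightarrow> q (d v) = cinner v y *\<^sub>C \<xi> q" by (auto simp: Z_def)
    show "x + y \<in> Z"
      unfolding Z_def using x c y d csubspace_add[OF L(1)] csubspace_add[OF A_csubspace]
      by (auto intro!: bexI[of _ "c + d"] simp: blinfun.add_left blinfun.add_right cinner_add_right scaleC_add_left)
  qed
  note cZ = csubspace_closure[OF Z] closed_closure[of Z]
  have ZL: "closure Z \<subseteq> L" using L(2) by (intro closure_minimal) (auto simp: Z_def)
  define w0 where "w0 = w - proj (closure Z) w"
  have w0L: "w0 \<in> cyclic (\<xi> q)" unfolding w0_def L_def[symmetric]
    using w ZL proj_in[OF cZ, of w] csubspace_diff[OF L(1)] by (auto simp: L_def)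
  have "q (blinfun_apply c w0) = 0" if c: "c \<in> A" for c
  proof -
    obtain z where z: "z \<in> L" "\<And>v. v \<in> L \<Longrightarrow> q (c v) = cinner v z *\<^sub>C \<xi> q"
      using coefficient_functional[OF q c] unfolding L_def by blast
    then have "z \<in> closure Z" using c by (intro closure_subset[THEN subsetD]) (auto simp: Z_def)
    then have "cinner w0 z = 0" unfolding w0_def by (rule proj_corth[OF cZ])
    then show ?thesis using z(2)[of w0] w0L by (simp add: L_def cvs.scale_zero_left)
  qed
  then have "w0 = 0" by (rule cyclic_irreducible[OF minimal[OF q] xi(1)[OF q] w0L])
  then have "w \<in> closure Z" using proj_in[OF cZ, of w] by (simp add: w0_def)
  then obtain z where z: "\<And>n. z n \<in> Z" "z \<longlonglongrightarrow> w" unfolding closure_sequential by blast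
  have "\<forall>n. \<exists>T. is_rank_one q b (z n) T"
  proof
    fix n
    obtain c where "c \<in> A" "\<And>v. v \<in> L \<Longrightarrow> q (c v) = cinner v (z n) *\<^sub>C \<xi> q" using z(1)[of n] by (auto simp: Z_def)
    then show "\<exists>T. is_rank_one q b (z n) T" using is_rank_one_coefficient[OF q _ b] unfolding L_def by blast
  qed
  then obtain T where "\<And>n. is_rank_one q b (z n) (T n)" by metis
  then show ?thesis using is_rank_one_limit[OF _ z(2) b] by blast
qed

end

section \<open>Adjoints for the new inner product\<close>

context atoms_form
begin

text \<open>Adjointness is tested only on the dense set of vectors \<open>syn f\<close>, where the
  form is known explicitly; \<open>invariant_form\<close> passes to \<open>R\<close>.\<close>

definition adjoint_pair :: "('a \<Rightarrow>\<^sub>L 'a) \<Rightarrow> ('a \<Rightarrow>\<^sub>L 'a) \<Rightarrow> bool" where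
  "adjoint_pair a b \<longleftrightarrow> a \<in> A \<and> b \<in> A \<and>
     (\<forall>f\<in>fams. \<forall>g\<in>fams. cinner (blinfun_apply a (syn f)) (G (syn g)) = cinner (syn f) (G (blinfun_apply b (syn g))))"

lemma adjoint_pairD: "adjoint_pair a b \<Longrightarrow> a \<in> A" "adjoint_pair a b \<Longrightarrow> b \<in> A"
  "adjoint_pair a b \<Longrightarrow> f \<in> fams \<Longrightarrow> g \<in> fams \<Longrightarrow> cinner (blinfun_apply a (syn f)) (G (syn g)) = cinner (syn f) (G (blinfun_apply b (syn g)))"
  by (auto simp: adjoint_pair_def)

lemma adjoint_pair_diff: "adjoint_pair a b \<Longrightarrow> adjoint_pair a' b' \<Longrightarrow> adjoint_pair (a - a') (b - b')"
  unfolding adjoint_pair_def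
  by (auto simp: csubspace_diff[OF A_csubspace] blinfun.diff_left blinfun.diff_right cinner_diff_left cinner_diff_right)

lemma adjoint_pair_add: "adjoint_pair a b \<Longrightarrow> adjoint_pair a' b' \<Longrightarrow> adjoint_pair (a + a') (b + b')"
  unfolding adjoint_pair_def
  by (auto simp: csubspace_add[OF A_csubspace] blinfun.add_left blinfun.add_right cinner_add_left cinner_add_right)

text \<open>In the new inner product the squared norm of \<open>b x\<close> is the product of
  \<open>a b x\<close> with \<open>x\<close>, which bounds \<open>b\<close> by \<open>a\<close>. The
  fourth power of \<open>C\<close> comes from four changes between vectors and coordinates.\<close>

lemma adjoint_pair_norm:
  assumes ab: "adjoint_pair a b"
  shows "norm b \<le> C ^ 4 * M * norm a"
proof -
  note a = adjoint_pairD(1)[OF ab] and b = adjoint_pairD(2)[OF ab]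
  have C0: "C \<ge> 0" using C_ge_1 by simp
  have "norm b \<le> (C ^ 4 * norm a) * M"
  proof (rule op_bound[OF b])
    show "0 \<le> C ^ 4 * norm a" using C0 by simp
    fix f assume f: "f \<in> fams"
    define h where "h = (\<lambda>t. b o\<^sub>L f t)"
    define k where "k = (\<lambda>t. a o\<^sub>L h t)"
    have h: "h \<in> fams" "syn h = b (syn f)" unfolding h_def by (rule fams_act[OF b f], rule syn_act[OF b f])
    have k: "k \<in> fams" "syn k = a (syn h)" unfolding k_def by (rule fams_act[OF a h(1)], rule syn_act[OF a h(1)])
    have "frm k f = frm h h"
      using adjoint_pairD(3)[OF ab h(1) f] form[OF k(1) f] form[OF h(1) h(1)] by (simp add: k(2) h(2))
    then have "complex_of_real ((nrm h)\<^sup>2) = frm k f" by (simp only: nrm_sq[OF h(1)])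
    then have "(nrm h)\<^sup>2 \<le> nrm k * nrm f"
      using frm_bound[OF k(1) f] by (metis norm_of_real abs_of_nonneg zero_le_power2)
    also have "nrm k \<le> C * (norm a * (C * nrm h))"
    proof -
      have "norm (syn k) \<le> norm a * norm (syn h)" unfolding k(2) by (rule norm_blinfun)
      also have "\<dots> \<le> norm a * (C * nrm h)" by (intro mult_left_mono syn_upper h) simp
      finally show ?thesis using syn_lower[OF k(1)] C0 by (meson mult_left_mono order_trans)
    qed
    finally have "(nrm h)\<^sup>2 \<le> C * (norm a * (C * nrm h)) * nrm f" using nrm_nonneg by (simp add: mult_right_mono)
    then have "nrm h * nrm h \<le> (C * norm a * C * nrm f) * nrm h" by (simp add: power2_eq_square mult_ac)
    then have nh: "nrm h \<le> C * norm a * C * nrm f"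
      using nrm_nonneg[of h] nrm_nonneg[of f] C0 by (cases "nrm h = 0") auto
    have "norm (b (syn f)) \<le> C * nrm h" using syn_upper[OF h(1)] h(2) by simp
    also have "\<dots> \<le> C * (C * norm a * C * (C * norm (syn f)))"
      using C0 syn_lower[OF f] by (intro mult_left_mono order_trans[OF nh]) auto
    finally show "norm (b (syn f)) \<le> C ^ 4 * norm a * norm (syn f)" by (simp add: power4_eq_xxxx mult_ac)
  qed
  then show ?thesis by (simp add: mult_ac)
qed

lemma adjoint_pair_limit:
  assumes "\<And>n. \<exists>b. adjoint_pair (a n) b" and lim: "a \<longlonglongrightarrow> a'"
  shows "\<exists>b. adjoint_pair a' b"
proof -
  obtain b where ab: "\<And>n. adjoint_pair (a n) (b n)" using assms(1) by metis
  define k where "k = C ^ 4 * M + 1"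
  have k: "k > 0" using C_ge_1 M_pos by (auto simp: k_def intro!: add_nonneg_pos)
  have bd: "norm (b m - b n) \<le> k * norm (a m - a n)" for m n
    by (rule order_trans[OF adjoint_pair_norm[OF adjoint_pair_diff[OF ab ab]]]) (auto simp: k_def intro!: mult_right_mono)
  have "Cauchy b"
  proof (rule CauchyI)
    fix e :: real assume e: "0 < e"
    obtain N where N: "\<And>m n. m \<ge> N \<Longrightarrow> n \<ge> N \<Longrightarrow> norm (a m - a n) < e / k"
      using CauchyD[OF LIMSEQ_imp_Cauchy[OF lim], of "e / k"] e k by auto
    have "norm (b m - b n) < e" if "m \<ge> N" "n \<ge> N" for m n
      using bd[of m n] mult_strict_left_mono[OF N[OF that] k] k by simp
    then show "\<exists>N. \<forall>m\<ge>N. \<forall>n\<ge>N. norm (b m - b n) < e" by blast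
  qed
  then obtain b' where b': "b \<longlonglongrightarrow> b'" using Cauchy_convergent by (auto simp: convergent_def)
  have "a' \<in> A" "b' \<in> A" using A_closed adjoint_pairD(1,2)[OF ab] lim b' by (auto simp: closed_sequential_limits)
  moreover have "cinner (a' (syn f)) (G (syn g)) = cinner (syn f) (G (b' (syn g)))" if "f \<in> fams" "g \<in> fams" for f g
  proof (rule LIMSEQ_unique)
    show "(\<lambda>n. cinner (a n (syn f)) (G (syn g))) \<longlonglongrightarrow> cinner (a' (syn f)) (G (syn g))"
      by (intro tendsto_cinner tendsto_blinfun_apply lim tendsto_const)
    have "(\<lambda>n. cinner (syn f) (G (b n (syn g)))) \<longlonglongrightarrow> cinner (syn f) (G (b' (syn g)))"
      by (intro tendsto_cinner blinfun.tendsto tendsto_blinfun_apply b' tendsto_const)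
    then show "(\<lambda>n. cinner (a n (syn f)) (G (syn g))) \<longlonglongrightarrow> cinner (syn f) (G (b' (syn g)))"
      by (simp only: adjoint_pairD(3)[OF ab that])
  qed
  ultimately show ?thesis by (auto simp: adjoint_pair_def)
qed

lemma adjoint_pair_rank_one:
  assumes b: "b \<in> A" and e: "e \<in> A" and T: "is_rank_one q b (blinfun_apply e (\<xi> q)) T" and T': "is_rank_one q e (blinfun_apply b (\<xi> q)) T'"
  shows "adjoint_pair T T'"
  unfolding adjoint_pair_def
proof (intro conjI ballI)
  show "T \<in> A" "T' \<in> A" using T T' by (auto simp: is_rank_one_def)
  fix f g assume f: "f \<in> fams" and g: "g \<in> fams"
  define F where "F = {t. f t \<noteq> 0}"
  have F: "finite F" "{t. f t \<noteq> 0} \<subseteq> F" using famsD(1)[OF f] by (auto simp: F_def)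
  have vF: "{t. rank_one_fam q b w f t \<noteq> 0} \<subseteq> F" for w using rank_one_fam_support F(2) by blast
  have "cinner (T (syn f)) (G (syn g)) = frm (rank_one_fam q b (e (\<xi> q)) f) g"
    using T f by (simp add: is_rank_one_def form rank_one_fam_fams[OF b] g)
  also have "\<dots> = (\<Sum>t\<in>F. cinner (ev f t) (ev (rank_one_fam q e (blinfun_apply b (\<xi> q)) g) t))"
    unfolding frm_on[OF F(1) vF]
  proof (rule sum.cong)
    fix t
    have "cinner (b (\<xi> q)) (ev g t) = cnj (cinner (ev g t) (b (\<xi> q)))" by (rule cinner_commute)
    then show "cinner (ev (rank_one_fam q b (blinfun_apply e (\<xi> q)) f) t) (ev g t) = cinner (ev f t) (ev (rank_one_fam q e (blinfun_apply b (\<xi> q)) g) t)"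
      by (simp add: ev_rank_one_fam cinner_scaleC_left cinner_scaleC_right)
  qed simp
  also have "\<dots> = cinner (syn f) (G (T' (syn g)))"
    using T' g by (simp add: is_rank_one_def form f rank_one_fam_fams[OF e] frm_on[OF F])
  finally show "cinner (T (syn f)) (G (syn g)) = cinner (syn f) (G (T' (syn g)))" .
qed

text \<open>Taking the adjoint exchanges the two vectors, and the vector that comes first must have
  the form \<open>e (\<xi> q)\<close> with \<open>e\<close> in \<open>A\<close>. A general
  \<open>w\<close> is a limit of such vectors.\<close>

lemma adjoint_pair_is_rank_one:
  assumes q: "q \<in> Q" and b: "b \<in> A" and w: "w \<in> cyclic (\<xi> q)" and T: "is_rank_one q b w T"
  shows "\<exists>T'. adjoint_pair T T'"
proof -
  have "\<forall>n. \<exists>e. e \<in> A \<and> norm (blinfun_apply e (\<xi> q) - w) < 1 / real (Suc n)"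
    using cyclic_approx[OF w] by (metis zero_less_divide_1_iff of_nat_0_less_iff zero_less_Suc)
  then obtain e where e: "\<And>n. e n \<in> A" "\<And>n. norm (e n (\<xi> q) - w) < 1 / real (Suc n)" by metis
  have lim: "(\<lambda>n. e n (\<xi> q)) \<longlonglongrightarrow> w"
    by (rule LIM_zero_cancel, rule Lim_null_comparison[OF _ LIMSEQ_inverse_real_of_nat])
      (use e(2) in \<open>auto intro!: always_eventually less_imp_le simp: inverse_eq_divide\<close>)
  have "\<forall>n. \<exists>S. is_rank_one q b (e n (\<xi> q)) S" using is_rank_one_exists[OF q b] cyclic_base e(1) by blast
  then obtain S where S: "\<And>n. is_rank_one q b (e n (\<xi> q)) (S n)" by metis
  have adj: "\<exists>S'. adjoint_pair (S n) S'" for n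
  proof -
    obtain S' where "is_rank_one q (e n) (b (\<xi> q)) S'" using is_rank_one_exists[OF q e(1) cyclic_base[OF b]] by blast
    then show ?thesis using adjoint_pair_rank_one[OF b e(1) S] by blast
  qed
  define k where "k = C * C * M * norm (blinfun_apply b (\<xi> q))"
  have "S \<longlonglongrightarrow> T"
  proof (rule LIM_zero_cancel, rule Lim_null_comparison)
    show "\<forall>\<^sub>F n in sequentially. norm (S n - T) \<le> k * norm (e n (\<xi> q) - w)"
      using is_rank_one_norm[OF is_rank_one_diff[OF S T b] b] by (simp add: k_def)
    have "(\<lambda>n. k * norm (e n (\<xi> q) - w)) \<longlonglongrightarrow> k * norm (w - w)" by (intro tendsto_intros lim)
    then show "(\<lambda>n. k * norm (e n (\<xi> q) - w)) \<longlonglongrightarrow> 0" by simp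
  qed
  with adj show ?thesis by (rule adjoint_pair_limit)
qed

text \<open>A right factor \<open>a\<close> merely replaces the vector of the functional by its
  image under the Hilbert space adjoint of \<open>a\<close>, projected back into the module. The
  product is again of rank one.\<close>

lemma adjoint_pair_is_rank_one_compose:
  assumes q: "q \<in> Q" and b: "b \<in> A" and e: "e \<in> A" and a: "a \<in> A" and T: "is_rank_one q b (blinfun_apply e (\<xi> q)) T"
  shows "\<exists>T'. adjoint_pair (T o\<^sub>L a) T'"
proof -
  note L = submodD(1,2)[OF submod_cyclic[of "\<xi> q"]]
  obtain a' where a': "\<And>x y. cinner (a x) y = cinner x (blinfun_apply a' y)"
    using adjoint_exists[OF A_bounded[OF a]] by (auto simp: is_adjoint_def)
  define w where "w = proj (cyclic (\<xi> q)) (a' (e (\<xi> q)))"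
  have w: "cinner (a v) (e (\<xi> q)) = cinner v w" if "v \<in> cyclic (\<xi> q)" for v
  proof -
    have "cinner (a' (e (\<xi> q)) - w) v = 0" unfolding w_def by (rule proj_corth[OF L that])
    then have "cinner v (a' (e (\<xi> q)) - w) = 0" by (simp add: cinner_eq_0_commute)
    then show ?thesis by (simp add: cinner_diff_right a')
  qed
  have "is_rank_one q b w (T o\<^sub>L a)"
    unfolding is_rank_one_def
  proof (intro conjI ballI)
    show "T o\<^sub>L a \<in> A" using T a by (simp add: is_rank_one_def A_compose)
    fix f assume f: "f \<in> fams"
    have "rank_one_fam q b (e (\<xi> q)) (\<lambda>t. a o\<^sub>L f t) = rank_one_fam q b w f"
    proof
      fix t
      have "ev f t \<in> cyclic (\<xi> q)" if "fst t = q" using cyclic_base[OF famsD(2)[OF f]] that by (simp add: ev_def)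
      then show "rank_one_fam q b (e (\<xi> q)) (\<lambda>t. a o\<^sub>L f t) t = rank_one_fam q b w f t"
        by (simp add: rank_one_fam_def ev_act w)
    qed
    then show "(T o\<^sub>L a) (syn f) = syn (rank_one_fam q b w f)"
      using T f by (simp add: is_rank_one_def fams_act[OF a] flip: syn_act[OF a])
  qed
  moreover have "w \<in> cyclic (\<xi> q)" unfolding w_def by (rule proj_in[OF L])
  ultimately show ?thesis using adjoint_pair_is_rank_one[OF q b] by blast
qed

end

section \<open>Approximate units and self-adjointness\<close>

context atoms_form
begin

lemma adjoint_pair_sum:
  assumes "\<And>i. i \<in> I \<Longrightarrow> \<exists>b. adjoint_pair (a i) b" shows "\<exists>b. adjoint_pair (\<Sum>i\<in>I. a i) b"
proof -
  have "adjoint_pair 0 0" by (simp add: adjoint_pair_def csubspace_0[OF A_csubspace])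
  then have zero: "\<exists>b. adjoint_pair 0 b" by blast
  show ?thesis
    using assms
  proof (induction I rule: infinite_finite_induct)
    case (insert i I)
    then obtain b b' where "adjoint_pair (a i) b" "adjoint_pair (\<Sum>i\<in>I. a i) b'" by blast
    then have "adjoint_pair (\<Sum>i\<in>insert i I. a i) (b + b')" using insert adjoint_pair_add by simp
    then show ?case by blast
  qed (simp_all add: zero)
qed

lemma cyclic_range_subspace: "csubspace ((\<lambda>a. blinfun_apply a x) ` A)"
  unfolding csubspace_def
proof (intro conjI ballI allI)
  show "0 \<in> (\<lambda>a. blinfun_apply a x) ` A"
    by (rule image_eqI[of _ _ 0]) (simp_all add: csubspace_0[OF A_csubspace])
  fix u assume "u \<in> (\<lambda>a. blinfun_apply a x) ` A"
  then obtain a where a: "a \<in> A" "u = a x" by blast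
  show "c *\<^sub>C u \<in> (\<lambda>a. blinfun_apply a x) ` A" for c
    by (rule image_eqI[of _ _ "c *\<^sub>C a"]) (simp_all add: a csubspace_scaleC[OF A_csubspace])
  fix v assume "v \<in> (\<lambda>a. blinfun_apply a x) ` A"
  then obtain b where b: "b \<in> A" "v = b x" by blast
  show "u + v \<in> (\<lambda>a. blinfun_apply a x) ` A"
    by (rule image_eqI[of _ _ "a + b"]) (simp_all add: a b blinfun.add_left csubspace_add[OF A_csubspace])
qed

text \<open>In coordinates, \<open>u\<close> is an orthogonal projection of finite rank on each copy of \<open>cyclic (\<xi> q)\<close>.\<close>

lemma approximate_unit:
  assumes X: "finite X" "X \<subseteq> fams"
  shows "\<exists>u\<in>A. (\<forall>g\<in>X. blinfun_apply u (syn g) = syn g) \<and> norm u \<le> C * C * M \<and> (\<forall>a\<in>A. \<exists>b. adjoint_pair (u o\<^sub>L a) b)"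
proof -
  define I where "I = fst ` (\<Union>g\<in>X. {t. g t \<noteq> 0})"
  have Xf: "finite {t. g t \<noteq> 0}" if "g \<in> X" for g using X that famsD(1) by blast
  have I: "finite I" unfolding I_def using X(1) Xf by blast
  have IQ: "q \<in> Q" if "q \<in> I" for q using that X(2) famsD(3) by (auto simp: I_def idx_def)
  define Y where "Y q = (\<Union>g\<in>X. ev g ` {t. g t \<noteq> 0 \<and> fst t = q})" for q
  have Yf: "finite (Y q)" for q
    unfolding Y_def using X(1) Xf by (intro finite_UN_I finite_imageI) auto
  have YA: "Y q \<subseteq> (\<lambda>a. blinfun_apply a (\<xi> q)) ` A" for q
    using X(2) famsD(2) by (auto simp: Y_def ev_def)
  have "\<forall>q. \<exists>F. finite F \<and> orthonormal F \<and> F \<subseteq> cvs.span (Y q) \<and> (\<forall>x\<in>Y q. x = (\<Sum>f\<in>F. cinner x f *\<^sub>C f))"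
    using gram_schmidt[OF Yf] by blast
  then obtain F where F: "\<And>q. finite (F q)" "\<And>q. orthonormal (F q)" "\<And>q. F q \<subseteq> cvs.span (Y q)"
    "\<And>q x. x \<in> Y q \<Longrightarrow> x = (\<Sum>f\<in>F q. cinner x f *\<^sub>C f)" by metis
  \<comment> \<open>Gram-Schmidt does not leave the algebraic orbit of \<open>\<xi> q\<close>. Each
    basis vector is thus exactly \<open>b (\<xi> q)\<close> for some \<open>b\<close> in
    \<open>A\<close>, as the rank one operators require.\<close>
  have "F q \<subseteq> (\<lambda>a. blinfun_apply a (\<xi> q)) ` A" for q
    by (rule order_trans[OF F(3) cvs.span_minimal[OF YA]]) (simp add: cyclic_range_subspace flip: csubspace_iff)
  then have "\<forall>q v. \<exists>b. v \<in> F q \<longrightarrow> b \<in> A \<and> blinfun_apply b (\<xi> q) = v" by blast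
  then obtain b where b: "\<And>q v. v \<in> F q \<Longrightarrow> b q v \<in> A" "\<And>q v. v \<in> F q \<Longrightarrow> blinfun_apply (b q v) (\<xi> q) = v"
    by metis
  have "\<exists>T. is_rank_one q (b q v) v T" if "q \<in> I" "v \<in> F q" for q v
    using is_rank_one_exists[OF IQ[OF that(1)] b(1)[OF that(2)] cyclic_base[OF b(1)[OF that(2)], of "\<xi> q"]] b(2)[OF that(2)] by simp
  then obtain T where T: "\<And>q v. q \<in> I \<Longrightarrow> v \<in> F q \<Longrightarrow> is_rank_one q (b q v) v (T q v)" by metis
  define u where "u = (\<Sum>q\<in>I. \<Sum>v\<in>F q. T q v)"
  define h where "h f t = (\<Sum>q\<in>I. \<Sum>v\<in>F q. rank_one_fam q (b q v) v f t)" for f t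
  have uA: "u \<in> A" unfolding u_def using T by (intro csubspace_sum[OF A_csubspace]) (auto simp: is_rank_one_def)
  have hf: "h f \<in> fams" and uh: "u (syn f) = syn (h f)" if f: "f \<in> fams" for f
  proof -
    have vff: "rank_one_fam q (b q v) v f \<in> fams" if "v \<in> F q" for q v by (rule rank_one_fam_fams[OF b(1)[OF that] f])
    show "h f \<in> fams" unfolding h_def by (intro fams_sum vff)
    have "u (syn f) = (\<Sum>q\<in>I. \<Sum>v\<in>F q. syn (rank_one_fam q (b q v) v f))"
      unfolding u_def blinfun.sum_left using T f by (intro sum.cong) (auto simp: is_rank_one_def)
    also have "\<dots> = syn (h f)" unfolding h_def by (simp add: syn_sum fams_sum vff)
    finally show "u (syn f) = syn (h f)" .
  qed
  have evh: "ev (h f) t = (if fst t \<in> I then \<Sum>v\<in>F (fst t). cinner (ev f t) v *\<^sub>C v else 0)" for f t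
  proof -
    have "ev (h f) t = (\<Sum>q\<in>I. \<Sum>v\<in>F q. ev (rank_one_fam q (b q v) v f) t)" by (simp add: ev_def h_def blinfun.sum_left)
    also have "\<dots> = (\<Sum>q\<in>I. if fst t = q then \<Sum>v\<in>F q. cinner (ev f t) v *\<^sub>C v else 0)"
      by (intro sum.cong refl) (auto simp: ev_rank_one_fam b(2) intro!: sum.cong)
    finally show ?thesis using I by simp
  qed
  \<comment> \<open>Bessel's inequality makes \<open>u\<close> contractive in coordinates, so the
    bound does not depend on the given finite set \<open>X\<close>.\<close>
  have "norm u \<le> C * C * M"
  proof (rule op_bound[OF uA])
    show "0 \<le> C * C" by simp
    fix f assume f: "f \<in> fams"
    define S where "S = {t. f t \<noteq> 0}"
    have S: "finite S" "{t. f t \<noteq> 0} \<subseteq> S" "{t. h f t \<noteq> 0} \<subseteq> S"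
    proof -
      have "h f t = 0" if "f t = 0" for t
        unfolding h_def using that by (intro sum.neutral ballI) (simp add: rank_one_fam_def ev_zero cvs.scale_zero_left)
      then show "finite S" "{t. f t \<noteq> 0} \<subseteq> S" "{t. h f t \<noteq> 0} \<subseteq> S" using famsD(1)[OF f] by (auto simp: S_def)
    qed
    have "norm (u (syn f)) \<le> C * nrm (h f)" unfolding uh[OF f] by (rule syn_upper[OF hf[OF f]])
    also have "nrm (h f) \<le> nrm f"
      unfolding nrm_on[OF S(1,2)] nrm_on[OF S(1,3)] by (rule L2_set_mono) (auto simp: evh bessel[OF F(1,2)])
    also have "\<dots> \<le> C * norm (syn f)" by (rule syn_lower[OF f])
    finally show "norm (u (syn f)) \<le> C * C * norm (syn f)" using C_ge_1 by (simp add: mult_left_mono)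
  qed
  moreover have "u (syn g) = syn g" if g: "g \<in> X" for g
  proof -
    have gf: "g \<in> fams" using g X by blast
    have "ev (h g) t = ev g t" for t
    proof (cases "g t = 0")
      case True
      then show ?thesis by (simp add: evh ev_zero cvs.scale_zero_left)
    next
      case False
      then have "ev g t \<in> Y (fst t)" "fst t \<in> I" using g by (auto simp: Y_def I_def)
      then show ?thesis using F(4)[of "ev g t" "fst t"] by (simp add: evh)
    qed
    then show ?thesis using uh[OF gf] syn_eq_iff[OF hf[OF gf] gf] by auto
  qed
  moreover have "\<exists>b. adjoint_pair (u o\<^sub>L a) b" if a: "a \<in> A" for a
  proof -
    have "u o\<^sub>L a = (\<Sum>q\<in>I. \<Sum>v\<in>F q. T q v o\<^sub>L a)"
      by (rule blinfun_eqI) (simp add: u_def blinfun.sum_left)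
    moreover have "\<exists>b. adjoint_pair (T q v o\<^sub>L a) b" if q: "q \<in> I" and v: "v \<in> F q" for q v
      using adjoint_pair_is_rank_one_compose[OF IQ[OF q] b(1)[OF v] b(1)[OF v] a] T[OF q v] b(2)[OF v] by simp
    ultimately show ?thesis by (simp only:) (intro adjoint_pair_sum; blast)
  qed
  ultimately show ?thesis using uA by blast
qed

text \<open>A finite net of the image of the unit ball under \<open>a\<close> is approximated by
  vectors \<open>syn g\<close>. An operator \<open>u\<close> fixing these satisfies
  \<open>u a\<close> close to \<open>a\<close> in norm, \<open>u a\<close> has an adjoint in
  \<open>A\<close>, and such elements are closed under limits.\<close>

lemma adjointable:
  assumes a: "a \<in> A" shows "\<exists>b. adjoint_pair a b"
proof -
  \<comment> \<open>Each \<open>a x\<close> is within \<open>2 * d\<close> of a vector fixed by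
    \<open>u\<close>, and \<open>u - 1\<close> has norm at most
    \<open>C * C * M + 1\<close>.\<close>
  define k where "k = 2 * (C * C * M + 1)"
  have k: "k \<ge> 0" using C_ge_1 M_pos by (simp add: k_def)
  have "\<exists>u\<in>A. norm ((u o\<^sub>L a) - a) \<le> k * d \<and> (\<exists>b. adjoint_pair (u o\<^sub>L a) b)" if d: "d > 0" for d
  proof -
    obtain N where N: "finite N" "N \<subseteq> blinfun_apply a ` cball 0 1"
      "\<And>x. norm x \<le> 1 \<Longrightarrow> \<exists>y\<in>N. norm (blinfun_apply a x - y) < d"
      using compact_ops_finite_net[of a d] A_compact a d by blast
    have "\<exists>g\<in>fams. norm (y - syn g) < d" if "y \<in> N" for y
    proof -
      have "y \<in> closure (syn ` fams)" using N(2) that range_R[OF a] R_dense by blast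
      then show ?thesis using d unfolding closure_approachable by (auto simp: dist_norm norm_minus_commute)
    qed
    then obtain g where g: "\<And>y. y \<in> N \<Longrightarrow> g y \<in> fams" "\<And>y. y \<in> N \<Longrightarrow> norm (y - syn (g y)) < d" by metis
    obtain u where u: "u \<in> A" "\<And>y. y \<in> N \<Longrightarrow> blinfun_apply u (syn (g y)) = syn (g y)" "norm u \<le> C * C * M" "\<exists>b. adjoint_pair (u o\<^sub>L a) b"
    proof -
      have "g ` N \<subseteq> fams" using g(1) by blast
      then show thesis using approximate_unit[OF finite_imageI[OF N(1)], of g] a that by auto
    qed
    have unit: "norm (u (a x) - a x) \<le> k * d" if x: "norm x \<le> 1" for x
    proof -
      obtain y where y: "y \<in> N" "norm (a x - y) < d" using N(3)[OF x] by blast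
      define z where "z = a x - syn (g y)"
      have "norm z \<le> norm (a x - y) + norm (y - syn (g y))"
        using norm_triangle_ineq[of "a x - y" "y - syn (g y)"] by (simp add: z_def)
      then have z: "norm z \<le> 2 * d" using y g(2)[OF y(1)] by linarith
      have "u (a x) - a x = u z - z" using u(2)[OF y(1)] by (simp add: z_def blinfun.diff_right)
      then have "norm (u (a x) - a x) \<le> norm (u z) + norm z" by (simp add: norm_triangle_ineq4)
      also have "\<dots> \<le> (C * C * M + 1) * norm z"
        using order_trans[OF norm_blinfun[of u z] mult_right_mono[OF u(3)]] by (simp add: algebra_simps)
      also have "\<dots> \<le> (C * C * M + 1) * (2 * d)" using z M_pos by (intro mult_left_mono) auto
      finally show ?thesis by (simp add: k_def algebra_simps)
    qed
    have "norm ((u o\<^sub>L a) - a) \<le> k * d"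
    proof (rule norm_blinfun_bound)
      show "0 \<le> k * d" using k d by simp
      fix x
      show "norm (((u o\<^sub>L a) - a) x) \<le> k * d * norm x"
      proof (cases "x = 0")
        case False
        have "norm (u (a ((1 / norm x) *\<^sub>R x)) - a ((1 / norm x) *\<^sub>R x)) \<le> k * d"
          by (rule unit) (use False in simp)
        then have "norm ((1 / norm x) *\<^sub>R (u (a x) - a x)) \<le> k * d"
          by (simp add: blinfun.scaleR_right scaleR_diff_right)
        then show ?thesis using False by (simp add: blinfun.diff_left divide_simps)
      qed simp
    qed
    with u show ?thesis by blast
  qed
  then have "\<forall>n. \<exists>u. norm ((u o\<^sub>L a) - a) \<le> k * (1 / real (Suc n)) \<and> (\<exists>b. adjoint_pair (u o\<^sub>L a) b)"
    by (metis zero_less_divide_1_iff of_nat_0_less_iff zero_less_Suc)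
  then obtain u where u: "\<And>n. norm ((u n o\<^sub>L a) - a) \<le> k * (1 / real (Suc n))" "\<And>n. \<exists>b. adjoint_pair (u n o\<^sub>L a) b" by metis
  have "(\<lambda>n. u n o\<^sub>L a) \<longlonglongrightarrow> a"
  proof (rule LIM_zero_cancel, rule Lim_null_comparison)
    show "\<forall>\<^sub>F n in sequentially. norm ((u n o\<^sub>L a) - a) \<le> k * inverse (real (Suc n))"
      using u(1) by (auto intro!: always_eventually simp: inverse_eq_divide)
    have "(\<lambda>n. k * inverse (real (Suc n))) \<longlonglongrightarrow> k * 0" by (intro tendsto_intros LIMSEQ_inverse_real_of_nat)
    then show "(\<lambda>n. k * inverse (real (Suc n))) \<longlonglongrightarrow> 0" by simp
  qed
  with u(2) show ?thesis by (rule adjoint_pair_limit)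
qed

text \<open>The transported inner product on \<open>R\<close> is added to the original one on the
  annihilated vectors. \<open>A\<close> vanishes on the latter and maps into \<open>R\<close>, so
  the second summand does not affect adjoints.\<close>

lemma invariant_form:
  "\<exists>H\<in>bounded_ops. (\<forall>x y. cinner (blinfun_apply H x) y = cinner x (H y)) \<and> (\<exists>c>0. \<forall>x. c * (norm x)\<^sup>2 \<le> Re (cinner x (blinfun_apply H x)))
    \<and> (\<forall>a\<in>A. \<exists>b\<in>A. \<forall>x y. cinner (blinfun_apply a x) (H y) = cinner x (H (blinfun_apply b y)))"
proof -
  define q where "q x = x - P x" for x
  have Pb: "P \<in> bounded_ops" by (rule mprojD(1)[OF P])
  have q: "q (x + y) = q x + q y" "q (c *\<^sub>C x) = c *\<^sub>C q x" "q x \<in> R" "norm (q x) \<le> M * norm x" for x y c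
    using split by (simp_all add: q_def blinfun.add_right bounded_opsD[OF Pb] cvs.scale_right_diff_distrib)
  define B where "B x y = cinner (q x) (G (q y)) + cinner (P x) (P y)" for x y
  have "\<exists>H\<in>bounded_ops. \<forall>x y. B x y = cinner x (blinfun_apply H y)"
  proof (rule riesz_form)
    fix x x' y y' :: 'a and c
    show "B (x + x') y = B x y + B x' y" "B x (y + y') = B x y + B x y'"
      by (simp_all add: B_def q blinfun.add_right cinner_add_left cinner_add_right)
    show "B (c *\<^sub>C x) y = c * B x y" "B x (c *\<^sub>C y) = cnj c * B x y"
      by (simp_all add: B_def q bounded_opsD[OF Pb] bounded_opsD[OF G] cinner_scaleC_left cinner_scaleC_right algebra_simps)
    have "cmod (B x y) \<le> norm (q x) * norm (G (q y)) + norm (P x) * norm (P y)"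
      unfolding B_def by (intro order_trans[OF norm_triangle_ineq] add_mono norm_cinner_le)
    also have "\<dots> \<le> (M * norm x) * (norm G * (M * norm y)) + (norm P * norm x) * (norm P * norm y)"
      using M_pos by (intro add_mono mult_mono norm_blinfun q(4) order_trans[OF norm_blinfun[of G] mult_left_mono]) auto
    finally show "cmod (B x y) \<le> (M * norm G * M + norm P * norm P) * norm x * norm y" by (simp add: algebra_simps)
  qed
  then obtain H where H: "H \<in> bounded_ops" "\<And>x y. B x y = cinner x (blinfun_apply H y)" by blast
  have cont: "continuous_on UNIV (\<lambda>x. cinner (S x) (T x))" if "continuous_on UNIV S" "continuous_on UNIV T" for S T :: "'a \<Rightarrow> 'a"
    using that unfolding continuous_on_def by (auto intro: tendsto_cinner)
  have adjoint: "cinner (a x) (G y) = cinner x (G (b y))" if ab: "adjoint_pair a b" and x: "x \<in> R" and y: "y \<in> R" for a b x y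
  proof -
    have 1: "cinner (a (syn f)) (G y) = cinner (syn f) (G (b y))" if f: "f \<in> fams" for f
      by (rule R_eq_on[OF y]) (use adjoint_pairD(3)[OF ab f] in \<open>auto intro!: cont continuous_intros\<close>)
    show ?thesis by (rule R_eq_on[OF x]) (use 1 in \<open>auto intro!: cont continuous_intros\<close>)
  qed
  have hermG: "cinner x (G y) = cnj (cinner y (G x))" if x: "x \<in> R" and y: "y \<in> R" for x y
  proof -
    have 1: "cinner (syn f) (G y) = cnj (cinner y (G (syn f)))" if f: "f \<in> fams" for f
    proof (rule R_eq_on[OF y])
      show "cinner (syn f) (G (syn g)) = cnj (cinner (syn g) (G (syn f)))" if g: "g \<in> fams" for g
        unfolding form[OF f g] form[OF g f] by (rule frm_herm[OF g f])
    qed (auto intro!: cont continuous_intros)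
    show ?thesis by (rule R_eq_on[OF x]) (use 1 in \<open>auto intro!: cont continuous_intros\<close>)
  qed
  have posG: "(norm x)\<^sup>2 \<le> C\<^sup>2 * Re (cinner x (G x))" if x: "x \<in> R" for x
  proof -
    have cl: "closed {x. (norm x)\<^sup>2 \<le> C\<^sup>2 * Re (cinner x (G x))}"
      by (intro closed_Collect_le continuous_intros cont)
    have "(norm (syn f))\<^sup>2 \<le> C\<^sup>2 * Re (cinner (syn f) (G (syn f)))" if f: "f \<in> fams" for f
      using power_mono[OF syn_upper[OF f] norm_ge_zero, of 2] by (simp add: form f nrm_sq power_mult_distrib)
    then have "closure (syn ` fams) \<subseteq> {x. (norm x)\<^sup>2 \<le> C\<^sup>2 * Re (cinner x (G x))}"
      by (intro closure_minimal cl) auto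
    then show ?thesis using R_dense x by blast
  qed
  have "cinner (H x) y = cinner x (H y)" for x y
  proof -
    have "cnj (B y x) = B x y"
      using hermG[OF q(3) q(3), of x y] cinner_commute[of "P x" "P y"] by (simp add: B_def)
    then show ?thesis using cinner_commute[of "H x" y] by (simp flip: H(2))
  qed
  \<comment> \<open>The factor \<open>2\<close> comes from splitting \<open>x\<close> into its two
    components, and \<open>C\<^sup>2\<close> from comparing norms on \<open>R\<close>.\<close>
  moreover have "1 / (2 * C\<^sup>2) * (norm x)\<^sup>2 \<le> Re (cinner x (H x))" for x
  proof -
    have C2: "C\<^sup>2 \<ge> 1" using C_ge_1 by (rule one_le_power)
    have "x = q x + P x" by (simp add: q_def)
    then have "(norm x)\<^sup>2 \<le> 2 * (norm (q x))\<^sup>2 + 2 * (norm (P x))\<^sup>2"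
      using parallelogram[of "q x" "P x"] zero_le_power2[of "norm (q x - P x)"] by (metis le_add_same_cancel1)
    also have "\<dots> \<le> 2 * (C\<^sup>2 * Re (cinner (q x) (G (q x)))) + 2 * (C\<^sup>2 * (norm (P x))\<^sup>2)"
      using posG[OF q(3)] mult_right_mono[OF C2, of "(norm (P x))\<^sup>2"] by (intro add_mono) auto
    also have "\<dots> = 2 * C\<^sup>2 * Re (B x x)" by (simp add: B_def cinner_self algebra_simps)
    finally have "(norm x)\<^sup>2 \<le> (2 * C\<^sup>2) * Re (cinner x (H x))" by (simp only: H(2))
    moreover have "2 * C\<^sup>2 > 0" using C2 by linarith
    ultimately show ?thesis by (simp add: pos_divide_le_eq mult.commute del: zero_less_mult_iff)
  qed
  moreover have "1 / (2 * C\<^sup>2) > 0" using C_ge_1 by simp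
  moreover have "\<exists>b\<in>A. \<forall>x y. cinner (blinfun_apply a x) (H y) = cinner x (H (blinfun_apply b y))" if a: "a \<in> A" for a
  proof -
    obtain b where ab: "adjoint_pair a b" using adjointable[OF a] by blast
    have b: "b \<in> A" by (rule adjoint_pairD(2)[OF ab])
    have PA: "P (blinfun_apply c x) = 0" if "c \<in> A" for c x using range_R[OF that] by (simp add: R_def)
    have qA: "q (blinfun_apply c x) = c (q x)" if "c \<in> A" for c x
      using PA[OF that] act_split[OF that] by (simp add: q_def)
    have "B (a x) y = B x (b y)" for x y
      using adjoint[OF ab q(3) q(3)] by (simp add: B_def PA a b qA)
    then show ?thesis using b H(2) by metis
  qed
  ultimately show ?thesis using H(1) by blast
qed

end

section \<open>Square roots and similarity\<close>

definition hermitian :: "('a::chilbert_space \<Rightarrow>\<^sub>L 'a) \<Rightarrow> bool" where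
  "hermitian T \<longleftrightarrow> T \<in> bounded_ops \<and> is_adjoint T T"

lemma hermitianD: "hermitian T \<Longrightarrow> cinner (blinfun_apply T x) y = cinner x (T y)"
  by (simp add: hermitian_def is_adjoint_def)

lemma hermitian_closure:
  shows hermitian_id: "hermitian id_blinfun"
    and hermitian_diff: "hermitian S \<Longrightarrow> hermitian T \<Longrightarrow> hermitian (S - T)"
    and hermitian_add: "hermitian S \<Longrightarrow> hermitian T \<Longrightarrow> hermitian (S + T)"
    and hermitian_square: "hermitian T \<Longrightarrow> hermitian (T o\<^sub>L T)"
    and hermitian_scaleC: "hermitian T \<Longrightarrow> hermitian (complex_of_real r *\<^sub>C T)"
  by (auto simp: hermitian_def is_adjoint_def bounded_ops_closure blinfun.bilinear_simps cinner_diff_left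
      cinner_diff_right cinner_add_left cinner_add_right cinner_scaleC_left cinner_scaleC_right)

lemma closed_hermitian: "closed {T :: 'a::chilbert_space \<Rightarrow>\<^sub>L 'a. hermitian T}"
  unfolding closed_sequential_limits
proof (intro allI impI, elim conjE)
  fix F :: "nat \<Rightarrow> 'a \<Rightarrow>\<^sub>L 'a" and T assume F: "\<forall>n. F n \<in> {T. hermitian T}" and T: "F \<longlonglongrightarrow> T"
  have "T \<in> bounded_ops" using closed_bounded_ops F T by (auto simp: closed_sequential_limits hermitian_def)
  moreover have "cinner (T x) y = cinner x (T y)" for x y
  proof (rule LIMSEQ_unique)
    show "(\<lambda>n. cinner (F n x) y) \<longlonglongrightarrow> cinner (T x) y"
      by (intro tendsto_cinner tendsto_blinfun_apply T tendsto_const)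
    have "(\<lambda>n. cinner x (F n y)) \<longlonglongrightarrow> cinner x (T y)"
      by (intro tendsto_cinner tendsto_blinfun_apply T tendsto_const)
    moreover have "cinner (F n x) y = cinner x (F n y)" for n using F by (intro hermitianD) auto
    ultimately show "(\<lambda>n. cinner (F n x) y) \<longlonglongrightarrow> cinner x (T y)" by simp
  qed
  ultimately show "T \<in> {T. hermitian T}" by (simp add: hermitian_def is_adjoint_def)
qed

text \<open>The square root of \<open>1 - X\<close> is \<open>1 - Y\<close>, where \<open>Y\<close> is the fixed point of the contraction \<open>Y \<mapsto> (X + Y\<^sup>2) / 2\<close>.\<close>

lemma sqrt_id_minus:
  fixes X :: "'a::chilbert_space \<Rightarrow>\<^sub>L 'a"
  assumes X: "hermitian X" and r: "norm X \<le> r" "r < 1"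
  shows "\<exists>Y. hermitian Y \<and> norm Y \<le> r \<and> (\<forall>x. (x - blinfun_apply Y x) - Y (x - Y x) = x - X x)"
proof -
  have r0: "r \<ge> 0" using r(1) norm_ge_zero order_trans by blast
  define D where "D = {Y :: 'a \<Rightarrow>\<^sub>L 'a. hermitian Y} \<inter> cball 0 r"
  define f where "f Y = complex_of_real (1 / 2) *\<^sub>C (X + (Y o\<^sub>L Y))" for Y
  have "\<exists>!Y. Y \<in> D \<and> f Y = Y"
  proof (rule Banach_fix[where c = r])
    show "complete D" unfolding D_def by (intro closed_Int closed_hermitian closed_cball complete_eq_closed[THEN iffD2])
    show "D \<noteq> {}" using X r by (auto simp: D_def)
    show "f ` D \<subseteq> D"
    proof clarify
      fix Y assume "Y \<in> D"
      then have Y: "hermitian Y" "norm Y \<le> r" by (auto simp: D_def)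
      have "norm (Y o\<^sub>L Y) \<le> r * 1"
        using Y r r0 by (intro order_trans[OF norm_blinfun_compose] mult_mono) auto
      then have "norm (X + (Y o\<^sub>L Y)) \<le> r + r" using r by (intro order_trans[OF norm_triangle_ineq] add_mono) auto
      moreover have "hermitian (f Y)" unfolding f_def by (intro hermitian_scaleC hermitian_add X hermitian_square Y)
      ultimately show "f Y \<in> D" by (simp add: D_def f_def norm_scaleC)
    qed
    fix Y Z assume "Y \<in> D" "Z \<in> D"
    then have YZ: "norm Y \<le> r" "norm Z \<le> r" by (auto simp: D_def)
    have eq: "f Y - f Z = complex_of_real (1 / 2) *\<^sub>C ((Y o\<^sub>L (Y - Z)) + ((Y - Z) o\<^sub>L Z))"
      unfolding f_def cvs.scale_right_diff_distrib[symmetric]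
      by (simp add: bounded_bilinear.diff_right[OF bounded_bilinear_blinfun_compose] bounded_bilinear.diff_left[OF bounded_bilinear_blinfun_compose])
    have "norm ((Y o\<^sub>L (Y - Z)) + ((Y - Z) o\<^sub>L Z)) \<le> norm Y * norm (Y - Z) + norm (Y - Z) * norm Z"
      by (intro order_trans[OF norm_triangle_ineq] add_mono norm_blinfun_compose)
    also have "\<dots> \<le> r * norm (Y - Z) + norm (Y - Z) * r" by (intro add_mono mult_right_mono mult_left_mono YZ) auto
    finally show "dist (f Y) (f Z) \<le> r * dist Y Z" by (simp add: dist_norm eq norm_scaleC)
  qed (use r r0 in auto)
  then obtain Y where Y: "Y \<in> D" "f Y = Y" by blast
  have "X x + Y (Y x) = Y x + Y x" for x
  proof -
    have "Y x + Y x = f Y x + f Y x" by (simp only: Y(2))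
    also have "\<dots> = (complex_of_real (1 / 2) + complex_of_real (1 / 2)) *\<^sub>C (X x + Y (Y x))"
      unfolding f_def scaleC_add_left by (simp add: blinfun.add_left)
    finally show ?thesis by simp
  qed
  then have "(x - Y x) - Y (x - Y x) = x - X x" for x
    by (simp add: blinfun.diff_right algebra_simps)
  then show ?thesis using Y(1) by (auto simp: D_def)
qed

text \<open>Scaling makes \<open>X = 1 - t H\<close> a strict contraction, so the square root and
  its inverse come from fixed points and Neumann series, without spectral theory.\<close>

lemma positive_sqrt:
  fixes H :: "'a::chilbert_space \<Rightarrow>\<^sub>L 'a"
  assumes H: "hermitian H" and c: "c > 0" "\<And>x. c * (norm x)\<^sup>2 \<le> Re (cinner x (blinfun_apply H x))"
  shows "\<exists>S R. are_inverse_ops S R \<and> hermitian S \<and> (\<forall>x. S (blinfun_apply S x) = H x)"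
proof -
  define h where "h = norm H + 1"
  define d where "d = min c 1"
  \<comment> \<open>This value minimizes the bound
    \<open>1 - 2 * t * d + t\<^sup>2 * h\<^sup>2\<close> for the squared norm of \<open>X\<close>,
    with minimum \<open>1 - d\<^sup>2 / h\<^sup>2\<close>. Truncating \<open>c\<close> at
    \<open>1\<close> and enlarging \<open>norm H\<close> by \<open>1\<close> keep this number
    nonnegative.\<close>
  define t where "t = d / h\<^sup>2"
  have h: "h \<ge> 1" by (simp add: h_def)
  have d: "d > 0" "d \<le> 1" using c by (auto simp: d_def)
  have t: "t > 0" using d h by (simp add: t_def)
  define X where "X = id_blinfun - complex_of_real t *\<^sub>C H"
  have X: "hermitian X" unfolding X_def by (intro hermitian_diff hermitian_id hermitian_scaleC H)
  define r where "r = sqrt (1 - d\<^sup>2 / h\<^sup>2)"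
  have dh: "d\<^sup>2 / h\<^sup>2 > 0" "d\<^sup>2 / h\<^sup>2 \<le> 1"
    using d h by (auto simp: divide_le_eq_1 intro!: power_mono)
  have r: "r \<ge> 0" "r < 1" using dh by (auto simp: r_def)
  have "norm X \<le> r"
  proof (rule norm_blinfun_bound[OF r(1)])
    fix x
    have Hx: "(norm (H x))\<^sup>2 \<le> h\<^sup>2 * (norm x)\<^sup>2"
    proof -
      have "norm (H x) \<le> h * norm x"
        using norm_blinfun[of H x] norm_ge_zero[of x] unfolding h_def distrib_right by linarith
      then show ?thesis by (metis norm_ge_zero power_mono power_mult_distrib)
    qed
    have "d * (norm x)\<^sup>2 \<le> Re (cinner x (H x))"
      by (rule order_trans[OF mult_right_mono c(2)]) (auto simp: d_def)
    then have i: "d * (norm x)\<^sup>2 \<le> inner x (H x)" by (simp add: inner_eq_Re_cinner)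
    have Xx: "X x = x + (- t) *\<^sub>R H x" by (simp add: X_def blinfun.diff_left scaleR_eq_scaleC)
    have "(norm (X x))\<^sup>2 = (norm x)\<^sup>2 - 2 * t * inner x (H x) + t\<^sup>2 * (norm (H x))\<^sup>2"
      unfolding Xx norm_add_sq by (simp add: power_mult_distrib)
    also have "\<dots> \<le> (norm x)\<^sup>2 - 2 * t * (d * (norm x)\<^sup>2) + t\<^sup>2 * (h\<^sup>2 * (norm x)\<^sup>2)"
      using i t Hx by (intro add_mono diff_mono mult_left_mono) auto
    also have "\<dots> = (1 - d\<^sup>2 / h\<^sup>2) * (norm x)\<^sup>2"
      using h by (simp add: t_def power2_eq_square field_simps)
    also have "\<dots> = (r * norm x)\<^sup>2" using dh by (simp add: r_def power_mult_distrib)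
    finally show "norm (X x) \<le> r * norm x" by (rule power2_le_imp_le) (simp add: r)
  qed
  then obtain Y where Y: "hermitian Y" "norm Y \<le> r" "\<And>x. (x - blinfun_apply Y x) - Y (x - Y x) = x - X x"
    using sqrt_id_minus[OF X _ r(2)] by blast
  have Yb: "Y \<in> bounded_ops" using Y(1) by (simp add: hermitian_def)
  obtain Z where Z: "Z \<in> bounded_ops" "\<And>x. (x + blinfun_apply Z x) - Y (x + Z x) = x" "\<And>x. (x - Y x) + Z (x - Y x) = x"
  proof -
    have "op_subalgebra bounded_ops" by (simp add: op_subalgebra_def csubspace_bounded_ops bounded_ops_compose)
    moreover have "norm Y < 1" using Y(2) r(2) by simp
    ultimately show thesis using neumann_in_subalgebra[of bounded_ops Y] closed_bounded_ops Yb that by blast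
  qed
  \<comment> \<open>The factor undoes the scaling:
    \<open>s\<^sup>2 (1 - X) = s\<^sup>2 t H = H\<close>.\<close>
  define s where "s = complex_of_real (1 / sqrt t)"
  have s0: "s \<noteq> 0" using t by (simp add: s_def)
  define S where "S = s *\<^sub>C (id_blinfun - Y)"
  define S' where "S' = (1 / s) *\<^sub>C (id_blinfun + Z)"
  have S: "hermitian S" unfolding S_def s_def by (intro hermitian_scaleC hermitian_diff hermitian_id Y(1))
  have Sx: "S x = s *\<^sub>C (x - Y x)" and S'x: "S' x = (1 / s) *\<^sub>C (x + Z x)" for x
    by (simp_all add: S_def S'_def blinfun.diff_left blinfun.add_left)
  have "S (S x) = H x" for x
  proof -
    have "S (S x) = (s * s) *\<^sub>C ((x - Y x) - Y (x - Y x))"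
      unfolding Sx bounded_opsD[OF Yb] by (simp add: cvs.scale_right_diff_distrib scaleC_scaleC)
    also have "\<dots> = (s * s * complex_of_real t) *\<^sub>C H x"
      unfolding Y(3) by (simp add: X_def blinfun.diff_left scaleC_scaleC)
    also have "s * s * complex_of_real t = complex_of_real (1 / sqrt t * (1 / sqrt t) * t)" by (simp only: s_def of_real_mult)
    also have "1 / sqrt t * (1 / sqrt t) * t = 1" using t by simp
    finally show ?thesis by simp
  qed
  moreover have "are_inverse_ops S S'"
    unfolding are_inverse_ops_def
  proof (intro conjI blinfun_eqI)
    show "S \<in> bounded_ops" using S by (simp add: hermitian_def)
    show "S' \<in> bounded_ops" unfolding S'_def by (intro bounded_ops_scaleC bounded_ops_add bounded_ops_id Z(1))
    fix x
    have "S (S' x) = (s * (1 / s)) *\<^sub>C ((x + Z x) - Y (x + Z x))"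
      unfolding Sx S'x bounded_opsD[OF Yb] by (simp add: cvs.scale_right_diff_distrib scaleC_scaleC)
    then show "(S o\<^sub>L S') x = id_blinfun x" using s0 Z(2) by simp
    have "S' (S x) = (1 / s * s) *\<^sub>C ((x - Y x) + Z (x - Y x))"
      unfolding Sx S'x bounded_opsD[OF Z(1)] by (simp add: scaleC_add_right scaleC_scaleC)
    then show "(S' o\<^sub>L S) x = id_blinfun x" using s0 Z(3) by simp
  qed
  ultimately show ?thesis using S by blast
qed

text \<open>Since \<open>S\<^sup>2 = H\<close>, the operator \<open>S\<close> carries the new inner
  product to the original one. Adjoints for the form therefore become ordinary adjoints after
  conjugation by \<open>S\<close>.\<close>

lemma similar_of_invariant_form:
  fixes A :: "('a::chilbert_space \<Rightarrow>\<^sub>L 'a) set"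
  assumes A: "op_subalgebra A" and H: "hermitian H" and c: "c > 0" "\<And>x. c * (norm x)\<^sup>2 \<le> Re (cinner x (blinfun_apply H x))"
    and adj: "\<And>a. a \<in> A \<Longrightarrow> \<exists>b\<in>A. \<forall>x y. cinner (blinfun_apply a x) (H y) = cinner x (H (blinfun_apply b y))"
  shows "similar_to_cstar_algebra A"
proof -
  obtain S R where SR: "are_inverse_ops S R" and S: "hermitian S" "\<And>x. S (blinfun_apply S x) = H x"
    using positive_sqrt[OF H c] by blast
  have b: "S \<in> bounded_ops" "R \<in> bounded_ops" and comp: "S o\<^sub>L R = id_blinfun" "R o\<^sub>L S = id_blinfun"
    using SR by (auto simp: are_inverse_ops_def)
  have inv: "S (R x) = x" "R (blinfun_apply S x) = x" for x
    using arg_cong[OF comp(1), of "\<lambda>T. blinfun_apply T x"] arg_cong[OF comp(2), of "\<lambda>T. blinfun_apply T x"] by simp_all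
  let ?f = "\<lambda>T. S o\<^sub>L T o\<^sub>L R"
  have Ab: "A \<subseteq> bounded_ops" and As: "csubspace A" and Ac: "\<And>T T'. T \<in> A \<Longrightarrow> T' \<in> A \<Longrightarrow> T o\<^sub>L T' \<in> A"
    using A by (auto simp: op_subalgebra_def)
  have "op_subalgebra (?f ` A)"
    unfolding op_subalgebra_def csubspace_def
  proof (intro conjI ballI allI)
    show "?f ` A \<subseteq> bounded_ops" using Ab b by (auto intro!: bounded_ops_compose)
    show "0 \<in> ?f ` A" using csubspace_0[OF As] by (intro image_eqI[of _ _ 0]) auto
    fix X assume "X \<in> ?f ` A"
    then obtain T where T: "T \<in> A" "X = ?f T" by blast
    show "k *\<^sub>C X \<in> ?f ` A" for k
      by (rule image_eqI[of _ _ "k *\<^sub>C T"])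
        (auto simp: T csubspace_scaleC[OF As] bounded_opsD[OF b(1)] intro!: blinfun_eqI)
    fix Y assume "Y \<in> ?f ` A"
    then obtain T' where T': "T' \<in> A" "Y = ?f T'" by blast
    show "X + Y \<in> ?f ` A"
      by (rule image_eqI[of _ _ "T + T'"])
        (auto simp: T T' csubspace_add[OF As] blinfun.add_left blinfun.add_right intro!: blinfun_eqI)
    show "X o\<^sub>L Y \<in> ?f ` A"
      by (rule image_eqI[of _ _ "T o\<^sub>L T'"]) (auto simp: T T' Ac inv intro!: blinfun_eqI)
  qed
  moreover have "self_adjoint_set (?f ` A)"
    unfolding self_adjoint_set_def
  proof
    fix X assume "X \<in> ?f ` A"
    then obtain T where T: "T \<in> A" "X = ?f T" by blast
    obtain T' where T': "T' \<in> A" "\<And>x y. cinner (T x) (H y) = cinner x (H (blinfun_apply T' y))" using adj[OF T(1)] by blast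
    have "cinner (S (T (R u))) v = cinner u (S (T' (R v)))" for u v
    proof -
      have "cinner (S (T (R u))) v = cinner (T (R u)) (S (S (R v)))" by (simp add: hermitianD[OF S(1)] inv)
      also have "\<dots> = cinner (R u) (S (S (T' (R v))))" by (simp add: S(2) T'(2))
      also have "\<dots> = cinner u (S (T' (R v)))" by (simp add: inv flip: hermitianD[OF S(1)])
      finally show ?thesis .
    qed
    then have "is_adjoint X (?f T')" by (simp add: is_adjoint_def T(2))
    then show "\<exists>X'\<in>?f ` A. is_adjoint X X'" using T'(1) by blast
  qed
  ultimately show ?thesis using SR unfolding similar_to_cstar_algebra_def by blast
qed

section \<open>From similarity back to complete reduction\<close>

lemma is_adjoint_amplify:
  assumes "is_adjoint T T'" shows "cinner (amplify T x) y = cinner x (amplify T' y)"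
  using assms by (simp add: cinner_ell2.rep_eq amplify.rep_eq is_adjoint_def)

text \<open>The amplification of \<open>S\<close> carries submodules of \<open>A\<close> to
  submodules of the self-adjoint algebra. There the orthogonal complement is invariant, and it is
  carried back.\<close>

lemma complete_reduction_of_similar:
  fixes A :: "('a::chilbert_space \<Rightarrow>\<^sub>L 'a) set"
  assumes sim: "similar_to_cstar_algebra A" and A: "A \<subseteq> bounded_ops"
  shows "complete_reduction_property A"
  unfolding complete_reduction_property_def
proof (intro allI impI)
  fix V :: "'a ell2 set" assume V: "is_submodule A V"
  obtain S R where b: "S \<in> bounded_ops" "R \<in> bounded_ops" and comp: "S o\<^sub>L R = id_blinfun" "R o\<^sub>L S = id_blinfun"
    and sa: "self_adjoint_set ((\<lambda>T. S o\<^sub>L T o\<^sub>L R) ` A)"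
    using sim by (auto simp: similar_to_cstar_algebra_def are_inverse_ops_def)
  have inv: "amplify S (amplify R x) = x" "amplify R (amplify S x) = x" for x
    using comp amplify_id by (metis amplify_compose)+
  have cV: "csubspace V" "closed V" and Vi: "\<And>T x. T \<in> A \<Longrightarrow> x \<in> V \<Longrightarrow> amplify T x \<in> V"
    using V by (auto simp: is_submodule_def)
  have pre: "csubspace {x. amplify T x \<in> U}" "closed {x. amplify T x \<in> U}"
    if "csubspace U" "closed U" "T \<in> bounded_ops" for U and T :: "'a \<Rightarrow>\<^sub>L 'a"
  proof -
    have "closed (amplify T -` U)"
      by (intro closed_vimage that linear_continuous_on bounded_linear_amplify)
    then show "closed {x. amplify T x \<in> U}" by (simp add: vimage_def)
    show "csubspace {x. amplify T x \<in> U}"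
      using csubspaceD[OF that(1)] bounded_linear.linear[OF bounded_linear_amplify[OF that(3)]]
      by (auto simp: csubspace_def amplify_scaleC[OF that(3)] amplify_add linear_0)
  qed
  \<comment> \<open>The image of \<open>V\<close> under the amplified \<open>S\<close>, written as a
    preimage under its inverse so that closedness is immediate.\<close>
  define V' where "V' = {x. amplify R x \<in> V}"
  have cV': "csubspace V'" "closed V'" unfolding V'_def by (rule pre[OF cV b(2)])+
  define W where "W = {x. amplify S x \<in> ocomp V'}"
  have "is_submodule A W"
    unfolding is_submodule_def
  proof (intro conjI ballI)
    show "csubspace W" "closed W" unfolding W_def by (rule pre[OF csubspace_ocomp closed_ocomp b(1)])+
    fix T x assume T: "T \<in> A" and x: "x \<in> W"
    obtain T' where T': "T' \<in> A" "is_adjoint (S o\<^sub>L T o\<^sub>L R) (S o\<^sub>L T' o\<^sub>L R)"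
      using sa T unfolding self_adjoint_set_def by blast
    have "cinner (amplify S (amplify T x)) v = 0" if v: "v \<in> V'" for v
    proof -
      have "amplify S (amplify T x) = amplify (S o\<^sub>L T o\<^sub>L R) (amplify S x)" by (simp add: amplify_compose inv)
      then have "cinner (amplify S (amplify T x)) v = cinner (amplify S x) (amplify (S o\<^sub>L T' o\<^sub>L R) v)"
        by (simp only: is_adjoint_amplify[OF T'(2)])
      also have "amplify (S o\<^sub>L T' o\<^sub>L R) v \<in> V'"
        using Vi[OF T'(1)] v by (simp add: V'_def amplify_compose inv)
      then have "cinner (amplify S x) (amplify (S o\<^sub>L T' o\<^sub>L R) v) = 0" using x by (simp add: W_def ocomp_def)
      finally show ?thesis .
    qed
    then show "amplify T x \<in> W" by (simp add: W_def ocomp_def)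
  qed
  moreover have "x = 0" if x: "x \<in> V" "x \<in> W" for x
  proof -
    have "amplify S x \<in> V'" using x(1) by (simp add: V'_def inv)
    then have "cinner (amplify S x) (amplify S x) = 0" using x(2) by (simp add: W_def ocomp_def)
    then have "amplify S x = 0" by (simp add: cinner_self)
    moreover have "amplify R 0 = 0" using bounded_linear.linear[OF bounded_linear_amplify[OF b(2)]] by (rule linear_0)
    ultimately show ?thesis using inv(2)[of x] by simp
  qed
  moreover have "0 \<in> V" "0 \<in> W"
    using csubspace_0[OF cV(1)] csubspace_0[OF pre(1)[OF csubspace_ocomp closed_ocomp b(1)]] by (auto simp: W_def)
  moreover have "\<exists>x\<in>V. \<exists>y\<in>W. z = x + y" for z
  proof (intro bexI)
    define v where "v = proj V' (amplify S z)"
    show "amplify R v \<in> V" using proj_in[OF cV', of "amplify S z"] by (simp add: v_def V'_def)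
    have "amplify S z - v \<in> ocomp V'" unfolding v_def by (simp add: ocomp_def proj_corth[OF cV'])
    then show "amplify R (amplify S z - v) \<in> W" by (simp add: W_def inv)
    show "z = amplify R v + amplify R (amplify S z - v)" by (simp add: inv flip: amplify_add)
  qed
  ultimately show "\<exists>W. is_submodule A W \<and> V \<inter> W = {0} \<and> (\<forall>z. \<exists>x\<in>V. \<exists>y\<in>W. z = x + y)" by blast
qed

lemma (in crp_algebra) similar_to_cstar: "similar_to_cstar_algebra A"
proof -
  obtain P where P: "mproj annihilated P" using mproj_exists[OF submod_annihilated] by blast
  interpret split_module A K P by unfold_locales (rule P)
  obtain Q where Q0: "(\<forall>q\<in>Q. minimal_idem q) \<and> (\<forall>q\<in>Q. \<forall>q'\<in>Q. q \<noteq> q' \<longrightarrow> (\<forall>a\<in>A. \<forall>x. blinfun_apply q (blinfun_apply a (blinfun_apply q' x)) = 0))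
     \<and> (\<forall>V. submod V \<longrightarrow> (\<forall>q\<in>Q. \<forall>x. blinfun_apply q x \<in> V) \<longrightarrow> R \<subseteq> V)"
    by (rule exE[OF maximal_inequivalent_family])
  have Q: "\<And>q. q \<in> Q \<Longrightarrow> minimal_idem q"
      "\<And>q q' a x. q \<in> Q \<Longrightarrow> q' \<in> Q \<Longrightarrow> q \<noteq> q' \<Longrightarrow> a \<in> A \<Longrightarrow> blinfun_apply q (blinfun_apply a (blinfun_apply q' x)) = 0"
      "\<And>V. submod V \<Longrightarrow> (\<And>q x. q \<in> Q \<Longrightarrow> blinfun_apply q x \<in> V) \<Longrightarrow> R \<subseteq> V"
    using Q0 by simp_all
  have "\<exists>F. finite F \<and> orthonormal F \<and> (\<forall>e\<in>F. blinfun_apply q e = e) \<and> (\<forall>x. blinfun_apply q x = x \<longrightarrow> x = (\<Sum>e\<in>F. cinner x e *\<^sub>C e))"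
    if "q \<in> Q" for q
  proof -
    have "idem q" using Q(1)[OF that] by (simp add: minimal_idem_def)
    then have "\<exists>F. finite F \<and> orthonormal F \<and> F \<subseteq> {x. blinfun_apply q x = x} \<and> (\<forall>x\<in>{x. blinfun_apply q x = x}. x = (\<Sum>e\<in>F. cinner x e *\<^sub>C e))"
      by (intro compact_fixed_onb[OF idem_compact idem_range(2)]) auto
    then show ?thesis by blast
  qed
  then obtain bas where bas: "\<And>q. q \<in> Q \<Longrightarrow> finite (bas q)" "\<And>q. q \<in> Q \<Longrightarrow> orthonormal (bas q)"
      "\<And>q e. q \<in> Q \<Longrightarrow> e \<in> bas q \<Longrightarrow> blinfun_apply q e = e"
      "\<And>q x. q \<in> Q \<Longrightarrow> blinfun_apply q x = x \<Longrightarrow> x = (\<Sum>e\<in>bas q. cinner x e *\<^sub>C e)"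
    by metis
  have "bas q \<noteq> {}" if q: "q \<in> Q" for q
  proof
    assume e: "bas q = {}"
    have "q x = 0" for x using bas(4)[OF q minimal_idemD(2)[OF Q(1)[OF q]], of x] e by simp
    then have "q = 0" by (intro blinfun_eqI) simp
    then show False using minimal_idemD(3)[OF Q(1)[OF q]] by simp
  qed
  then have "\<forall>q\<in>Q. \<exists>e. e \<in> bas q" by (simp add: ex_in_conv)
  then obtain \<xi> where \<xi>: "\<And>q. q \<in> Q \<Longrightarrow> \<xi> q \<in> bas q" using bchoice[of Q "\<lambda>q e. e \<in> bas q"] by blast
  interpret atoms A K P Q bas \<xi> by unfold_locales (fact Q bas \<xi>)+
  obtain G where "G \<in> bounded_ops" "\<And>f g. f \<in> fams \<Longrightarrow> g \<in> fams \<Longrightarrow> cinner (syn f) (blinfun_apply G (syn g)) = frm f g"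
    using form_operator by blast
  then interpret atoms_form A K P Q bas \<xi> G by unfold_locales
  obtain H c where H: "H \<in> bounded_ops" "\<And>x y. cinner (blinfun_apply H x) y = cinner x (H y)" "c > 0"
      "\<And>x. c * (norm x)\<^sup>2 \<le> Re (cinner x (blinfun_apply H x))"
      "\<And>a. a \<in> A \<Longrightarrow> \<exists>b\<in>A. \<forall>x y. cinner (blinfun_apply a x) (H y) = cinner x (H (blinfun_apply b y))"
    using invariant_form by blast
  have "hermitian H" using H(1,2) by (simp add: hermitian_def is_adjoint_def)
  then show ?thesis by (rule similar_of_invariant_form[OF A_alg _ H(3,4,5)])
qed

theorem theorem4p3p13:
  fixes A :: "('h::chilbert_space \<Rightarrow>\<^sub>L 'h) set"
  assumes "A \<subseteq> compact_ops" and "op_subalgebra A" and "closed A"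
  shows "complete_reduction_property A \<longleftrightarrow> similar_to_cstar_algebra A"
proof
  have b: "A \<subseteq> bounded_ops" using assms(2) by (simp add: op_subalgebra_def)
  show "complete_reduction_property A" if "similar_to_cstar_algebra A"
    using that b by (rule complete_reduction_of_similar)
  assume "complete_reduction_property A"
  then obtain K where K: "\<And>V. is_submodule A V \<Longrightarrow> \<exists>P. module_proj A V P \<and> norm P \<le> K"
    using module_proj_uniform[OF _ b] by blast
  interpret crp_algebra A K by unfold_locales (fact assms | rule K)+
  show "similar_to_cstar_algebra A" by (rule similar_to_cstar)
qed

end
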